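(* Let $S_0>0$, $T>0$, strikes $0<K_1<\dots<K_n$ with call prices $c(K_1),\dots,c(K_n)$, and barrier levels $S_0=:B_0<B_1\le\dots\le B_m$ with simple barrier option prices $b(B_1),\dots,b(B_m)$ be given. Assume that the asset $S$ has continuous trajectories, has zero cost of carry, and is strictly positive. Then there exists a market model if and only if the following two conditions hold: 1. There exists a call price function $c_\mu(\cdot)=\int (y-\cdot)^+\,\mu(\mathrm{d}y)$ which interpolates the given call prices, i.e. $c_\mu(K_i)=c(K_i)$ for $i=1,\dots,n$, and satisfies $-c_\mu'(0+)=1$. 2. There exist functions $\mathfrak{c}^{B_1},\dots,\mathfrak{c}^{B_m}$ such that, with $\mathfrak{c}^{B_{m+1}}:=c_\mu$, for all $j=1,\dots,m$: (i) $\mathfrak{c}^{B_j}:\mathbb{R}_{\ge 0}\to[0,S_0]$ is convex; (ii) $0\le \mathfrak{c}^{B_1}\le\dots\le\mathfrak{c}^{B_m}\le\mathfrak{c}^{B_{m+1}}=c_\mu$; (iii) $-\frac{\mathrm{d}\mathfrak{c}^{B_j}}{\mathrm{d}x}(0+)=1$, $\mathfrak{c}^{B_j}(0)=S_0$, and $\mathfrak{c}^{B_j}(x)=0$ for all $x\ge B_j$; (iv) $-\frac{\mathrm{d}\mathfrak{c}^{B_j}}{\mathrm{d}x}(B_j-)=b(B_j)$; (v) $x\mapsto \mathfrak{c}^{B_{j+1}}(x)-\mathfrak{c}^{B_j}(x)+b(B_j)\,(B_j-x)^+$ is convex. This market model can be chosen with bounded support (but does not have to be). Furthermore, in the market models characterized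 by conditions (i)–(v), one has for $j=1,\dots,m$ and $0\le x<B_j$ $$\mathbb{P}\left[S_T>x,\ M_T<B_j\right]=-\frac{\mathrm{d}\mathfrak{c}^{B_j}}{\mathrm{d}x}(x+)-b(B_j).$$
   Context: Write $M_T=\sup_{u\le T}S_u$ and let $H_B=\inf\{t: S_t=B\}$ (with $\inf\emptyset=\infty$) be the first hitting time of $B$ by $S$. A market model is a filtered probability space $(\Omega,\mathcal{F},(\mathcal{F}_t)_{t\in[0,T]},\mathbb{P})$, with filtration satisfying the usual hypotheses, carrying an adapted martingale $S=(S_t)_{t\in[0,T]}$ (the asset, started at $S_0$, and under the assumption of the theorem continuous and strictly positive) such that $$\mathbb{E}[(S_T-K_i)^+]=c(K_i),\quad i=1,\dots,n,\qquad \mathbb{E}[\mathbf{1}_{\{M_T\ge B_j\}}]=b(B_j),\quad j=1,\dots,m.$$ Zero cost of carry holds, for example, when interest rates are zero. A call price function is a non-negative convex function $c$ on $[0,\infty)$ with $-\frac{\partial c}{\partial x}(0+)\le 1$ and $c(x)\to0$ as $x\to\infty$; it is written as $c_\mu(x)=\int(y-x)^+\mu(\mathrm{d}y)$, where $\mu$ is the associated measure on $[0,\infty)$. One-sided limits of derivatives (or one-sided derivatives) are indicated by $x+$ and $x-$. Bounded support refers to the law $\mu$ of $S_T$. The market models characterized by (i)–(v) are those corresponding to given functions $c_\mu,\mathfrak{c}^{B_1},\dots,\mathfrak{c}^{B_m}$ satisfying the conditions via $\mathbb{E}[(S_T-x)^+]=c_\mu(x)$ and $\mathbb{E}[(S_{T\wedge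 H_{B_j}}-x)^+]=\mathfrak{c}^{B_j}(x)$ for all $x\ge0$ and $j=1,\dots,m$.
   Formalization: Condition 1 additionally requires c_μ(0)=S_0; without it conditions 1–2 can hold with c_μ(K_1)>S_0, which no martingale model allows, so the "if" direction would be false. *)

theory Defs
  imports "HOL-Probability.Probability"
begin

definition usual_filtration :: "'a measure \<Rightarrow> real \<Rightarrow> (real \<Rightarrow> 'a measure) \<Rightarrow> bool" where
  "usual_filtration P T F \<longleftrightarrow>
     (\<forall>t\<in>{0..T}. subalgebra P (F t)) \<and>
     (\<forall>s t. 0 \<le> s \<and> s \<le> t \<and> t \<le> T \<longrightarrow> sets (F s) \<subseteq> sets (F t)) \<and>
     complete_measure P \<and> null_sets P \<subseteq> sets (F 0) \<and>
     (\<forall>t\<in>{0..<T}. sets (F t) = (\<Inter>s\<in>{t<..T}. sets (F s)))"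

definition martingale_on ::
    "'a measure \<Rightarrow> real \<Rightarrow> (real \<Rightarrow> 'a measure) \<Rightarrow> (real \<Rightarrow> 'a \<Rightarrow> real) \<Rightarrow> bool" where
  "martingale_on P T F S \<longleftrightarrow>
     (\<forall>t\<in>{0..T}. S t \<in> borel_measurable (F t) \<and> integrable P (S t)) \<and>
     (\<forall>s t. 0 \<le> s \<and> s \<le> t \<and> t \<le> T \<longrightarrow> (AE \<omega> in P. real_cond_exp P (F s) (S t) \<omega> = S s \<omega>))"

definition running_max :: "(real \<Rightarrow> 'a \<Rightarrow> real) \<Rightarrow> real \<Rightarrow> 'a \<Rightarrow> real" where
  "running_max S T \<omega> = (SUP u\<in>{0..T}. S u \<omega>)"

text \<open>The infimum is taken in the extended reals, so that it is \<open>\<infinity>\<close> if the level is not hit.\<close>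

definition hitting_time :: "(real \<Rightarrow> 'a \<Rightarrow> real) \<Rightarrow> real \<Rightarrow> real \<Rightarrow> 'a \<Rightarrow> ereal" where
  "hitting_time S T B \<omega> = Inf (ereal ` {t\<in>{0..T}. S t \<omega> = B})"

definition stopped_value :: "(real \<Rightarrow> 'a \<Rightarrow> real) \<Rightarrow> real \<Rightarrow> real \<Rightarrow> 'a \<Rightarrow> real" where
  "stopped_value S T B \<omega> = S (real_of_ereal (min (ereal T) (hitting_time S T B \<omega>))) \<omega>"

text \<open>
  Zero cost of carry is the martingale property of the undiscounted asset \<open>S\<close>.
\<close>

definition market_model ::
    "real \<Rightarrow> real \<Rightarrow> nat \<Rightarrow> (nat \<Rightarrow> real) \<Rightarrow> (real \<Rightarrow> real) \<Rightarrow> nat \<Rightarrow> (nat \<Rightarrow> real) \<Rightarrow> (real \<Rightarrow> real)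
     \<Rightarrow> 'a measure \<Rightarrow> (real \<Rightarrow> 'a measure) \<Rightarrow> (real \<Rightarrow> 'a \<Rightarrow> real) \<Rightarrow> bool" where
  "market_model S\<^sub>0 T n K c m B b P F S \<longleftrightarrow>
     prob_space P \<and> usual_filtration P T F \<and> martingale_on P T F S \<and>
     (\<forall>\<omega>\<in>space P. S 0 \<omega> = S\<^sub>0) \<and>
     (\<forall>\<omega>\<in>space P. continuous_on {0..T} (\<lambda>t. S t \<omega>)) \<and>
     (\<forall>\<omega>\<in>space P. \<forall>t\<in>{0..T}. 0 < S t \<omega>) \<and>
     (\<forall>i\<in>{1..n}. (\<integral>\<omega>. max (S T \<omega> - K i) 0 \<partial>P) = c (K i)) \<and>
     (\<forall>j\<in>{1..m}. (\<integral>\<omega>. indicator {\<omega>\<in>space P. B j \<le> running_max S T \<omega>} \<omega> \<partial>P) = b (B j))"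

text \<open>
  HOL cannot quantify existentially over types, so existence of a market model is stated on the
  type of all functions from time to prices.  This is no restriction: a market model over any type
  induces one here, namely its law on path space with the augmented canonical filtration.
\<close>

type_synonym path = "real \<Rightarrow> real"

definition call_price_function :: "(real \<Rightarrow> real) \<Rightarrow> bool" where
  "call_price_function c \<longleftrightarrow>
     convex_on {0..} c \<and> (\<forall>x\<ge>0. 0 \<le> c x) \<and>
     (\<exists>d. (c has_real_derivative d) (at_right 0) \<and> - d \<le> 1) \<and> (c \<longlongrightarrow> 0) at_top"

definition call_of_measure :: "real measure \<Rightarrow> real \<Rightarrow> real" where
  "call_of_measure \<mu> x = (\<integral>y. max (y - x) 0 \<partial>\<mu>)"

text \<open>
  A call price function determines its measure on \<open>(0,\<infinity>)\<close>, where the total mass is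
  \<open>- c'(0+) \<le> 1\<close>; the remaining mass is an atom at \<open>0\<close>, so that \<open>\<mu>\<close> is a probability measure.
\<close>

definition call_measure :: "real measure \<Rightarrow> bool" where
  "call_measure \<mu> \<longleftrightarrow>
     prob_space \<mu> \<and> sets \<mu> = sets borel \<and> (AE y in \<mu>. 0 \<le> y) \<and> integrable \<mu> (\<lambda>y. y)"

definition bounded_support :: "real measure \<Rightarrow> bool" where
  "bounded_support \<mu> \<longleftrightarrow> (\<exists>C. AE y in \<mu>. \<bar>y\<bar> \<le> C)"

text \<open>
  The clause \<open>c\<^sub>\<mu>(0) = S\<^sub>0\<close> says that the call with strike zero is the asset itself (zero cost of
  carry, nonnegative asset).  It does not follow from the other conditions below: these only give
  \<open>c\<^sub>\<mu>(0) \<ge> S\<^sub>0\<close>, and without it \<open>c\<^sub>\<mu>\<close> could interpolate call prices above \<open>S\<^sub>0\<close>.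
\<close>

definition interpolating_calls ::
    "real \<Rightarrow> nat \<Rightarrow> (nat \<Rightarrow> real) \<Rightarrow> (real \<Rightarrow> real) \<Rightarrow> real measure \<Rightarrow> bool" where
  "interpolating_calls S\<^sub>0 n K c \<mu> \<longleftrightarrow>
     call_measure \<mu> \<and> call_price_function (call_of_measure \<mu>) \<and>
     call_of_measure \<mu> 0 = S\<^sub>0 \<and>
     (\<forall>i\<in>{1..n}. call_of_measure \<mu> (K i) = c (K i)) \<and>
     (call_of_measure \<mu> has_real_derivative - 1) (at_right 0)"

text \<open>
  \<open>\<cc> j\<close> stands for \<open>\<cc>\<^sup>B\<close> with \<open>B = B\<^sub>j\<close>, and \<open>\<cc> (m + 1)\<close> for \<open>c\<^sub>\<mu>\<close>.  These are functions on
  the nonnegative reals: their values at negative arguments play no role.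
\<close>

definition barrier_calls ::
    "real \<Rightarrow> nat \<Rightarrow> (nat \<Rightarrow> real) \<Rightarrow> (real \<Rightarrow> real) \<Rightarrow> real measure \<Rightarrow> (nat \<Rightarrow> real \<Rightarrow> real) \<Rightarrow> bool" where
  "barrier_calls S\<^sub>0 m B b \<mu> \<cc> \<longleftrightarrow>
     \<cc> (m + 1) = call_of_measure \<mu> \<and>
     (\<forall>j\<in>{1..m}.
        (\<cc> j ` {0..} \<subseteq> {0..S\<^sub>0} \<and> convex_on {0..} (\<cc> j)) \<and>
        (\<forall>x\<ge>0. 0 \<le> \<cc> 1 x \<and> \<cc> j x \<le> \<cc> (j + 1) x) \<and>
        ((\<cc> j has_real_derivative - 1) (at_right 0) \<and> \<cc> j 0 = S\<^sub>0 \<and> (\<forall>x\<ge>B j. \<cc> j x = 0)) \<and>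
        (\<cc> j has_real_derivative - b (B j)) (at_left (B j)) \<and>
        convex_on {0..} (\<lambda>x. \<cc> (j + 1) x - \<cc> j x + b (B j) * max (B j - x) 0))"

definition corresponding ::
    "real \<Rightarrow> nat \<Rightarrow> (nat \<Rightarrow> real) \<Rightarrow> real measure \<Rightarrow> (nat \<Rightarrow> real \<Rightarrow> real)
     \<Rightarrow> 'a measure \<Rightarrow> (real \<Rightarrow> 'a \<Rightarrow> real) \<Rightarrow> bool" where
  "corresponding T m B \<mu> \<cc> P S \<longleftrightarrow>
     (\<forall>x\<ge>0. (\<integral>\<omega>. max (S T \<omega> - x) 0 \<partial>P) = call_of_measure \<mu> x) \<and>
     (\<forall>j\<in>{1..m}. \<forall>x\<ge>0. (\<integral>\<omega>. max (stopped_value S T (B j) \<omega> - x) 0 \<partial>P) = \<cc> j x)"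

end

theory Submission
  imports Defs
begin

text \<open>
  Necessity. For a barrier \<open>B > S\<^sub>0\<close> optional stopping along finite grids gives
  \<open>\<bbbE>[S\<^sub>T; M\<^sub>T \<ge> B] = B \<P>(M\<^sub>T \<ge> B)\<close>; the functions \<open>\<cc>\<close> are the call prices of the asset stopped at the
  barriers, and all conditions are read off from this identity.

  Sufficiency. By (v) the function \<open>\<cc>\<^bsub>j+1\<^esub> - \<cc>\<^sub>j + b\<^sub>j (B\<^sub>j - \<cdot>)\<^sup>+\<close> is \<open>b\<^sub>j\<close> times the call function of a law
  \<open>\<nu>\<^sub>j\<close> with mean \<open>B\<^sub>j\<close>, carried by \<open>(0, B\<^bsub>j+1\<^esub>]\<close> and with mass \<open>b\<^bsub>j+1\<^esub> / b\<^sub>j\<close> at \<open>B\<^bsub>j+1\<^esub>\<close>.  In stage \<open>j\<close>, the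
  paths sitting at \<open>B\<^sub>j\<close> move continuously to a value with law \<open>\<nu>\<^sub>j\<close>, and all other paths stay where they
  are.  The stages are driven by a Brownian motion, built by Levy's midpoint construction.  Every
  integrable function of a unit increment is the terminal value of a continuous martingale: this holds
  for indicators of half-lines by an explicit formula, and the class of such terminal values is closed
  in \<open>L\<^sup>1\<close> by the maximal inequality.  A nonnegative martingale stays at zero once it gets there, so a
  path reaches \<open>B\<^bsub>j+1\<^esub>\<close> exactly if it sits there at the end of stage \<open>j\<close>.
\<close>

section \<open>Optional stopping along grids\<close>

text \<open>The identity for the event of reaching \<open>B\<close> carries (i) to (v) because the
  asset stopped at \<open>B\<close> and any later value differ only on that event, where both have
  conditional mean \<open>B\<close>: the function in (v) is the expected payoff of the later value
  on the event, hence convex, and Jensen's inequality there gives the ordering in (ii). The obstacle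
  is the limit over grids. At the first grid time above a level the asset overshoots; the overshoot
  vanishes pathwise, but its mean vanishes only by uniform integrability, obtained by truncation.
  For the converse, continuous paths, the usual hypotheses and prescribed terminal laws have to hold
  together. A midpoint step is an orthogonal map of a pair of independent normals, so the whole
  noise, reserve included, is an iid family at every dyadic level. The filtration intersects the
  completed pasts of all levels, taken just after \<open>t\<close>, and is right continuous by
  construction. Properties that hold only almost surely are forced on all paths by changes on null
  sets, which the completed filtration permits.\<close>

locale filtered_prob_space = prob_space P for P :: "'a measure" +
  fixes I :: "real set" and F :: "real \<Rightarrow> 'a measure"
  assumes subalg: "\<And>t. t \<in> I \<Longrightarrow> subalgebra P (F t)"
    and filt_mono: "\<And>s t. s \<in> I \<Longrightarrow> t \<in> I \<Longrightarrow> s \<le> t \<Longrightarrow> sets (F s) \<subseteq> sets (F t)"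
begin

text \<open>A martingale closed by \<open>X\<close>, expressed through set integrals instead of
  conditional expectations: linear combinations, changes on null sets and L1 limits can then be
  checked directly. The index set \<open>I\<close> is left open because the market lives on
  \<open>{0..T}\<close> and the noise on \<open>{0..}\<close>.\<close>

definition mart_to :: "(real \<Rightarrow> 'a \<Rightarrow> real) \<Rightarrow> ('a \<Rightarrow> real) \<Rightarrow> bool" where
  "mart_to Y X \<longleftrightarrow> integrable P X \<and>
     (\<forall>t\<in>I. Y t \<in> borel_measurable (F t) \<and> integrable P (Y t) \<and>
        (\<forall>A\<in>sets (F t). (\<integral>\<omega>\<in>A. Y t \<omega> \<partial>P) = (\<integral>\<omega>\<in>A. X \<omega> \<partial>P)))"

lemma space_F: "t \<in> I \<Longrightarrow> space (F t) = space P"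
  using subalg by (auto simp: subalgebra_def)

lemma sets_F: "t \<in> I \<Longrightarrow> A \<in> sets (F t) \<Longrightarrow> A \<in> sets P"
  using subalg by (auto simp: subalgebra_def)

lemma mart_toD:
  assumes "mart_to Y X"
  shows "integrable P X" "\<And>t. t \<in> I \<Longrightarrow> Y t \<in> borel_measurable (F t)"
    "\<And>t. t \<in> I \<Longrightarrow> integrable P (Y t)"
    "\<And>t A. t \<in> I \<Longrightarrow> A \<in> sets (F t) \<Longrightarrow> (\<integral>\<omega>\<in>A. Y t \<omega> \<partial>P) = (\<integral>\<omega>\<in>A. X \<omega> \<partial>P)"
  using assms by (auto simp: mart_to_def)

lemma set_integrable_sub: "integrable P f \<Longrightarrow> A \<in> sets P \<Longrightarrow> set_integrable P A f" for f :: "'a \<Rightarrow> real"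
  unfolding set_integrable_def by (rule integrable_mult_indicator)

lemma mart_to_measurable: "mart_to Y X \<Longrightarrow> t \<in> I \<Longrightarrow> Y t \<in> borel_measurable P"
  by (auto simp: mart_to_def)

lemma level_sets:
  assumes "mart_to Y X" "t \<in> I"
  shows "{\<omega>\<in>space P. Y t \<omega> < a} \<in> sets (F t)" "{\<omega>\<in>space P. Y t \<omega> \<le> a} \<in> sets (F t)"
    "{\<omega>\<in>space P. a < Y t \<omega>} \<in> sets (F t)" "{\<omega>\<in>space P. a \<le> Y t \<omega>} \<in> sets (F t)"
proof -
  have [measurable]: "Y t \<in> borel_measurable (F t)" using assms by (auto simp: mart_to_def)
  note sp = space_F[OF assms(2), symmetric]
  show "{\<omega>\<in>space P. Y t \<omega> < a} \<in> sets (F t)" "{\<omega>\<in>space P. Y t \<omega> \<le> a} \<in> sets (F t)"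
    "{\<omega>\<in>space P. a < Y t \<omega>} \<in> sets (F t)" "{\<omega>\<in>space P. a \<le> Y t \<omega>} \<in> sets (F t)"
    unfolding sp by measurable
qed

text \<open>A first entrance time over the time set \<open>J\<close>, encoded by the disjoint events
  on which it takes each of its values.\<close>

definition entrance :: "real set \<Rightarrow> (real \<Rightarrow> 'a set) \<Rightarrow> real \<Rightarrow> 'a set" where
  "entrance J H t = H t - (\<Union>s\<in>{s\<in>J. s < t}. H s)"

lemma entrance_disjoint: "disjoint_family_on (entrance J H) J"
  unfolding disjoint_family_on_def entrance_def
proof (safe, goal_cases)
  case (1 s t x) then show ?case by (cases s t rule: linorder_cases) auto
qed

lemma entrance_UN:
  assumes "finite J" shows "(\<Union>t\<in>J. entrance J H t) = (\<Union>t\<in>J. H t)"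
proof
  show "(\<Union>t\<in>J. H t) \<subseteq> (\<Union>t\<in>J. entrance J H t)"
  proof
    fix x assume "x \<in> (\<Union>t\<in>J. H t)"
    then have ne: "{t\<in>J. x \<in> H t} \<noteq> {}" by auto
    have fin: "finite {t\<in>J. x \<in> H t}" using assms by auto
    define t where "t = Min {t\<in>J. x \<in> H t}"
    have "t \<in> {t\<in>J. x \<in> H t}" unfolding t_def using fin ne by (rule Min_in)
    moreover have "s \<in> J \<Longrightarrow> x \<in> H s \<Longrightarrow> t \<le> s" for s unfolding t_def using fin by auto
    ultimately show "x \<in> (\<Union>t\<in>J. entrance J H t)" by (force simp: entrance_def)
  qed
qed (auto simp: entrance_def)

lemma entrance_sets:
  assumes "finite J" "J \<subseteq> I" "\<And>t. t \<in> J \<Longrightarrow> H t \<in> sets (F t)" "t \<in> J"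
  shows "entrance J H t \<in> sets (F t)"
proof -
  have "H s \<in> sets (F t)" if "s \<in> J" "s < t" for s
    using assms(3)[OF that(1)] filt_mono[of s t] that assms(2,4) by (auto simp: subset_iff)
  then show ?thesis unfolding entrance_def using assms by (intro sets.Diff sets.finite_UN) auto
qed

text \<open>Optional stopping at the first entrance: the event of entering at \<open>t\<close> is
  known at time \<open>t\<close>, so the final value \<open>X\<close> may be replaced there by
  \<open>Y t\<close>.\<close>

lemma entrance_integral:
  assumes m: "mart_to Y X" and J: "finite J" "J \<subseteq> I" and H: "\<And>t. t \<in> J \<Longrightarrow> H t \<in> sets (F t)"
  shows "(\<integral>\<omega>\<in>(\<Union>t\<in>J. H t). X \<omega> \<partial>P) = (\<Sum>t\<in>J. \<integral>\<omega>\<in>entrance J H t. Y t \<omega> \<partial>P)"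
proof -
  note E = entrance_sets[OF J H]
  have E': "entrance J H t \<in> sets P" if "t \<in> J" for t using E[OF _ that] sets_F that J by blast
  have "(\<integral>\<omega>\<in>(\<Union>t\<in>J. H t). X \<omega> \<partial>P) = (\<integral>\<omega>\<in>(\<Union>t\<in>J. entrance J H t). X \<omega> \<partial>P)"
    using entrance_UN[OF J(1)] by simp
  also have "\<dots> = (\<Sum>t\<in>J. \<integral>\<omega>\<in>entrance J H t. X \<omega> \<partial>P)"
    using mart_toD(1)[OF m] E' J(1) entrance_disjoint[of J H]
    by (intro set_integral_finite_Union) (auto intro!: set_integrable_sub)
  also have "\<dots> = (\<Sum>t\<in>J. \<integral>\<omega>\<in>entrance J H t. Y t \<omega> \<partial>P)"
    using mart_toD(4)[OF m] E J by (intro sum.cong) auto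
  finally show ?thesis .
qed

lemma entrance_prob:
  assumes J: "finite J" "J \<subseteq> I" and H: "\<And>t. t \<in> J \<Longrightarrow> H t \<in> sets (F t)"
  shows "prob (\<Union>t\<in>J. H t) = (\<Sum>t\<in>J. prob (entrance J H t))"
proof -
  have E': "entrance J H t \<in> sets P" if "t \<in> J" for t 
    using entrance_sets[OF J H _] sets_F that J by blast
  have "prob (\<Union>t\<in>J. entrance J H t) = (\<Sum>t\<in>J. prob (entrance J H t))"
    using E' entrance_disjoint[of J H] by (intro finite_measure_finite_Union J(1)) auto
  then show ?thesis by (simp add: entrance_UN[OF J(1)])
qed

lemma set_integral_ge_prob:
  assumes "integrable P f" "A \<in> sets P" "\<And>\<omega>. \<omega> \<in> A \<Longrightarrow> c \<le> f \<omega>"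
  shows "c * prob A \<le> (\<integral>\<omega>\<in>A. f \<omega> \<partial>P)"
proof -
  have "c * prob A = (\<integral>\<omega>\<in>A. c \<partial>P)" using assms by (simp add: set_lebesgue_integral_def)
  also have "\<dots> \<le> (\<integral>\<omega>\<in>A. f \<omega> \<partial>P)"
    using assms by (intro set_integral_mono set_integrable_sub) auto
  finally show ?thesis .
qed

lemma set_integral_le_prob:
  assumes "integrable P f" "A \<in> sets P" "\<And>\<omega>. \<omega> \<in> A \<Longrightarrow> f \<omega> \<le> c"
  shows "(\<integral>\<omega>\<in>A. f \<omega> \<partial>P) \<le> c * prob A"
proof -
  have "(\<integral>\<omega>\<in>A. f \<omega> \<partial>P) \<le> (\<integral>\<omega>\<in>A. c \<partial>P)"
    using assms by (intro set_integral_mono set_integrable_sub) auto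
  also have "\<dots> = c * prob A" using assms by (simp add: set_lebesgue_integral_def)
  finally show ?thesis .
qed

lemma entrance_lower:
  assumes m: "mart_to Y X" and J: "finite J" "J \<subseteq> I" and H: "\<And>t. t \<in> J \<Longrightarrow> H t \<in> sets (F t)"
    and c: "\<And>t \<omega>. t \<in> J \<Longrightarrow> \<omega> \<in> H t \<Longrightarrow> c \<le> Y t \<omega>"
  shows "c * prob (\<Union>t\<in>J. H t) \<le> (\<integral>\<omega>\<in>(\<Union>t\<in>J. H t). X \<omega> \<partial>P)"
proof -
  have E': "entrance J H t \<in> sets P" if "t \<in> J" for t 
    using entrance_sets[OF J H _] sets_F that J by blast
  have "(\<integral>\<omega>\<in>(\<Union>t\<in>J. H t). X \<omega> \<partial>P) = (\<Sum>t\<in>J. \<integral>\<omega>\<in>entrance J H t. Y t \<omega> \<partial>P)"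
    by (rule entrance_integral[OF m J H])
  moreover have "prob (\<Union>t\<in>J. H t) = (\<Sum>t\<in>J. prob (entrance J H t))"
    by (rule entrance_prob[OF J H])
  moreover have "c * prob (entrance J H t) \<le> (\<integral>\<omega>\<in>entrance J H t. Y t \<omega> \<partial>P)" if "t \<in> J" for t
    using c[OF that] J(2) E'[OF that] mart_toD(3)[OF m] that
    by (intro set_integral_ge_prob) (auto simp: entrance_def)
  ultimately show ?thesis by (simp add: sum_distrib_left sum_mono)
qed

lemma entrance_upper:
  assumes m: "mart_to Y X" and J: "finite J" "J \<subseteq> I" and H: "\<And>t. t \<in> J \<Longrightarrow> H t \<in> sets (F t)"
    and c: "\<And>t \<omega>. t \<in> J \<Longrightarrow> \<omega> \<in> H t \<Longrightarrow> Y t \<omega> \<le> c"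
  shows "(\<integral>\<omega>\<in>(\<Union>t\<in>J. H t). X \<omega> \<partial>P) \<le> c * prob (\<Union>t\<in>J. H t)"
proof -
  have E': "entrance J H t \<in> sets P" if "t \<in> J" for t 
    using entrance_sets[OF J H _] sets_F that J by blast
  have "(\<integral>\<omega>\<in>(\<Union>t\<in>J. H t). X \<omega> \<partial>P) = (\<Sum>t\<in>J. \<integral>\<omega>\<in>entrance J H t. Y t \<omega> \<partial>P)"
    by (rule entrance_integral[OF m J H])
  moreover have "prob (\<Union>t\<in>J. H t) = (\<Sum>t\<in>J. prob (entrance J H t))"
    by (rule entrance_prob[OF J H])
  moreover have "(\<integral>\<omega>\<in>entrance J H t. Y t \<omega> \<partial>P) \<le> c * prob (entrance J H t)" if "t \<in> J" for t
    using c[OF that] J(2) E'[OF that] mart_toD(3)[OF m] that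
    by (intro set_integral_le_prob) (auto simp: entrance_def)
  ultimately show ?thesis by (simp add: sum_distrib_left sum_mono)
qed

lemma mart_to_cmult:
  assumes "mart_to Y X" 
  shows "mart_to (\<lambda>t \<omega>. c * Y t \<omega>) (\<lambda>\<omega>. c * X \<omega>)"
  using assms unfolding mart_to_def by auto

lemma mart_to_uminus: "mart_to Y X \<Longrightarrow> mart_to (\<lambda>t \<omega>. - Y t \<omega>) (\<lambda>\<omega>. - X \<omega>)"
  using mart_to_cmult[of Y X "-1"] by simp

lemma mart_to_add:
  assumes "mart_to Y X" "mart_to Y' X'"
  shows "mart_to (\<lambda>t \<omega>. Y t \<omega> + Y' t \<omega>) (\<lambda>\<omega>. X \<omega> + X' \<omega>)"
proof -
  have "(\<integral>\<omega>\<in>A. Y t \<omega> + Y' t \<omega> \<partial>P) = (\<integral>\<omega>\<in>A. X \<omega> + X' \<omega> \<partial>P)"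
    if "t \<in> I" "A \<in> sets (F t)" for t A
  proof -
    have "set_integrable P A f" if "integrable P f" for f :: "'a \<Rightarrow> real"
      using integrable_mult_indicator[OF _ that] sets_F \<open>t \<in> I\<close> \<open>A \<in> sets (F t)\<close>
      by (simp add: set_integrable_def)
    then show ?thesis
      using assms that by (simp add: mart_to_def set_integral_add)
  qed
  then show ?thesis using assms by (auto simp: mart_to_def intro: borel_measurable_add)
qed

lemma mart_to_diff:
  assumes "mart_to Y X" "mart_to Y' X'"
  shows "mart_to (\<lambda>t \<omega>. Y t \<omega> - Y' t \<omega>) (\<lambda>\<omega>. X \<omega> - X' \<omega>)"
  using mart_to_add[OF assms(1) mart_to_uminus[OF assms(2)]] by simp

lemma mart_to_const: "mart_to (\<lambda>t \<omega>. c) (\<lambda>\<omega>. c)"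
  by (auto simp: mart_to_def)

lemma set_integral_abs_le:
  fixes X :: "'a \<Rightarrow> real"
  assumes "integrable P X" "A \<in> sets P"
  shows "(\<integral>\<omega>\<in>A. X \<omega> \<partial>P) \<le> (\<integral>\<omega>. \<bar>X \<omega>\<bar> \<partial>P)"
  unfolding set_lebesgue_integral_def using assms integrable_mult_indicator[OF assms(2,1)]
  by (intro integral_mono) (auto simp: indicator_def)

lemma countable_exhaustion:
  assumes "countable (Q :: 'b set)" 
  obtains J :: "nat \<Rightarrow> 'b set" where "\<And>k. finite (J k)" "incseq J" "(\<Union>k. J k) = Q"
proof (cases "Q = {}")
  case True then show ?thesis using that[of "\<lambda>_. {}"] by (auto simp: incseq_def)
next
  case False
  show ?thesis
  proof (rule that[of "\<lambda>k. from_nat_into Q ` {..k}"])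
    show "(\<Union>k. from_nat_into Q ` {..k}) = Q"
    proof -
      have "(\<Union>k. from_nat_into Q ` {..k}) = range (from_nat_into Q)" by auto
      then show ?thesis using range_from_nat_into[OF False assms] by simp
    qed
  qed (auto simp: incseq_def)
qed

text \<open>Doob's inequality on a countable time set: at the first entrance above \<open>c\<close>
  the value is at least \<open>c\<close>, and finite subsets exhaust \<open>Q\<close>.\<close>

lemma maximal_one_sided:
  assumes m: "mart_to Y X" and Q: "countable Q" "Q \<subseteq> I" and c: "0 \<le> c"
  shows "c * prob {\<omega>\<in>space P. \<exists>t\<in>Q. c < Y t \<omega>} \<le> (\<integral>\<omega>. \<bar>X \<omega>\<bar> \<partial>P)"
proof -
  obtain J where J: "\<And>k::nat. finite (J k)" "incseq J" "(\<Union>k. J k) = Q"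
    using countable_exhaustion[OF Q(1)] by metis
  have JI: "J k \<subseteq> I" for k using J(3) Q(2) by blast
  define H where "H t = {\<omega>\<in>space P. c < Y t \<omega>}" for t
  have H: "t \<in> I \<Longrightarrow> H t \<in> sets (F t)" for t unfolding H_def by (rule level_sets[OF m])
  have HP: "t \<in> I \<Longrightarrow> H t \<in> sets P" for t using H sets_F by blast
  have UP: "(\<Union>t\<in>J k. H t) \<in> sets P" for k using J(1) JI HP by (intro sets.finite_UN) auto
  have inc: "incseq (\<lambda>k. \<Union>t\<in>J k. H t)" using J(2) by (intro monoI UN_mono) (auto simp: incseq_def)
  have "c * prob (\<Union>t\<in>J k. H t) \<le> (\<integral>\<omega>. \<bar>X \<omega>\<bar> \<partial>P)" for k
  proof -
    have "c * prob (\<Union>t\<in>J k. H t) \<le> (\<integral>\<omega>\<in>(\<Union>t\<in>J k. H t). X \<omega> \<partial>P)"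
      using JI H by (intro entrance_lower[OF m J(1) JI]) (auto simp: H_def)
    also have "\<dots> \<le> (\<integral>\<omega>. \<bar>X \<omega>\<bar> \<partial>P)" using UP mart_toD(1)[OF m] by (intro set_integral_abs_le)
    finally show ?thesis .
  qed
  moreover have "(\<lambda>k. c * prob (\<Union>t\<in>J k. H t)) \<longlonglongrightarrow> c * prob (\<Union>k. \<Union>t\<in>J k. H t)"
    using UP inc by (intro tendsto_mult_left finite_Lim_measure_incseq) auto
  ultimately have "c * prob (\<Union>k. \<Union>t\<in>J k. H t) \<le> (\<integral>\<omega>. \<bar>X \<omega>\<bar> \<partial>P)"
    by (intro LIMSEQ_le_const2) auto
  moreover have "(\<Union>k. \<Union>t\<in>J k. H t) = {\<omega>\<in>space P. \<exists>t\<in>Q. c < Y t \<omega>}"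
    unfolding J(3)[symmetric] H_def by auto
  ultimately show ?thesis by simp
qed

text \<open>The one-sided bound is applied to \<open>Y\<close> and to its negative, each time at the
  cost of the full L1 norm of \<open>X\<close>; this is the origin of the factor 2.\<close>

lemma maximal_inequality:
  assumes m: "mart_to Y X" and Q: "countable Q" "Q \<subseteq> I" and c: "0 \<le> c"
  shows "c * prob {\<omega>\<in>space P. \<exists>t\<in>Q. c < \<bar>Y t \<omega>\<bar>} \<le> 2 * (\<integral>\<omega>. \<bar>X \<omega>\<bar> \<partial>P)"
proof -
  let ?A = "{\<omega>\<in>space P. \<exists>t\<in>Q. c < Y t \<omega>}" and ?B = "{\<omega>\<in>space P. \<exists>t\<in>Q. c < - Y t \<omega>}"
  have meas: "?A \<in> sets P" "?B \<in> sets P"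
  proof -
    have "{\<omega>\<in>space P. c < Y t \<omega>} \<in> sets P" "{\<omega>\<in>space P. c < - Y t \<omega>} \<in> sets P" if "t \<in> Q" for t
      using level_sets[OF m] level_sets[OF mart_to_uminus[OF m]] sets_F that Q(2) by blast+
    then show "?A \<in> sets P" "?B \<in> sets P"
      using Q(1) by (auto intro!: sets.sets_Collect_countable_Bex)
  qed
  have "prob {\<omega>\<in>space P. \<exists>t\<in>Q. c < \<bar>Y t \<omega>\<bar>} \<le> prob (?A \<union> ?B)"
    using meas by (intro finite_measure_mono) (auto simp: abs_real_def split: if_splits)
  also have "\<dots> \<le> prob ?A + prob ?B" using meas by (intro measure_Un_le)
  finally have "prob {\<omega>\<in>space P. \<exists>t\<in>Q. c < \<bar>Y t \<omega>\<bar>} \<le> prob ?A + prob ?B" .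
  then have "c * prob {\<omega>\<in>space P. \<exists>t\<in>Q. c < \<bar>Y t \<omega>\<bar>} \<le> c * prob ?A + c * prob ?B"
    using c mult_left_mono[of "prob {\<omega>\<in>space P. \<exists>t\<in>Q. c < \<bar>Y t \<omega>\<bar>}" "prob ?A + prob ?B" c] by (simp add: distrib_left)
  then show ?thesis
    using maximal_one_sided[OF m Q c] maximal_one_sided[OF mart_to_uminus[OF m] Q c] by simp
qed

text \<open>Stopping at the first value below \<open>c\<close> bounds the integral of
  \<open>X\<close> over that event by \<open>c\<close> times its probability. Letting
  \<open>c\<close> tend to 0 will show that a nonnegative martingale which ends above 0 has stayed
  away from 0.\<close>

lemma small_value_integral:
  assumes m: "mart_to Y X" and Q: "countable Q" "Q \<subseteq> I" and c: "0 \<le> c"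
  shows "(\<integral>\<omega>\<in>{\<omega>\<in>space P. \<exists>t\<in>Q. Y t \<omega> \<le> c}. X \<omega> \<partial>P) \<le> c"
proof -
  obtain J where J: "\<And>k::nat. finite (J k)" "incseq J" "(\<Union>k. J k) = Q"
    using countable_exhaustion[OF Q(1)] by metis
  have JI: "J k \<subseteq> I" for k using J(3) Q(2) by blast
  define H where "H t = {\<omega>\<in>space P. Y t \<omega> \<le> c}" for t
  have H: "t \<in> I \<Longrightarrow> H t \<in> sets (F t)" for t unfolding H_def by (rule level_sets[OF m])
  have HP: "t \<in> I \<Longrightarrow> H t \<in> sets P" for t using H sets_F by blast
  have UP: "(\<Union>t\<in>J k. H t) \<in> sets P" for k using J(1) JI HP by (intro sets.finite_UN) auto
  have inc: "incseq (\<lambda>k. \<Union>t\<in>J k. H t)" using J(2) by (intro monoI UN_mono) (auto simp: incseq_def)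
  have "(\<integral>\<omega>\<in>(\<Union>t\<in>J k. H t). X \<omega> \<partial>P) \<le> c" for k
  proof -
    have "(\<integral>\<omega>\<in>(\<Union>t\<in>J k. H t). X \<omega> \<partial>P) \<le> c * prob (\<Union>t\<in>J k. H t)"
      using JI H by (intro entrance_upper[OF m J(1) JI]) (auto simp: H_def)
    also have "\<dots> \<le> c" using c mult_left_mono[of "prob (\<Union>t\<in>J k. H t)" 1 c] by simp
    finally show ?thesis .
  qed
  moreover have "(\<lambda>k. \<integral>\<omega>\<in>(\<Union>t\<in>J k. H t). X \<omega> \<partial>P) \<longlonglongrightarrow> (\<integral>\<omega>\<in>(\<Union>k. \<Union>t\<in>J k. H t). X \<omega> \<partial>P)"
    using UP inc mart_toD(1)[OF m]
    by (intro set_integral_cont_up set_integrable_sub sets.countable_UN) auto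
  ultimately have "(\<integral>\<omega>\<in>(\<Union>k. \<Union>t\<in>J k. H t). X \<omega> \<partial>P) \<le> c"
    by (intro LIMSEQ_le_const2) auto
  moreover have "(\<Union>k. \<Union>t\<in>J k. H t) = {\<omega>\<in>space P. \<exists>t\<in>Q. Y t \<omega> \<le> c}"
    unfolding J(3)[symmetric] H_def by auto
  ultimately show ?thesis by simp
qed

text \<open>The sign of \<open>Y t\<close> is known at time \<open>t\<close>, so on each of the two
  sign sets \<open>Y t\<close> can be replaced by \<open>X\<close>.\<close>

lemma mart_to_L1:
  assumes m: "mart_to Y X" and t: "t \<in> I"
  shows "(\<integral>\<omega>. \<bar>Y t \<omega>\<bar> \<partial>P) \<le> (\<integral>\<omega>. \<bar>X \<omega>\<bar> \<partial>P)"
proof -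
  let ?A = "{\<omega>\<in>space P. 0 \<le> Y t \<omega>}" and ?B = "{\<omega>\<in>space P. Y t \<omega> < 0}"
  have AB: "?A \<in> sets (F t)" "?B \<in> sets (F t)" using level_sets[OF m t] by blast+
  have ABP: "?A \<in> sets P" "?B \<in> sets P" using AB sets_F t by blast+
  note iY = mart_toD(3)[OF m t] and iX = mart_toD(1)[OF m]
  have "(\<integral>\<omega>. \<bar>Y t \<omega>\<bar> \<partial>P) = (\<integral>\<omega>. indicator ?A \<omega> *\<^sub>R Y t \<omega> - indicator ?B \<omega> *\<^sub>R Y t \<omega> \<partial>P)"
    by (intro Bochner_Integration.integral_cong) (auto simp: indicator_def)
  also have "\<dots> = (\<integral>\<omega>\<in>?A. Y t \<omega> \<partial>P) - (\<integral>\<omega>\<in>?B. Y t \<omega> \<partial>P)"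
    unfolding set_lebesgue_integral_def using iY ABP
    by (intro Bochner_Integration.integral_diff integrable_mult_indicator)
  also have "\<dots> = (\<integral>\<omega>\<in>?A. X \<omega> \<partial>P) - (\<integral>\<omega>\<in>?B. X \<omega> \<partial>P)"
    using mart_toD(4)[OF m t] AB by simp
  also have "\<dots> = (\<integral>\<omega>. indicator ?A \<omega> *\<^sub>R X \<omega> - indicator ?B \<omega> *\<^sub>R X \<omega> \<partial>P)"
    unfolding set_lebesgue_integral_def using iX ABP
    by (intro Bochner_Integration.integral_diff[symmetric] integrable_mult_indicator)
  also have "\<dots> \<le> (\<integral>\<omega>. \<bar>X \<omega>\<bar> \<partial>P)"
    using iX ABP by (intro integral_mono Bochner_Integration.integrable_diff integrable_mult_indicator)
       (auto simp: indicator_def)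
  finally show ?thesis .
qed

end

abbreviation gauss :: "real measure" where "gauss \<equiv> std_normal_distribution"

text \<open>Over a partition into equal steps \<open>h\<close> the bounds on the increments
  telescope to \<open>h * (G p - G q)\<close>, which vanishes as \<open>h\<close> tends to 0. This
  identifies two functions with the same monotone one-sided slope without differentiating
  either.\<close>

lemma telescoping_increments_const:
  fixes \<phi> G :: "real \<Rightarrow> real"
  assumes le: "p \<le> q"
    and bd: "\<And>x y. p \<le> x \<Longrightarrow> x < y \<Longrightarrow> y \<le> q \<Longrightarrow> \<bar>\<phi> y - \<phi> x\<bar> \<le> (y - x) * (G x - G y)"
  shows "\<phi> p = \<phi> q"
proof (cases "p = q")
  case False
  then have pq: "p < q" using le by simp
  have bound: "\<bar>\<phi> q - \<phi> p\<bar> \<le> (q - p) * (G p - G q) / real (Suc n)" for n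
  proof -
    define h where "h = (q - p) / real (Suc n)"
    have h: "0 < h" "real (Suc n) * h = q - p" using pq by (auto simp: h_def)
    define x where "x i = p + real i * h" for i :: nat
    have x: "x 0 = p" "x (Suc n) = q" using h by (auto simp: x_def)
    have step: "\<bar>\<phi> (x (Suc i)) - \<phi> (x i)\<bar> \<le> h * (G (x i) - G (x (Suc i)))" if "i < Suc n" for i
    proof -
      have "real (Suc i) * h \<le> real (Suc n) * h" using that h by (intro mult_right_mono) auto
      then have "x (Suc i) \<le> q" using h by (simp add: x_def del: of_nat_Suc)
      moreover have "p \<le> x i" "x (Suc i) - x i = h" using h by (auto simp: x_def algebra_simps)
      ultimately show ?thesis using bd[of "x i" "x (Suc i)"] h by simp
    qed
    have "\<phi> q - \<phi> p = (\<Sum>i<Suc n. \<phi> (x (Suc i)) - \<phi> (x i))"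
      using x sum_lessThan_telescope[of "\<lambda>i. \<phi> (x i)" "Suc n"] by simp
    then have "\<bar>\<phi> q - \<phi> p\<bar> \<le> (\<Sum>i<Suc n. \<bar>\<phi> (x (Suc i)) - \<phi> (x i)\<bar>)"
      by (simp only:) (rule sum_abs)
    also have "\<dots> \<le> (\<Sum>i<Suc n. h * (G (x i) - G (x (Suc i))))"
      using step by (intro sum_mono) auto
    also have "\<dots> = h * (G p - G q)"
      using x sum_lessThan_telescope'[of "\<lambda>i. G (x i)" "Suc n"] by (simp only: sum_distrib_left[symmetric])
    finally show ?thesis by (simp add: h_def)
  qed
  have "(\<lambda>n. (q - p) * (G p - G q) / real (Suc n)) \<longlonglongrightarrow> 0"
    by (rule LIMSEQ_Suc) (rule lim_const_over_n)
  then have "\<bar>\<phi> q - \<phi> p\<bar> \<le> 0" using bound by (intro LIMSEQ_le_const) auto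
  then show ?thesis by simp
qed simp

section \<open>Call functions of probability laws and their one-sided derivatives\<close>

locale call_distribution = real_distribution \<mu> for \<mu> +
  assumes integrable_ident: "integrable \<mu> (\<lambda>y. y)"
begin

lemma integrable_call: "integrable \<mu> (\<lambda>y. max (y - x) 0)"
  by (rule Bochner_Integration.integrable_bound[of _ "\<lambda>y. \<bar>y\<bar> + \<bar>x\<bar>"])
     (auto intro!: integrable_ident)

lemma call_diff:
  "call_of_measure \<mu> p - call_of_measure \<mu> q = (\<integral>y. max (y - p) 0 - max (y - q) 0 \<partial>\<mu>)"
  unfolding call_of_measure_def by (simp add: integrable_call)

lemma integral_indicator_real: "A \<in> sets borel \<Longrightarrow> (\<integral>y. c * indicator A y \<partial>\<mu>) = c * measure \<mu> A"
  for c :: real by simp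

lemma integrable_indicator_real: "A \<in> sets borel \<Longrightarrow> integrable \<mu> (\<lambda>y. c * indicator A y :: real)"
  by (intro integrable_mult_right integrable_real_indicator) (auto simp: emeasure_eq_measure)

lemma tail: "measure \<mu> {x<..} = 1 - cdf \<mu> x"
proof -
  have "measure \<mu> (space \<mu> - {..x}) = 1 - measure \<mu> {..x}" by (rule prob_compl) simp
  moreover have "space \<mu> - {..x} = {x<..}" by auto
  ultimately show ?thesis by (simp add: cdf_def)
qed

text \<open>The difference of the two payoffs rises linearly from 0 to \<open>q - p\<close> between
  \<open>p\<close> and \<open>q\<close>, hence lies between \<open>q - p\<close> times the
  indicators of the tails beyond \<open>q\<close> and beyond \<open>p\<close>.\<close>

lemma call_diff_bounds:
  assumes "p < q"
  shows "call_of_measure \<mu> p - call_of_measure \<mu> q \<le> (q - p) * measure \<mu> {p<..}"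
    "(q - p) * measure \<mu> {q..} \<le> call_of_measure \<mu> p - call_of_measure \<mu> q"
    "(q - p) * measure \<mu> {q<..} \<le> call_of_measure \<mu> p - call_of_measure \<mu> q"
proof -
  have i: "integrable \<mu> (\<lambda>y. max (y - p) 0 - max (y - q) 0)" by (simp add: integrable_call)
  have "(\<integral>y. max (y - p) 0 - max (y - q) 0 \<partial>\<mu>) \<le> (\<integral>y. (q - p) * indicator {p<..} y \<partial>\<mu>)"
    using assms by (intro integral_mono i integrable_indicator_real) (auto simp: indicator_def max_def)
  then show 1: "call_of_measure \<mu> p - call_of_measure \<mu> q \<le> (q - p) * measure \<mu> {p<..}"
    unfolding call_diff by (subst (asm) integral_indicator_real) auto
  have "(\<integral>y. (q - p) * indicator {q..} y \<partial>\<mu>) \<le> (\<integral>y. max (y - p) 0 - max (y - q) 0 \<partial>\<mu>)"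
    using assms by (intro integral_mono i integrable_indicator_real) (auto simp: indicator_def max_def)
  then show 2: "(q - p) * measure \<mu> {q..} \<le> call_of_measure \<mu> p - call_of_measure \<mu> q"
    unfolding call_diff by (subst (asm) integral_indicator_real) auto
  have "(q - p) * measure \<mu> {q<..} \<le> (q - p) * measure \<mu> {q..}"
    using assms by (intro mult_left_mono finite_measure_mono) auto
  with 2 show "(q - p) * measure \<mu> {q<..} \<le> call_of_measure \<mu> p - call_of_measure \<mu> q" by simp
qed

text \<open>Difference quotients are squeezed between the tails at the two endpoints, and the open
  tail is right continuous.\<close>

lemma call_right_derivative:
  "(call_of_measure \<mu> has_real_derivative - measure \<mu> {x<..}) (at_right x)"
  unfolding has_field_derivative_iff
proof (rule tendsto_sandwich)
  have cdf: "(cdf \<mu> \<longlongrightarrow> cdf \<mu> x) (at_right x)"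
    using cdf_is_right_cont[of x] by (simp add: continuous_within)
  show "((\<lambda>y. - measure \<mu> {x<..}) \<longlongrightarrow> - measure \<mu> {x<..}) (at_right x)" by simp
  show "((\<lambda>y. - measure \<mu> {y<..}) \<longlongrightarrow> - measure \<mu> {x<..}) (at_right x)"
    unfolding tail by (intro tendsto_intros cdf)
  show "\<forall>\<^sub>F y in at_right x. - measure \<mu> {x<..} \<le> (call_of_measure \<mu> y - call_of_measure \<mu> x) / (y - x)"
    using call_diff_bounds(1)[of x] by (auto simp: eventually_at_filter le_divide_eq algebra_simps)
  show "\<forall>\<^sub>F y in at_right x. (call_of_measure \<mu> y - call_of_measure \<mu> x) / (y - x) \<le> - measure \<mu> {y<..}"
    using call_diff_bounds(3)[of x] by (auto simp: eventually_at_filter divide_le_eq algebra_simps)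
qed

text \<open>From the left the open tails converge to the closed one, so the jump of the slope at
  \<open>x\<close> is the atom there. This is how a slope at a barrier becomes the probability of
  sitting at it.\<close>

lemma call_left_derivative:
  "(call_of_measure \<mu> has_real_derivative - measure \<mu> {x..}) (at_left x)"
  unfolding has_field_derivative_iff
proof (rule tendsto_sandwich)
  have "measure \<mu> (space \<mu> - {..<x}) = 1 - measure \<mu> {..<x}" by (rule prob_compl) simp
  moreover have "space \<mu> - {..<x} = {x..}" by auto
  ultimately have t: "measure \<mu> {x..} = 1 - measure \<mu> {..<x}" by simp
  show "((\<lambda>y. - measure \<mu> {y<..}) \<longlongrightarrow> - measure \<mu> {x..}) (at_left x)"
    unfolding tail t by (intro tendsto_intros cdf_at_left)
  show "((\<lambda>y. - measure \<mu> {x..}) \<longlongrightarrow> - measure \<mu> {x..}) (at_left x)" by simp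
  have e: "(call_of_measure \<mu> y - call_of_measure \<mu> x) / (y - x)
      = - ((call_of_measure \<mu> y - call_of_measure \<mu> x) / (x - y))" if "y < x" for y
    using that by (simp add: field_simps)
  show "\<forall>\<^sub>F y in at_left x. - measure \<mu> {y<..} \<le> (call_of_measure \<mu> y - call_of_measure \<mu> x) / (y - x)"
    using call_diff_bounds(1)[of _ x] e by (auto simp: eventually_at_filter divide_le_eq algebra_simps)
  show "\<forall>\<^sub>F y in at_left x. (call_of_measure \<mu> y - call_of_measure \<mu> x) / (y - x) \<le> - measure \<mu> {x..}"
    using call_diff_bounds(2)[of _ x] e by (auto simp: eventually_at_filter le_divide_eq algebra_simps)
qed

text \<open>The negative tail probability is a subgradient at every point.\<close>

lemma call_convex: "convex_on A (call_of_measure \<mu>)" if "convex A"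
proof (rule convex_on_subset[OF pos_convex_function])
  fix x y :: real
  show "- measure \<mu> {x<..} * (y - x) \<le> call_of_measure \<mu> y - call_of_measure \<mu> x"
  proof (cases x y rule: linorder_cases)
    case less then show ?thesis using call_diff_bounds(1)[of x y] by (simp add: algebra_simps)
  next
    case greater then show ?thesis using call_diff_bounds(3)[of y x] by (simp add: algebra_simps)
  qed simp
qed (use that in auto)

lemma call_nonneg: "0 \<le> call_of_measure \<mu> x"
  unfolding call_of_measure_def by (rule integral_nonneg_AE) auto

lemma call_tendsto_0: "(call_of_measure \<mu> \<longlongrightarrow> 0) at_top"
proof -
  have "((\<lambda>x. \<integral>y. max (y - x) 0 \<partial>\<mu>) \<longlongrightarrow> (\<integral>y. 0 \<partial>\<mu>)) at_top"
  proof (rule integral_dominated_convergence_at_top[where w = "\<lambda>y. \<bar>y\<bar>"])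
    show "integrable \<mu> (\<lambda>y. \<bar>y\<bar>)" using integrable_ident by simp
    show "\<forall>\<^sub>F i in at_top. AE x in \<mu>. norm (max (x - i) 0) \<le> \<bar>x\<bar>"
      using eventually_ge_at_top[of 0] by eventually_elim auto
    show "AE x in \<mu>. ((\<lambda>i. max (x - i) 0) \<longlongrightarrow> 0) at_top"
    proof (rule AE_I2)
      fix x :: real show "((\<lambda>i. max (x - i) 0) \<longlongrightarrow> 0) at_top"
        by (rule tendsto_eventually) (use eventually_ge_at_top[of x] in eventually_elim, auto)
    qed
  qed auto
  then show ?thesis unfolding call_of_measure_def by simp
qed

end

lemma call_distributionI:
  "prob_space \<mu> \<Longrightarrow> sets \<mu> = sets borel \<Longrightarrow> integrable \<mu> (\<lambda>y. y) \<Longrightarrow> call_distribution \<mu>"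
  by (auto simp: call_distribution_def call_distribution_axioms_def real_distribution_def
      real_distribution_axioms_def dest: sets_eq_imp_space_eq)

lemma (in prob_space) call_distribution_distr:
  assumes "integrable M X" shows "call_distribution (distr M borel X)"
proof -
  have [measurable]: "X \<in> borel_measurable M" using assms by auto
  show ?thesis
    by (rule call_distributionI) (auto intro!: prob_space_distr simp: integrable_distr_eq assms)
qed

lemma call_of_distr:
  assumes "X \<in> borel_measurable M"
  shows "call_of_measure (distr M borel X) x = (\<integral>\<omega>. max (X \<omega> - x) 0 \<partial>M)"
  unfolding call_of_measure_def using assms by (subst integral_distr) auto

section \<open>Laws from convex functions\<close>

text \<open>It will turn out that \<open>g\<close> is \<open>\<beta>\<close> times the call function
  of a probability law on the positive reals. The case \<open>\<beta> = 0\<close>, a barrier reached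
  with probability zero, is included and forces \<open>g\<close> to vanish on the half-line.\<close>

locale convex_call =
  fixes g :: "real \<Rightarrow> real" and \<beta> :: real
  assumes conv: "convex_on {0..} g"
    and der: "(g has_real_derivative - \<beta>) (at_right 0)"
    and lim: "(g \<longlongrightarrow> 0) at_top"
begin

definition slope :: "real \<Rightarrow> real \<Rightarrow> real" where "slope x y = (g y - g x) / (y - x)"

text \<open>The right derivative of \<open>g\<close>: slopes of chords from \<open>x\<close>
  increase with the other endpoint, so the limit is an infimum. In this form it is available before
  any differentiability is shown.\<close>

definition rder :: "real \<Rightarrow> real" where "rder x = (INF y\<in>{x<..}. slope x y)"

lemma slope_mono:
  assumes "0 \<le> x" "x < y" "y < z"
  shows "slope x y \<le> slope x z" "slope x z \<le> slope y z" "slope x y \<le> slope y z"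
proof -
  have e: "slope a b = (g a - g b) / (a - b)" for a b
    unfolding slope_def by (metis minus_diff_eq minus_divide_divide)
  show "slope x y \<le> slope x z" "slope x z \<le> slope y z"
    unfolding e using convex_on_slope_le[OF conv, of x z y] assms by auto
  then show "slope x y \<le> slope y z" by simp
qed

lemma slope_0_lim: "(slope 0 \<longlongrightarrow> - \<beta>) (at_right 0)"
  using der unfolding has_field_derivative_iff slope_def by simp

lemma slope_0_ge: "0 < y \<Longrightarrow> - \<beta> \<le> slope 0 y"
proof (rule tendsto_upperbound[OF slope_0_lim])
  assume "0 < y"
  then have "\<forall>\<^sub>F z in at_right 0. z < y \<and> 0 < z"
    by (auto simp: eventually_at_right_field)
  then show "\<forall>\<^sub>F z in at_right 0. slope 0 z \<le> slope 0 y"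
    by eventually_elim (auto intro: slope_mono)
qed simp

lemma slope_ge: "0 \<le> x \<Longrightarrow> x < y \<Longrightarrow> - \<beta> \<le> slope x y"
  using slope_0_ge[of y] slope_0_ge[of x] slope_mono(2)[of 0 x y] by (cases "x = 0") auto

lemma bdd: "0 \<le> x \<Longrightarrow> bdd_below (slope x ` {x<..})"
  using slope_ge by (intro bdd_belowI[of _ "- \<beta>"]) auto

lemma rder_le_slope: "0 \<le> x \<Longrightarrow> x < y \<Longrightarrow> rder x \<le> slope x y"
  unfolding rder_def using bdd by (intro cINF_lower) auto

lemma slope_le_rder: "0 \<le> x \<Longrightarrow> x < y \<Longrightarrow> slope x y \<le> rder y"
  unfolding rder_def using slope_mono(3) by (intro cINF_greatest) auto

lemma rder_mono: "0 \<le> x \<Longrightarrow> x \<le> y \<Longrightarrow> rder x \<le> rder y"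
  using rder_le_slope[of x y] slope_le_rder[of x y] by (cases "x = y") auto

lemma rder_ge: "0 \<le> x \<Longrightarrow> - \<beta> \<le> rder x"
  unfolding rder_def using slope_ge by (intro cINF_greatest) auto

text \<open>The infimum agrees with the derivative given at 0. Later this makes the distribution
  function vanish at 0, so that the law has no atom there.\<close>

lemma rder_0: "rder 0 = - \<beta>"
proof (rule antisym)
  show "rder 0 \<le> - \<beta>"
    by (rule tendsto_lowerbound[OF slope_0_lim])
       (auto intro!: rder_le_slope exI[of _ 1] simp: eventually_at_right_field)
qed (simp add: rder_ge)

lemma g_continuous: "0 \<le> x \<Longrightarrow> (g \<longlongrightarrow> g x) (at_right x)"
proof (cases "x = 0")
  case True
  have "continuous (at_right 0) g" using der by (rule DERIV_continuous)
  then show ?thesis using True by (simp add: continuous_within)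
next
  case False
  assume "0 \<le> x"
  with False have "0 < x" by simp
  have "continuous_on {0<..} g"
    by (rule convex_on_continuous) (auto intro: convex_on_subset[OF conv])
  then have "isCont g x" using \<open>0 < x\<close> by (simp add: continuous_on_eq_continuous_at)
  then show ?thesis by (simp add: continuous_at tendsto_within_subset[where S=UNIV])
qed

text \<open>One half is monotonicity. For the other, a chord from \<open>x\<close> with slope below
  \<open>a\<close> keeps a slope below \<open>a\<close> when its left endpoint moves slightly to the
  right.\<close>

lemma rder_right_cont:
  assumes x: "0 \<le> x" shows "(rder \<longlongrightarrow> rder x) (at_right x)"
proof (rule order_tendstoI)
  fix a assume "a < rder x"
  have "\<forall>\<^sub>F z in at_right x. x < z" by (simp add: eventually_at_right_less)
  then show "\<forall>\<^sub>F z in at_right x. a < rder z"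
  proof eventually_elim
    case (elim z) then show ?case using rder_mono[OF x, of z] \<open>a < rder x\<close> by simp
  qed
next
  fix a assume a: "rder x < a"
  then obtain y where y: "x < y" "slope x y < a"
    unfolding rder_def using x bdd cINF_less_iff[of "{x<..}" "slope x" a] by auto
  have "((\<lambda>z. slope z y) \<longlongrightarrow> slope x y) (at_right x)"
    unfolding slope_def using y by (intro tendsto_intros g_continuous x) auto
  then have "\<forall>\<^sub>F z in at_right x. slope z y < a" using y(2) by (rule order_tendstoD)
  moreover have "\<forall>\<^sub>F z in at_right x. x < z \<and> z < y" using y(1) by (auto simp: eventually_at_right_field)
  ultimately show "\<forall>\<^sub>F z in at_right x. rder z < a"
  proof eventually_elim
    case (elim z) then show ?case using rder_le_slope[of z y] x by simp
  qed
qed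

text \<open>The derivative lies between the slopes of the unit chords to the left and to the right,
  and both vanish in the limit because \<open>g\<close> converges.\<close>

lemma rder_lim: "(rder \<longlongrightarrow> 0) at_top"
proof (rule tendsto_sandwich)
  have "filterlim (\<lambda>x::real. x - 1) at_top at_top" "filterlim (\<lambda>x::real. x + 1) at_top at_top"
    using filterlim_tendsto_add_at_top[OF tendsto_const filterlim_ident, of "- 1 :: real"]
      filterlim_tendsto_add_at_top[OF tendsto_const filterlim_ident, of "1 :: real"]
    by (simp_all add: add.commute)
  then have l: "((\<lambda>x. g (x - 1)) \<longlongrightarrow> 0) at_top" "((\<lambda>x. g (x + 1)) \<longlongrightarrow> 0) at_top"
    using lim by (auto intro: filterlim_compose)
  show "((\<lambda>x. g x - g (x - 1)) \<longlongrightarrow> 0) at_top" using tendsto_diff[OF lim l(1)] by simp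
  show "((\<lambda>x. g (x + 1) - g x) \<longlongrightarrow> 0) at_top" using tendsto_diff[OF l(2) lim] by simp
  show "\<forall>\<^sub>F x in at_top. g x - g (x - 1) \<le> rder x"
    using eventually_ge_at_top[of 1] 
  proof eventually_elim
    case (elim x) then show ?case using slope_le_rder[of "x - 1" x] by (simp add: slope_def)
  qed
  show "\<forall>\<^sub>F x in at_top. rder x \<le> g (x + 1) - g x"
    using eventually_ge_at_top[of 0] 
  proof eventually_elim
    case (elim x) then show ?case using rder_le_slope[of x "x + 1"] by (simp add: slope_def)
  qed
qed

lemma rder_nonpos: "0 \<le> x \<Longrightarrow> rder x \<le> 0"
  using rder_mono by (intro tendsto_lowerbound[OF rder_lim])
    (auto simp: eventually_at_top_linorder)

lemma g_decreasing: "0 \<le> x \<Longrightarrow> x \<le> y \<Longrightarrow> g y \<le> g x"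
proof (cases "x = y")
  case False
  assume xy: "0 \<le> x" "x \<le> y"
  with False have "(g y - g x) / (y - x) \<le> 0" "0 < y - x"
    using slope_le_rder[of x y] rder_nonpos[of y] by (auto simp: slope_def)
  then have "(g y - g x) \<le> 0 * (y - x)" by (subst (asm) pos_divide_le_eq)
  then show ?thesis by simp
qed simp

lemma g_nonneg: "0 \<le> x \<Longrightarrow> 0 \<le> g x"
  using g_decreasing by (intro tendsto_upperbound[OF lim]) (auto simp: eventually_at_top_linorder)

lemma beta_nonneg: "0 \<le> \<beta>" using rder_nonpos[of 0] rder_0 by simp

lemma g_zero: assumes "\<beta> = 0" "0 \<le> x" shows "g x = 0"
proof -
  have "slope 0 y \<ge> 0" if "0 < y" for y using slope_0_ge[OF that] assms by simp
  then have "g 0 \<le> g y" if "0 \<le> y" for y using that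
    by (cases "y = 0") (auto simp: slope_def zero_le_divide_iff)
  then have "g 0 \<le> 0" using lim by (intro tendsto_lowerbound[OF lim]) (auto simp: eventually_at_top_linorder)
  then show ?thesis using g_decreasing[of 0 x] g_nonneg[of x] assms by simp
qed

text \<open>The tail of a law is minus the slope of its call function; division by
  \<open>\<beta>\<close> normalizes the mass beyond 0 to 1.\<close>

definition cdf_g :: "real \<Rightarrow> real" where "cdf_g x = (if x < 0 then 0 else 1 + rder x / \<beta>)"

definition law_g :: "real measure" where "law_g = interval_measure cdf_g"

context assumes bpos: "0 < \<beta>" begin

lemma cdf_g_mono: "x \<le> y \<Longrightarrow> cdf_g x \<le> cdf_g y"
  using bpos rder_mono[of x y] rder_ge[of y] 
  by (auto simp: cdf_g_def divide_right_mono) (simp add: field_simps)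

lemma cdf_g_right_cont: "continuous (at_right a) cdf_g"
proof (cases "a < 0")
  case True
  have "\<forall>\<^sub>F x in at_right a. cdf_g x = cdf_g a"
    using True by (auto simp: eventually_at_right_field cdf_g_def)
  then show ?thesis unfolding continuous_within by (rule tendsto_eventually)
next
  case False
  have "((\<lambda>x. 1 + rder x / \<beta>) \<longlongrightarrow> 1 + rder a / \<beta>) (at_right a)"
    using False bpos by (intro tendsto_intros rder_right_cont) auto
  moreover have "\<forall>\<^sub>F x in at_right a. 1 + rder x / \<beta> = cdf_g x"
    using False by (auto simp: eventually_at_right_field cdf_g_def intro!: exI[of _ "a + 1"])
  ultimately have "(cdf_g \<longlongrightarrow> 1 + rder a / \<beta>) (at_right a)"
    by (rule Lim_transform_eventually)
  then show ?thesis using False by (simp add: continuous_within cdf_g_def)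
qed

lemma cdf_g_bot: "(cdf_g \<longlongrightarrow> 0) at_bot"
  by (rule tendsto_eventually) (auto simp: eventually_at_bot_dense cdf_g_def)

lemma cdf_g_top: "(cdf_g \<longlongrightarrow> 1) at_top"
proof -
  have "((\<lambda>x. 1 + rder x / \<beta>) \<longlongrightarrow> 1 + 0 / \<beta>) at_top"
    using bpos by (intro tendsto_intros rder_lim) auto
  moreover have "\<forall>\<^sub>F x in at_top. 1 + rder x / \<beta> = cdf_g x"
    using eventually_ge_at_top[of 0] by eventually_elim (simp add: cdf_g_def)
  ultimately show ?thesis by (auto intro: Lim_transform_eventually)
qed

lemma real_distribution_law_g: "real_distribution law_g"
  unfolding law_g_def using cdf_g_mono cdf_g_right_cont cdf_g_bot cdf_g_top
  by (rule real_distribution_interval_measure)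

lemma cdf_law_g: "cdf law_g = cdf_g"
  unfolding law_g_def using cdf_g_mono cdf_g_right_cont cdf_g_bot by (rule cdf_interval_measure)

lemma law_g_props:
  shows "integrable law_g (\<lambda>y. y)" "AE y in law_g. 0 < y"
    and "\<And>x. 0 \<le> x \<Longrightarrow> call_of_measure law_g x = g x / \<beta>"
proof -
  interpret real_distribution law_g by (rule real_distribution_law_g)
  have "measure law_g {..0} = 0"
    using fun_cong[OF cdf_law_g, of 0] bpos by (simp add: cdf_def cdf_g_def rder_0)
  then have "{..0} \<in> null_sets law_g" by (auto simp: null_sets_def emeasure_eq_measure)
  then have "AE y in law_g. y \<notin> {..0}" by (rule AE_not_in)
  then show pos: "AE y in law_g. 0 < y" by eventually_elim auto
  have tail: "measure law_g {x<..} = - rder x / \<beta>" if "0 \<le> x" for x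
  proof -
    have "measure law_g (space law_g - {..x}) = 1 - measure law_g {..x}" by (rule prob_compl) simp
    moreover have "space law_g - {..x} = {x<..}" by auto
    ultimately show ?thesis using fun_cong[OF cdf_law_g, of x] that by (simp add: cdf_def cdf_g_def)
  qed
  \<comment> \<open>Calls capped at the distance to \<open>Z\<close>: their payoffs are bounded, so
    they can be integrated before the law is known to have a mean.\<close>
  define J where "J Z x = (\<integral>y. min (max (y - x) 0) (Z - x) \<partial>law_g)" for Z x
  have J: "J Z x = (g x - g Z) / \<beta>" if "0 \<le> x" "x \<le> Z" for x Z
  proof -
    have int: "integrable law_g (\<lambda>y. min (max (y - x) 0) (Z - x))" if "x \<le> Z" for x
      using that by (intro integrable_const_bound[where B="Z - x"]) auto
    \<comment> \<open>The increments of \<open>J Z\<close> and of \<open>g / \<beta>\<close> over a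
      step both lie between the step times the tails at its ends, so the difference of the two
      functions is constant.\<close>
    have "J Z x - g x / \<beta> = J Z Z - g Z / \<beta>"
    proof (rule telescoping_increments_const[where G = "\<lambda>x. - rder x / \<beta>", OF that(2)])
      fix p q assume pq: "x \<le> p" "p < q" "q \<le> Z"
      have iI: "integrable law_g (\<lambda>y. (q - p) * indicator A y)" if "A \<in> sets borel" for A
        using that by (intro integrable_mult_right integrable_real_indicator) (auto simp: emeasure_eq_measure)
      have d: "J Z p - J Z q = (\<integral>y. min (max (y - p) 0) (Z - p) - min (max (y - q) 0) (Z - q) \<partial>law_g)"
        unfolding J_def using pq by (intro Bochner_Integration.integral_diff[symmetric] int) auto
      have "J Z p - J Z q \<le> (\<integral>y. (q - p) * indicator {p<..} y \<partial>law_g)"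
        unfolding d using pq by (intro integral_mono Bochner_Integration.integrable_diff int iI)
          (auto simp: indicator_def)
      then have u: "J Z p - J Z q \<le> (q - p) * (- rder p / \<beta>)" using tail[of p] pq \<open>0 \<le> x\<close> by simp
      have "(\<integral>y. (q - p) * indicator {q<..} y \<partial>law_g) \<le> J Z p - J Z q"
        unfolding d using pq by (intro integral_mono Bochner_Integration.integrable_diff int iI)
          (auto simp: indicator_def)
      then have l: "(q - p) * (- rder q / \<beta>) \<le> J Z p - J Z q" using tail[of q] pq \<open>0 \<le> x\<close> by simp
      have s: "(q - p) * rder p \<le> g q - g p" "g q - g p \<le> (q - p) * rder q"
        using rder_le_slope[of p q] slope_le_rder[of p q] pq \<open>0 \<le> x\<close>
        by (auto simp: slope_def divide_le_eq le_divide_eq mult.commute)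
      have s': "(q - p) * rder p / \<beta> \<le> g q / \<beta> - g p / \<beta>" "g q / \<beta> - g p / \<beta> \<le> (q - p) * rder q / \<beta>"
        using divide_right_mono[OF s(1), of \<beta>] divide_right_mono[OF s(2), of \<beta>] bpos
        by (auto simp: diff_divide_distrib)
      show "\<bar>J Z q - g q / \<beta> - (J Z p - g p / \<beta>)\<bar> \<le> (q - p) * (- rder p / \<beta> - - rder q / \<beta>)"
        using u l s' by (simp add: right_diff_distrib abs_le_iff)
    qed
    moreover have "J Z Z = 0"
    proof -
      have "min (max (y - Z) 0) (Z - Z) = 0" for y by simp
      then show ?thesis unfolding J_def by (simp only: integral_zero)
    qed
    ultimately show ?thesis by (simp add: diff_divide_distrib)
  qed
  have call: "integrable law_g (\<lambda>y. max (y - x) 0) \<and> call_of_measure law_g x = g x / \<beta>" if "0 \<le> x" for x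
  proof -
    \<comment> \<open>Removing the cap by monotone convergence yields integrability and the value at
      once.\<close>
    have 1: "integrable law_g (\<lambda>y. min (max (y - x) 0) (real n))" for n
      by (intro integrable_const_bound[where B="real n"]) auto
    have 2: "AE y in law_g. mono (\<lambda>n. min (max (y - x) 0) (real n))"
      by (auto simp: mono_def)
    have 3: "AE y in law_g. (\<lambda>n. min (max (y - x) 0) (real n)) \<longlonglongrightarrow> max (y - x) 0"
    proof (rule AE_I2)
      fix y
      obtain N :: nat where N: "max (y - x) 0 \<le> real N" using real_arch_simple by blast
      have "\<forall>\<^sub>F n in sequentially. min (max (y - x) 0) (real n) = max (y - x) 0"
        using eventually_ge_at_top[of N]
      proof eventually_elim
        case (elim n)
        then have "real N \<le> real n" by simp
        with N show ?case by linarith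
      qed
      then show "(\<lambda>n. min (max (y - x) 0) (real n)) \<longlonglongrightarrow> max (y - x) 0" by (rule tendsto_eventually)
    qed
    have "(\<integral>y. min (max (y - x) 0) (real n) \<partial>law_g) = (g x - g (x + real n)) / \<beta>" for n
      using J[of x "x + real n"] that by (simp add: J_def)
    moreover have "(\<lambda>n. (g x - g (x + real n)) / \<beta>) \<longlonglongrightarrow> (g x - 0) / \<beta>"
      using bpos by (intro tendsto_intros filterlim_compose[OF lim]
          filterlim_tendsto_add_at_top[OF tendsto_const] filterlim_real_sequentially) auto
    ultimately have 4: "(\<lambda>n. \<integral>y. min (max (y - x) 0) (real n) \<partial>law_g) \<longlonglongrightarrow> g x / \<beta>" by simp
    show ?thesis unfolding call_of_measure_def
      using integrable_monotone_convergence[OF 1 2 3 4] integral_monotone_convergence[OF 1 2 3 4] by simp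
  qed
  show "call_of_measure law_g x = g x / \<beta>" if "0 \<le> x" for x using call that by simp
  have "AE y in law_g. max (y - 0) 0 = y" using pos by eventually_elim auto
  then show "integrable law_g (\<lambda>y. y)"
    using call[of 0] by (subst integrable_cong_AE[where g="\<lambda>y. max (y - 0) 0"]) auto
qed

end
end

section \<open>Laws as images of the standard normal law\<close>

lemma real_distribution_gauss: "real_distribution gauss" by (rule real_dist_normal_dist)

interpretation gauss: real_distribution gauss by (rule real_distribution_gauss)

lemma isCont_cdf_gauss: "isCont (cdf gauss) x"
proof -
  have "emeasure gauss {x} = 0"
    by (subst emeasure_density)
       (auto intro!: nn_integral_0_iff_AE[THEN iffD2] AE_I[where N="{x}"] simp: indicator_def)
  then show ?thesis by (simp add: gauss.isCont_cdf measure_def)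
qed

lemma cdf_gauss_IVT:
  assumes "0 < u" "u < 1" obtains z where "cdf gauss z = u"
proof -
  obtain a where a: "cdf gauss a < u"
    using order_tendstoD(2)[OF gauss.cdf_lim_at_bot assms(1)] by (auto simp: eventually_at_bot_linorder)
  obtain b where b: "u < cdf gauss b"
    using order_tendstoD(1)[OF gauss.cdf_lim_at_top_prob assms(2)] by (auto simp: eventually_at_top_linorder)
  have "a \<le> b" using a b gauss.cdf_nondecreasing[of b a] by (cases "a \<le> b") auto
  then have "\<exists>z\<ge>a. z \<le> b \<and> cdf gauss z = u"
    using a b isCont_cdf_gauss by (intro IVT) auto
  then show ?thesis using that by blast
qed

lemma cdf_gauss_measurable[measurable]: "cdf gauss \<in> borel_measurable borel"
  by (intro borel_measurable_continuous_onI continuous_at_imp_continuous_on ballI isCont_cdf_gauss)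

text \<open>The probability integral transform. Both bounds compare with a half-line
  \<open>{..z}\<close> whose normal mass is a nearby level \<open>v\<close>, so monotonicity and the
  intermediate value property of the distribution function suffice.\<close>

lemma gauss_cdf_uniform:
  assumes "0 \<le> u" "u \<le> 1" shows "measure gauss {z. cdf gauss z \<le> u} = u"
proof (rule antisym)
  have m: "{z. cdf gauss z \<le> u} \<in> sets borel" by measurable
  show "measure gauss {z. cdf gauss z \<le> u} \<le> u"
  proof (rule dense_ge)
    fix v assume v: "u < v"
    show "measure gauss {z. cdf gauss z \<le> u} \<le> v"
    proof (cases "v < 1")
      case True
      then obtain z where z: "cdf gauss z = v" using cdf_gauss_IVT[of v] assms v by auto
      have "measure gauss {z. cdf gauss z \<le> u} \<le> measure gauss {..z}"
      proof (rule gauss.finite_measure_mono)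
        show "{z. cdf gauss z \<le> u} \<subseteq> {..z}"
        proof
          fix w assume "w \<in> {z. cdf gauss z \<le> u}"
          then show "w \<in> {..z}" using z v gauss.cdf_nondecreasing[of z w] by (cases "w \<le> z") auto
        qed
      qed simp
      then show ?thesis using z by (simp add: cdf_def)
    next
      case False then show ?thesis using gauss.prob_le_1[of "{z. cdf gauss z \<le> u}"] by linarith
    qed
  qed
  show "u \<le> measure gauss {z. cdf gauss z \<le> u}"
  proof (rule dense_le)
    fix v assume v: "v < u"
    show "v \<le> measure gauss {z. cdf gauss z \<le> u}"
    proof (cases "0 < v")
      case True
      then obtain z where z: "cdf gauss z = v" using cdf_gauss_IVT[of v] assms v by auto
      have "measure gauss {..z} \<le> measure gauss {z. cdf gauss z \<le> u}"
      proof (rule gauss.finite_measure_mono)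
        show "{..z} \<subseteq> {z. cdf gauss z \<le> u}"
          using z v gauss.cdf_nondecreasing[of _ z] by force
      qed (use m in simp)
      then show ?thesis using z by (simp add: cdf_def)
    next
      case False then show ?thesis using measure_nonneg[of gauss "{z. cdf gauss z \<le> u}"] by linarith
    qed
  qed
qed

text \<open>The quantile function of \<nu> applied to a uniform variable, here the normal
  distribution function evaluated at \<open>z\<close>.\<close>

lemma gauss_quantile:
  assumes "real_distribution \<nu>"
  obtains y where "y \<in> borel_measurable borel" "distr gauss borel y = \<nu>"
proof -
  interpret \<nu>: cdf_distribution \<nu> using assms by (simp add: cdf_distribution_def)
  \<comment> \<open>The pseudoinverse is characterized at levels strictly between 0 and 1;
    elsewhere, on a null set, \<open>y\<close> gets the value 0.\<close>
  define U where "U = {z. 0 < cdf gauss z \<and> cdf gauss z < 1}"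
  have U[measurable]: "U \<in> sets borel" unfolding U_def by measurable
  define y where "y z = (if z \<in> U then Inf {x. cdf gauss z \<le> cdf \<nu> x} else 0)" for z
  have y_le: "y z \<le> x \<longleftrightarrow> cdf gauss z \<le> cdf \<nu> x" if "z \<in> U" for x z
    using that \<nu>.pseudoinverse[of "cdf gauss z" x] by (simp add: y_def U_def)
  have "{z. y z \<le> x} = ({z. cdf gauss z \<le> cdf \<nu> x} \<inter> U) \<union> (if 0 \<le> x then - U else {})" for x
    using y_le by (auto simp: y_def)
  then have y[measurable]: "y \<in> borel_measurable borel"
    by (intro borel_measurableI_le) (auto simp: Compl_eq_Diff_UNIV intro!: sets.Un sets.Int, measurable)
  have "AE z in gauss. z \<in> U"
  proof -
    have "{z. cdf gauss z \<le> 0} \<in> null_sets gauss"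
      using gauss_cdf_uniform[of 0] by (auto simp: null_sets_def gauss.emeasure_eq_measure)
    then have 1: "AE z in gauss. z \<notin> {z. cdf gauss z \<le> 0}" by (rule AE_not_in)
    \<comment> \<open>The event lies above each level \<open>1 - d\<close>, so uniformity bounds its
      mass by every small \<open>d\<close>.\<close>
    have "measure gauss {z. 1 \<le> cdf gauss z} \<le> e" if "0 < e" for e
    proof -
      define d where "d = min e 1"
      have d: "0 < d" "d \<le> 1" "d \<le> e" using that by (auto simp: d_def)
      have "measure gauss {z. 1 \<le> cdf gauss z} \<le> measure gauss (space gauss - {z. cdf gauss z \<le> 1 - d})"
        using d by (intro gauss.finite_measure_mono) auto
      also have "\<dots> = 1 - measure gauss {z. cdf gauss z \<le> 1 - d}" by (rule gauss.prob_compl) simp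
      also have "\<dots> = d" using d gauss_cdf_uniform[of "1 - d"] by simp
      finally show ?thesis using d by simp
    qed
    then have "measure gauss {z. 1 \<le> cdf gauss z} \<le> 0" by (rule field_le_epsilon[where y=0, simplified])
    then have "{z. 1 \<le> cdf gauss z} \<in> null_sets gauss"
      by (auto simp: null_sets_def gauss.emeasure_eq_measure measure_le_0_iff)
    then have 2: "AE z in gauss. z \<notin> {z. 1 \<le> cdf gauss z}" by (rule AE_not_in)
    from 1 2 show ?thesis by eventually_elim (auto simp: U_def)
  qed
  then have ae: "AE z in gauss. y z \<le> x \<longleftrightarrow> cdf gauss z \<le> cdf \<nu> x" for x
    by eventually_elim (rule y_le)
  have "cdf (distr gauss borel y) x = cdf \<nu> x" for x
  proof -
    have "cdf (distr gauss borel y) x = measure gauss {z. y z \<le> x}"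
      by (simp add: cdf_def measure_distr vimage_def)
    also have "\<dots> = measure gauss {z. cdf gauss z \<le> cdf \<nu> x}"
      using ae[of x] by (intro gauss.finite_measure_eq_AE) (auto simp: )
    also have "\<dots> = cdf \<nu> x" by (intro gauss_cdf_uniform \<nu>.cdf_nonneg \<nu>.cdf_bounded_prob)
    finally show ?thesis .
  qed
  then have "distr gauss borel y = \<nu>"
    by (intro cdf_unique gauss.real_distribution_distr assms) auto
  with y show ?thesis by (rule that)
qed

lemma (in convex_call) quantile_of_calls:
  assumes "0 < \<beta>"
  obtains y where "y \<in> borel_measurable borel" "integrable gauss y" "AE z in gauss. 0 < y z"
    "\<And>x. 0 \<le> x \<Longrightarrow> (\<integral>z. max (y z - x) 0 \<partial>gauss) = g x / \<beta>"
proof -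
  obtain y where y: "y \<in> borel_measurable borel" "distr gauss borel y = law_g"
    using gauss_quantile real_distribution_law_g[OF assms] by blast
  have y'[measurable]: "y \<in> borel_measurable gauss" using y(1) by simp
  note p = law_g_props[OF assms, folded y(2)]
  show ?thesis
  proof (rule that[OF y(1)])
    show "integrable gauss y" using p(1) by (simp add: integrable_distr_eq)
    show "AE z in gauss. 0 < y z" using p(2) by (simp add: AE_distr_iff)
    show "(\<integral>z. max (y z - x) 0 \<partial>gauss) = g x / \<beta>" if "0 \<le> x" for x
      using p(3)[OF that] by (simp add: call_of_distr)
  qed
qed

context filtered_prob_space begin

text \<open>Since entrance events are disjoint, such a sum is the process evaluated at the entrance
  time.\<close>

lemma sum_entrance:
  assumes "finite J" "t \<in> J" "\<omega> \<in> entrance J H t"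
  shows "(\<Sum>s\<in>J. indicator (entrance J H s) \<omega> * f s :: real) = f t"
proof -
  have "indicator (entrance J H s) \<omega> = (0::real)" if "s \<in> J - {t}" for s
    using entrance_disjoint[of J H] assms(2,3) that
    by (auto simp: disjoint_family_on_def indicator_def)
  then have "(\<Sum>s\<in>J. indicator (entrance J H s) \<omega> * f s) = (\<Sum>s\<in>J. if s = t then f t else 0)"
    using assms(3) by (intro sum.cong) auto
  then show ?thesis using assms by simp
qed

lemma sum_entrance_0:
  assumes "finite J" "\<omega> \<notin> (\<Union>t\<in>J. H t)"
  shows "(\<Sum>s\<in>J. indicator (entrance J H s) \<omega> * f s :: real) = 0"
  using assms entrance_UN[OF assms(1), of H] by (intro sum.neutral) (auto simp: indicator_def)

lemma finite_measure_subalgebra_F: "t \<in> I \<Longrightarrow> sigma_finite_subalgebra P (F t)"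
  using subalg by (intro finite_measure_subalgebra_is_sigma_finite)
    (auto simp: finite_measure_subalgebra_def finite_measure_subalgebra_axioms_def intro: finite_measure_axioms)

end

lemma convex_on_integral:
  assumes "convex C" "\<And>\<omega>. \<omega> \<in> space M \<Longrightarrow> convex_on C (f \<omega>)" "\<And>x. x \<in> C \<Longrightarrow> integrable M (\<lambda>\<omega>. f \<omega> x :: real)"
  shows "convex_on C (\<lambda>x. \<integral>\<omega>. f \<omega> x \<partial>M)"
proof (rule convex_onI)
  fix t :: real and x y assume t: "0 < t" "t < 1" and xy: "x \<in> C" "y \<in> C"
  have c: "(1 - t) *\<^sub>R x + t *\<^sub>R y \<in> C" using convexD[OF assms(1) xy, of "1 - t" t] t by simp
  have "(\<integral>\<omega>. f \<omega> ((1 - t) *\<^sub>R x + t *\<^sub>R y) \<partial>M) \<le> (\<integral>\<omega>. (1 - t) * f \<omega> x + t * f \<omega> y \<partial>M)"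
  proof (rule integral_mono)
    fix \<omega> assume "\<omega> \<in> space M"
    then show "f \<omega> ((1 - t) *\<^sub>R x + t *\<^sub>R y) \<le> (1 - t) * f \<omega> x + t * f \<omega> y"
      using convex_onD[OF assms(2), of \<omega> t x y] xy t by simp
  qed (use assms(3) c xy in auto)
  then show "(\<integral>\<omega>. f \<omega> ((1 - t) *\<^sub>R x + t *\<^sub>R y) \<partial>M) \<le> (1 - t) * (\<integral>\<omega>. f \<omega> x \<partial>M) + t * (\<integral>\<omega>. f \<omega> y \<partial>M)"
    using assms(3) xy by simp
qed (rule assms)

lemma convex_on_call_payoff: "convex_on {0..} (\<lambda>x::real. max (y - x) 0)"
proof (rule convex_onI)
  fix t a b :: real assume t: "0 < t" "t < 1"
  have "y - ((1 - t) * a + t * b) = (1 - t) * (y - a) + t * (y - b)" by (simp add: algebra_simps)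
  also have "\<dots> \<le> (1 - t) * max (y - a) 0 + t * max (y - b) 0"
    using t by (intro add_mono mult_left_mono) auto
  finally show "max (y - ((1 - t) *\<^sub>R a + t *\<^sub>R b)) 0 \<le> (1 - t) * max (y - a) 0 + t * max (y - b) 0"
    using t by simp
qed simp

section \<open>The hitting identity for a continuous positive martingale\<close>

locale continuous_market = filtered_prob_space P "{0..T}" F
  for P :: "'a measure" and T :: real and F +
  fixes S :: "real \<Rightarrow> 'a \<Rightarrow> real" and S\<^sub>0 :: real
  assumes Tpos: "0 < T" and S0pos: "0 < S\<^sub>0"
    and mart: "mart_to S (S T)"
    and S_0: "\<And>\<omega>. \<omega> \<in> space P \<Longrightarrow> S 0 \<omega> = S\<^sub>0"
    and cont: "\<And>\<omega>. \<omega> \<in> space P \<Longrightarrow> continuous_on {0..T} (\<lambda>t. S t \<omega>)"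
    and S_pos: "\<And>\<omega> t. \<omega> \<in> space P \<Longrightarrow> t \<in> {0..T} \<Longrightarrow> 0 < S t \<omega>"
begin

abbreviation "M \<equiv> running_max S T"

lemma max_attained:
  assumes "\<omega> \<in> space P" obtains u where "u \<in> {0..T}" "M \<omega> = S u \<omega>" "\<And>t. t \<in> {0..T} \<Longrightarrow> S t \<omega> \<le> S u \<omega>"
proof -
  obtain u where u: "u \<in> {0..T}" "\<And>t. t \<in> {0..T} \<Longrightarrow> S t \<omega> \<le> S u \<omega>"
    using continuous_attains_sup[OF _ _ cont[OF assms]] Tpos by auto
  have "M \<omega> = S u \<omega>" unfolding running_max_def
    by (rule cSup_eq_maximum) (use u in auto)
  with u show ?thesis by (intro that)
qed

lemma max_ge_iff: "\<omega> \<in> space P \<Longrightarrow> B \<le> M \<omega> \<longleftrightarrow> (\<exists>u\<in>{0..T}. B \<le> S u \<omega>)"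
  using max_attained[of \<omega>] by (metis order_trans)

lemma max_gt_iff: "\<omega> \<in> space P \<Longrightarrow> b < M \<omega> \<longleftrightarrow> (\<exists>u\<in>{0..T}. b < S u \<omega>)"
proof -
  assume w: "\<omega> \<in> space P"
  obtain u where "u \<in> {0..T}" "M \<omega> = S u \<omega>" "\<And>t. t \<in> {0..T} \<Longrightarrow> S t \<omega> \<le> S u \<omega>"
    using max_attained[OF w] by blast
  then show ?thesis by force
qed

lemma S_T_le_max: "\<omega> \<in> space P \<Longrightarrow> S T \<omega> \<le> M \<omega>"
  using Tpos by (subst max_ge_iff) auto

text \<open>Dyadic times including both endpoints. The grids are nested, so the events seen on them
  increase.\<close>

definition grid :: "nat \<Rightarrow> real set" where "grid k = (\<lambda>i. T * real i / 2 ^ k) ` {..2 ^ k}"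

lemma grid: "finite (grid k)" "grid k \<subseteq> {0..T}" "0 \<in> grid k" "T \<in> grid k"
proof -
  show "finite (grid k)" by (simp add: grid_def)
  have "T * real i / 2 ^ k \<le> T" if "i \<le> 2 ^ k" for i :: nat
  proof -
    have "real i \<le> 2 ^ k" using that by (metis of_nat_le_iff of_nat_numeral of_nat_power)
    then have "T * real i \<le> T * 2 ^ k" using Tpos by (intro mult_left_mono) auto
    then show ?thesis by (simp add: divide_le_eq)
  qed
  then show "grid k \<subseteq> {0..T}" using Tpos by (auto simp: grid_def)
  show "0 \<in> grid k" unfolding grid_def by (rule image_eqI[of _ _ 0]) auto
  show "T \<in> grid k" unfolding grid_def by (rule image_eqI[of _ _ "2 ^ k"]) auto
qed

lemma grid_incseq: "incseq grid"
proof (rule incseq_SucI, rule subsetI)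
  fix k x assume "x \<in> grid k"
  then obtain i where "i \<le> 2 ^ k" "x = T * real i / 2 ^ k" by (auto simp: grid_def)
  then show "x \<in> grid (Suc k)" unfolding grid_def by (intro image_eqI[of _ _ "2 * i"]) auto
qed

lemma grid_above:
  assumes "u \<in> {0..T}"
  obtains t where "t \<in> grid k" "u \<le> t" "t - u \<le> T / 2 ^ k"
proof -
  define i where "i = nat \<lceil>u * 2 ^ k / T\<rceil>"
  have ge: "0 \<le> u * 2 ^ k / T" using assms Tpos by simp
  then have ri: "real i = of_int \<lceil>u * 2 ^ k / T\<rceil>" by (simp add: i_def)
  have i: "u * 2 ^ k / T \<le> real i" "real i \<le> u * 2 ^ k / T + 1"
    unfolding ri by linarith+
  have "u * 2 ^ k / T \<le> 2 ^ k" using assms Tpos by (simp add: divide_le_eq mult.commute)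
  then have "\<lceil>u * 2 ^ k / T\<rceil> \<le> 2 ^ k" by (simp add: ceiling_le_iff)
  then have "i \<le> 2 ^ k" unfolding i_def by (simp add: nat_le_iff)
  show ?thesis
  proof (rule that[of "T * real i / 2 ^ k"])
    show "T * real i / 2 ^ k \<in> grid k" using \<open>i \<le> 2 ^ k\<close> by (auto simp: grid_def)
    show "u \<le> T * real i / 2 ^ k" using i(1) Tpos by (simp add: field_simps)
    have "T * real i \<le> T * (u * 2 ^ k / T + 1)" using i(2) Tpos by (intro mult_left_mono) auto
    then have "T * real i / 2 ^ k \<le> T * (u * 2 ^ k / T + 1) / 2 ^ k" by (intro divide_right_mono) auto
    also have "\<dots> = u + T / 2 ^ k" using Tpos by (simp add: field_simps)
    finally show "T * real i / 2 ^ k - u \<le> T / 2 ^ k" by simp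
  qed
qed

lemma grid_mesh_small: assumes "0 < d" shows "\<forall>\<^sub>F k in sequentially. T / 2 ^ k < d"
proof -
  have "(\<lambda>k. T * (1 / 2) ^ k) \<longlonglongrightarrow> T * 0"
    by (intro tendsto_intros LIMSEQ_power_zero) auto
  then have "(\<lambda>k. T / 2 ^ k) \<longlonglongrightarrow> 0" by (simp add: power_one_over)
  then show ?thesis using assms by (rule order_tendstoD)
qed

text \<open>Strict exceedance is an open condition on a continuous path, so all sufficiently fine
  grids notice it. A level that is merely touched may escape every grid, which is why levels are
  first exceeded and only later hit.\<close>

lemma exceed_grid:
  assumes "\<omega> \<in> space P" "b < M \<omega>"
  obtains k0 where "\<And>k. k0 \<le> k \<Longrightarrow> \<exists>t\<in>grid k. b < S t \<omega>"
proof -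
  obtain u where u: "u \<in> {0..T}" "b < S u \<omega>" using assms max_gt_iff by auto
  obtain d where d: "0 < d" "\<And>t. t \<in> {0..T} \<Longrightarrow> dist t u < d \<Longrightarrow> dist (S t \<omega>) (S u \<omega>) < S u \<omega> - b"
    using cont[OF assms(1)] u unfolding continuous_on_iff by (metis diff_gt_0_iff_gt)
  obtain k0 where k0: "\<And>k. k0 \<le> k \<Longrightarrow> T / 2 ^ k < d"
    using grid_mesh_small[OF d(1)] by (auto simp: eventually_sequentially)
  show ?thesis
  proof (rule that)
    fix k assume "k0 \<le> k"
    obtain t where t: "t \<in> grid k" "u \<le> t" "t - u \<le> T / 2 ^ k" using grid_above[OF u(1)] by blast
    then have "dist t u < d" using k0[OF \<open>k0 \<le> k\<close>] by (simp add: dist_real_def)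
    then have "dist (S t \<omega>) (S u \<omega>) < S u \<omega> - b" using d(2) t(1) grid(2) by blast
    then have "b < S t \<omega>" by (simp add: dist_real_def abs_less_iff)
    then show "\<exists>t\<in>grid k. b < S t \<omega>" using t(1) by auto
  qed
qed

lemma UN_grid_exceed:
  "(\<Union>k. \<Union>t\<in>grid k. {\<omega>\<in>space P. b < S t \<omega>}) = {\<omega>\<in>space P. b < M \<omega>}"
proof (rule set_eqI)
  fix \<omega>
  have "(\<exists>k. \<exists>t\<in>grid k. b < S t \<omega>) \<longleftrightarrow> b < M \<omega>" if w: "\<omega> \<in> space P"
  proof
    assume "\<exists>k. \<exists>t\<in>grid k. b < S t \<omega>"
    then obtain k t where t: "t \<in> grid k" "b < S t \<omega>" by blast
    then show "b < M \<omega>" using grid(2)[of k] by (subst max_gt_iff[OF w]) blast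
  next
    assume "b < M \<omega>"
    then obtain k0 where "\<And>k. k0 \<le> k \<Longrightarrow> \<exists>t\<in>grid k. b < S t \<omega>"
      using exceed_grid[OF w] by blast
    then show "\<exists>k. \<exists>t\<in>grid k. b < S t \<omega>" by blast
  qed
  then show "\<omega> \<in> (\<Union>k. \<Union>t\<in>grid k. {\<omega>\<in>space P. b < S t \<omega>})
      \<longleftrightarrow> \<omega> \<in> {\<omega>\<in>space P. b < M \<omega>}" by auto
qed

lemma S_measurable: "t \<in> {0..T} \<Longrightarrow> S t \<in> borel_measurable P"
  using mart by (rule mart_to_measurable)

lemma S_integrable: "t \<in> {0..T} \<Longrightarrow> integrable P (S t)"
  using mart mart_toD(3) by blast

lemma T_mem: "T \<in> {0..T}" using Tpos by simp

lemma exceed_sets: "t \<in> {0..T} \<Longrightarrow> {\<omega>\<in>space P. b < S t \<omega>} \<in> sets P"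
  using level_sets(3)[OF mart] sets_F by blast

lemma max_exceed_sets: "{\<omega>\<in>space P. b < M \<omega>} \<in> sets P"
  unfolding UN_grid_exceed[symmetric] using exceed_sets grid(1,2)
  by (intro sets.countable_UN sets.finite_UN) (auto simp: subset_iff)

lemma max_measurable: "M \<in> borel_measurable P"
  using max_exceed_sets by (simp add: borel_measurable_iff_greater)

text \<open>The grid point before the first exceedance still has value at most \<open>b\<close>, so
  the overshoot is bounded by the oscillation over one mesh width and vanishes by uniform
  continuity.\<close>

lemma first_exceed_limit:
  assumes b: "S\<^sub>0 \<le> b" and w: "\<omega> \<in> space P" and H: "\<And>t. H t = {\<omega>\<in>space P. b < S t \<omega>}"
  shows "(\<lambda>k. \<Sum>t\<in>grid k. indicator (entrance (grid k) H t) \<omega> * S t \<omega>)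
    \<longlonglongrightarrow> b * indicator {\<omega>\<in>space P. b < M \<omega>} \<omega>" (is "?V \<longlonglongrightarrow> _")
proof (cases "b < M \<omega>")
  case False
  have "?V k = 0" for k
  proof (rule sum_entrance_0[OF grid(1)])
    show "\<omega> \<notin> \<Union> (H ` grid k)" using False w UN_grid_exceed[of b] unfolding H by blast
  qed
  then show ?thesis using False by simp
next
  case True
  have uc: "uniformly_continuous_on {0..T} (\<lambda>t. S t \<omega>)"
    using cont[OF w] by (intro compact_uniformly_continuous) auto
  obtain k0 where k0: "\<And>k. k0 \<le> k \<Longrightarrow> \<exists>t\<in>grid k. b < S t \<omega>" using exceed_grid[OF w True] by blast
  have "?V \<longlonglongrightarrow> b"
  proof (rule tendstoI)
    fix e :: real assume "0 < e"
    obtain d where d: "0 < d" "\<And>x y. x \<in> {0..T} \<Longrightarrow> y \<in> {0..T} \<Longrightarrow> dist y x < d \<Longrightarrow> dist (S y \<omega>) (S x \<omega>) < e"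
      using uc \<open>0 < e\<close> unfolding uniformly_continuous_on_def by meson
    show "\<forall>\<^sub>F k in sequentially. dist (?V k) b < e"
      using grid_mesh_small[OF d(1)] eventually_ge_at_top[of k0]
    proof eventually_elim
      case (elim k)
      have "\<omega> \<in> (\<Union>t\<in>grid k. H t)" using k0[OF elim(2)] w by (auto simp: H)
      then obtain t where t: "t \<in> grid k" "\<omega> \<in> entrance (grid k) H t"
        using entrance_UN[OF grid(1), of k H] by blast
      have V: "?V k = S t \<omega>" by (rule sum_entrance[OF grid(1) t])
      have bt: "b < S t \<omega>" using t(2) by (auto simp: entrance_def H)
      obtain i where i: "i \<le> 2 ^ k" "t = T * real i / 2 ^ k" using t(1) by (auto simp: grid_def)
      \<comment> \<open>A previous grid point exists because the path starts at or below
        \<open>b\<close>.\<close>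
      have "i \<noteq> 0"
      proof
        assume "i = 0"
        then have "S t \<omega> = S\<^sub>0" using i S_0[OF w] by simp
        then show False using bt b by simp
      qed
      define s where "s = T * real (i - 1) / 2 ^ k"
      have ri: "real (i - 1) = real i - 1" using \<open>i \<noteq> 0\<close> by (simp add: of_nat_diff)
      have s: "s \<in> grid k" using i by (auto simp: s_def grid_def)
      have st: "t - s = T / 2 ^ k" unfolding s_def i(2) ri by (simp add: field_simps)
      moreover have "0 < T / 2 ^ k" using Tpos by simp
      ultimately have "s < t" by linarith
      then have "\<omega> \<notin> H s" using t(2) s by (auto simp: entrance_def)
      then have "S s \<omega> \<le> b" using w by (auto simp: H)
      moreover have "dist (S t \<omega>) (S s \<omega>) < e"
      proof (rule d(2))
        show "s \<in> {0..T}" "t \<in> {0..T}" using s t(1) grid(2)[of k] by blast+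
        show "dist t s < d" using st elim(1) \<open>s < t\<close> by (simp add: dist_real_def)
      qed
      ultimately show "dist (?V k) b < e" using bt unfolding V by (simp add: dist_real_def abs_less_iff)
    qed
  qed
  then show ?thesis using True w by simp
qed

lemma set_integral_exceed_tendsto_0: "(\<lambda>n. \<integral>\<omega>\<in>{\<omega>\<in>space P. real n < M \<omega>}. S T \<omega> \<partial>P) \<longlonglongrightarrow> 0"
proof -
  have "(\<lambda>n. \<integral>\<omega>\<in>{\<omega>\<in>space P. real n < M \<omega>}. S T \<omega> \<partial>P)
      \<longlonglongrightarrow> (\<integral>\<omega>\<in>(\<Inter>n. {\<omega>\<in>space P. real n < M \<omega>}). S T \<omega> \<partial>P)"
    using max_exceed_sets S_integrable[OF T_mem]
    by (intro set_integral_cont_down set_integrable_sub) (auto simp: decseq_def)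
  moreover have "(\<Inter>n. {\<omega>\<in>space P. real n < M \<omega>}) = {}"
    using real_arch_simple not_le by blast
  ultimately show ?thesis by (simp add: set_lebesgue_integral_def)
qed

text \<open>On grid \<open>k\<close>, optional stopping says that \<open>V k\<close>, the value at
  the first exceedance, has the same mean as \<open>S T\<close> restricted to the exceedance event.
  Passing to the limit requires uniform integrability of the \<open>V k\<close>.\<close>

lemma exceed_integral:
  assumes b: "S\<^sub>0 \<le> b"
  shows "(\<integral>\<omega>\<in>{\<omega>\<in>space P. b < M \<omega>}. S T \<omega> \<partial>P) = b * prob {\<omega>\<in>space P. b < M \<omega>}"
proof -
  define H where "H t = {\<omega>\<in>space P. b < S t \<omega>}" for t
  have H: "H t \<in> sets (F t)" if "t \<in> {0..T}" for t
    unfolding H_def using that by (rule level_sets(3)[OF mart])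
  have Hg: "\<And>t. t \<in> grid k \<Longrightarrow> H t \<in> sets (F t)" for k using H grid(2) by blast
  define E where "E k t = entrance (grid k) H t" for k t
  have EF: "E k t \<in> sets (F t)" if "t \<in> grid k" for k t
    unfolding E_def by (rule entrance_sets[OF grid(1,2) Hg that])
  have EP: "E k t \<in> sets P" if "t \<in> grid k" for k t using EF[OF that] sets_F grid(2) that by blast
  define V where "V k \<omega> = (\<Sum>t\<in>grid k. indicator (E k t) \<omega> * S t \<omega>)" for k \<omega>
  define r where "r n = (\<integral>\<omega>\<in>{\<omega>\<in>space P. real n < M \<omega>}. S T \<omega> \<partial>P)" for n
  have Sg: "t \<in> {0..T}" if "t \<in> grid k" for t k using that grid(2) by blast
  have iV0: "integrable P (\<lambda>\<omega>. indicator A \<omega> * S t \<omega>)" if "t \<in> {0..T}" "A \<in> sets P" for t A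
    using integrable_mult_indicator[OF that(2) S_integrable[OF that(1)]] by simp
  have iV: "integrable P (V k)" for k
    unfolding V_def using EP Sg by (intro Bochner_Integration.integrable_sum iV0) auto
  have V0: "0 \<le> V k \<omega>" if "\<omega> \<in> space P" for k \<omega>
    unfolding V_def using S_pos[OF that] Sg by (intro sum_nonneg) (auto simp: less_imp_le)
  have EV: "(\<integral>\<omega>. V k \<omega> \<partial>P) = (\<integral>\<omega>\<in>(\<Union>t\<in>grid k. H t). S T \<omega> \<partial>P)" for k
  proof -
    have "(\<integral>\<omega>\<in>(\<Union>t\<in>grid k. H t). S T \<omega> \<partial>P) = (\<Sum>t\<in>grid k. \<integral>\<omega>\<in>E k t. S t \<omega> \<partial>P)"
      unfolding E_def by (rule entrance_integral[OF mart grid(1,2) Hg])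
    also have "\<dots> = (\<integral>\<omega>. V k \<omega> \<partial>P)"
      unfolding V_def set_lebesgue_integral_def using EP Sg iV0
      by (subst Bochner_Integration.integral_sum) auto
    finally show ?thesis by simp
  qed
  \<comment> \<open>Uniform integrability: the part of \<open>V k\<close> above \<open>n\<close> is
    moved to time \<open>T\<close> by the martingale property, and there it is carried by the event
    that the maximum exceeds \<open>n\<close>. The bound \<open>r n\<close> is the same for all
    \<open>k\<close>.\<close>
  have trunc: "(\<integral>\<omega>. max (V k \<omega> - real n) 0 \<partial>P) \<le> r n" for k n
  proof -
    define A where "A t = E k t \<inter> {\<omega>\<in>space P. real n < S t \<omega>}" for t
    have AF: "A t \<in> sets (F t)" if "t \<in> grid k" for t
      unfolding A_def using EF[OF that] level_sets(3)[OF mart Sg[OF that]] by auto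
    have AP: "A t \<in> sets P" if "t \<in> grid k" for t using AF[OF that] sets_F Sg[OF that] by blast
    have "(\<integral>\<omega>. max (V k \<omega> - real n) 0 \<partial>P) \<le> (\<integral>\<omega>. (\<Sum>t\<in>grid k. indicator (A t) \<omega> * S t \<omega>) \<partial>P)"
    proof (rule integral_mono)
      show "integrable P (\<lambda>\<omega>. max (V k \<omega> - real n) 0)"
        using iV[of k] by (intro integrable_max Bochner_Integration.integrable_diff) auto
      show "integrable P (\<lambda>\<omega>. (\<Sum>t\<in>grid k. indicator (A t) \<omega> * S t \<omega>))"
        using AP Sg by (intro Bochner_Integration.integrable_sum iV0) auto
      fix \<omega> assume w: "\<omega> \<in> space P"
      have nn: "0 \<le> (\<Sum>t\<in>grid k. indicator (A t) \<omega> * S t \<omega>)"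
        using S_pos[OF w] Sg by (intro sum_nonneg) (auto simp: less_imp_le)
      show "max (V k \<omega> - real n) 0 \<le> (\<Sum>t\<in>grid k. indicator (A t) \<omega> * S t \<omega>)"
      proof (cases "\<exists>t\<in>grid k. \<omega> \<in> E k t")
        case False
        then have "V k \<omega> = 0" unfolding V_def by (intro sum.neutral) (auto simp: indicator_def)
        then show ?thesis using nn by simp
      next
        case True
        then obtain t where t: "t \<in> grid k" "\<omega> \<in> E k t" by blast
        have V: "V k \<omega> = S t \<omega>" unfolding V_def E_def
          by (rule sum_entrance[OF grid(1) t[unfolded E_def]])
        have "indicator (A t) \<omega> * S t \<omega> \<le> (\<Sum>t\<in>grid k. indicator (A t) \<omega> * S t \<omega>)"
          using S_pos[OF w] Sg t(1) grid(1) by (intro member_le_sum) (auto simp: less_imp_le)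
        moreover have "max (S t \<omega> - real n) 0 \<le> indicator (A t) \<omega> * S t \<omega>"
          using t w S_pos[OF w Sg[OF t(1)]] by (cases "real n < S t \<omega>") (auto simp: A_def)
        ultimately show ?thesis unfolding V by (rule order_trans[rotated])
      qed
    qed
    also have "\<dots> = (\<Sum>t\<in>grid k. \<integral>\<omega>\<in>A t. S t \<omega> \<partial>P)"
      unfolding set_lebesgue_integral_def using AP Sg iV0
      by (subst Bochner_Integration.integral_sum) auto
    also have "\<dots> = (\<Sum>t\<in>grid k. \<integral>\<omega>\<in>A t. S T \<omega> \<partial>P)"
      using mart_toD(4)[OF mart Sg AF] by (intro sum.cong) auto
    also have "\<dots> = (\<integral>\<omega>. (\<Sum>t\<in>grid k. indicator (A t) \<omega> * S T \<omega>) \<partial>P)"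
      unfolding set_lebesgue_integral_def using AP iV0[OF T_mem]
      by (subst Bochner_Integration.integral_sum) auto
    also have "\<dots> \<le> r n"
      unfolding r_def set_lebesgue_integral_def
    proof (rule integral_mono)
      show "integrable P (\<lambda>\<omega>. (\<Sum>t\<in>grid k. indicator (A t) \<omega> * S T \<omega>))"
        using AP by (intro Bochner_Integration.integrable_sum iV0 T_mem) auto
      show "integrable P (\<lambda>\<omega>. indicat_real {\<omega> \<in> space P. real n < M \<omega>} \<omega> *\<^sub>R S T \<omega>)"
        using max_exceed_sets S_integrable[OF T_mem] by (rule integrable_mult_indicator)
      fix \<omega> assume w: "\<omega> \<in> space P"
      have pos: "0 \<le> S T \<omega>" using S_pos[OF w T_mem] by simp
      show "(\<Sum>t\<in>grid k. indicator (A t) \<omega> * S T \<omega>) \<le> indicat_real {\<omega> \<in> space P. real n < M \<omega>} \<omega> *\<^sub>R S T \<omega>"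
      proof (cases "\<exists>t\<in>grid k. \<omega> \<in> A t")
        case False
        then have "(\<Sum>t\<in>grid k. indicator (A t) \<omega> * S T \<omega>) = 0" by (intro sum.neutral) (auto simp: indicator_def)
        then show ?thesis using pos by simp
      next
        case True
        then obtain t where t: "t \<in> grid k" "\<omega> \<in> E k t" "real n < S t \<omega>" by (auto simp: A_def)
        have "(\<Sum>t\<in>grid k. indicator (A t) \<omega> * S T \<omega>) \<le> (\<Sum>t\<in>grid k. indicator (E k t) \<omega> * S T \<omega>)"
          using pos by (intro sum_mono mult_right_mono) (auto simp: A_def indicator_def)
        also have "\<dots> = S T \<omega>" unfolding E_def
          by (rule sum_entrance[OF grid(1) t(1,2)[unfolded E_def]])
        finally show ?thesis using t(3) w max_gt_iff[OF w] Sg[OF t(1)] by (auto simp: indicator_def)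
      qed
    qed
    finally show ?thesis .
  qed
  let ?A = "{\<omega>\<in>space P. b < M \<omega>}"
  have UP: "(\<Union>t\<in>grid k. H t) \<in> sets P" for k
    using H sets_F Sg grid(1) by (intro sets.finite_UN) blast+
  have lim1: "(\<lambda>k. \<integral>\<omega>. V k \<omega> \<partial>P) \<longlonglongrightarrow> (\<integral>\<omega>\<in>?A. S T \<omega> \<partial>P)"
  proof -
    have inc: "incseq (\<lambda>k. \<Union>t\<in>grid k. H t)"
      using grid_incseq by (intro monoI UN_mono) (auto simp: incseq_def)
    have "(\<lambda>k. \<integral>\<omega>\<in>(\<Union>t\<in>grid k. H t). S T \<omega> \<partial>P) \<longlonglongrightarrow> (\<integral>\<omega>\<in>(\<Union>k. \<Union>t\<in>grid k. H t). S T \<omega> \<partial>P)"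
      using UP S_integrable[OF T_mem]
      by (intro set_integral_cont_up inc set_integrable_sub sets.countable_UN) auto
    then show ?thesis unfolding EV H_def UN_grid_exceed .
  qed
  \<comment> \<open>Below the cap \<open>n\<close> the pathwise limit passes under the integral by
    bounded convergence; \<open>b \<le> real n\<close> keeps the cap away from the limit.\<close>
  have lim2: "(\<lambda>k. \<integral>\<omega>. min (V k \<omega>) (real n) \<partial>P) \<longlonglongrightarrow> b * prob ?A" if n: "b \<le> real n" for n
  proof -
    have "(\<lambda>k. \<integral>\<omega>. min (V k \<omega>) (real n) \<partial>P) \<longlonglongrightarrow> (\<integral>\<omega>. b * indicator ?A \<omega> \<partial>P)"
    proof (rule integral_dominated_convergence[where w = "\<lambda>_. real n"])
      show "AE \<omega> in P. (\<lambda>k. min (V k \<omega>) (real n)) \<longlonglongrightarrow> b * indicator ?A \<omega>"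
      proof (rule AE_I2)
        fix \<omega> assume w: "\<omega> \<in> space P"
        have "(\<lambda>k. V k \<omega>) \<longlonglongrightarrow> b * indicator ?A \<omega>"
          unfolding V_def E_def by (rule first_exceed_limit[OF b w H_def])
        then have "(\<lambda>k. min (V k \<omega>) (real n)) \<longlonglongrightarrow> min (b * indicator ?A \<omega>) (real n)"
          by (intro tendsto_min tendsto_const)
        moreover have "min (b * indicator ?A \<omega>) (real n) = b * indicator ?A \<omega>"
          using n by (auto simp: indicator_def)
        ultimately show "(\<lambda>k. min (V k \<omega>) (real n)) \<longlonglongrightarrow> b * indicator ?A \<omega>" by simp
      qed
      show "AE \<omega> in P. norm (min (V k \<omega>) (real n)) \<le> real n" for k
        using V0[of _ k] by (intro AE_I2) auto
    qed (use iV max_exceed_sets in auto)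
    then show ?thesis using max_exceed_sets[of b] by simp
  qed
  have split: "(\<integral>\<omega>. V k \<omega> \<partial>P) = (\<integral>\<omega>. min (V k \<omega>) (real n) \<partial>P) + (\<integral>\<omega>. max (V k \<omega> - real n) 0 \<partial>P)" for k n
  proof -
    have "(\<integral>\<omega>. V k \<omega> \<partial>P) = (\<integral>\<omega>. min (V k \<omega>) (real n) + max (V k \<omega> - real n) 0 \<partial>P)"
      by (intro Bochner_Integration.integral_cong) auto
    also have "\<dots> = (\<integral>\<omega>. min (V k \<omega>) (real n) \<partial>P) + (\<integral>\<omega>. max (V k \<omega> - real n) 0 \<partial>P)"
      using iV[of k] by (intro Bochner_Integration.integral_add integrable_min integrable_max Bochner_Integration.integrable_diff) auto
    finally show ?thesis .
  qed
  \<comment> \<open>Capped and uncapped means differ by at most \<open>r n\<close>, uniformly in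
    \<open>k\<close>, and \<open>r n\<close> tends to 0.\<close>
  have bound: "\<bar>(\<integral>\<omega>\<in>?A. S T \<omega> \<partial>P) - b * prob ?A\<bar> \<le> r n" if n: "b \<le> real n" for n
  proof (rule LIMSEQ_le_const2)
    show "(\<lambda>k. \<bar>(\<integral>\<omega>. V k \<omega> \<partial>P) - (\<integral>\<omega>. min (V k \<omega>) (real n) \<partial>P)\<bar>) \<longlonglongrightarrow> \<bar>(\<integral>\<omega>\<in>?A. S T \<omega> \<partial>P) - b * prob ?A\<bar>"
      by (intro tendsto_intros lim1 lim2 n)
    have "0 \<le> (\<integral>\<omega>. max (V k \<omega> - real n) 0 \<partial>P)" for k by (rule integral_nonneg_AE) auto
    then show "\<exists>N. \<forall>k\<ge>N. \<bar>(\<integral>\<omega>. V k \<omega> \<partial>P) - (\<integral>\<omega>. min (V k \<omega>) (real n) \<partial>P)\<bar> \<le> r n"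
      using split[of _ n] trunc[of _ n] by auto
  qed
  obtain N :: nat where "b \<le> real N" using real_arch_simple by blast
  then have "\<bar>(\<integral>\<omega>\<in>?A. S T \<omega> \<partial>P) - b * prob ?A\<bar> \<le> r n" if "N \<le> n" for n
    using bound[of n] that by (meson of_nat_mono order_trans)
  then have "\<bar>(\<integral>\<omega>\<in>?A. S T \<omega> \<partial>P) - b * prob ?A\<bar> \<le> 0"
    using set_integral_exceed_tendsto_0 unfolding r_def[symmetric]
    by (intro LIMSEQ_le_const[of r]) (auto)
  then show ?thesis by simp
qed

abbreviation "hit B \<equiv> {\<omega>\<in>space P. B \<le> M \<omega>}"

lemma hit_sets: "hit B \<in> sets P"
  using max_measurable by (simp add: borel_measurable_iff_ge)

text \<open>Reaching \<open>B\<close> means exceeding every level below \<open>B\<close>. The levels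
  \<open>b k\<close> increase from \<open>S\<^sub>0\<close> to \<open>B\<close>; a lower start would
  leave the scope of \<open>exceed_integral\<close>.\<close>

lemma hit_integral:
  assumes B: "S\<^sub>0 < B"
  shows "(\<integral>\<omega>\<in>hit B. S T \<omega> \<partial>P) = B * prob (hit B)"
proof -
  define b where "b k = B - (B - S\<^sub>0) / real (Suc k)" for k
  have bB: "b k < B" "S\<^sub>0 \<le> b k" for k
  proof -
    show "b k < B" using B by (simp add: b_def)
    have "(B - S\<^sub>0) / real (Suc k) \<le> (B - S\<^sub>0) / 1" using B by (intro divide_left_mono) auto
    then show "S\<^sub>0 \<le> b k" by (simp add: b_def)
  qed
  have blim: "b \<longlonglongrightarrow> B"
  proof -
    have "(\<lambda>k. B - (B - S\<^sub>0) / real (Suc k)) \<longlonglongrightarrow> B - 0"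
      by (intro tendsto_diff tendsto_const LIMSEQ_Suc lim_const_over_n)
    then show ?thesis by (simp add: b_def[abs_def])
  qed
  have bmono: "b k \<le> b l" if "k \<le> l" for k l
    unfolding b_def using B that by (intro diff_left_mono divide_left_mono) auto
  let ?A = "\<lambda>k. {\<omega>\<in>space P. b k < M \<omega>}"
  have dec: "decseq ?A" using bmono by (auto simp: decseq_def intro: order.strict_trans1)
  have INT: "(\<Inter>k. ?A k) = hit B"
  proof (intro equalityI subsetI)
    fix \<omega> assume w: "\<omega> \<in> (\<Inter>k. ?A k)"
    then have "B \<le> M \<omega>" by (intro LIMSEQ_le_const2[OF blim]) (auto intro: less_imp_le)
    then show "\<omega> \<in> hit B" using w by auto
  qed (use bB in \<open>auto intro: order.strict_trans2\<close>)
  have "(\<lambda>k. \<integral>\<omega>\<in>?A k. S T \<omega> \<partial>P) \<longlonglongrightarrow> (\<integral>\<omega>\<in>(\<Inter>k. ?A k). S T \<omega> \<partial>P)"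
    using max_exceed_sets S_integrable[OF T_mem] by (intro set_integral_cont_down dec set_integrable_sub) auto
  then have 1: "(\<lambda>k. b k * prob (?A k)) \<longlonglongrightarrow> (\<integral>\<omega>\<in>hit B. S T \<omega> \<partial>P)"
    unfolding INT using exceed_integral[OF bB(2)] by simp
  have "(\<lambda>k. prob (?A k)) \<longlonglongrightarrow> prob (\<Inter>k. ?A k)"
    using max_exceed_sets by (intro finite_Lim_measure_decseq dec) auto
  then have "(\<lambda>k. b k * prob (?A k)) \<longlonglongrightarrow> B * prob (hit B)"
    unfolding INT by (intro tendsto_mult blim)
  with 1 show ?thesis by (rule LIMSEQ_unique)
qed

end

lemma market_filtered:
  assumes "prob_space P" "usual_filtration P T F"
  shows "filtered_prob_space P {0..T} F"
  using assms unfolding usual_filtration_def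
  by (intro filtered_prob_space.intro filtered_prob_space_axioms.intro) auto

text \<open>A conditional expectation is characterized by its set integrals. The single closing
  variable \<open>S T\<close> covers all intermediate times because the sigma-algebras
  increase.\<close>

lemma martingale_on_iff_mart_to:
  assumes "filtered_prob_space P {0..T} F" "0 \<le> T"
  shows "martingale_on P T F S \<longleftrightarrow> filtered_prob_space.mart_to P {0..T} F S (S T)"
proof -
  interpret filtered_prob_space P "{0..T}" F by (rule assms)
  show ?thesis
  proof
    assume m: "martingale_on P T F S"
    show "mart_to S (S T)"
      unfolding mart_to_def
    proof (intro conjI ballI)
      fix t A assume t: "t \<in> {0..T}" and A: "A \<in> sets (F t)"
      interpret sigma_finite_subalgebra P "F t" by (rule finite_measure_subalgebra_F[OF t])
      have "(\<integral>\<omega>\<in>A. S T \<omega> \<partial>P) = (\<integral>\<omega>\<in>A. real_cond_exp P (F t) (S T) \<omega> \<partial>P)"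
        using m assms(2) A by (intro real_cond_exp_intA) (auto simp: martingale_on_def)
      also have "\<dots> = (\<integral>\<omega>\<in>A. S t \<omega> \<partial>P)"
      proof (rule set_lebesgue_integral_cong_AE)
        show "A \<in> sets P" using A t sets_F by blast
        have "AE \<omega> in P. real_cond_exp P (F t) (S T) \<omega> = S t \<omega>"
          using m t by (auto simp: martingale_on_def)
        then show "AE \<omega>\<in>A in P. real_cond_exp P (F t) (S T) \<omega> = S t \<omega>" by eventually_elim auto
        show "S t \<in> borel_measurable P" using m t by (auto simp: martingale_on_def)
      qed simp
      finally show "(\<integral>\<omega>\<in>A. S t \<omega> \<partial>P) = (\<integral>\<omega>\<in>A. S T \<omega> \<partial>P)" by simp
    qed (use m assms(2) in \<open>auto simp: martingale_on_def\<close>)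
  next
    assume m: "mart_to S (S T)"
    show "martingale_on P T F S"
      unfolding martingale_on_def
    proof (intro conjI ballI allI impI)
      fix s t assume st: "0 \<le> s \<and> s \<le> t \<and> t \<le> T"
      then have s: "s \<in> {0..T}" and t: "t \<in> {0..T}" by auto
      interpret sigma_finite_subalgebra P "F s" by (rule finite_measure_subalgebra_F[OF s])
      show "AE \<omega> in P. real_cond_exp P (F s) (S t) \<omega> = S s \<omega>"
      proof (rule real_cond_exp_charact)
        fix A assume A: "A \<in> sets (F s)"
        then have "A \<in> sets (F t)" using filt_mono[OF s t] st by auto
        then show "(\<integral>\<omega>\<in>A. S t \<omega> \<partial>P) = (\<integral>\<omega>\<in>A. S s \<omega> \<partial>P)"
          using mart_toD(4)[OF m] A s t by simp
      qed (use mart_toD[OF m] s t in auto)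
    qed (use mart_toD[OF m] in auto)
  qed
qed

lemma market_model_continuous_market:
  assumes "market_model S\<^sub>0 T n K c m B b P F S" "0 < T" "0 < S\<^sub>0"
  shows "continuous_market P T F S S\<^sub>0"
proof -
  have f: "filtered_prob_space P {0..T} F"
    using assms by (intro market_filtered) (auto simp: market_model_def)
  show ?thesis
    using assms f martingale_on_iff_mart_to[OF f, of S]
    by (intro continuous_market.intro continuous_market_axioms.intro) (auto simp: market_model_def)
qed

section \<open>Necessity of the conditions\<close>

context continuous_market begin

text \<open>The asset stopped at \<open>B\<close> in closed form: a continuous path that starts
  below \<open>B\<close> and gets to \<open>B\<close> is stopped exactly there. The hitting time
  itself then disappears from the computations.\<close>

definition stop :: "real \<Rightarrow> 'a \<Rightarrow> real" where
  "stop B \<omega> = (if B \<le> M \<omega> then B else S T \<omega>)"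

text \<open>The intermediate value theorem provides a hit, and the set of hitting times is closed,
  so its infimum is itself a hitting time. Without a hit the infimum is \<infinity>, and the minimum
  with \<open>T\<close> returns the terminal value.\<close>

lemma stopped_value_eq:
  assumes w: "\<omega> \<in> space P" and B: "S\<^sub>0 < B"
  shows "stopped_value S T B \<omega> = stop B \<omega>"
proof (cases "B \<le> M \<omega>")
  case True
  define Hs where "Hs = {t\<in>{0..T}. S t \<omega> = B}"
  obtain u where u: "u \<in> {0..T}" "B \<le> S u \<omega>" using True max_ge_iff[OF w] by auto
  have "\<exists>t\<ge>0. t \<le> u \<and> S t \<omega> = B"
    using u B S_0[OF w] by (intro IVT') (auto intro: continuous_on_subset[OF cont[OF w]])
  then obtain t where "0 \<le> t" "t \<le> u" "S t \<omega> = B" by blast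
  then have "t \<in> Hs" using u by (auto simp: Hs_def)
  then have ne: "Hs \<noteq> {}" by blast
  have bdd: "bdd_below Hs" by (auto simp: Hs_def intro: bdd_belowI[of _ 0])
  have "closed ({0..T} \<inter> (\<lambda>t. S t \<omega>) -` {B})"
    by (rule continuous_closed_preimage[OF cont[OF w]]) auto
  moreover have "{0..T} \<inter> (\<lambda>t. S t \<omega>) -` {B} = Hs" by (auto simp: Hs_def)
  ultimately have h: "Inf Hs \<in> Hs" using closed_contains_Inf[OF ne bdd] by simp
  have "Inf (ereal ` Hs) = ereal (Inf Hs)"
    using h bdd by (intro antisym Inf_lower Inf_greatest) (auto intro: cInf_lower)
  then have "hitting_time S T B \<omega> = ereal (Inf Hs)" by (simp add: hitting_time_def Hs_def)
  moreover have "Inf Hs \<le> T" "S (Inf Hs) \<omega> = B" using h by (auto simp: Hs_def)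
  ultimately show ?thesis using True by (simp add: stopped_value_def stop_def min_absorb2)
next
  case False
  then have "{t\<in>{0..T}. S t \<omega> = B} = {}" using max_ge_iff[OF w, of B] by auto
  then have "hitting_time S T B \<omega> = \<infinity>" by (simp only: hitting_time_def image_empty Inf_empty top_ereal_def)
  then show ?thesis using False by (simp add: stopped_value_def stop_def)
qed

lemma stop_measurable[measurable]: "stop B \<in> borel_measurable P"
proof -
  have [measurable]: "M \<in> borel_measurable P" "S T \<in> borel_measurable P"
    using max_measurable S_measurable[OF T_mem] by auto
  show ?thesis unfolding stop_def[abs_def] by measurable
qed

lemma stop_bounds: "\<omega> \<in> space P \<Longrightarrow> 0 < B \<Longrightarrow> 0 < stop B \<omega>" "\<omega> \<in> space P \<Longrightarrow> stop B \<omega> \<le> B"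
  using S_pos[OF _ T_mem, of \<omega>] S_T_le_max[of \<omega>] by (auto simp: stop_def)

lemma stop_integrable: "0 < B \<Longrightarrow> integrable P (stop B)"
proof (rule integrable_const_bound[where B=B])
  assume "0 < B"
  then have "\<bar>stop B \<omega>\<bar> \<le> B" if "\<omega> \<in> space P" for \<omega>
    using stop_bounds[OF that, of B] by linarith
  then show "AE \<omega> in P. norm (stop B \<omega>) \<le> B" by simp
qed simp

lemma mean_S_T: "(\<integral>\<omega>. S T \<omega> \<partial>P) = S\<^sub>0"
proof -
  have 0: "0 \<in> {0..T}" using Tpos by simp
  have "space P \<in> sets (F 0)" using space_F[OF 0] sets.top[of "F 0"] by simp
  then have "(\<integral>\<omega>\<in>space P. S 0 \<omega> \<partial>P) = (\<integral>\<omega>\<in>space P. S T \<omega> \<partial>P)"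
    using mart_toD(4)[OF mart 0] by simp
  moreover have "(\<integral>\<omega>\<in>space P. S 0 \<omega> \<partial>P) = (\<integral>\<omega>. S\<^sub>0 \<partial>P)"
    unfolding set_lebesgue_integral_def using S_0 by (intro Bochner_Integration.integral_cong) auto
  moreover have "(\<integral>\<omega>\<in>space P. S T \<omega> \<partial>P) = (\<integral>\<omega>. S T \<omega> \<partial>P)"
    unfolding set_lebesgue_integral_def by (intro Bochner_Integration.integral_cong) auto
  ultimately show ?thesis by (simp add: prob_space)
qed

text \<open>Stopping replaces \<open>S T\<close> by \<open>B\<close> on the hitting event, and by
  \<open>hit_integral\<close> this does not change the integral over it.\<close>

lemma mean_stop: assumes "S\<^sub>0 < B" shows "(\<integral>\<omega>. stop B \<omega> \<partial>P) = S\<^sub>0"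
proof -
  have "(\<integral>\<omega>. stop B \<omega> \<partial>P)
      = (\<integral>\<omega>. S T \<omega> + (B * indicator (hit B) \<omega> - indicator (hit B) \<omega> *\<^sub>R S T \<omega>) \<partial>P)"
    by (intro Bochner_Integration.integral_cong) (auto simp: stop_def)
  also have "\<dots> = S\<^sub>0 + (B * prob (hit B) - (\<integral>\<omega>\<in>hit B. S T \<omega> \<partial>P))"
    unfolding set_lebesgue_integral_def
    using S_integrable[OF T_mem] hit_sets[of B] integrable_mult_indicator[OF hit_sets S_integrable[OF T_mem]]
    by (subst Bochner_Integration.integral_add Bochner_Integration.integral_diff;
        simp add: mean_S_T emeasure_eq_measure)+
  finally show ?thesis using hit_integral[OF assms] by simp
qed

text \<open>\<open>X\<close> stands for the asset at the next barrier or at \<open>T\<close>. Off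
  the hitting event the two payoffs agree, which leaves the payoff of \<open>X\<close> on that
  event. There \<open>X\<close> integrates to \<open>B\<close> times the probability, so Jensen's
  inequality gives the comparison.\<close>

lemma later_value:
  assumes B: "S\<^sub>0 < B" and X: "integrable P X" "(\<integral>\<omega>. X \<omega> \<partial>P) = S\<^sub>0"
    and eq: "\<And>\<omega>. \<omega> \<in> space P \<Longrightarrow> M \<omega> < B \<Longrightarrow> X \<omega> = S T \<omega>"
  shows "(\<integral>\<omega>. max (X \<omega> - x) 0 \<partial>P) - (\<integral>\<omega>. max (stop B \<omega> - x) 0 \<partial>P) + prob (hit B) * max (B - x) 0
      = (\<integral>\<omega>. indicator (hit B) \<omega> * max (X \<omega> - x) 0 \<partial>P)" (is ?th1)
    and "(\<integral>\<omega>. max (stop B \<omega> - x) 0 \<partial>P) \<le> (\<integral>\<omega>. max (X \<omega> - x) 0 \<partial>P)"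
proof -
  have B0: "0 < B" using B S0pos by simp
  have ipay: "integrable P (\<lambda>\<omega>. max (Y \<omega> - x) 0)" if "integrable P Y" for Y :: "'a \<Rightarrow> real" and x
    using that by (intro integrable_max Bochner_Integration.integrable_diff) auto
  have iind: "integrable P (\<lambda>\<omega>. indicator (hit B) \<omega> * Y \<omega>)" if "integrable P Y" for Y :: "'a \<Rightarrow> real"
    using integrable_mult_indicator[OF hit_sets that] by simp
  have "(\<integral>\<omega>. indicator (hit B) \<omega> * max (X \<omega> - x) 0 \<partial>P) =
    (\<integral>\<omega>. max (X \<omega> - x) 0 - max (stop B \<omega> - x) 0 + indicator (hit B) \<omega> * max (B - x) 0 \<partial>P)"
    using eq by (intro Bochner_Integration.integral_cong) (auto simp: stop_def not_le)
  also have "\<dots> = (\<integral>\<omega>. max (X \<omega> - x) 0 \<partial>P) - (\<integral>\<omega>. max (stop B \<omega> - x) 0 \<partial>P) + prob (hit B) * max (B - x) 0"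
    using ipay[OF X(1)] ipay[OF stop_integrable[OF B0]] hit_sets[of B] by (simp add: emeasure_eq_measure)
  finally show th1: ?th1 by simp
  have "prob (hit B) * max (B - x) 0 \<le> (\<integral>\<omega>. indicator (hit B) \<omega> * max (X \<omega> - x) 0 \<partial>P)"
  proof (cases "B \<le> x")
    case True
    then show ?thesis by (simp add: integral_nonneg_AE)
  next
    case False
    \<comment> \<open>The total means agree and \<open>X\<close> equals \<open>S T\<close> off the
      event, so their integrals over the event agree as well.\<close>
    have "(\<integral>\<omega>. indicator (hit B) \<omega> * X \<omega> \<partial>P) = (\<integral>\<omega>. X \<omega> - S T \<omega> + indicator (hit B) \<omega> * S T \<omega> \<partial>P)"
    proof (intro Bochner_Integration.integral_cong refl)
      fix \<omega> assume "\<omega> \<in> space P"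
      then show "indicator (hit B) \<omega> * X \<omega> = X \<omega> - S T \<omega> + indicator (hit B) \<omega> * S T \<omega>"
        using eq[of \<omega>] by (cases "B \<le> M \<omega>") (simp_all add: not_le)
    qed
    also have "\<dots> = (\<integral>\<omega>\<in>hit B. S T \<omega> \<partial>P)"
      unfolding set_lebesgue_integral_def using X S_integrable[OF T_mem] iind[OF S_integrable[OF T_mem]] mean_S_T by simp
    finally have hX: "(\<integral>\<omega>. indicator (hit B) \<omega> * X \<omega> \<partial>P) = B * prob (hit B)" using hit_integral[OF B] by simp
    have "prob (hit B) * max (B - x) 0 = (\<integral>\<omega>. indicator (hit B) \<omega> * X \<omega> - x * indicator (hit B) \<omega> \<partial>P)"
      using hX False iind[OF X(1)] hit_sets[of B] by (simp add: emeasure_eq_measure algebra_simps)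
    also have "\<dots> \<le> (\<integral>\<omega>. indicator (hit B) \<omega> * max (X \<omega> - x) 0 \<partial>P)"
    proof (rule integral_mono)
      show "integrable P (\<lambda>\<omega>. indicator (hit B) \<omega> * X \<omega> - x * indicator (hit B) \<omega>)"
        using hit_sets[of B]
        by (intro Bochner_Integration.integrable_diff iind X(1) integrable_mult_right integrable_real_indicator)
           (auto simp: emeasure_eq_measure)
      show "integrable P (\<lambda>\<omega>. indicator (hit B) \<omega> * max (X \<omega> - x) 0)" by (intro iind ipay X(1))
    qed (auto simp: indicator_def)
    finally show ?thesis .
  qed
  then show "(\<integral>\<omega>. max (stop B \<omega> - x) 0 \<partial>P) \<le> (\<integral>\<omega>. max (X \<omega> - x) 0 \<partial>P)" using th1 by linarith
qed

text \<open>By \<open>later_value\<close> the function is an average of payoffs, each of them convex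
  in the strike.\<close>

lemma later_value_convex:
  assumes B: "S\<^sub>0 < B" and X: "integrable P X" "(\<integral>\<omega>. X \<omega> \<partial>P) = S\<^sub>0"
    and eq: "\<And>\<omega>. \<omega> \<in> space P \<Longrightarrow> M \<omega> < B \<Longrightarrow> X \<omega> = S T \<omega>"
  shows "convex_on {0..} (\<lambda>x. (\<integral>\<omega>. max (X \<omega> - x) 0 \<partial>P) - (\<integral>\<omega>. max (stop B \<omega> - x) 0 \<partial>P) + prob (hit B) * max (B - x) 0)"
proof -
  have e: "(\<integral>\<omega>. max (X \<omega> - x) 0 \<partial>P) - (\<integral>\<omega>. max (stop B \<omega> - x) 0 \<partial>P) + prob (hit B) * max (B - x) 0
      = (\<integral>\<omega>. indicator (hit B) \<omega> * max (X \<omega> - x) 0 \<partial>P)" for x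
    by (rule later_value(1)[OF B X]) (rule eq)
  show ?thesis unfolding e
proof (rule convex_on_integral)
  fix \<omega> show "convex_on {0..} (\<lambda>x. indicator (hit B) \<omega> * max (X \<omega> - x) 0)"
    by (intro convex_on_cmul convex_on_call_payoff) auto
next
  fix x 
  have "integrable P (\<lambda>\<omega>. max (X \<omega> - x) 0)" using X(1) by (intro integrable_max Bochner_Integration.integrable_diff) auto
  then show "integrable P (\<lambda>\<omega>. indicator (hit B) \<omega> * max (X \<omega> - x) 0)"
    using integrable_mult_indicator[OF hit_sets, of "\<lambda>\<omega>. max (X \<omega> - x) 0"] by simp
qed simp
qed

abbreviation "stop_law B \<equiv> distr P borel (stop B)"

lemma stop_law_call: "call_of_measure (stop_law B) x = (\<integral>\<omega>. max (stop B \<omega> - x) 0 \<partial>P)"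
  by (rule call_of_distr) simp

lemma stop_law_distribution: "0 < B \<Longrightarrow> call_distribution (stop_law B)"
  by (intro call_distribution_distr stop_integrable)

lemma stop_ge_hit: "{\<omega>\<in>space P. B \<le> stop B \<omega>} = hit B"
  using S_T_le_max by (auto simp: stop_def intro: order_trans)

lemma S_T_law_distribution: "call_distribution (distr P borel (S T))"
  by (intro call_distribution_distr S_integrable T_mem)

lemma S_T_law_call: "call_of_measure (distr P borel (S T)) x = (\<integral>\<omega>. max (S T \<omega> - x) 0 \<partial>P)"
  by (rule call_of_distr) (rule S_measurable[OF T_mem])

lemma positive_law_derivative:
  assumes X: "integrable P X" "\<And>\<omega>. \<omega> \<in> space P \<Longrightarrow> 0 < X \<omega>"
  shows "(call_of_measure (distr P borel X) has_real_derivative - 1) (at_right 0)"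
    and "call_of_measure (distr P borel X) 0 = (\<integral>\<omega>. X \<omega> \<partial>P)"
proof -
  have [measurable]: "X \<in> borel_measurable P" using X by auto
  interpret d: call_distribution "distr P borel X" by (rule call_distribution_distr[OF X(1)])
  have "measure (distr P borel X) {0<..} = prob {\<omega>\<in>space P. 0 < X \<omega>}"
    by (simp add: measure_distr) (auto intro!: arg_cong[where f=prob])
  also have "{\<omega>\<in>space P. 0 < X \<omega>} = space P" using X(2) by auto
  finally show "(call_of_measure (distr P borel X) has_real_derivative - 1) (at_right 0)"
    using d.call_right_derivative[of 0] by (simp add: prob_space)
  show "call_of_measure (distr P borel X) 0 = (\<integral>\<omega>. X \<omega> \<partial>P)"
    using X(2) by (subst call_of_distr) (auto intro!: Bochner_Integration.integral_cong simp: less_imp_le max_absorb1)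
qed

lemma stop_law_left_derivative:
  assumes "0 < B"
  shows "(call_of_measure (stop_law B) has_real_derivative - prob (hit B)) (at_left B)"
proof -
  interpret d: call_distribution "stop_law B" by (rule stop_law_distribution[OF assms])
  have "measure (stop_law B) {B..} = prob {\<omega>\<in>space P. B \<le> stop B \<omega>}"
    by (simp add: measure_distr) (auto intro!: arg_cong[where f=prob])
  then show ?thesis using d.call_left_derivative[of B] by (simp add: stop_ge_hit)
qed

text \<open>For \<open>x < B\<close> the stopped value exceeds \<open>x\<close> either because
  \<open>B\<close> was reached or because the path stayed below \<open>B\<close> and ended above
  \<open>x\<close>; the two cases are disjoint.\<close>

lemma stop_law_right_derivative:
  assumes "0 < B" "x < B"
  shows "(call_of_measure (stop_law B) has_real_derivative
      - (prob (hit B) + prob {\<omega>\<in>space P. x < S T \<omega> \<and> M \<omega> < B})) (at_right x)"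
proof -
  interpret d: call_distribution "stop_law B" by (rule stop_law_distribution[OF assms(1)])
  have [measurable]: "M \<in> borel_measurable P" "S T \<in> borel_measurable P"
    using max_measurable S_measurable[OF T_mem] by auto
  have "measure (stop_law B) {x<..} = prob {\<omega>\<in>space P. x < stop B \<omega>}"
    by (simp add: measure_distr) (auto intro!: arg_cong[where f=prob])
  also have "{\<omega>\<in>space P. x < stop B \<omega>} = hit B \<union> {\<omega>\<in>space P. x < S T \<omega> \<and> M \<omega> < B}"
    using assms(2) by (auto simp: stop_def not_le)
  also have "prob \<dots> = prob (hit B) + prob {\<omega>\<in>space P. x < S T \<omega> \<and> M \<omega> < B}"
    by (intro finite_measure_Union hit_sets) auto
  finally show ?thesis using d.call_right_derivative[of x] by simp
qed

lemma interpolating_S_T: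
  assumes "\<forall>i\<in>{1..n}. (\<integral>\<omega>. max (S T \<omega> - K i) 0 \<partial>P) = c (K i)"
  shows "interpolating_calls S\<^sub>0 n K c (distr P borel (S T))"
proof -
  let ?\<mu> = "distr P borel (S T)"
  have [measurable]: "S T \<in> borel_measurable P" using S_measurable[OF T_mem] by auto
  interpret d: call_distribution ?\<mu> by (rule S_T_law_distribution)
  note p = positive_law_derivative[OF S_integrable[OF T_mem] S_pos[OF _ T_mem]]
  have "AE \<omega> in P. 0 \<le> S T \<omega>" using S_pos[OF _ T_mem] by (simp add: less_imp_le)
  then have "AE y in ?\<mu>. 0 \<le> y" by (subst AE_distr_iff) auto
  then have "call_measure ?\<mu>" unfolding call_measure_def
    using d.integrable_ident d.prob_space_axioms by simp
  moreover have "call_price_function (call_of_measure ?\<mu>)"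
    unfolding call_price_function_def using p(1) d.call_nonneg d.call_tendsto_0 d.call_convex[of "{0..}"]
    by (auto intro!: exI[of _ "-1"])
  ultimately show ?thesis
    unfolding interpolating_calls_def using p assms by (simp add: S_T_law_call mean_S_T)
qed

lemma barrier_calls_S_T:
  fixes B :: "nat \<Rightarrow> real"
  assumes B: "\<And>j. j \<in> {1..m} \<Longrightarrow> S\<^sub>0 < B j" "mono_on {1..m} B"
    and b: "\<And>j. j \<in> {1..m} \<Longrightarrow> prob (hit (B j)) = b (B j)"
  shows "\<exists>\<cc>. barrier_calls S\<^sub>0 m B b (distr P borel (S T)) \<cc>"
proof -
  \<comment> \<open>One family for all barriers: index \<open>m + 1\<close> is the asset that is not
    stopped, matching \<open>\<cc> (m + 1)\<close>.\<close>
  define X where "X j = (if j \<le> m then stop (B j) else S T)" for j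
  define \<cc> where "\<cc> j = call_of_measure (distr P borel (X j))" for j
  have B0: "0 < B j" if "j \<in> {1..m}" for j using B(1)[OF that] S0pos by simp
  have X: "integrable P (X j)" "(\<integral>\<omega>. X j \<omega> \<partial>P) = S\<^sub>0" "\<And>\<omega>. \<omega> \<in> space P \<Longrightarrow> 0 < X j \<omega>" if "1 \<le> j" for j
    using that stop_integrable B0 B mean_stop S_integrable[OF T_mem] mean_S_T stop_bounds(1) S_pos[OF _ T_mem]
    by (auto simp: X_def)
  have \<cc>: "\<cc> j x = (\<integral>\<omega>. max (X j \<omega> - x) 0 \<partial>P)" if "1 \<le> j" for j x
    unfolding \<cc>_def using X(1)[OF that] by (intro call_of_distr) auto
  \<comment> \<open>A path that never reaches \<open>B j\<close> does not reach the next barrier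
    either, so stopping it there changes nothing.\<close>
  have later: "X (Suc j) \<omega> = S T \<omega>" if "j \<in> {1..m}" "\<omega> \<in> space P" "M \<omega> < B j" for j \<omega>
  proof (cases "j < m")
    case True
    then have "B j \<le> B (Suc j)" using B(2) that(1) by (intro mono_onD[OF B(2)]) auto
    then show ?thesis using that True by (simp add: X_def stop_def)
  qed (use that in \<open>simp add: X_def\<close>)
  show ?thesis
  proof (intro exI[of _ \<cc>], unfold barrier_calls_def, intro conjI ballI)
    show "\<cc> (m + 1) = call_of_measure (distr P borel (S T))" by (simp add: \<cc>_def X_def)
    fix j assume j: "j \<in> {1..m}"
    then have j1: "1 \<le> j" by simp
    have Xj: "X j = stop (B j)" using j by (simp add: X_def)
    interpret d: call_distribution "distr P borel (X j)" by (rule call_distribution_distr[OF X(1)[OF j1]])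
    have "\<cc> j x \<le> S\<^sub>0" if "0 \<le> x" for x
    proof -
      have "\<cc> j x \<le> (\<integral>\<omega>. X j \<omega> \<partial>P)"
        unfolding \<cc>[OF j1] using X[OF j1] that
        by (intro integral_mono integrable_max) (auto simp: less_imp_le intro: less_imp_le)
      then show ?thesis using X(2)[OF j1] by simp
    qed
    then show "\<cc> j ` {0..} \<subseteq> {0..S\<^sub>0}" using d.call_nonneg by (auto simp: \<cc>_def)
    show "convex_on {0..} (\<cc> j)" unfolding \<cc>_def by (rule d.call_convex) simp
    show "\<forall>x\<ge>0. 0 \<le> \<cc> 1 x \<and> \<cc> j x \<le> \<cc> (j + 1) x"
    proof (intro allI impI conjI)
      fix x :: real
      show "0 \<le> \<cc> 1 x" unfolding \<cc>[OF order_refl] by (rule integral_nonneg_AE) auto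
      show "\<cc> j x \<le> \<cc> (j + 1) x" unfolding \<cc>[OF j1] using j later[OF j]
        by (subst \<cc>) (auto simp: Xj intro!: later_value(2)[OF B(1)[OF j]] X)
    qed
    show "(\<cc> j has_real_derivative - 1) (at_right 0)" "\<cc> j 0 = S\<^sub>0"
      using positive_law_derivative[OF X(1,3)[OF j1]] X(2)[OF j1] by (simp_all add: \<cc>_def)
    show "\<forall>x\<ge>B j. \<cc> j x = 0"
    proof (intro allI impI)
      fix x assume x: "B j \<le> x"
      have "\<cc> j x = (\<integral>\<omega>. 0 \<partial>P)" unfolding \<cc>[OF j1] Xj
      proof (intro Bochner_Integration.integral_cong refl)
        fix \<omega> assume "\<omega> \<in> space P"
        then have "stop (B j) \<omega> \<le> x" using stop_bounds(2)[of \<omega> "B j"] x by linarith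
        then show "max (stop (B j) \<omega> - x) 0 = 0" by simp
      qed
      then show "\<cc> j x = 0" by simp
    qed
    show "(\<cc> j has_real_derivative - b (B j)) (at_left (B j))"
      using stop_law_left_derivative[OF B0[OF j]] b[OF j] by (simp add: \<cc>_def Xj)
    show "convex_on {0..} (\<lambda>x. \<cc> (j + 1) x - \<cc> j x + b (B j) * max (B j - x) 0)"
      using later_value_convex[OF B(1)[OF j] X(1,2)[of "Suc j"] later[OF j]] j1 b[OF j]
      by (simp add: \<cc> Xj)
  qed
qed

end

theorem market_model_necessary:
  assumes mm: "market_model S\<^sub>0 T n K c m B b P F S" and "0 < T" "0 < S\<^sub>0"
    and B: "\<And>j. j \<in> {1..m} \<Longrightarrow> S\<^sub>0 < B j" "mono_on {1..m} B"
  shows "interpolating_calls S\<^sub>0 n K c (distr P borel (S T)) \<and> (\<exists>\<cc>. barrier_calls S\<^sub>0 m B b (distr P borel (S T)) \<cc>)"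
proof -
  interpret continuous_market P T F S S\<^sub>0 by (rule market_model_continuous_market[OF assms(1-3)])
  have "prob (hit (B j)) = b (B j)" if "j \<in> {1..m}" for j
  proof -
    have "(\<integral>\<omega>. indicator (hit (B j)) \<omega> \<partial>P) = prob (hit (B j))" using hit_sets by simp
    then show ?thesis using mm that by (simp add: market_model_def)
  qed
  then show ?thesis using interpolating_S_T[of n K c] barrier_calls_S_T[OF B, of b] mm B
    by (auto simp: market_model_def)
qed

theorem market_model_joint_law:
  assumes mm: "market_model S\<^sub>0 T n K c m B b P F S" and "0 < T" "0 < S\<^sub>0"
    and B: "S\<^sub>0 < B j" and j: "j \<in> {1..m}" and x: "0 \<le> x" "x < B j"
    and cor: "corresponding T m B \<mu> \<cc> P S"
  shows "\<exists>d. (\<cc> j has_real_derivative d) (at_right x) \<and>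
                measure P {\<omega>\<in>space P. S T \<omega> > x \<and> running_max S T \<omega> < B j} = - d - b (B j)"
proof -
  interpret continuous_market P T F S S\<^sub>0 by (rule market_model_continuous_market[OF assms(1-3)])
  have b: "prob (hit (B j)) = b (B j)"
  proof -
    have "(\<integral>\<omega>. indicator (hit (B j)) \<omega> \<partial>P) = prob (hit (B j))" using hit_sets by simp
    then show ?thesis using mm j by (simp add: market_model_def)
  qed
  have eq: "\<cc> j y = call_of_measure (stop_law (B j)) y" if "0 \<le> y" for y
  proof -
    have "\<cc> j y = (\<integral>\<omega>. max (stopped_value S T (B j) \<omega> - y) 0 \<partial>P)"
      using cor j that by (simp add: corresponding_def)
    also have "\<dots> = (\<integral>\<omega>. max (stop (B j) \<omega> - y) 0 \<partial>P)"
      using stopped_value_eq[OF _ B] by (intro Bochner_Integration.integral_cong) auto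
    finally show ?thesis by (simp add: stop_law_call)
  qed
  have "0 < B j" using B assms(3) by simp
  let ?d = "- (b (B j) + prob {\<omega>\<in>space P. x < S T \<omega> \<and> M \<omega> < B j})"
  \<comment> \<open>The two functions agree at nonnegative strikes, which is enough for a right
    derivative at \<open>x \<ge> 0\<close>.\<close>
  have "(\<cc> j has_real_derivative ?d) (at_right x)"
    using stop_law_right_derivative[OF \<open>0 < B j\<close> x(2)] x(1) eq unfolding b
    by (subst has_field_derivative_cong_eventually[where g="call_of_measure (stop_law (B j))"])
       (auto simp: eventually_at_filter)
  then show ?thesis by (intro exI[of _ ?d]) auto
qed

section \<open>Gaussian noise and Levy's construction\<close>

text \<open>The map is orthogonal, so it preserves the sum of squares and with it the joint
  density.\<close>

lemma std_normal_rotate: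
  "std_normal_density ((u + v) / sqrt 2) * std_normal_density ((u - v) / sqrt 2)
    = std_normal_density u * std_normal_density v"
proof -
  have "((u + v) / sqrt 2)\<^sup>2 / 2 + ((u - v) / sqrt 2)\<^sup>2 / 2 = u\<^sup>2 / 2 + v\<^sup>2 / 2"
    by (simp add: power_divide power2_eq_square field_simps)
  then have "exp (- (((u + v) / sqrt 2)\<^sup>2 / 2)) * exp (- (((u - v) / sqrt 2)\<^sup>2 / 2)) = exp (- (u\<^sup>2 / 2)) * exp (- (v\<^sup>2 / 2))"
    by (simp only: exp_add[symmetric] minus_add_distrib[symmetric])
  then show ?thesis by (simp add: std_normal_density_def)
qed

interpretation gauss2: pair_prob_space gauss gauss ..

lemma gauss_pair_nn_integral:
  assumes f[measurable]: "f \<in> borel_measurable (borel \<Otimes>\<^sub>M borel)"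
  shows "(\<integral>\<^sup>+z. f z \<partial>(gauss \<Otimes>\<^sub>M gauss))
    = (\<integral>\<^sup>+x. (\<integral>\<^sup>+y. ennreal (std_normal_density x * std_normal_density y) * f (x, y) \<partial>lborel) \<partial>lborel)"
proof -
  have s: "sets (gauss \<Otimes>\<^sub>M gauss) = sets (borel \<Otimes>\<^sub>M borel)" by (intro sets_pair_measure_cong) auto
  have [measurable]: "f \<in> borel_measurable (gauss \<Otimes>\<^sub>M gauss)" by (simp add: measurable_cong_sets[OF s refl])
  have "(\<integral>\<^sup>+z. f z \<partial>(gauss \<Otimes>\<^sub>M gauss)) = (\<integral>\<^sup>+x. (\<integral>\<^sup>+y. f (x, y) \<partial>gauss) \<partial>gauss)"
    by (rule gauss.nn_integral_fst[symmetric]) measurable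
  also have "\<dots> = (\<integral>\<^sup>+x. ennreal (std_normal_density x) * (\<integral>\<^sup>+y. ennreal (std_normal_density y) * f (x, y) \<partial>lborel) \<partial>lborel)"
    by (subst nn_integral_density; (subst nn_integral_density)?) (auto intro!: nn_integral_cong)
  also have "\<dots> = (\<integral>\<^sup>+x. (\<integral>\<^sup>+y. ennreal (std_normal_density x * std_normal_density y) * f (x, y) \<partial>lborel) \<partial>lborel)"
    by (subst nn_integral_cmult[symmetric]) (auto simp: ennreal_mult mult.assoc intro!: nn_integral_cong)
  finally show ?thesis .
qed

text \<open>The change of variables is done one coordinate at a time with Fubini in between; the
  factors \<open>sqrt 2\<close> and \<open>1 / sqrt 2\<close> of the two affine substitutions
  cancel.\<close>

lemma gauss_rotation_nn_integral:
  assumes f[measurable]: "f \<in> borel_measurable (borel \<Otimes>\<^sub>M borel)"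
  shows "(\<integral>\<^sup>+(x, y). f ((x + y) / sqrt 2, (x - y) / sqrt 2) \<partial>(gauss \<Otimes>\<^sub>M gauss)) = (\<integral>\<^sup>+z. f z \<partial>(gauss \<Otimes>\<^sub>M gauss))"
proof -
  let ?p = "\<lambda>x y. ennreal (std_normal_density x * std_normal_density y)"
  have "(\<integral>\<^sup>+(x, y). f ((x + y) / sqrt 2, (x - y) / sqrt 2) \<partial>(gauss \<Otimes>\<^sub>M gauss))
      = (\<integral>\<^sup>+x. \<integral>\<^sup>+y. ?p x y * f ((x + y) / sqrt 2, (x - y) / sqrt 2) \<partial>lborel \<partial>lborel)"
    by (subst gauss_pair_nn_integral) auto
  also have "\<dots> = (\<integral>\<^sup>+x. \<integral>\<^sup>+u. sqrt 2 * (?p x (- x + sqrt 2 * u) * f (u, sqrt 2 * x - u)) \<partial>lborel \<partial>lborel)"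
  proof (rule nn_integral_cong)
    fix x :: real
    have "(x - (- x + sqrt 2 * u)) / sqrt 2 = sqrt 2 * x - u" for u
      by (simp add: field_simps)
    then show "(\<integral>\<^sup>+y. ?p x y * f ((x + y) / sqrt 2, (x - y) / sqrt 2) \<partial>lborel)
       = (\<integral>\<^sup>+u. sqrt 2 * (?p x (- x + sqrt 2 * u) * f (u, sqrt 2 * x - u)) \<partial>lborel)"
      by (subst nn_integral_real_affine[of _ "sqrt 2" "- x"]) (auto simp: nn_integral_cmult)
  qed
  also have "\<dots> = (\<integral>\<^sup>+u. \<integral>\<^sup>+x. sqrt 2 * (?p x (- x + sqrt 2 * u) * f (u, sqrt 2 * x - u)) \<partial>lborel \<partial>lborel)"
    by (intro lborel_pair.Fubini') measurable
  also have "\<dots> = (\<integral>\<^sup>+u. \<integral>\<^sup>+v. ?p u v * f (u, v) \<partial>lborel \<partial>lborel)"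
  proof (rule nn_integral_cong)
    fix u :: real
    have e1: "sqrt 2 * (u / sqrt 2 + (1 / sqrt 2) * v) - u = v" for v
      by (simp add: field_simps)
    have e2: "?p (u / sqrt 2 + (1 / sqrt 2) * v) (- (u / sqrt 2 + (1 / sqrt 2) * v) + sqrt 2 * u) = ?p u v" for v
    proof -
      have "u / sqrt 2 + (1 / sqrt 2) * v = (u + v) / sqrt 2" by (simp add: field_simps)
      moreover have "- ((u + v) / sqrt 2) + sqrt 2 * u = (u - v) / sqrt 2"
        by (simp add: field_simps)
      ultimately show ?thesis using std_normal_rotate[of u v] by simp
    qed
    have "(\<integral>\<^sup>+x. sqrt 2 * (?p x (- x + sqrt 2 * u) * f (u, sqrt 2 * x - u)) \<partial>lborel)
      = ennreal \<bar>1 / sqrt 2\<bar> * (\<integral>\<^sup>+v. sqrt 2 * (?p u v * f (u, v)) \<partial>lborel)"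
      by (subst nn_integral_real_affine[of _ "1 / sqrt 2" "u / sqrt 2"]) (simp_all only: e1 e2, auto)
    also have "\<dots> = (\<integral>\<^sup>+v. ?p u v * f (u, v) \<partial>lborel)"
      by (subst nn_integral_cmult) (auto simp: mult.assoc[symmetric] ennreal_mult[symmetric])
    finally show "(\<integral>\<^sup>+x. sqrt 2 * (?p x (- x + sqrt 2 * u) * f (u, sqrt 2 * x - u)) \<partial>lborel) = \<dots>" .
  qed
  also have "\<dots> = (\<integral>\<^sup>+z. f z \<partial>(gauss \<Otimes>\<^sub>M gauss))"
    by (rule gauss_pair_nn_integral[symmetric]) measurable
  finally show ?thesis .
qed

lemma gauss_rotation_prob:
  assumes A: "A \<in> sets borel" "B \<in> sets borel"
  shows "emeasure (gauss \<Otimes>\<^sub>M gauss) {(x, y). (x + y) / sqrt 2 \<in> A \<and> (x - y) / sqrt 2 \<in> B} = emeasure gauss A * emeasure gauss B"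
proof -
  have s: "sets (gauss \<Otimes>\<^sub>M gauss) = sets (borel \<Otimes>\<^sub>M borel)" by (intro sets_pair_measure_cong) auto
  have sp: "space (borel \<Otimes>\<^sub>M borel :: (real \<times> real) measure) = UNIV" by (simp add: space_pair_measure)
  note [measurable] = A
  have m: "{(x, y). (x + y) / sqrt 2 \<in> A \<and> (x - y) / sqrt 2 \<in> B} \<in> sets (borel \<Otimes>\<^sub>M borel)"
  proof -
    have "{z \<in> space (borel \<Otimes>\<^sub>M borel). (fst z + snd z) / sqrt 2 \<in> A \<and> (fst z - snd z) / sqrt 2 \<in> B} \<in> sets (borel \<Otimes>\<^sub>M borel)"
      by measurable
    also have "{z \<in> space (borel \<Otimes>\<^sub>M borel). (fst z + snd z) / sqrt 2 \<in> A \<and> (fst z - snd z) / sqrt 2 \<in> B}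
      = {(x, y). (x + y) / sqrt 2 \<in> A \<and> (x - y) / sqrt 2 \<in> B}" by (auto simp: sp)
    finally show ?thesis .
  qed
  have "emeasure (gauss \<Otimes>\<^sub>M gauss) {(x, y). (x + y) / sqrt 2 \<in> A \<and> (x - y) / sqrt 2 \<in> B}
     = (\<integral>\<^sup>+z. indicator {(x, y). (x + y) / sqrt 2 \<in> A \<and> (x - y) / sqrt 2 \<in> B} z \<partial>(gauss \<Otimes>\<^sub>M gauss))"
    using m by (simp add: s)
  also have "\<dots> = (\<integral>\<^sup>+(x, y). indicator (A \<times> B) ((x + y) / sqrt 2, (x - y) / sqrt 2) \<partial>(gauss \<Otimes>\<^sub>M gauss))"
    by (intro nn_integral_cong) (auto simp: indicator_def)
  also have "\<dots> = (\<integral>\<^sup>+z. indicator (A \<times> B) z \<partial>(gauss \<Otimes>\<^sub>M gauss))"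
    by (rule gauss_rotation_nn_integral) (use A in auto)
  also have "\<dots> = emeasure gauss A * emeasure gauss B"
    using A by (simp add: gauss.emeasure_pair_measure_Times)
  finally show ?thesis .
qed

context prob_space begin

definition iid_gauss :: "('i \<Rightarrow> 'a \<Rightarrow> real) \<Rightarrow> bool" where
  "iid_gauss X \<longleftrightarrow> indep_vars (\<lambda>_. borel) X UNIV \<and> (\<forall>i. distr M borel (X i) = gauss)"

lemma iid_gauss_measurable: "iid_gauss X \<Longrightarrow> X i \<in> borel_measurable M"
  unfolding iid_gauss_def indep_vars_def by auto

lemma iid_gauss_prob:
  assumes "iid_gauss X" "A \<in> sets borel" shows "prob {\<omega>\<in>space M. X i \<omega> \<in> A} = measure gauss A"
proof -
  have "measure (distr M borel (X i)) A = measure gauss A" using assms by (simp add: iid_gauss_def)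
  then show ?thesis using assms iid_gauss_measurable[OF assms(1)]
    by (simp add: measure_distr vimage_def Int_def conj_commute)
qed

text \<open>Product probabilities over finite index sets determine both the marginal laws and the
  independence. In this form families can be compared set by set, with \<open>UNIV\<close> at
  indices that carry no condition.\<close>

lemma iid_gauss_iff:
  "iid_gauss X \<longleftrightarrow> (\<forall>i. X i \<in> borel_measurable M) \<and>
     (\<forall>J A. finite J \<longrightarrow> (\<forall>j\<in>J. A j \<in> sets borel) \<longrightarrow>
        prob {\<omega>\<in>space M. \<forall>j\<in>J. X j \<omega> \<in> A j} = (\<Prod>j\<in>J. measure gauss (A j)))"
proof (intro iffI conjI allI impI)
  assume X: "iid_gauss X"
  show "X i \<in> borel_measurable M" for i by (rule iid_gauss_measurable[OF X])
  fix J :: "'b set" and A :: "'b \<Rightarrow> real set" assume J: "finite J" and A: "\<forall>j\<in>J. A j \<in> sets borel"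
  show "prob {\<omega>\<in>space M. \<forall>j\<in>J. X j \<omega> \<in> A j} = (\<Prod>j\<in>J. measure gauss (A j))"
  proof (cases "J = {}")
    case False
    have "prob (\<Inter>j\<in>J. X j -` A j \<inter> space M) = (\<Prod>j\<in>J. prob (X j -` A j \<inter> space M))"
      using X J A False by (intro indep_varsD[of _ _ UNIV]) (auto simp: iid_gauss_def)
    also have "\<dots> = (\<Prod>j\<in>J. measure gauss (A j))"
    proof (intro prod.cong refl)
      fix j assume "j \<in> J"
      then have "measure (distr M borel (X j)) (A j) = prob (X j -` A j \<inter> space M)"
        using iid_gauss_measurable[OF X] A by (intro measure_distr) auto
      then show "prob (X j -` A j \<inter> space M) = measure gauss (A j)" using X by (simp add: iid_gauss_def)
    qed
    also have "(\<Inter>j\<in>J. X j -` A j \<inter> space M) = {\<omega>\<in>space M. \<forall>j\<in>J. X j \<omega> \<in> A j}" using False by auto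
    finally show ?thesis .
  qed (simp add: prob_space)
next
  assume *: "(\<forall>i. X i \<in> borel_measurable M) \<and>
     (\<forall>J A. finite J \<longrightarrow> (\<forall>j\<in>J. A j \<in> sets borel) \<longrightarrow>
        prob {\<omega>\<in>space M. \<forall>j\<in>J. X j \<omega> \<in> A j} = (\<Prod>j\<in>J. measure gauss (A j)))"
  then have m[measurable]: "X i \<in> borel_measurable M" for i by blast
  have p: "prob {\<omega>\<in>space M. \<forall>j\<in>J. X j \<omega> \<in> A j} = (\<Prod>j\<in>J. measure gauss (A j))"
    if "finite J" "\<And>j. j \<in> J \<Longrightarrow> A j \<in> sets borel" for J A using * that by blast
  have p1: "prob (X i -` A \<inter> space M) = measure gauss A" if "A \<in> sets borel" for i A
    using p[of "{i}" "\<lambda>_. A"] that by (simp add: vimage_def Int_def conj_commute)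
  have d: "distr M borel (X i) = gauss" for i
  proof (rule measure_eqI)
    fix A assume "A \<in> sets (distr M borel (X i))"
    then have A: "A \<in> sets borel" by simp
    then show "emeasure (distr M borel (X i)) A = emeasure gauss A"
      using p1[OF A] by (simp add: emeasure_distr emeasure_eq_measure gauss.emeasure_eq_measure)
  qed simp
  have "indep_vars (\<lambda>_. borel) X UNIV"
    unfolding indep_vars_def2
  proof (intro conjI ballI indep_setsI)
    fix E :: "'b \<Rightarrow> 'a set" and J assume J: "J \<noteq> {}" "finite J" and E: "\<forall>j\<in>J. E j \<in> {X j -` A \<inter> space M |A. A \<in> sets borel}"
    then have "\<forall>j\<in>J. \<exists>A. A \<in> sets borel \<and> E j = X j -` A \<inter> space M" by auto
    then obtain A where A: "\<And>j. j \<in> J \<Longrightarrow> A j \<in> sets borel \<and> E j = X j -` A j \<inter> space M" by metis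
    have "(\<Inter>j\<in>J. E j) = {\<omega>\<in>space M. \<forall>j\<in>J. X j \<omega> \<in> A j}" using A J by auto
    then have "prob (\<Inter>j\<in>J. E j) = (\<Prod>j\<in>J. measure gauss (A j))" using p[OF J(2), of A] A by simp
    also have "\<dots> = (\<Prod>j\<in>J. prob (E j))" using A p1 by (intro prod.cong) auto
    finally show "prob (\<Inter>j\<in>J. E j) = (\<Prod>j\<in>J. prob (E j))" .
  qed auto
  then show "iid_gauss X" using d by (simp add: iid_gauss_def)
qed

lemma iid_gauss_pair_prob:
  assumes X: "iid_gauss X" and ab: "a \<noteq> b" and C: "C \<in> sets (borel \<Otimes>\<^sub>M borel)"
  shows "prob {\<omega>\<in>space M. (X a \<omega>, X b \<omega>) \<in> C} = measure (gauss \<Otimes>\<^sub>M gauss) C"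
proof -
  have m[measurable]: "X i \<in> borel_measurable M" for i by (rule iid_gauss_measurable[OF X])
  have iv: "indep_vars (\<lambda>_. borel) X UNIV" using X by (simp add: iid_gauss_def)
  have "indep_var (PiM {a} (\<lambda>_. borel)) (\<lambda>\<omega>. restrict (\<lambda>i. X i \<omega>) {a}) (PiM {b} (\<lambda>_. borel)) (\<lambda>\<omega>. restrict (\<lambda>i. X i \<omega>) {b})"
    using ab by (intro indep_var_restrict[OF iv]) auto
  then have "indep_var borel ((\<lambda>f. f a) \<circ> (\<lambda>\<omega>. restrict (\<lambda>i. X i \<omega>) {a})) borel ((\<lambda>f. f b) \<circ> (\<lambda>\<omega>. restrict (\<lambda>i. X i \<omega>) {b}))"
    by (rule indep_var_compose) auto
  then have "indep_var borel (X a) borel (X b)" by (simp add: o_def)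
  then have "distr M borel (X a) \<Otimes>\<^sub>M distr M borel (X b) = distr M (borel \<Otimes>\<^sub>M borel) (\<lambda>x. (X a x, X b x))"
    by (simp add: indep_var_distribution_eq)
  then have "measure (gauss \<Otimes>\<^sub>M gauss) C = measure (distr M (borel \<Otimes>\<^sub>M borel) (\<lambda>x. (X a x, X b x))) C"
    using X by (simp add: iid_gauss_def)
  also have "\<dots> = prob {\<omega>\<in>space M. (X a \<omega>, X b \<omega>) \<in> C}"
    using C by (subst measure_distr) (auto simp: vimage_def Int_def conj_commute)
  finally show ?thesis by simp
qed

text \<open>Each pair \<open>X l\<close>, \<open>X (\<sigma> l)\<close> is replaced by its
  orthogonal image, again a pair of independent standard normals. The pairs are disjoint blocks, so
  independence across blocks survives. This is one refinement step of Levy's construction for all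
  intervals at once.\<close>

lemma iid_gauss_rotate:
  assumes X: "iid_gauss X" and inj: "inj_on \<sigma> L" and disj: "\<sigma> ` L \<inter> L = {}"
    and L1: "\<And>l \<omega>. l \<in> L \<Longrightarrow> X' l \<omega> = (X l \<omega> + X (\<sigma> l) \<omega>) / sqrt 2"
    and L2: "\<And>l \<omega>. l \<in> L \<Longrightarrow> X' (\<sigma> l) \<omega> = (X l \<omega> - X (\<sigma> l) \<omega>) / sqrt 2"
    and L3: "\<And>i \<omega>. i \<notin> L \<Longrightarrow> i \<notin> \<sigma> ` L \<Longrightarrow> X' i \<omega> = X i \<omega>"
  shows "iid_gauss X'"
proof -
  have m[measurable]: "X i \<in> borel_measurable M" for i by (rule iid_gauss_measurable[OF X])
  have m'[measurable]: "X' i \<in> borel_measurable M" for i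
  proof -
    consider "i \<in> L" | l where "l \<in> L" "i = \<sigma> l" | "i \<notin> L" "i \<notin> \<sigma> ` L" by blast
    then show ?thesis
    proof cases
      case 1 then show ?thesis by (simp add: L1 cong: measurable_cong)
    next
      case 2 then show ?thesis by (simp add: L2 cong: measurable_cong)
    next
      case 3 then show ?thesis by (simp add: L3 cong: measurable_cong)
    qed
  qed
  \<comment> \<open>Representatives of the blocks: the first members of pairs, and the indices that
    are left alone.\<close>
  define G where "G = - (\<sigma> ` L)"
  define K where "K g = (if g \<in> L then {g, \<sigma> g} else {g})" for g
  \<comment> \<open>All blocks have to map into one type, so singletons are padded with a second
    component 0.\<close>
  define h where "h g f = (if g \<in> L then ((f g + f (\<sigma> g)) / sqrt 2, (f g - f (\<sigma> g)) / sqrt 2) else (f g, 0 :: real))"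
    for g and f :: "'b \<Rightarrow> real"
  have LG: "L \<subseteq> G" using disj by (auto simp: G_def)
  have iv: "indep_vars (\<lambda>_. borel) X UNIV" using X by (simp add: iid_gauss_def)
  have dK: "disjoint_family_on K G"
    using inj disj by (auto simp: disjoint_family_on_def K_def G_def inj_on_def split: if_splits)
  have "indep_vars (\<lambda>g. PiM (K g) (\<lambda>_. borel)) (\<lambda>g \<omega>. restrict (\<lambda>i. X i \<omega>) (K g)) G"
    by (rule indep_vars_restrict[OF iv _ dK]) auto
  then have "indep_vars (\<lambda>_. borel \<Otimes>\<^sub>M borel) (\<lambda>g \<omega>. h g (restrict (\<lambda>i. X i \<omega>) (K g))) G"
  proof (rule indep_vars_compose2)
    fix g
    have [measurable]: "(\<lambda>f. f g) \<in> borel_measurable (PiM (K g) (\<lambda>_. borel :: real measure))"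
      by (rule measurable_component_singleton) (auto simp: K_def)
    have [measurable]: "(\<lambda>f. f (\<sigma> g)) \<in> borel_measurable (PiM (K g) (\<lambda>_. borel :: real measure))" if "g \<in> L"
      by (rule measurable_component_singleton) (use that in \<open>auto simp: K_def\<close>)
    show "h g \<in> PiM (K g) (\<lambda>_. borel) \<rightarrow>\<^sub>M borel \<Otimes>\<^sub>M borel"
      unfolding h_def by (cases "g \<in> L") (simp_all, measurable)
  qed
  moreover have "h g (restrict (\<lambda>i. X i \<omega>) (K g)) = (if g \<in> L then (X' g \<omega>, X' (\<sigma> g) \<omega>) else (X' g \<omega>, 0))"
    if "g \<in> G" for g \<omega>
    using that L1 L2 L3 by (auto simp: h_def K_def G_def)
  ultimately have iY: "indep_vars (\<lambda>_. borel \<Otimes>\<^sub>M borel)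
      (\<lambda>g \<omega>. if g \<in> L then (X' g \<omega>, X' (\<sigma> g) \<omega>) else (X' g \<omega>, 0)) G"
    by (subst (asm) indep_vars_cong[OF refl _ refl]) (auto simp: fun_eq_iff)
  show ?thesis
    unfolding iid_gauss_iff
  proof (intro conjI allI impI m')
    fix J :: "'b set" and A :: "'b \<Rightarrow> real set" assume J: "finite J" and A: "\<forall>j\<in>J. A j \<in> sets borel"
    \<comment> \<open>With \<open>UNIV\<close> outside \<open>J\<close> a pair can be completed even
      if only one of its members lies in \<open>J\<close>.\<close>
    define A' where "A' j = (if j \<in> J then A j else UNIV)" for j
    have A'[measurable]: "A' j \<in> sets borel" for j using A by (auto simp: A'_def)
    \<comment> \<open>The representatives of the blocks that meet \<open>J\<close>.\<close>
    define J0 where "J0 = (J \<inter> G) \<union> {l\<in>L. \<sigma> l \<in> J}"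
    have "finite {l\<in>L. \<sigma> l \<in> J}"
      by (rule inj_on_finite[of \<sigma> _ J]) (use J inj in \<open>auto simp: inj_on_def\<close>)
    then have J0: "finite J0" "J0 \<subseteq> G" using J LG by (auto simp: J0_def)
    define C where "C g = (if g \<in> L then A' g \<times> A' (\<sigma> g) else A' g \<times> UNIV)" for g
    have C: "C g \<in> sets (borel \<Otimes>\<^sub>M borel)" for g unfolding C_def by auto
    define Y where "Y g \<omega> = (if g \<in> L then (X' g \<omega>, X' (\<sigma> g) \<omega>) else (X' g \<omega>, 0))" for g \<omega>
    have PY: "prob (Y g -` C g \<inter> space M)
        = (if g \<in> L then measure gauss (A' g) * measure gauss (A' (\<sigma> g)) else measure gauss (A' g))" if "g \<in> G" for g
    proof (cases "g \<in> L")
      case True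
      then have ne: "g \<noteq> \<sigma> g" using disj by auto
      let ?C = "{(x, y). (x + y) / sqrt 2 \<in> A' g \<and> (x - y) / sqrt 2 \<in> A' (\<sigma> g)}"
      have sp: "space (borel \<Otimes>\<^sub>M borel :: (real \<times> real) measure) = UNIV" by (simp add: space_pair_measure)
      have "{z \<in> space (borel \<Otimes>\<^sub>M borel). (fst z + snd z) / sqrt 2 \<in> A' g \<and> (fst z - snd z) / sqrt 2 \<in> A' (\<sigma> g)} \<in> sets (borel \<Otimes>\<^sub>M borel)"
        by measurable
      also have "{z \<in> space (borel \<Otimes>\<^sub>M borel). (fst z + snd z) / sqrt 2 \<in> A' g \<and> (fst z - snd z) / sqrt 2 \<in> A' (\<sigma> g)} = ?C"
        by (auto simp: sp)
      finally have mC: "?C \<in> sets (borel \<Otimes>\<^sub>M borel)" .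
      have "Y g -` C g \<inter> space M = {\<omega>\<in>space M. (X g \<omega>, X (\<sigma> g) \<omega>) \<in> ?C}"
        using True by (auto simp: Y_def C_def L1 L2)
      then have "prob (Y g -` C g \<inter> space M) = measure (gauss \<Otimes>\<^sub>M gauss) ?C"
        using iid_gauss_pair_prob[OF X ne mC] by simp
      also have "\<dots> = measure gauss (A' g) * measure gauss (A' (\<sigma> g))"
        unfolding measure_def gauss_rotation_prob[OF A' A'] by (simp add: enn2real_mult)
      finally show ?thesis using True by simp
    next
      case False
      have "Y g -` C g \<inter> space M = {\<omega>\<in>space M. X g \<omega> \<in> A' g}"
        using False that L3[of g] by (auto simp: Y_def C_def G_def)
      then show ?thesis using False iid_gauss_prob[OF X A'] by simp
    qed
    have "{\<omega>\<in>space M. \<forall>j\<in>J. X' j \<omega> \<in> A j} = {\<omega>\<in>space M. \<forall>g\<in>J0. Y g \<omega> \<in> C g}"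
    proof (intro Collect_cong conj_cong refl)
      fix \<omega>
      show "(\<forall>j\<in>J. X' j \<omega> \<in> A j) = (\<forall>g\<in>J0. Y g \<omega> \<in> C g)"
      proof
        assume "\<forall>j\<in>J. X' j \<omega> \<in> A j"
        then have "X' j \<omega> \<in> A' j" for j by (auto simp: A'_def)
        then show "\<forall>g\<in>J0. Y g \<omega> \<in> C g" by (auto simp: Y_def C_def)
      next
        assume *: "\<forall>g\<in>J0. Y g \<omega> \<in> C g"
        show "\<forall>j\<in>J. X' j \<omega> \<in> A j"
        proof
          fix j assume j: "j \<in> J"
          show "X' j \<omega> \<in> A j"
          proof (cases "j \<in> G")
            case True
            then have "j \<in> J0" using j by (auto simp: J0_def)
            with * have "Y j \<omega> \<in> C j" by blast
            then show ?thesis using j by (auto simp: Y_def C_def A'_def split: if_splits)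
          next
            case False
            then obtain l where l: "l \<in> L" "j = \<sigma> l" by (auto simp: G_def)
            then have "l \<in> J0" using j by (auto simp: J0_def)
            with * have "Y l \<omega> \<in> C l" by blast
            then show ?thesis using j l by (auto simp: Y_def C_def A'_def split: if_splits)
          qed
        qed
      qed
    qed
    then have "prob {\<omega>\<in>space M. \<forall>j\<in>J. X' j \<omega> \<in> A j} = prob {\<omega>\<in>space M. \<forall>g\<in>J0. Y g \<omega> \<in> C g}" by simp
    also have "\<dots> = (\<Prod>g\<in>J0. prob (Y g -` C g \<inter> space M))"
    proof (cases "J0 = {}")
      case False
      have "prob (\<Inter>g\<in>J0. Y g -` C g \<inter> space M) = (\<Prod>g\<in>J0. prob (Y g -` C g \<inter> space M))"
        using iY C J0 False by (intro indep_varsD[of _ _ G]) (auto simp: Y_def[abs_def])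
      moreover have "(\<Inter>g\<in>J0. Y g -` C g \<inter> space M) = {\<omega>\<in>space M. \<forall>g\<in>J0. Y g \<omega> \<in> C g}" using False by auto
      ultimately show ?thesis by simp
    qed (simp add: prob_space)
    also have "\<dots> = (\<Prod>g\<in>J0. measure gauss (A' g) * (if g \<in> L then measure gauss (A' (\<sigma> g)) else 1))"
      using PY J0(2) by (intro prod.cong) auto
    also have "\<dots> = (\<Prod>g\<in>J0. measure gauss (A' g)) * (\<Prod>g\<in>J0 \<inter> L. measure gauss (A' (\<sigma> g)))"
      using J0(1) by (simp add: prod.distrib prod.inter_restrict)
    also have "(\<Prod>g\<in>J0 \<inter> L. measure gauss (A' (\<sigma> g))) = (\<Prod>j\<in>\<sigma> ` (J0 \<inter> L). measure gauss (A' j))"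
      by (subst prod.reindex) (use inj in \<open>auto simp: inj_on_def\<close>)
    also have "(\<Prod>g\<in>J0. measure gauss (A' g)) * (\<Prod>j\<in>\<sigma> ` (J0 \<inter> L). measure gauss (A' j))
        = (\<Prod>j\<in>J0 \<union> \<sigma> ` (J0 \<inter> L). measure gauss (A' j))"
      using J0 by (subst prod.union_disjoint) (auto simp: G_def)
    also have "\<dots> = (\<Prod>j\<in>J. measure gauss (A' j))"
    proof (rule prod.mono_neutral_right)
      show "finite (J0 \<union> \<sigma> ` (J0 \<inter> L))" using J0 by auto
      show "J \<subseteq> J0 \<union> \<sigma> ` (J0 \<inter> L)" by (auto simp: J0_def G_def)
      show "\<forall>i\<in>J0 \<union> \<sigma> ` (J0 \<inter> L) - J. measure gauss (A' i) = 1"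
        using gauss.prob_space by (auto simp: A'_def)
    qed
    also have "\<dots> = (\<Prod>j\<in>J. measure gauss (A j))" by (intro prod.cong) (auto simp: A'_def)
    finally show "prob {\<omega>\<in>space M. \<forall>j\<in>J. X' j \<omega> \<in> A j} = (\<Prod>j\<in>J. measure gauss (A j))" .
  qed
qed

end

section \<open>Dyadic paths\<close>

lemma floor_dyadic_double:
  assumes "0 \<le> (t::real)"
  shows "nat \<lfloor>t * 2 ^ Suc n\<rfloor> = 2 * nat \<lfloor>t * 2 ^ n\<rfloor> \<or> nat \<lfloor>t * 2 ^ Suc n\<rfloor> = 2 * nat \<lfloor>t * 2 ^ n\<rfloor> + 1"
proof -
  define x where "x = t * 2 ^ n"
  have x: "0 \<le> x" "t * 2 ^ Suc n = 2 * x" using assms by (auto simp: x_def)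
  have "\<lfloor>2 * x\<rfloor> = 2 * \<lfloor>x\<rfloor> \<or> \<lfloor>2 * x\<rfloor> = 2 * \<lfloor>x\<rfloor> + 1" by linarith
  moreover have "0 \<le> \<lfloor>x\<rfloor>" using x by simp
  ultimately show ?thesis unfolding x(2) x_def[symmetric] by (auto simp: nat_mult_distrib nat_add_distrib)
qed

text \<open>\<open>w n k\<close> is the value at \<open>k / 2 ^ n\<close>, and \<open>cons\<close>
  says that refinement keeps old values. Since increments of level \<open>n\<close> are at most
  \<open>r ^ n\<close>, the approximations converge geometrically, and the limit inherits a modulus
  of continuity on the dyadic scale.\<close>

lemma dyadic_limit:
  fixes w :: "nat \<Rightarrow> nat \<Rightarrow> real" and r :: real and J :: nat
  assumes r: "0 < r" "r < 1"
    and cons: "\<And>n k. w (Suc n) (2 * k) = w n k"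
    and inc: "\<And>n k. n0 \<le> n \<Longrightarrow> k < J * 2 ^ n \<Longrightarrow> \<bar>w n (Suc k) - w n k\<bar> \<le> r ^ n"
  shows "continuous_on {0..<real J} (\<lambda>t. lim (\<lambda>n. w n (nat \<lfloor>t * 2 ^ n\<rfloor>)))"
proof -
  define f where "f n t = w n (nat \<lfloor>t * 2 ^ n\<rfloor>)" for n and t :: real
  define W where "W t = lim (\<lambda>n. f n t)" for t
  define C where "C = 1 / (1 - r)"
  have C: "0 < C" using r by (simp add: C_def)
  have lt: "nat \<lfloor>t * 2 ^ n\<rfloor> < J * 2 ^ n" if "t \<in> {0..<real J}" for t n
  proof -
    have "t * 2 ^ n < real J * 2 ^ n" using that by simp
    then have "\<lfloor>t * 2 ^ n\<rfloor> < int (J * 2 ^ n)" by (simp add: floor_less_iff)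
    then show ?thesis using that by (simp add: nat_less_iff)
  qed
  \<comment> \<open>Rounding at the finer level gives the same point or its right neighbour, so a
    single fine increment is the whole change.\<close>
  have step: "\<bar>f (Suc n) t - f n t\<bar> \<le> r ^ Suc n" if t: "t \<in> {0..<real J}" and n: "n0 \<le> n" for t n
  proof -
    define k where "k = nat \<lfloor>t * 2 ^ n\<rfloor>"
    have k: "k < J * 2 ^ n" using lt[OF t] by (simp add: k_def)
    have "nat \<lfloor>t * 2 ^ Suc n\<rfloor> = 2 * k \<or> nat \<lfloor>t * 2 ^ Suc n\<rfloor> = Suc (2 * k)"
      using floor_dyadic_double[of t n] t by (simp add: k_def)
    then show ?thesis
    proof
      assume "nat \<lfloor>t * 2 ^ Suc n\<rfloor> = 2 * k"
      then show ?thesis using cons[of n k] r by (simp add: f_def k_def)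
    next
      assume *: "nat \<lfloor>t * 2 ^ Suc n\<rfloor> = Suc (2 * k)"
      have "\<bar>w (Suc n) (Suc (2 * k)) - w (Suc n) (2 * k)\<bar> \<le> r ^ Suc n"
        using n k by (intro inc) auto
      then show ?thesis using * cons[of n k] by (simp add: f_def k_def)
    qed
  qed
  have multi: "\<bar>f (n + p) t - f n t\<bar> \<le> C * r ^ n" if t: "t \<in> {0..<real J}" and n: "n0 \<le> n" for t n p
  proof -
    have "\<bar>f (n + p) t - f n t\<bar> \<le> (\<Sum>i<p. r ^ n * r ^ i)"
    proof (induction p)
      case (Suc p)
      have "r ^ (n + Suc p) \<le> r ^ (n + p)" using r by (intro power_decreasing) auto
      then have "\<bar>f (n + Suc p) t - f (n + p) t\<bar> \<le> r ^ n * r ^ p"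
        using step[OF t, of "n + p"] n by (simp add: power_add)
      with Suc show ?case by simp
    qed simp
    also have "\<dots> = r ^ n * (\<Sum>i<p. r ^ i)" by (simp add: sum_distrib_left)
    also have "\<dots> \<le> r ^ n * C"
    proof (rule mult_left_mono)
      have "(\<Sum>i<p. r ^ i) = (1 - r ^ p) / (1 - r)" using r by (simp add: sum_gp_strict)
      also have "\<dots> \<le> C" unfolding C_def using r by (intro divide_right_mono) auto
      finally show "(\<Sum>i<p. r ^ i) \<le> C" .
    qed (use r in simp)
    finally show ?thesis by (simp add: mult.commute)
  qed
  have r0: "(\<lambda>n. c * r ^ n) \<longlonglongrightarrow> 0" for c
    using tendsto_mult_right_zero[OF LIMSEQ_power_zero[of r]] r by simp
  have conv: "(\<lambda>n. f n t) \<longlonglongrightarrow> W t" if t: "t \<in> {0..<real J}" for t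
  proof -
    have "Cauchy (\<lambda>n. f n t)"
    proof (rule CauchyI')
      fix e :: real assume "0 < e"
      then have "\<forall>\<^sub>F n in sequentially. C * r ^ n < e" using order_tendstoD(2)[OF r0[of C]] by simp
      then have "\<forall>\<^sub>F n in sequentially. C * r ^ n < e \<and> n0 \<le> n"
        using eventually_ge_at_top[of n0] by eventually_elim simp
      then obtain N where N: "C * r ^ N < e" "n0 \<le> N" by (auto simp: eventually_sequentially)
      then have "\<forall>\<^sub>F n in sequentially. C * r ^ n < e \<and> n0 \<le> n" using \<open>\<forall>\<^sub>F n in sequentially. C * r ^ n < e \<and> n0 \<le> n\<close> by simp
      then obtain N where N: "\<And>n. N \<le> n \<Longrightarrow> C * r ^ n < e \<and> n0 \<le> n" by (auto simp: eventually_sequentially)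
      show "\<exists>M. \<forall>m\<ge>M. \<forall>n>m. dist (f m t) (f n t) < e"
      proof (intro exI allI impI)
        fix m n assume "N \<le> m" "m < n"
        then show "dist (f m t) (f n t) < e"
          using multi[OF t, of m "n - m"] N[of m] by (simp add: dist_real_def abs_minus_commute)
      qed
    qed
    then show ?thesis unfolding W_def by (simp add: Cauchy_convergent_iff convergent_LIMSEQ_iff)
  qed
  have Wf: "\<bar>W t - f n t\<bar> \<le> C * r ^ n" if t: "t \<in> {0..<real J}" and n: "n0 \<le> n" for t n
  proof (rule LIMSEQ_le_const2)
    show "(\<lambda>p. \<bar>f (p + n) t - f n t\<bar>) \<longlonglongrightarrow> \<bar>W t - f n t\<bar>"
      using conv[OF t] by (intro tendsto_intros LIMSEQ_ignore_initial_segment)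
    show "\<exists>N. \<forall>p\<ge>N. \<bar>f (p + n) t - f n t\<bar> \<le> C * r ^ n" using multi[OF t n] by (auto simp: add.commute)
  qed
  \<comment> \<open>Points closer than \<open>1 / 2 ^ n\<close> round to the same or to adjacent
    grid points.\<close>
  have ff: "\<bar>f n t - f n s\<bar> \<le> r ^ n"
    if s: "s \<in> {0..<real J}" and t: "t \<in> {0..<real J}" and st: "s \<le> t" "t - s < 1 / 2 ^ n" and n: "n0 \<le> n" for s t n
  proof -
    have "t * 2 ^ n < s * 2 ^ n + 1" using st(2) by (simp add: field_simps)
    moreover have "s * 2 ^ n \<le> t * 2 ^ n" using st(1) by simp
    ultimately have "\<lfloor>t * 2 ^ n\<rfloor> = \<lfloor>s * 2 ^ n\<rfloor> \<or> \<lfloor>t * 2 ^ n\<rfloor> = \<lfloor>s * 2 ^ n\<rfloor> + 1" by linarith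
    moreover have "0 \<le> \<lfloor>s * 2 ^ n\<rfloor>" using s by simp
    ultimately have "nat \<lfloor>t * 2 ^ n\<rfloor> = nat \<lfloor>s * 2 ^ n\<rfloor> \<or> nat \<lfloor>t * 2 ^ n\<rfloor> = Suc (nat \<lfloor>s * 2 ^ n\<rfloor>)"
      by (auto simp: nat_add_distrib)
    then show ?thesis using inc[OF n lt[OF s, of n]] r by (auto simp: f_def)
  qed
  have WW: "\<bar>W t - W s\<bar> \<le> (2 * C + 1) * r ^ n"
    if s: "s \<in> {0..<real J}" and t: "t \<in> {0..<real J}" and st: "\<bar>t - s\<bar> < 1 / 2 ^ n" and n: "n0 \<le> n" for s t n
  proof -
    have "\<bar>f n t - f n s\<bar> \<le> r ^ n"
      using ff[OF s t _ _ n] ff[OF t s _ _ n] st by (cases "s \<le> t") (auto simp: abs_minus_commute)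
    then show ?thesis using Wf[OF s n] Wf[OF t n] by (simp add: distrib_right)
  qed
  have "continuous_on {0..<real J} W"
    unfolding continuous_on_iff
  proof (intro ballI allI impI)
    fix s e :: real assume s: "s \<in> {0..<real J}" and e: "0 < e"
    have "\<forall>\<^sub>F n in sequentially. (2 * C + 1) * r ^ n < e" using order_tendstoD(2)[OF r0 e] .
    then have "\<forall>\<^sub>F n in sequentially. (2 * C + 1) * r ^ n < e \<and> n0 \<le> n"
      using eventually_ge_at_top[of n0] by eventually_elim simp
    then obtain n where n: "(2 * C + 1) * r ^ n < e" "n0 \<le> n" by (auto simp: eventually_sequentially)
    show "\<exists>d>0. \<forall>t\<in>{0..<real J}. dist t s < d \<longrightarrow> dist (W t) (W s) < e"
    proof (intro exI[of _ "1 / 2 ^ n"] conjI ballI impI)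
      fix t assume t: "t \<in> {0..<real J}" "dist t s < 1 / 2 ^ n"
      then show "dist (W t) (W s) < e"
        using WW[OF s t(1) _ n(2)] n(1) by (auto simp: dist_real_def)
    qed simp
  qed
  then show ?thesis by (simp add: W_def[abs_def] f_def)
qed

text \<open>Markov's inequality for the fourth moment, which is 3. The second moment would be too
  weak, because the bound has to stay summable after a union over a multiple of \<open>2 ^ n\<close>
  intervals at level \<open>n\<close>.\<close>

lemma gauss_tail_bound:
  assumes "0 < c" shows "measure gauss {x. c < \<bar>x\<bar>} \<le> 3 / c ^ 4"
proof -
  have i: "integrable gauss (\<lambda>x. x ^ (2 * 2))" and m: "(\<integral>x. x ^ (2 * 2) \<partial>gauss) = fact (2 * 2) / (2 ^ 2 * fact 2)"
    by (rule std_normal_distribution_even_moments)+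
  have "measure gauss {x \<in> space gauss. c ^ 4 \<le> x ^ 4} \<le> (\<integral>x. x ^ 4 \<partial>gauss) / c ^ 4"
    using i assms by (intro integral_Markov_inequality_measure[where A="{}"]) auto
  also have "(\<integral>x. x ^ 4 \<partial>gauss) = 3" using m by (simp add: fact_numeral)
  finally have "measure gauss {x. c ^ 4 \<le> x ^ 4} \<le> 3 / c ^ 4" by simp
  moreover have "measure gauss {x. c < \<bar>x\<bar>} \<le> measure gauss {x. c ^ 4 \<le> x ^ 4}"
  proof (rule gauss.finite_measure_mono)
    have "c ^ 4 \<le> x ^ 4" if "c < \<bar>x\<bar>" for x
      using power_mono[of c "\<bar>x\<bar>" 4] that assms by simp
    then show "{x. c < \<bar>x\<bar>} \<subseteq> {x. c ^ 4 \<le> x ^ 4}" by auto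
    have "{x \<in> space borel. c ^ 4 \<le> (x::real) ^ 4} \<in> sets borel" by measurable
    then show "{x. c ^ 4 \<le> x ^ 4} \<in> gauss.events" by simp
  qed
  ultimately show ?thesis by simp
qed

text \<open>Real indices give every dyadic point its own variable. The natural numbers carry the
  unit increments of the Brownian motion, the other nonnegative dyadic points the corrections at
  midpoints. Completeness of \<open>P\<close> serves the usual hypotheses and the changes on null
  sets.\<close>

locale gaussian_noise = prob_space P for P :: "'a measure" +
  fixes \<xi> :: "real \<Rightarrow> 'a \<Rightarrow> real"
  assumes iid: "iid_gauss \<xi>" and complete: "complete_measure P"
begin

text \<open>At a point \<open>q\<close> of the level-\<open>n\<close> grid, \<open>Z n q\<close> is
  the increment over the next interval of length \<open>1 / 2 ^ n\<close>, rescaled to variance 1;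
  elsewhere it is noise kept in reserve. Refinement turns an increment and the reserve variable at
  the midpoint into the increments over the two halves.\<close>

fun Z :: "nat \<Rightarrow> real \<Rightarrow> 'a \<Rightarrow> real" where
  "Z 0 q \<omega> = \<xi> q \<omega>"
| "Z (Suc n) q \<omega> =
    (if q * 2 ^ n \<in> \<nat> then (Z n q \<omega> + Z n (q + 1 / 2 ^ Suc n) \<omega>) / sqrt 2
     else if (q - 1 / 2 ^ Suc n) * 2 ^ n \<in> \<nat> then (Z n (q - 1 / 2 ^ Suc n) \<omega> - Z n q \<omega>) / sqrt 2
     else Z n q \<omega>)"

lemma half_not_Nats:
  assumes "(q :: real) * 2 ^ n \<in> \<nat>" shows "(q + 1 / 2 ^ Suc n) * 2 ^ n \<notin> (\<nat> :: real set)"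
proof
  assume "(q + 1 / 2 ^ Suc n) * 2 ^ n \<in> \<nat>"
  moreover have "(q + 1 / 2 ^ Suc n) * 2 ^ n = q * 2 ^ n + 1 / 2" by (simp add: distrib_right)
  ultimately obtain i j :: nat where "real i = real j + 1 / 2"
    using assms by (metis Nats_cases)
  then have "2 * real i = 2 * real j + 1" by simp
  then have "2 * i = 2 * j + 1" by linarith
  then show False by presburger
qed

lemma iid_Z: "iid_gauss (Z n)"
proof (induction n)
  case 0
  have "Z 0 = \<xi>" by (auto simp: fun_eq_iff)
  then show ?case using iid by simp
next
  case (Suc n)
  show ?case
  proof (rule iid_gauss_rotate[OF Suc, where L="{q :: real. q * 2 ^ n \<in> \<nat>}" and \<sigma>="\<lambda>q. q + 1 / 2 ^ Suc n"])
    show "(\<lambda>q::real. q + 1 / 2 ^ Suc n) ` {q. q * 2 ^ n \<in> \<nat>} \<inter> {q. q * 2 ^ n \<in> \<nat>} = {}"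
      using half_not_Nats by auto
    fix q :: real and \<omega>
    assume q: "q \<notin> {q. q * 2 ^ n \<in> \<nat>}" "q \<notin> (\<lambda>q. q + 1 / 2 ^ Suc n) ` {q. q * 2 ^ n \<in> \<nat>}"
    have "(q - 1 / 2 ^ Suc n) * 2 ^ n \<notin> \<nat>"
    proof
      assume "(q - 1 / 2 ^ Suc n) * 2 ^ n \<in> \<nat>"
      then have "q \<in> (\<lambda>q. q + 1 / 2 ^ Suc n) ` {q. q * 2 ^ n \<in> \<nat>}"
        by (intro image_eqI[of _ _ "q - 1 / 2 ^ Suc n"]) auto
      with q(2) show False by simp
    qed
    then show "Z (Suc n) q \<omega> = Z n q \<omega>" using q(1) by simp
  qed (use half_not_Nats in \<open>auto simp: inj_on_def\<close>)
qed

lemma Z_measurable[measurable]: "Z n q \<in> borel_measurable P"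
  by (rule iid_gauss_measurable[OF iid_Z])

definition w :: "nat \<Rightarrow> nat \<Rightarrow> 'a \<Rightarrow> real" where
  "w n k \<omega> = (\<Sum>i<k. Z n (real i / 2 ^ n) \<omega>) / sqrt (2 ^ n)"

text \<open>The two half increments add up to \<open>sqrt 2\<close> times the old one, which is
  exactly the change of scale between the levels.\<close>

lemma w_Suc_double: "w (Suc n) (2 * k) \<omega> = w n k \<omega>"
proof -
  have "(\<Sum>i<2 * k. Z (Suc n) (real i / 2 ^ Suc n) \<omega>) = sqrt 2 * (\<Sum>i<k. Z n (real i / 2 ^ n) \<omega>)"
  proof (induction k)
    case (Suc k)
    have N: "real k / 2 ^ n * 2 ^ n \<in> \<nat>" by simp
    have e1: "real (2 * k) / 2 ^ Suc n = real k / 2 ^ n" by simp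
    have e2: "real (Suc (2 * k)) / 2 ^ Suc n = real k / 2 ^ n + 1 / 2 ^ Suc n" by (simp add: field_simps)
    have z1: "Z (Suc n) (real (2 * k) / 2 ^ Suc n) \<omega> = (Z n (real k / 2 ^ n) \<omega> + Z n (real k / 2 ^ n + 1 / 2 ^ Suc n) \<omega>) / sqrt 2"
      unfolding e1 using N by simp
    have z2: "Z (Suc n) (real (Suc (2 * k)) / 2 ^ Suc n) \<omega> = (Z n (real k / 2 ^ n) \<omega> - Z n (real k / 2 ^ n + 1 / 2 ^ Suc n) \<omega>) / sqrt 2"
      unfolding e2 using N half_not_Nats[OF N] by simp
    have "(\<Sum>i<2 * Suc k. Z (Suc n) (real i / 2 ^ Suc n) \<omega>) =
      (\<Sum>i<2 * k. Z (Suc n) (real i / 2 ^ Suc n) \<omega>) + Z (Suc n) (real (2 * k) / 2 ^ Suc n) \<omega> + Z (Suc n) (real (Suc (2 * k)) / 2 ^ Suc n) \<omega>"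
      by (simp del: Z.simps)
    also have "\<dots> = sqrt 2 * (\<Sum>i<k. Z n (real i / 2 ^ n) \<omega>) + 2 * Z n (real k / 2 ^ n) \<omega> / sqrt 2"
      unfolding Suc.IH z1 z2 by (simp add: add_divide_distrib diff_divide_distrib)
    also have "2 * Z n (real k / 2 ^ n) \<omega> / sqrt 2 = sqrt 2 * Z n (real k / 2 ^ n) \<omega>"
      using real_div_sqrt[of 2] by (simp add: field_simps)
    finally show ?case by (simp add: distrib_left)
  qed simp
  moreover have "sqrt (2 ^ Suc n) = sqrt 2 * sqrt (2 ^ n)" by (simp add: real_sqrt_mult)
  ultimately show ?thesis unfolding w_def by simp
qed

lemma w_shift: "w (n + p) (k * 2 ^ p) \<omega> = w n k \<omega>"
proof (induction p)
  case (Suc p)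
  have "w (n + Suc p) (k * 2 ^ Suc p) \<omega> = w (Suc (n + p)) (2 * (k * 2 ^ p)) \<omega>" by (simp add: ac_simps)
  then show ?case using Suc w_Suc_double by simp
qed simp

text \<open>Convergence at all times holds only almost surely, but at dyadic times the sequence is
  eventually constant on every path.\<close>

definition W :: "real \<Rightarrow> 'a \<Rightarrow> real" where
  "W t \<omega> = lim (\<lambda>n. w n (nat \<lfloor>t * 2 ^ n\<rfloor>) \<omega>)"

lemma W_dyadic: "W (real k / 2 ^ n) \<omega> = w n k \<omega>"
proof -
  have "w (p + n) (nat \<lfloor>real k / 2 ^ n * 2 ^ (p + n)\<rfloor>) \<omega> = w n k \<omega>" for p
  proof -
    have "real k / 2 ^ n * 2 ^ (p + n) = real (k * 2 ^ p)" by (simp add: power_add)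
    then have "nat \<lfloor>real k / 2 ^ n * 2 ^ (p + n)\<rfloor> = k * 2 ^ p" by (simp only: floor_of_nat nat_int)
    then show ?thesis using w_shift[of n p k \<omega>] by (simp add: add.commute)
  qed
  then have "(\<lambda>p. w (p + n) (nat \<lfloor>real k / 2 ^ n * 2 ^ (p + n)\<rfloor>) \<omega>) \<longlonglongrightarrow> w n k \<omega>" by simp
  then have "(\<lambda>p. w p (nat \<lfloor>real k / 2 ^ n * 2 ^ p\<rfloor>) \<omega>) \<longlonglongrightarrow> w n k \<omega>"
    by (rule LIMSEQ_offset)
  then show ?thesis unfolding W_def by (rule limI)
qed

text \<open>Values at integer times are never corrected, so the noise of a stage can be read off the
  Brownian path without exceptional paths.\<close>

lemma W_noise: "W (real j + 1) \<omega> - W (real j) \<omega> = \<xi> (real j) \<omega>"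
  using W_dyadic[of "Suc j" 0 \<omega>] W_dyadic[of j 0 \<omega>] by (simp add: w_def add.commute)

text \<open>Borel-Cantelli over the levels. The ratio must be below 1 while its fourth power exceeds
  1/2: then \<open>2 / (4 * (9 / 10) ^ 4) < 1\<close>, and the number of intervals times the tail
  bound is summable.\<close>

lemma increments_small:
  "AE \<omega> in P. \<exists>n0. \<forall>n\<ge>n0. \<forall>k<j * 2 ^ n. \<bar>w n (Suc k) \<omega> - w n k \<omega>\<bar> \<le> (9 / 10) ^ n"
proof -
  \<comment> \<open>The threshold for the normalized variables: an increment of level
    \<open>n\<close> is a \<open>Z\<close> divided by \<open>sqrt (2 ^ n)\<close>.\<close>
  define c :: "nat \<Rightarrow> real" where "c n = (9 / 10) ^ n * sqrt (2 ^ n)" for n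
  have c0: "0 < c n" for n by (simp add: c_def)
  have c4: "c n ^ 4 = (4 * (9 / 10) ^ 4) ^ n" for n
  proof -
    have "sqrt (2 ^ n) ^ 4 = ((2::real) ^ n)\<^sup>2"
      using power_mult[of "sqrt (2 ^ n)" 2 2] by simp
    then show ?thesis unfolding c_def
      by (simp add: power_mult_distrib power2_eq_square power_mult[symmetric] mult.commute[of n]) 
         (simp add: power_mult power_mult_distrib[symmetric])
  qed
  define E where "E n = (\<Union>k<j * 2 ^ n. {\<omega>\<in>space P. Z n (real k / 2 ^ n) \<omega> \<in> {x. c n < \<bar>x\<bar>}})" for n
  have tail: "{x. c n < \<bar>x\<bar>} \<in> sets borel" for n
  proof -
    have "{x \<in> space borel. c n < \<bar>x\<bar>} \<in> sets borel" by measurable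
    then show ?thesis by simp
  qed
  have E1: "{\<omega>\<in>space P. Z n q \<omega> \<in> {x. c n < \<bar>x\<bar>}} \<in> events" for n q by simp
  have E[measurable]: "E n \<in> events" for n unfolding E_def using E1 by (intro sets.finite_UN) auto
  have bound: "prob (E n) \<le> 3 * real j * (2 / (4 * (9 / 10) ^ 4)) ^ n" for n
  proof -
    have "prob (E n) \<le> (\<Sum>k<j * 2 ^ n. prob {\<omega>\<in>space P. Z n (real k / 2 ^ n) \<omega> \<in> {x. c n < \<bar>x\<bar>}})"
      unfolding E_def using E1 by (intro finite_measure_subadditive_finite) auto
    also have "\<dots> \<le> (\<Sum>k<j * 2 ^ n. 3 / c n ^ 4)"
      unfolding iid_gauss_prob[OF iid_Z tail] by (intro sum_mono gauss_tail_bound c0)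
    also have "\<dots> = 3 * real j * (2 / (4 * (9 / 10) ^ 4)) ^ n"
      unfolding c4 power_divide[of 2] by simp
    finally show ?thesis .
  qed
  have "summable (\<lambda>n. 3 * real j * (2 / (4 * (9 / 10) ^ 4)) ^ n)"
    by (intro summable_mult summable_geometric) (simp add: power4_eq_xxxx)
  then have "summable (\<lambda>n. prob (E n))"
  proof (rule summable_comparison_test'[where N=0])
    fix n show "norm (prob (E n)) \<le> 3 * real j * (2 / (4 * (9 / 10) ^ 4)) ^ n"
      unfolding real_norm_def abs_of_nonneg[OF measure_nonneg] by (rule bound)
  qed
  then have "AE \<omega> in P. \<forall>\<^sub>F n in sequentially. \<omega> \<in> space P - E n"
    by (intro borel_cantelli_AE1) (auto simp: emeasure_eq_measure)
  then show ?thesis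
  proof eventually_elim
    case (elim \<omega>)
    then obtain n0 where n0: "\<And>n. n0 \<le> n \<Longrightarrow> \<omega> \<in> space P - E n" by (auto simp: eventually_sequentially)
    show ?case
    proof (intro exI allI impI)
      fix n k assume nk: "n0 \<le> n" "k < j * 2 ^ n"
      then have "\<bar>Z n (real k / 2 ^ n) \<omega>\<bar> \<le> c n" using n0[OF nk(1)] by (auto simp: E_def not_less)
      then have "\<bar>Z n (real k / 2 ^ n) \<omega>\<bar> / sqrt (2 ^ n) \<le> c n / sqrt (2 ^ n)" by (intro divide_right_mono) auto
      moreover have "w n (Suc k) \<omega> - w n k \<omega> = Z n (real k / 2 ^ n) \<omega> / sqrt (2 ^ n)"
        by (simp add: w_def diff_divide_distrib[symmetric])
      ultimately show "\<bar>w n (Suc k) \<omega> - w n k \<omega>\<bar> \<le> (9 / 10) ^ n"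
        by (simp add: c_def abs_div)
    qed
  qed
qed

lemma W_continuous: "AE \<omega> in P. continuous_on {0..} (\<lambda>t. W t \<omega>)"
proof -
  have "AE \<omega> in P. \<forall>j. \<exists>n0. \<forall>n\<ge>n0. \<forall>k<j * 2 ^ n. \<bar>w n (Suc k) \<omega> - w n k \<omega>\<bar> \<le> (9 / 10) ^ n"
    using increments_small by (simp add: AE_all_countable)
  then show ?thesis
  proof eventually_elim
    case (elim \<omega>)
    have c: "continuous_on {0..<real j} (\<lambda>t. W t \<omega>)" for j :: nat
    proof -
      obtain n0 where "\<And>n k. n0 \<le> n \<Longrightarrow> k < j * 2 ^ n \<Longrightarrow> \<bar>w n (Suc k) \<omega> - w n k \<omega>\<bar> \<le> (9 / 10) ^ n"
        using elim by blast
      then show ?thesis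
        unfolding W_def
        by (intro dyadic_limit[of "9/10" "\<lambda>n k. w n k \<omega>" n0 j]) (auto simp: w_Suc_double)
    qed
    show ?case
      unfolding continuous_on_eq_continuous_within
    proof
      fix t :: real assume t: "t \<in> {0..}"
      obtain j :: nat where j: "t < real j" using reals_Archimedean2 by blast
      have "at t within {0..} = at t within {0..<real j}"
        by (rule at_within_nhd[where S="{..<real j}"]) (use j in auto)
      moreover have "continuous (at t within {0..<real j}) (\<lambda>t. W t \<omega>)"
        using c[of j] t j by (auto simp: continuous_on_eq_continuous_within)
      ultimately show "continuous (at t within {0..}) (\<lambda>t. W t \<omega>)" by simp
    qed
  qed
qed

end

section \<open>The filtration of the noise\<close>

context gaussian_noise begin

text \<open>Everything indexed before \<open>s\<close>, reserve noise included. This contains more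
  than the Brownian past, yet at a grid point \<open>s\<close> the later increments of level
  \<open>n\<close> are independent of it.\<close>

definition past :: "nat \<Rightarrow> real \<Rightarrow> 'a measure" where
  "past n s = vimage_algebra (space P) (\<lambda>\<omega>. restrict (\<lambda>q. Z n q \<omega>) {..<s}) (PiM {..<s} (\<lambda>_. borel))"

lemma space_past[simp]: "space (past n s) = space P"
  by (simp add: past_def)

lemma Z_past: "q < s \<Longrightarrow> Z n q \<in> borel_measurable (past n s)"
proof -
  assume q: "q < s"
  have "(\<lambda>\<omega>. restrict (\<lambda>q. Z n q \<omega>) {..<s}) \<in> past n s \<rightarrow>\<^sub>M PiM {..<s} (\<lambda>_. borel)"
    unfolding past_def by (rule measurable_vimage_algebra1) (auto simp: space_PiM)
  then have "(\<lambda>\<omega>. (restrict (\<lambda>q. Z n q \<omega>) {..<s}) q) \<in> borel_measurable (past n s)"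
    by (rule measurable_compose) (rule measurable_component_singleton, use q in simp)
  then show ?thesis using q by simp
qed

lemma past_minimal:
  assumes "space N = space P" "\<And>q. q < s \<Longrightarrow> Z n q \<in> borel_measurable N"
  shows "sets (past n s) \<subseteq> sets N"
  unfolding past_def using assms by (intro sets_image_in_sets measurable_restrict) auto

lemma past_subset: "sets (past n s) \<subseteq> sets P"
  by (intro past_minimal) auto

lemma past_mono: "s \<le> t \<Longrightarrow> sets (past n s) \<subseteq> sets (past n t)"
  by (intro past_minimal Z_past) auto

text \<open>At a grid point \<open>s\<close> refinement mixes only pairs that lie entirely before
  \<open>s\<close> or entirely after: if \<open>q < s\<close> are both on the grid, the midpoint
  following \<open>q\<close> also precedes \<open>s\<close>. At other times a pair could straddle
  \<open>s\<close>.\<close>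

lemma past_Suc:
  assumes s: "s * 2 ^ n \<in> \<nat>"
  shows "sets (past (Suc n) s) \<subseteq> sets (past n s)"
proof (rule past_minimal)
  fix q assume q: "q < s"
  have next_le: "q + 1 / 2 ^ Suc n < s" if q': "q * 2 ^ n \<in> \<nat>"
  proof -
    obtain i j :: nat where ij: "q * 2 ^ n = real i" "s * 2 ^ n = real j" using q' s by (metis Nats_cases)
    have "real i < real j" using q unfolding ij[symmetric] by simp
    then have "real (Suc i) \<le> real j" by (simp only: of_nat_less_iff of_nat_le_iff Suc_le_eq)
    then have "real i + 1 \<le> real j" by simp
    then have "(q + 1 / 2 ^ n) * 2 ^ n \<le> s * 2 ^ n" unfolding ij[symmetric] by (simp add: distrib_right)
    then have "q + 1 / 2 ^ n \<le> s" by simp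
    moreover have "1 / 2 ^ Suc n < (1 / 2 ^ n :: real)" by (simp add: field_simps)
    ultimately show ?thesis by linarith
  qed
  have [measurable]: "Z n q \<in> borel_measurable (past n s)" using q by (rule Z_past)
  consider "q * 2 ^ n \<in> \<nat>" | "q * 2 ^ n \<notin> \<nat>" "(q - 1 / 2 ^ Suc n) * 2 ^ n \<in> \<nat>"
    | "q * 2 ^ n \<notin> \<nat>" "(q - 1 / 2 ^ Suc n) * 2 ^ n \<notin> \<nat>" by blast
  then show "Z (Suc n) q \<in> borel_measurable (past n s)"
  proof cases
    case 1
    then have [measurable]: "Z n (q + 1 / 2 ^ Suc n) \<in> borel_measurable (past n s)" by (intro Z_past next_le)
    have "Z (Suc n) q = (\<lambda>\<omega>. (Z n q \<omega> + Z n (q + 1 / 2 ^ Suc n) \<omega>) / sqrt 2)"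
      using 1 by (auto simp: fun_eq_iff)
    then show ?thesis by (simp only:) measurable
  next
    case 2
    have "q - 1 / 2 ^ Suc n < s" using q by (rule order.strict_trans1[rotated]) simp
    then have [measurable]: "Z n (q - 1 / 2 ^ Suc n) \<in> borel_measurable (past n s)" by (rule Z_past)
    have "Z (Suc n) q = (\<lambda>\<omega>. (Z n (q - 1 / 2 ^ Suc n) \<omega> - Z n q \<omega>) / sqrt 2)"
      using 2 by (auto simp: fun_eq_iff)
    then show ?thesis by (simp only:) measurable
  next
    case 3
    have "Z (Suc n) q = Z n q" using 3 by (auto simp: fun_eq_iff)
    then show ?thesis by simp
  qed
qed simp

text \<open>The first grid point of level \<open>n\<close> strictly after \<open>t\<close>.
  Strictness makes \<open>tick n\<close> constant on a right neighbourhood of \<open>t\<close>,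
  which is the source of right continuity below.\<close>

definition tick :: "nat \<Rightarrow> real \<Rightarrow> real" where
  "tick n t = (real (nat \<lfloor>t * 2 ^ n\<rfloor>) + 1) / 2 ^ n"

lemma tick_dyadic: "tick n t * 2 ^ n \<in> \<nat>" "tick n t = real (Suc (nat \<lfloor>t * 2 ^ n\<rfloor>)) / 2 ^ n"
proof -
  have "tick n t * 2 ^ n = real (Suc (nat \<lfloor>t * 2 ^ n\<rfloor>))" by (simp add: tick_def)
  then show "tick n t * 2 ^ n \<in> \<nat>" by (metis of_nat_in_Nats)
  show "tick n t = real (Suc (nat \<lfloor>t * 2 ^ n\<rfloor>)) / 2 ^ n" by (simp add: tick_def add.commute)
qed

lemma tick_bounds:
  assumes "0 \<le> t" shows "t < tick n t" "tick n t \<le> t + 1 / 2 ^ n"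
proof -
  have r: "real (nat \<lfloor>t * 2 ^ n\<rfloor>) = of_int \<lfloor>t * 2 ^ n\<rfloor>" using assms by simp
  have "t * 2 ^ n < tick n t * 2 ^ n" unfolding tick_def r by simp
  then show "t < tick n t" by simp
  have "tick n t * 2 ^ n = of_int \<lfloor>t * 2 ^ n\<rfloor> + 1" unfolding tick_def r by simp
  also have "\<dots> \<le> (t + 1 / 2 ^ n) * 2 ^ n" by (simp add: distrib_right)
  finally have "tick n t * 2 ^ n \<le> (t + 1 / 2 ^ n) * 2 ^ n" .
  then show "tick n t \<le> t + 1 / 2 ^ n" by simp
qed

lemma tick_mono: "s \<le> t \<Longrightarrow> tick n s \<le> tick n t"
  unfolding tick_def by (intro divide_right_mono add_right_mono) (auto intro!: nat_mono floor_mono)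

lemma tick_Suc: assumes "0 \<le> t" shows "tick (Suc n) t \<le> tick n t"
proof -
  have "real (nat \<lfloor>t * 2 ^ Suc n\<rfloor>) \<le> 2 * real (nat \<lfloor>t * 2 ^ n\<rfloor>) + 1"
    using floor_dyadic_double[OF assms, of n] by auto
  then have "(real (nat \<lfloor>t * 2 ^ Suc n\<rfloor>) + 1) / 2 ^ Suc n \<le> (2 * real (nat \<lfloor>t * 2 ^ n\<rfloor>) + 2) / 2 ^ Suc n"
    by (intro divide_right_mono) auto
  also have "2 * real (nat \<lfloor>t * 2 ^ n\<rfloor>) + 2 = 2 * (real (nat \<lfloor>t * 2 ^ n\<rfloor>) + 1)" by simp
  finally show ?thesis unfolding tick_def by (simp only: power_Suc mult_divide_mult_cancel_left_if) simp
qed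

lemma tick_tendsto: assumes "0 \<le> t" shows "(\<lambda>n. tick n t) \<longlonglongrightarrow> t"
proof (rule tendsto_sandwich[of "\<lambda>_. t" _ _ "\<lambda>n. t + 1 / 2 ^ n"])
  have "(\<lambda>n. t + (1 / 2) ^ n) \<longlonglongrightarrow> t + 0" by (intro tendsto_intros LIMSEQ_power_zero) auto
  then show "(\<lambda>n. t + 1 / 2 ^ n) \<longlonglongrightarrow> t" by (simp add: power_one_over)
qed (use tick_bounds[OF assms] in \<open>auto intro!: always_eventually less_imp_le\<close>)

text \<open>Two effects point the same way: finer levels have earlier ticks, and at a fixed grid
  point refinement does not enlarge the past.\<close>

lemma past_tick_decreasing:
  assumes "0 \<le> t" "n \<le> n'"
  shows "sets (past n' (tick n' t)) \<subseteq> sets (past n (tick n t))"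
  using assms(2)
proof (induction n' rule: dec_induct)
  case (step k)
  have "sets (past (Suc k) (tick (Suc k) t)) \<subseteq> sets (past (Suc k) (tick k t))"
    by (rule past_mono[OF tick_Suc[OF assms(1)]])
  also have "\<dots> \<subseteq> sets (past k (tick k t))" by (rule past_Suc[OF tick_dyadic(1)])
  finally show ?case using step by blast
qed simp

text \<open>The intersection over \<open>n\<close> of the completed pasts just after
  \<open>t\<close>; completion is expressed by symmetric differences that are null.\<close>

definition F_sets :: "real \<Rightarrow> 'a set set" where
  "F_sets t = {A \<in> sets P. \<forall>n. \<exists>A'\<in>sets (past n (tick n t)). (A - A') \<union> (A' - A) \<in> null_sets P}"

definition F :: "real \<Rightarrow> 'a measure" where "F t = sigma (space P) (F_sets t)"

lemma sigma_algebra_F_sets: "sigma_algebra (space P) (F_sets t)"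
  unfolding sigma_algebra_iff2
proof (intro conjI ballI allI impI)
  show "F_sets t \<subseteq> Pow (space P)" unfolding F_sets_def using sets.sets_into_space by auto
  show "{} \<in> F_sets t" unfolding F_sets_def by (auto intro!: bexI[of _ "{}"])
next
  fix A assume A: "A \<in> F_sets t"
  show "space P - A \<in> F_sets t"
    unfolding F_sets_def
  proof (safe)
    show "space P - A \<in> events" using A by (auto simp: F_sets_def)
    fix n
    obtain A' where A': "A' \<in> sets (past n (tick n t))" "(A - A') \<union> (A' - A) \<in> null_sets P"
      using A by (auto simp: F_sets_def)
    have sub: "A \<subseteq> space P" "A' \<subseteq> space P"
      using A A'(1) sets.sets_into_space[of A' "past n (tick n t)"] sets.sets_into_space by (auto simp: F_sets_def)
    have "(space P - A - (space P - A')) \<union> ((space P - A') - (space P - A)) = (A - A') \<union> (A' - A)"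
      using sub by auto
    moreover have "space P - A' \<in> sets (past n (tick n t))" using A'(1) by (metis sets.compl_sets space_past)
    ultimately show "\<exists>A'\<in>sets (past n (tick n t)). (space P - A - A') \<union> (A' - (space P - A)) \<in> null_sets P"
      using A'(2) by (intro bexI[of _ "space P - A'"]) auto
  qed
next
  fix A :: "nat \<Rightarrow> 'a set" assume A: "range A \<subseteq> F_sets t"
  then have AP: "A i \<in> events" for i by (auto simp: F_sets_def)
  show "(\<Union>i. A i) \<in> F_sets t"
    unfolding F_sets_def
  proof safe
    show "(\<Union>i. A i) \<in> events" using AP by auto
    fix n
    have "\<forall>i. \<exists>A'. A' \<in> sets (past n (tick n t)) \<and> (A i - A') \<union> (A' - A i) \<in> null_sets P"
    proof
      fix i
      have "A i \<in> F_sets t" using A by blast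
      then show "\<exists>A'. A' \<in> sets (past n (tick n t)) \<and> (A i - A') \<union> (A' - A i) \<in> null_sets P"
        unfolding F_sets_def by blast
    qed
    then obtain A' where A': "\<And>i. A' i \<in> sets (past n (tick n t))" "\<And>i. (A i - A' i) \<union> (A' i - A i) \<in> null_sets P"
      by metis
    have A'P: "A' i \<in> events" for i using A'(1) past_subset by blast
    show "\<exists>A'\<in>sets (past n (tick n t)). ((\<Union>i. A i) - A') \<union> (A' - (\<Union>i. A i)) \<in> null_sets P"
    proof (rule bexI[of _ "\<Union>i. A' i"])
      have "(\<Union>i. (A i - A' i) \<union> (A' i - A i)) \<in> null_sets P" using A'(2) by (intro null_sets_UN) auto
      then show "((\<Union>i. A i) - (\<Union>i. A' i)) \<union> ((\<Union>i. A' i) - (\<Union>i. A i)) \<in> null_sets P"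
        by (rule null_sets_subset) (use AP A'P in auto)
      show "(\<Union>i. A' i) \<in> sets (past n (tick n t))" using A'(1) by auto
    qed
  qed
qed

lemma sets_F_eq: "sets (F t) = F_sets t"
  unfolding F_def by (rule sigma_algebra.sets_measure_of_eq[OF sigma_algebra_F_sets])

lemma space_F_eq: "space (F t) = space P"
  unfolding F_def by (rule space_measure_of_conv)

lemma F_mono: "s \<le> t \<Longrightarrow> sets (F s) \<subseteq> sets (F t)"
  unfolding sets_F_eq F_sets_def using past_mono[OF tick_mono[of s t]] by blast

lemma F_subalgebra: "subalgebra P (F t)"
  unfolding subalgebra_def sets_F_eq space_F_eq by (auto simp: F_sets_def)

lemma null_sets_F: "null_sets P \<subseteq> sets (F t)"
  unfolding sets_F_eq F_sets_def by (auto intro!: bexI[of _ "{}"] simp: null_sets_def)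

text \<open>For each \<open>n\<close> a slightly later time \<open>s\<close> has the same tick, so
  membership in \<open>F s\<close> already contains the condition of level \<open>n\<close> at
  \<open>t\<close>.\<close>

lemma F_right_continuous:
  assumes t: "0 \<le> t" "t < u"
  shows "sets (F t) = (\<Inter>s\<in>{t<..u}. sets (F s))"
proof (intro equalityI INT_greatest F_mono subsetI)
  fix A assume A: "A \<in> (\<Inter>s\<in>{t<..u}. sets (F s))"
  show "A \<in> sets (F t)"
    unfolding sets_F_eq F_sets_def
  proof safe
    have "A \<in> sets (F u)" using A t by auto
    then show "A \<in> events" by (auto simp: sets_F_eq F_sets_def)
    fix n
    define s where "s = min u ((t + tick n t) / 2)"
    have "(t + tick n t) / 2 < tick n t" "t < (t + tick n t) / 2"
      using tick_bounds(1)[OF t(1), of n] by simp_all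
    then have s: "t < s" "s \<le> u" "s < tick n t" using t(2) by (auto simp: s_def min_less_iff_disj)
    have tk: "tick n s = tick n t"
    proof -
      have r: "real (nat \<lfloor>t * 2 ^ n\<rfloor>) = of_int \<lfloor>t * 2 ^ n\<rfloor>" using t by simp
      have "s * 2 ^ n < tick n t * 2 ^ n" using s(3) by simp
      then have "s * 2 ^ n < of_int \<lfloor>t * 2 ^ n\<rfloor> + 1" unfolding tick_def r by simp
      moreover have "t * 2 ^ n \<le> s * 2 ^ n" using s(1) by simp
      ultimately have "\<lfloor>s * 2 ^ n\<rfloor> = \<lfloor>t * 2 ^ n\<rfloor>" by linarith
      then show ?thesis by (simp add: tick_def)
    qed
    have "A \<in> sets (F s)" using A s by auto
    then show "\<exists>A'\<in>sets (past n (tick n t)). (A - A') \<union> (A' - A) \<in> null_sets P"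
      unfolding sets_F_eq F_sets_def tk[symmetric] by auto
  qed
qed (use t in auto)

sublocale filtered_prob_space P "{0..}" F
  using F_subalgebra F_mono by unfold_locales auto

lemma measurable_F_if_past:
  fixes X :: "'a \<Rightarrow> real"
  assumes "\<And>n. X \<in> borel_measurable (past n (tick n t))"
  shows "X \<in> borel_measurable (F t)"
proof (rule measurableI)
  fix A :: "real set" assume A: "A \<in> sets borel"
  have 1: "X -` A \<inter> space P \<in> sets (past n (tick n t))" for n
    using measurable_sets[OF assms A, of n] by simp
  then have "X -` A \<inter> space P \<in> events" using past_subset by blast
  with 1 show "X -` A \<inter> space (F t) \<in> sets (F t)"
    unfolding space_F_eq sets_F_eq F_sets_def by (auto intro!: bexI[of _ "X -` A \<inter> space P"])
qed simp

text \<open>All null sets belong to \<open>F t\<close>, so adaptedness survives a change on a null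
  set. Processes can therefore be redefined on exceptional paths.\<close>

lemma measurable_F_AE:
  fixes X Y :: "'a \<Rightarrow> real"
  assumes X: "X \<in> borel_measurable (F t)" and Y: "Y \<in> borel_measurable P" and eq: "AE \<omega> in P. X \<omega> = Y \<omega>"
  shows "Y \<in> borel_measurable (F t)"
proof (rule measurableI)
  fix A :: "real set" assume A: "A \<in> sets borel"
  have XF: "X -` A \<inter> space P \<in> sets (F t)" using measurable_sets[OF X A] by (simp add: space_F_eq)
  have YP: "Y -` A \<inter> space P \<in> events" using measurable_sets[OF Y A] .
  have XP: "X -` A \<inter> space P \<in> events" using XF by (auto simp: sets_F_eq F_sets_def)
  obtain N where N: "N \<in> null_sets P" "{\<omega>\<in>space P. X \<omega> \<noteq> Y \<omega>} \<subseteq> N"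
    using eq by (auto simp: eventually_ae_filter)
  have n1: "(X -` A \<inter> space P) - (Y -` A \<inter> space P) \<in> null_sets P"
    by (rule null_sets_subset[OF N(1)]) (use XP YP N(2) in auto)
  have n2: "(Y -` A \<inter> space P) - (X -` A \<inter> space P) \<in> null_sets P"
    by (rule null_sets_subset[OF N(1)]) (use XP YP N(2) in auto)
  have "Y -` A \<inter> space P = ((X -` A \<inter> space P) - ((X -` A \<inter> space P) - (Y -` A \<inter> space P)))
      \<union> ((Y -` A \<inter> space P) - (X -` A \<inter> space P))" by auto
  also have "\<dots> \<in> sets (F t)" using XF n1 n2 null_sets_F by blast
  finally show "Y -` A \<inter> space (F t) \<in> sets (F t)" by (simp add: space_F_eq)
qed simp

text \<open>From level \<open>n\<close> on, the approximations at \<open>u\<close> use only indices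
  before \<open>u\<close>, hence before every tick of \<open>t\<close>, and the pasts at the ticks
  decrease. Dropping the first \<open>n\<close> terms does not affect the limit.\<close>

lemma W_measurable_F:
  assumes u: "0 \<le> u" "u \<le> t" shows "W u \<in> borel_measurable (F t)"
proof (rule measurable_F_if_past)
  fix n
  let ?f = "\<lambda>n'. w n' (nat \<lfloor>u * 2 ^ n'\<rfloor>)"
  have m: "?f n' \<in> borel_measurable (past n (tick n t))" if "n \<le> n'" for n'
  proof -
    have "Z n' (real i / 2 ^ n') \<in> borel_measurable (past n' (tick n' t))" if "i < nat \<lfloor>u * 2 ^ n'\<rfloor>" for i
    proof (rule Z_past)
      have "real i < real (nat \<lfloor>u * 2 ^ n'\<rfloor>)" using that by simp
      also have "\<dots> \<le> u * 2 ^ n'" using u by simp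
      finally have "real i / 2 ^ n' < u" by (simp add: divide_less_eq)
      also have "u < tick n' t" using tick_bounds(1)[of t n'] u by simp
      finally show "real i / 2 ^ n' < tick n' t" .
    qed
    then have "?f n' \<in> borel_measurable (past n' (tick n' t))" unfolding w_def[abs_def] by measurable
    moreover have "sets (past n' (tick n' t)) \<subseteq> sets (past n (tick n t))"
      using past_tick_decreasing[OF _ that] u by simp
    ultimately show ?thesis using measurable_mono[of borel borel "past n' (tick n' t)" "past n (tick n t)"] by auto
  qed
  have "(\<lambda>\<omega>. lim (\<lambda>i. ?f (i + n) \<omega>)) \<in> borel_measurable (past n (tick n t))"
    by (rule borel_measurable_lim_metric) (rule m, simp)
  moreover have "lim (\<lambda>i. ?f (i + n) \<omega>) = W u \<omega>" for \<omega>
  proof -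
    have "((\<lambda>i. ?f (i + n) \<omega>) \<longlonglongrightarrow> l) = ((\<lambda>i. ?f i \<omega>) \<longlonglongrightarrow> l)" for l
      by (rule iffI[OF LIMSEQ_offset LIMSEQ_ignore_initial_segment])
    then show ?thesis unfolding W_def lim_def by simp
  qed
  ultimately show "W u \<in> borel_measurable (past n (tick n t))" by simp
qed

lemma W_measurable[measurable]: "0 \<le> u \<Longrightarrow> W u \<in> borel_measurable P"
  using W_measurable_F[of u u] measurable_from_subalg[OF F_subalgebra] by blast

lemma noise_measurable_F: "real j + 1 \<le> t \<Longrightarrow> \<xi> (real j) \<in> borel_measurable (F t)"
proof -
  assume t: "real j + 1 \<le> t"
  have [measurable]: "W (real j) \<in> borel_measurable (F t)" "W (real j + 1) \<in> borel_measurable (F t)"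
    using t by (auto intro!: W_measurable_F)
  have "(\<lambda>\<omega>. W (real j + 1) \<omega> - W (real j) \<omega>) \<in> borel_measurable (F t)" by measurable
  then show ?thesis unfolding W_noise by simp
qed

lemma noise_measurable[measurable]: "\<xi> q \<in> borel_measurable P"
  by (rule iid_gauss_measurable[OF iid])

subsection \<open>Independence of increments\<close>

text \<open>The increment is a normalized sum of \<open>l - k\<close> variables with indices in
  \<open>{s..<t}\<close>, disjoint from those that generate the past. Division by the standard
  deviation makes its law the same for all \<open>k\<close> and \<open>l\<close>.\<close>

lemma increment_indep:
  assumes k: "k < l"
  shows "A \<in> sets (past n (real k / 2 ^ n)) \<Longrightarrow> E \<in> sets borel \<Longrightarrow>
      prob {\<omega>\<in>A. (w n l \<omega> - w n k \<omega>) / sqrt (real l / 2 ^ n - real k / 2 ^ n) \<in> E} = prob A * measure gauss E"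
    and "distr P borel (\<lambda>\<omega>. (w n l \<omega> - w n k \<omega>) / sqrt (real l / 2 ^ n - real k / 2 ^ n)) = gauss"
proof -
  define s t where "s = real k / 2 ^ n" and "t = real l / 2 ^ n"
  define Q where "Q = (\<lambda>i. real i / 2 ^ n) ` {k..<l}"
  have injQ: "inj_on (\<lambda>i. real i / 2 ^ n) {k..<l}" by (auto simp: inj_on_def)
  have Q: "finite Q" "Q \<noteq> {}" "card Q = l - k" using k injQ by (auto simp: Q_def card_image)
  have Qs: "Q \<subseteq> {s..<t}" by (auto simp: Q_def s_def t_def divide_right_mono divide_strict_right_mono)
  define Y where "Y \<omega> = (w n l \<omega> - w n k \<omega>) / sqrt (t - s)" for \<omega>
  have Yeq: "Y \<omega> = (\<Sum>q\<in>Q. Z n q \<omega>) / sqrt (real (l - k))" for \<omega>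
  proof -
    have "{..<l} = {..<k} \<union> {k..<l}" using k by auto
    then have "(\<Sum>i<l. Z n (real i / 2 ^ n) \<omega>) = (\<Sum>i<k. Z n (real i / 2 ^ n) \<omega>) + (\<Sum>i\<in>{k..<l}. Z n (real i / 2 ^ n) \<omega>)"
      by (simp add: sum.union_disjoint ivl_disj_int)
    moreover have "(\<Sum>i\<in>{k..<l}. Z n (real i / 2 ^ n) \<omega>) = (\<Sum>q\<in>Q. Z n q \<omega>)"
      unfolding Q_def by (simp add: sum.reindex[OF injQ])
    ultimately have "w n l \<omega> - w n k \<omega> = (\<Sum>q\<in>Q. Z n q \<omega>) / sqrt (2 ^ n)"
      by (simp add: w_def diff_divide_distrib[symmetric])
    moreover have "t - s = real (l - k) / 2 ^ n" using k by (simp add: s_def t_def of_nat_diff diff_divide_distrib)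
    ultimately show ?thesis by (simp add: Y_def real_sqrt_divide)
  qed
  have iv: "indep_vars (\<lambda>_. borel) (Z n) UNIV" using iid_Z by (simp add: iid_gauss_def)
  have "indep_var (PiM {..<s} (\<lambda>_. borel)) (\<lambda>\<omega>. restrict (\<lambda>i. Z n i \<omega>) {..<s}) (PiM {s..<t} (\<lambda>_. borel)) (\<lambda>\<omega>. restrict (\<lambda>i. Z n i \<omega>) {s..<t})"
    by (intro indep_var_restrict[OF iv]) auto
  then have ind: "prob ((\<lambda>\<omega>. (restrict (\<lambda>i. Z n i \<omega>) {..<s}, restrict (\<lambda>i. Z n i \<omega>) {s..<t})) -` (A' \<times> B') \<inter> space P)
      = prob ((\<lambda>\<omega>. restrict (\<lambda>i. Z n i \<omega>) {..<s}) -` A' \<inter> space P) * prob ((\<lambda>\<omega>. restrict (\<lambda>i. Z n i \<omega>) {s..<t}) -` B' \<inter> space P)"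
    if "A' \<in> sets (PiM {..<s} (\<lambda>_. borel))" "B' \<in> sets (PiM {s..<t} (\<lambda>_. borel))" for A' B'
    using that by (rule indep_varD)
  define h :: "(real \<Rightarrow> real) \<Rightarrow> real" where "h f = (\<Sum>q\<in>Q. f q) / sqrt (real (l - k))" for f
  have h: "h \<in> borel_measurable (PiM {s..<t} (\<lambda>_. borel))"
  proof -
    have [measurable]: "(\<lambda>f. f q) \<in> borel_measurable (PiM {s..<t} (\<lambda>_. borel :: real measure))" if "q \<in> Q" for q
      by (rule measurable_component_singleton) (use Qs that in auto)
    show ?thesis unfolding h_def by measurable
  qed
  have hY: "h (restrict (\<lambda>i. Z n i \<omega>) {s..<t}) = Y \<omega>" for \<omega>
    unfolding h_def Yeq using Qs by (intro arg_cong2[where f="(/)"] sum.cong) auto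
  have YP: "Y \<in> borel_measurable P" unfolding Yeq[abs_def] by measurable
  have d: "distributed P lborel (Z n q) (normal_density 0 1)" for q
  proof -
    have "distr P lborel (Z n q) = distr P borel (Z n q)" by (rule distr_cong) auto
    then show ?thesis using iid_Z[of n] by (auto simp: distributed_def iid_gauss_def)
  qed
  have "distributed P lborel (\<lambda>\<omega>. \<Sum>q\<in>Q. Z n q \<omega>) (normal_density (\<Sum>q\<in>Q. 0) (sqrt (\<Sum>q\<in>Q. 1\<^sup>2)))"
    by (rule sum_indep_normal[OF Q(1,2) indep_vars_subset[OF iv]]) (auto intro: d)
  then have "distributed P lborel (\<lambda>\<omega>. \<Sum>q\<in>Q. Z n q \<omega>) (normal_density 0 (sqrt (real (l - k))))"
    using Q(3) by simp
  then have "distributed P lborel (\<lambda>\<omega>. ((\<Sum>q\<in>Q. Z n q \<omega>) - 0) / sqrt (real (l - k))) std_normal_density"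
    using k by (subst (asm) normal_standard_normal_convert) auto
  then have dY: "distributed P lborel Y std_normal_density" by (simp add: Yeq[abs_def])
  have "distr P borel Y = distr P lborel Y" by (rule distr_cong) auto
  then have "distr P borel Y = gauss" using dY by (simp add: distributed_def)
  then show g: "distr P borel (\<lambda>\<omega>. (w n l \<omega> - w n k \<omega>) / sqrt (real l / 2 ^ n - real k / 2 ^ n)) = gauss"
    unfolding Y_def[abs_def] s_def t_def .
  assume A: "A \<in> sets (past n (real k / 2 ^ n))" and E: "E \<in> sets borel"
  have "sets (past n s) = {(\<lambda>\<omega>. restrict (\<lambda>i. Z n i \<omega>) {..<s}) -` A \<inter> space P |A. A \<in> sets (PiM {..<s} (\<lambda>_. borel))}"
    unfolding past_def by (rule sets_vimage_algebra2) (auto simp: space_PiM)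
  then obtain A' where A': "A' \<in> sets (PiM {..<s} (\<lambda>_. borel))" "A = (\<lambda>\<omega>. restrict (\<lambda>i. Z n i \<omega>) {..<s}) -` A' \<inter> space P"
    using A unfolding s_def[symmetric] by auto
  define B' where "B' = h -` E \<inter> space (PiM {s..<t} (\<lambda>_. borel :: real measure))"
  have B': "B' \<in> sets (PiM {s..<t} (\<lambda>_. borel))" unfolding B'_def using h E by (rule measurable_sets)
  have mem: "restrict (\<lambda>i. Z n i \<omega>) {s..<t} \<in> B' \<longleftrightarrow> Y \<omega> \<in> E" for \<omega>
    by (auto simp: B'_def hY space_PiM)
  have "prob ((\<lambda>\<omega>. restrict (\<lambda>i. Z n i \<omega>) {s..<t}) -` B' \<inter> space P) = prob (Y -` E \<inter> space P)"
    using mem by (intro arg_cong[where f=prob]) auto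
  also have "\<dots> = measure (distr P borel Y) E" using YP E by (simp add: measure_distr)
  also have "distr P borel Y = gauss" using g unfolding Y_def[abs_def] s_def t_def .
  finally have pB: "prob ((\<lambda>\<omega>. restrict (\<lambda>i. Z n i \<omega>) {s..<t}) -` B' \<inter> space P) = measure gauss E" .
  have "{\<omega>\<in>A. Y \<omega> \<in> E} = (\<lambda>\<omega>. (restrict (\<lambda>i. Z n i \<omega>) {..<s}, restrict (\<lambda>i. Z n i \<omega>) {s..<t})) -` (A' \<times> B') \<inter> space P"
    using mem A'(2) by auto
  then have "prob {\<omega>\<in>A. Y \<omega> \<in> E} = prob A * measure gauss E"
    using ind[OF A'(1) B'] pB A'(2) by simp
  then show "prob {\<omega>\<in>A. (w n l \<omega> - w n k \<omega>) / sqrt (real l / 2 ^ n - real k / 2 ^ n) \<in> E} = prob A * measure gauss E"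
    unfolding Y_def s_def t_def .
qed

text \<open>The threshold \<open>X\<close> is known from the past, so it can be frozen while the
  independent increment is integrated out.\<close>

lemma increment_conditional:
  assumes k: "k < l" and A: "A \<in> sets (past n (real k / 2 ^ n))" and X: "X \<in> borel_measurable (past n (real k / 2 ^ n))"
  shows "prob {\<omega>\<in>A. W (real l / 2 ^ n) \<omega> - W (real k / 2 ^ n) \<omega> \<le> X \<omega>}
    = (\<integral>\<omega>\<in>A. cdf gauss (X \<omega> / sqrt (real l / 2 ^ n - real k / 2 ^ n)) \<partial>P)"
proof -
  let ?G = "past n (real k / 2 ^ n)"
  define \<sigma> where "\<sigma> = sqrt (real l / 2 ^ n - real k / 2 ^ n)"
  have \<sigma>: "0 < \<sigma>" using k by (simp add: \<sigma>_def divide_strict_right_mono)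
  define Y where "Y \<omega> = (w n l \<omega> - w n k \<omega>) / \<sigma>" for \<omega>
  have ind: "prob {\<omega>\<in>A. Y \<omega> \<in> E} = prob A * measure gauss E" if "A \<in> sets ?G" "E \<in> sets borel" for A E
    using increment_indep(1)[OF k that] by (simp add: Y_def \<sigma>_def)
  have id: "(\<lambda>\<omega>. \<omega>) \<in> P \<rightarrow>\<^sub>M ?G"
  proof (rule measurableI)
    fix A assume A: "A \<in> sets ?G"
    then have "A \<subseteq> space P" "A \<in> events" using sets.sets_into_space[OF A] past_subset by auto
    then show "(\<lambda>\<omega>. \<omega>) -` A \<inter> space P \<in> events" by (simp add: vimage_def Int_absorb2)
  qed simp
  have Ym[measurable]: "Y \<in> borel_measurable P" unfolding Y_def[abs_def] w_def[abs_def] by measurable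
  \<comment> \<open>Independence as a product law: the first component is the outcome itself, seen
    only through the past, the second the normalized increment.\<close>
  have pr: "distr P ?G (\<lambda>\<omega>. \<omega>) \<Otimes>\<^sub>M gauss = distr P (?G \<Otimes>\<^sub>M borel) (\<lambda>\<omega>. (\<omega>, Y \<omega>))"
  proof (rule pair_measure_eqI)
    interpret d1: prob_space "distr P ?G (\<lambda>\<omega>. \<omega>)" by (rule prob_space_distr[OF id])
    show "sigma_finite_measure (distr P ?G (\<lambda>\<omega>. \<omega>))" by unfold_locales
    show "sigma_finite_measure gauss" by unfold_locales
    show "sets (distr P ?G (\<lambda>\<omega>. \<omega>) \<Otimes>\<^sub>M gauss) = sets (distr P (?G \<Otimes>\<^sub>M borel) (\<lambda>\<omega>. (\<omega>, Y \<omega>)))"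
      unfolding sets_distr by (intro sets_pair_measure_cong) auto
    fix A E assume "A \<in> sets (distr P ?G (\<lambda>\<omega>. \<omega>))" "E \<in> sets gauss"
    then have A: "A \<in> sets ?G" and E: "E \<in> sets borel" by auto
    have AP: "A \<subseteq> space P" using sets.sets_into_space[OF A] by simp
    have "emeasure (distr P (?G \<Otimes>\<^sub>M borel) (\<lambda>\<omega>. (\<omega>, Y \<omega>))) (A \<times> E) = emeasure P {\<omega>\<in>A. Y \<omega> \<in> E}"
      using A E AP measurable_Pair[OF id Ym]
      by (subst emeasure_distr) (auto intro!: arg_cong[where f="emeasure P"])
    also have "\<dots> = emeasure P A * emeasure gauss E"
      using ind[OF A E] by (simp add: emeasure_eq_measure gauss.emeasure_eq_measure ennreal_mult)
    also have "emeasure P A = emeasure (distr P ?G (\<lambda>\<omega>. \<omega>)) A"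
      using id A AP by (subst emeasure_distr) (auto simp: Int_absorb2 vimage_def)
    finally show "emeasure (distr P ?G (\<lambda>\<omega>. \<omega>)) A * emeasure gauss E = emeasure (distr P (?G \<Otimes>\<^sub>M borel) (\<lambda>\<omega>. (\<omega>, Y \<omega>))) (A \<times> E)"
      by simp
  qed
  have AP: "A \<subseteq> space P" using sets.sets_into_space[OF A] by simp
  have AE: "A \<in> events" using A past_subset by blast
  have XP[measurable]: "X \<in> borel_measurable P" using measurable_compose[OF id X] by simp
  define D where "D = {z \<in> space (?G \<Otimes>\<^sub>M borel). fst z \<in> A \<and> snd z \<le> X (fst z) / \<sigma>}"
  have D: "D \<in> sets (?G \<Otimes>\<^sub>M borel)"
    unfolding D_def using A X by measurable
  interpret d1: prob_space "distr P ?G (\<lambda>\<omega>. \<omega>)" by (rule prob_space_distr[OF id])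
  have "emeasure P {\<omega>\<in>A. w n l \<omega> - w n k \<omega> \<le> X \<omega>} = emeasure (distr P (?G \<Otimes>\<^sub>M borel) (\<lambda>\<omega>. (\<omega>, Y \<omega>))) D"
  proof (subst emeasure_distr)
    show "(\<lambda>\<omega>. (\<omega>, Y \<omega>)) \<in> P \<rightarrow>\<^sub>M ?G \<Otimes>\<^sub>M borel" using id Ym by (rule measurable_Pair)
    have "Y \<omega> \<le> X \<omega> / \<sigma> \<longleftrightarrow> w n l \<omega> - w n k \<omega> \<le> X \<omega>" for \<omega>
      using \<sigma> by (simp add: Y_def divide_le_cancel)
    then have "(\<lambda>\<omega>. (\<omega>, Y \<omega>)) -` D \<inter> space P = {\<omega>\<in>A. w n l \<omega> - w n k \<omega> \<le> X \<omega>}"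
      using AP by (auto simp: D_def space_pair_measure)
    then show "emeasure P {\<omega>\<in>A. w n l \<omega> - w n k \<omega> \<le> X \<omega>} = emeasure P ((\<lambda>\<omega>. (\<omega>, Y \<omega>)) -` D \<inter> space P)" by simp
  qed (rule D)
  also have "\<dots> = emeasure (distr P ?G (\<lambda>\<omega>. \<omega>) \<Otimes>\<^sub>M gauss) D" by (simp add: pr)
  also have "\<dots> = (\<integral>\<^sup>+\<omega>. emeasure gauss (Pair \<omega> -` D) \<partial>distr P ?G (\<lambda>\<omega>. \<omega>))"
  proof (rule gauss.emeasure_pair_measure_alt)
    have "sets (distr P ?G (\<lambda>\<omega>. \<omega>) \<Otimes>\<^sub>M gauss) = sets (?G \<Otimes>\<^sub>M borel)" by (simp add: pr)
    then show "D \<in> sets (distr P ?G (\<lambda>\<omega>. \<omega>) \<Otimes>\<^sub>M gauss)" using D by simp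
  qed
  also have "\<dots> = (\<integral>\<^sup>+\<omega>. ennreal (indicator A \<omega> * cdf gauss (X \<omega> / \<sigma>)) \<partial>distr P ?G (\<lambda>\<omega>. \<omega>))"
  proof (rule nn_integral_cong)
    fix \<omega> assume "\<omega> \<in> space (distr P ?G (\<lambda>\<omega>. \<omega>))"
    then have "Pair \<omega> -` D = (if \<omega> \<in> A then {..X \<omega> / \<sigma>} else {})"
      by (auto simp: D_def space_pair_measure)
    then show "emeasure gauss (Pair \<omega> -` D) = ennreal (indicator A \<omega> * cdf gauss (X \<omega> / \<sigma>))"
      by (simp add: cdf_def gauss.emeasure_eq_measure)
  qed
  also have "\<dots> = (\<integral>\<^sup>+\<omega>. ennreal (indicator A \<omega> * cdf gauss (X \<omega> / \<sigma>)) \<partial>P)"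
  proof (rule nn_integral_distr[OF id])
    have [measurable]: "A \<in> sets ?G" "X \<in> borel_measurable ?G" using A X by auto
    have "(\<lambda>\<omega>. indicator A \<omega> * cdf gauss (X \<omega> / \<sigma>)) \<in> borel_measurable ?G" by measurable
    then show "(\<lambda>\<omega>. ennreal (indicator A \<omega> * cdf gauss (X \<omega> / \<sigma>))) \<in> borel_measurable (distr P ?G (\<lambda>\<omega>. \<omega>))" by simp
  qed
  finally have e: "emeasure P {\<omega>\<in>A. w n l \<omega> - w n k \<omega> \<le> X \<omega>} = (\<integral>\<^sup>+\<omega>. ennreal (indicator A \<omega> * cdf gauss (X \<omega> / \<sigma>)) \<partial>P)" .
  have "(\<integral>\<omega>\<in>A. cdf gauss (X \<omega> / \<sigma>) \<partial>P) = enn2real (\<integral>\<^sup>+\<omega>. ennreal (indicator A \<omega> * cdf gauss (X \<omega> / \<sigma>)) \<partial>P)"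
    unfolding set_lebesgue_integral_def using AE gauss.cdf_nonneg
    by (subst integral_eq_nn_integral) auto
  also have "\<dots> = prob {\<omega>\<in>A. w n l \<omega> - w n k \<omega> \<le> X \<omega>}" by (simp add: e[symmetric] measure_def)
  finally show ?thesis unfolding W_dyadic \<sigma>_def by simp
qed

end

context gaussian_noise begin

subsection \<open>Martingales ending in an indicator of the noise\<close>

text \<open>The conditional probability of \<open>\<xi> (real j) \<le> a\<close> given the
  information at \<open>t\<close>: between \<open>j\<close> and \<open>j + 1\<close> the remaining
  increment is normal with variance \<open>real j + 1 - t\<close>. The maximum freezes the formula
  before time \<open>j\<close>, where it reduces to \<open>cdf gauss a\<close>.\<close>

definition half_line :: "nat \<Rightarrow> real \<Rightarrow> real \<Rightarrow> 'a \<Rightarrow> real" where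
  "half_line j a t \<omega> = (if t < real j + 1
     then cdf gauss ((a - (W (max t (real j)) \<omega> - W (real j) \<omega>)) / sqrt (real j + 1 - max t (real j)))
     else indicator {..a} (\<xi> (real j) \<omega>))"

lemma half_line_early: "t \<le> real j \<Longrightarrow> half_line j a t \<omega> = cdf gauss a"
  by (simp add: half_line_def max_absorb2)

lemma half_line_late: "real j + 1 \<le> t \<Longrightarrow> half_line j a t \<omega> = indicator {..a} (\<xi> (real j) \<omega>)"
  by (simp add: half_line_def)

lemma half_line_bounds: "\<bar>half_line j a t \<omega>\<bar> \<le> 1"
  using gauss.cdf_nonneg gauss.cdf_bounded_prob by (auto simp: half_line_def indicator_def)

lemma half_line_measurable:
  assumes "0 \<le> t" shows "half_line j a t \<in> borel_measurable (F t)"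
proof -
  consider "t \<le> real j" | "real j \<le> t" "t < real j + 1" | "real j + 1 \<le> t" by linarith
  then show ?thesis
  proof cases
    case 1
    then have "half_line j a t = (\<lambda>\<omega>. cdf gauss a)" by (auto simp: half_line_early fun_eq_iff)
    then show ?thesis by simp
  next
    case 2
    have [measurable]: "W t \<in> borel_measurable (F t)" "W (real j) \<in> borel_measurable (F t)"
      using 2 assms by (auto intro!: W_measurable_F)
    have "half_line j a t = (\<lambda>\<omega>. cdf gauss ((a - (W t \<omega> - W (real j) \<omega>)) / sqrt (real j + 1 - t)))"
      using 2 by (auto simp: half_line_def fun_eq_iff max_absorb1)
    then show ?thesis by (simp only:) measurable
  next
    case 3
    have [measurable]: "\<xi> (real j) \<in> borel_measurable (F t)" by (rule noise_measurable_F[OF 3])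
    have "half_line j a t = (\<lambda>\<omega>. indicator {..a} (\<xi> (real j) \<omega>))"
      using 3 by (auto simp: half_line_late fun_eq_iff)
    then show ?thesis by (simp only:) measurable
  qed
qed

lemma half_line_measurable_P: "0 \<le> t \<Longrightarrow> half_line j a t \<in> borel_measurable P"
  using half_line_measurable measurable_from_subalg[OF F_subalgebra] by blast

lemma half_line_integrable: "0 \<le> t \<Longrightarrow> integrable P (half_line j a t)"
  using half_line_bounds half_line_measurable_P by (intro integrable_const_bound[where B=1]) auto

text \<open>The conditional law is known at grid points and for events of a past of that level. So
  \<open>t\<close> is replaced by its ticks and \<open>A\<close> by events of the pasts that differ
  by null sets; path continuity leads back to \<open>t\<close>.\<close>

lemma half_line_mid:
  assumes t: "real j \<le> t" "t < real j + 1" and A: "A \<in> sets (F t)"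
  shows "(\<integral>\<omega>\<in>A. half_line j a t \<omega> \<partial>P) = prob {\<omega>\<in>A. \<xi> (real j) \<omega> \<le> a}"
proof -
  have t0: "0 \<le> t" using t by simp
  have AP[measurable]: "A \<in> events" using A sets_F t0 by auto
  have sub: "A \<subseteq> space P" using sets.sets_into_space[OF AP] .
  define s where "s n = tick n t" for n
  have s: "t < s n" for n using tick_bounds(1)[OF t0] by (simp add: s_def)
  define Q where "Q n \<omega> = cdf gauss ((a - (W (s n) \<omega> - W (real j) \<omega>)) / sqrt (real j + 1 - s n))" for n \<omega>
  have "\<forall>n. \<exists>A'\<in>sets (past n (s n)). (A - A') \<union> (A' - A) \<in> null_sets P"
    using A unfolding sets_F_eq F_sets_def s_def by blast
  then obtain A' where A': "\<And>n. A' n \<in> sets (past n (s n))" "\<And>n. (A - A' n) \<union> (A' n - A) \<in> null_sets P"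
    by metis
  have A'P[measurable]: "A' n \<in> events" for n using A'(1) past_subset by blast
  have A'sub: "A' n \<subseteq> space P" for n using sets.sets_into_space[OF A'P] .
  have ae: "AE \<omega> in P. \<omega> \<in> A \<longleftrightarrow> \<omega> \<in> A' n" for n
    using AE_not_in[OF A'(2)[of n]] by eventually_elim auto
  have sm: "0 \<le> s n" for n using s[of n] t0 by linarith
  have [measurable]: "Q n \<in> borel_measurable P" for n
    unfolding Q_def[abs_def] using sm by measurable
  have Qb: "\<bar>Q n \<omega>\<bar> \<le> 1" for n \<omega>
    using gauss.cdf_nonneg gauss.cdf_bounded_prob by (simp add: Q_def)
  \<comment> \<open>At a tick the identity is exact: the unit increment splits at \<open>s n\<close>
    into a part known from the past and an independent rest.\<close>
  have step: "(\<integral>\<omega>\<in>A. Q n \<omega> \<partial>P) = prob {\<omega>\<in>A. \<xi> (real j) \<omega> \<le> a}" if n: "s n < real j + 1" for n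
  proof -
    define k l where "k = Suc (nat \<lfloor>t * 2 ^ n\<rfloor>)" and "l = (j + 1) * 2 ^ n"
    have sk: "s n = real k / 2 ^ n" unfolding s_def k_def by (rule tick_dyadic(2))
    have "real l = (real j + 1) * 2 ^ n" by (simp add: l_def distrib_right)
    then have jl: "real j + 1 = real l / 2 ^ n" by simp
    have "real k / 2 ^ n < real l / 2 ^ n" using n unfolding sk jl .
    then have "real k < real l" by (simp add: divide_less_cancel)
    then have kl: "k < l" by simp
    have Xm: "(\<lambda>\<omega>. a - (W (s n) \<omega> - W (real j) \<omega>)) \<in> borel_measurable (past n (real k / 2 ^ n))"
    proof -
      have Zm: "Z n (real i / 2 ^ n) \<in> borel_measurable (past n (real k / 2 ^ n))" if "i < k" for i
        using that by (intro Z_past) (simp add: divide_strict_right_mono)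
      have jn: "real j = real (j * 2 ^ n) / 2 ^ n" by simp
      have "real (j * 2 ^ n) / 2 ^ n < real k / 2 ^ n" using s[of n] t(1) unfolding sk[symmetric] jn[symmetric] by simp
      then have "real (j * 2 ^ n) < real k" by (simp add: less_divide_eq)
      then have jk: "j * 2 ^ n < k" by (simp only: of_nat_less_iff)
      have Wk: "W (s n) = w n k" unfolding sk by (auto simp: W_dyadic fun_eq_iff)
      have Wj: "W (real j) = w n (j * 2 ^ n)" by (subst jn) (auto simp only: W_dyadic fun_eq_iff)
      have [measurable]: "w n k' \<in> borel_measurable (past n (real k / 2 ^ n))" if "k' \<le> k" for k'
        unfolding w_def[abs_def] using Zm that by (intro borel_measurable_divide borel_measurable_sum) auto
      show ?thesis unfolding Wk Wj using jk by (intro borel_measurable_diff measurable_const) auto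
    qed
    have "(\<integral>\<omega>\<in>A. Q n \<omega> \<partial>P) = (\<integral>\<omega>\<in>A' n. Q n \<omega> \<partial>P)"
      unfolding set_lebesgue_integral_def using ae[of n]
      by (intro integral_cong_AE) (auto simp: indicator_def)
    also have "\<dots> = prob {\<omega>\<in>A' n. W (real l / 2 ^ n) \<omega> - W (real k / 2 ^ n) \<omega> \<le> a - (W (s n) \<omega> - W (real j) \<omega>)}"
      using increment_conditional[OF kl A'(1)[of n, unfolded sk] Xm] by (simp add: Q_def sk jl)
    also have "\<dots> = prob {\<omega>\<in>A' n. \<xi> (real j) \<omega> \<le> a}"
      unfolding sk[symmetric] jl[symmetric] W_noise[of j, symmetric] by (simp add: algebra_simps)
    also have "\<dots> = prob {\<omega>\<in>A. \<xi> (real j) \<omega> \<le> a}"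
    proof (rule finite_measure_eq_AE)
      show "AE x in P. (x \<in> {\<omega> \<in> A' n. \<xi> (real j) \<omega> \<le> a}) = (x \<in> {\<omega> \<in> A. \<xi> (real j) \<omega> \<le> a})"
        using ae[of n] by eventually_elim auto
      have "{\<omega> \<in> A' n. \<xi> (real j) \<omega> \<le> a} = {\<omega>\<in>space P. \<omega> \<in> A' n \<and> \<xi> (real j) \<omega> \<le> a}"
        "{\<omega> \<in> A. \<xi> (real j) \<omega> \<le> a} = {\<omega>\<in>space P. \<omega> \<in> A \<and> \<xi> (real j) \<omega> \<le> a}" using A'sub sub by auto
      then show "{\<omega> \<in> A' n. \<xi> (real j) \<omega> \<le> a} \<in> events" "{\<omega> \<in> A. \<xi> (real j) \<omega> \<le> a} \<in> events"
        by (simp_all only:) measurable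
    qed
    finally show ?thesis .
  qed
  have lim: "(\<lambda>n. \<integral>\<omega>\<in>A. Q n \<omega> \<partial>P) \<longlonglongrightarrow> (\<integral>\<omega>\<in>A. half_line j a t \<omega> \<partial>P)"
    unfolding set_lebesgue_integral_def
  proof (rule integral_dominated_convergence[where w="\<lambda>_. 1"])
    show "AE \<omega> in P. (\<lambda>n. indicat_real A \<omega> *\<^sub>R Q n \<omega>) \<longlonglongrightarrow> indicat_real A \<omega> *\<^sub>R half_line j a t \<omega>"
      using W_continuous
    proof eventually_elim
      case (elim \<omega>)
      have "(\<lambda>n. W (s n) \<omega>) \<longlonglongrightarrow> W t \<omega>"
        using continuous_on_tendsto_compose[OF elim tick_tendsto[OF t0]] t0 sm by (simp add: s_def)
      moreover have "(\<lambda>n. s n) \<longlonglongrightarrow> t" unfolding s_def by (rule tick_tendsto[OF t0])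
      ultimately have "(\<lambda>n. (a - (W (s n) \<omega> - W (real j) \<omega>)) / sqrt (real j + 1 - s n))
          \<longlonglongrightarrow> (a - (W t \<omega> - W (real j) \<omega>)) / sqrt (real j + 1 - t)"
        using t(2) by (intro tendsto_intros) auto
      then have "(\<lambda>n. Q n \<omega>) \<longlonglongrightarrow> cdf gauss ((a - (W t \<omega> - W (real j) \<omega>)) / sqrt (real j + 1 - t))"
        unfolding Q_def by (rule isCont_tendsto_compose[OF isCont_cdf_gauss])
      then show ?case using t by (intro tendsto_intros) (simp add: half_line_def max_absorb1)
    qed
    show "AE \<omega> in P. norm (indicat_real A \<omega> *\<^sub>R Q n \<omega>) \<le> 1" for n
      using Qb by (auto simp: indicator_def)
  qed (use half_line_measurable_P[OF t0] in auto)
  have "\<forall>\<^sub>F n in sequentially. s n < real j + 1"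
    using order_tendstoD(2)[OF tick_tendsto[OF t0] t(2)] by (simp add: s_def)
  then have "\<forall>\<^sub>F n in sequentially. (\<integral>\<omega>\<in>A. Q n \<omega> \<partial>P) = prob {\<omega>\<in>A. \<xi> (real j) \<omega> \<le> a}"
    by eventually_elim (rule step)
  then have "(\<lambda>n. \<integral>\<omega>\<in>A. Q n \<omega> \<partial>P) \<longlonglongrightarrow> prob {\<omega>\<in>A. \<xi> (real j) \<omega> \<le> a}" by (rule tendsto_eventually)
  with lim show ?thesis by (rule LIMSEQ_unique)
qed

lemma half_line_martingale: "mart_to (half_line j a) (\<lambda>\<omega>. indicator {..a} (\<xi> (real j) \<omega>))"
  unfolding mart_to_def
proof (intro conjI ballI)
  show "integrable P (\<lambda>\<omega>. indicat_real {..a} (\<xi> (real j) \<omega>))"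
    by (intro integrable_const_bound[where B=1]) (auto simp: indicator_def)
  fix t :: real assume "t \<in> {0..}"
  then have t0: "0 \<le> t" by simp
  show "half_line j a t \<in> borel_measurable (F t)" "integrable P (half_line j a t)"
    using half_line_measurable half_line_integrable t0 by auto
  fix A assume A: "A \<in> sets (F t)"
  have AP: "A \<in> events" using A sets_F t0 by auto
  have "A \<subseteq> space P" using sets.sets_into_space[OF AP] .
  then have "{\<omega>\<in>A. \<xi> (real j) \<omega> \<le> a} = {\<omega>\<in>space P. \<omega> \<in> A \<and> \<xi> (real j) \<omega> \<le> a}" by auto
  moreover have "{\<omega>\<in>space P. \<omega> \<in> A \<and> \<xi> (real j) \<omega> \<le> a} \<in> events" using AP by measurable
  ultimately have "{\<omega>\<in>A. \<xi> (real j) \<omega> \<le> a} \<in> events" by simp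
  then have rhs: "(\<integral>\<omega>\<in>A. indicat_real {..a} (\<xi> (real j) \<omega>) \<partial>P) = prob {\<omega>\<in>A. \<xi> (real j) \<omega> \<le> a}"
  proof -
    assume m: "{\<omega>\<in>A. \<xi> (real j) \<omega> \<le> a} \<in> events"
    have "(\<integral>\<omega>\<in>A. indicat_real {..a} (\<xi> (real j) \<omega>) \<partial>P) = (\<integral>\<omega>. indicat_real {\<omega>\<in>A. \<xi> (real j) \<omega> \<le> a} \<omega> \<partial>P)"
      unfolding set_lebesgue_integral_def by (intro Bochner_Integration.integral_cong) (auto simp: indicator_def)
    then show ?thesis using m by simp
  qed
  consider "t \<le> real j" | "real j \<le> t" "t < real j + 1" | "real j + 1 \<le> t" by linarith
  then show "(\<integral>\<omega>\<in>A. half_line j a t \<omega> \<partial>P) = (\<integral>\<omega>\<in>A. indicat_real {..a} (\<xi> (real j) \<omega>) \<partial>P)"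
  proof cases
    case 1
    \<comment> \<open>Before time \<open>j\<close> the process has the constant value that it takes
      at \<open>j\<close>, and \<open>A\<close> is still known at \<open>j\<close>.\<close>
    then have "A \<in> sets (F (real j))" using A F_mono[of t "real j"] by auto
    then have "(\<integral>\<omega>\<in>A. half_line j a (real j) \<omega> \<partial>P) = prob {\<omega>\<in>A. \<xi> (real j) \<omega> \<le> a}"
      by (intro half_line_mid) auto
    then show ?thesis using 1 rhs by (simp add: half_line_early)
  next
    case 2 then show ?thesis using half_line_mid[OF 2 A] rhs by simp
  next
    case 3 then show ?thesis by (simp add: half_line_late)
  qed
qed

text \<open>The delicate time is \<open>j + 1\<close>. There the numerator tends to
  \<open>a - \<xi> (real j) \<omega>\<close>, which is nonzero by assumption, and the denominator to
  0, so the argument runs to plus or minus infinity and the normal distribution function to the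
  indicator.\<close>

lemma half_line_path_continuous:
  assumes W: "continuous_on {0..} (\<lambda>t. W t \<omega>)" and ne: "\<xi> (real j) \<omega> \<noteq> a"
  shows "continuous_on {0..} (\<lambda>t. half_line j a t \<omega>)"
proof -
  define h where "h t = (a - (W (max t (real j)) \<omega> - W (real j) \<omega>)) / sqrt (real j + 1 - max t (real j))" for t
  have Wmax: "continuous_on {0..} (\<lambda>t. W (max t (real j)) \<omega>)"
    by (rule continuous_on_compose2[OF W]) (auto intro!: continuous_intros)
  have hl: "half_line j a t \<omega> = cdf gauss (h t)" if "t < real j + 1" for t
    using that by (simp add: half_line_def h_def)
  have ch: "continuous_on {0..<real j + 1} h"
    unfolding h_def by (intro continuous_intros continuous_on_subset[OF Wmax]) auto
  have "continuous_on {0..<real j + 1} (\<lambda>t. cdf gauss (h t))"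
    by (rule continuous_on_compose2[OF continuous_at_imp_continuous_on[of UNIV] ch]) (auto simp: isCont_cdf_gauss)
  then have c1: "continuous_on {0..<real j + 1} (\<lambda>t. half_line j a t \<omega>)"
    by (subst continuous_on_cong[OF refl hl]) auto
  have c2: "continuous_on {real j + 1..} (\<lambda>t. half_line j a t \<omega>)"
    by (subst continuous_on_cong[OF refl half_line_late]) auto
  have left: "((\<lambda>t. half_line j a t \<omega>) \<longlongrightarrow> half_line j a (real j + 1) \<omega>) (at (real j + 1) within {0..<real j + 1})"
  proof -
    let ?F = "at (real j + 1) within {0..<real j + 1}"
    define d where "d = a - \<xi> (real j) \<omega>"
    have d: "d \<noteq> 0" using ne by (simp add: d_def)
    have num: "((\<lambda>t. a - (W (max t (real j)) \<omega> - W (real j) \<omega>)) \<longlongrightarrow> d) ?F"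
    proof -
      have "((\<lambda>t. W (max t (real j)) \<omega>) \<longlongrightarrow> W (max (real j + 1) (real j)) \<omega>) (at (real j + 1) within {0..})"
        using Wmax unfolding continuous_on_def by (rule bspec) simp
      then have "((\<lambda>t. W (max t (real j)) \<omega>) \<longlongrightarrow> W (max (real j + 1) (real j)) \<omega>) ?F"
        by (rule tendsto_within_subset[of _ _ _ "{0..}"]) auto
      then have "((\<lambda>t. W (max t (real j)) \<omega>) \<longlongrightarrow> W (real j + 1) \<omega>) ?F"
        by (simp only: max_absorb1[of "real j" "real j + 1"] le_add_same_cancel1 zero_le_one)
      then have "((\<lambda>t. a - (W (max t (real j)) \<omega> - W (real j) \<omega>)) \<longlongrightarrow> a - (W (real j + 1) \<omega> - W (real j) \<omega>)) ?F"
        by (intro tendsto_intros)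
      then show ?thesis by (simp add: d_def W_noise)
    qed
    have ev: "\<forall>\<^sub>F t in ?F. t < real j + 1" by (simp add: eventually_at_filter)
    have den: "LIM t ?F. inverse (sqrt (real j + 1 - max t (real j))) :> at_top"
    proof (rule filterlim_inverse_at_top)
      have "((\<lambda>t. sqrt (real j + 1 - max t (real j))) \<longlongrightarrow> sqrt (real j + 1 - max (real j + 1) (real j))) ?F"
        by (intro tendsto_intros tendsto_ident_at)
      then show "((\<lambda>t. sqrt (real j + 1 - max t (real j))) \<longlongrightarrow> 0) ?F" by simp
      show "\<forall>\<^sub>F t in ?F. 0 < sqrt (real j + 1 - max t (real j))"
        using ev by eventually_elim auto
    qed
    have hd: "h t = (a - (W (max t (real j)) \<omega> - W (real j) \<omega>)) * inverse (sqrt (real j + 1 - max t (real j)))" for t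
      by (simp add: h_def divide_inverse)
    have "((\<lambda>t. cdf gauss (h t)) \<longlongrightarrow> indicator {..a} (\<xi> (real j) \<omega>)) ?F"
    proof (cases "0 < d")
      case True
      have "filterlim h at_top ?F" unfolding hd by (rule filterlim_tendsto_pos_mult_at_top[OF num True den])
      then have "((\<lambda>t. cdf gauss (h t)) \<longlongrightarrow> 1) ?F" by (rule filterlim_compose[OF gauss.cdf_lim_at_top_prob])
      then show ?thesis using True by (simp add: d_def)
    next
      case False
      then have "d < 0" using d by simp
      have "filterlim h at_bot ?F" unfolding hd by (rule filterlim_tendsto_neg_mult_at_bot[OF num \<open>d < 0\<close> den])
      then have "((\<lambda>t. cdf gauss (h t)) \<longlongrightarrow> 0) ?F" by (rule filterlim_compose[OF gauss.cdf_lim_at_bot])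
      then show ?thesis using \<open>d < 0\<close> by (simp add: d_def)
    qed
    moreover have "\<forall>\<^sub>F t in ?F. cdf gauss (h t) = half_line j a t \<omega>"
      using ev by eventually_elim (simp add: hl)
    ultimately show ?thesis by (simp add: half_line_late Lim_transform_eventually)
  qed
  show ?thesis
    unfolding continuous_on_def
  proof
    fix t :: real assume t: "t \<in> {0..}"
    let ?f = "\<lambda>t. half_line j a t \<omega>"
    consider "t < real j + 1" | "t = real j + 1" | "real j + 1 < t" by linarith
    then show "(?f \<longlongrightarrow> ?f t) (at t within {0..})"
    proof cases
      case 1
      have "at t within {0..} = at t within {0..<real j + 1}"
        by (rule at_within_nhd[where S="{..<real j + 1}"]) (use 1 in auto)
      then show ?thesis using c1 1 t by (simp add: continuous_on_def)
    next
      case 3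
      have "at t within {0..} = at t within {real j + 1..}"
        by (rule at_within_nhd[where S="{real j + 1<..}"]) (use 3 in auto)
      then show ?thesis using c2 3 by (simp add: continuous_on_def)
    next
      case 2
      have "{0..} = {0..<real j + 1} \<union> {real j + 1..}" by auto
      moreover have "(?f \<longlongrightarrow> ?f t) (at t within {real j + 1..})" using c2 2 by (simp add: continuous_on_def)
      ultimately show ?thesis using left 2 by (simp add: Lim_within_Un)
    qed
  qed
qed

subsection \<open>Continuous martingales ending in a function of the noise\<close>

text \<open>The building block of a stage: it starts from the mean of \<open>f\<close>, moves only
  between \<open>j\<close> and \<open>j + 1\<close>, and ends in \<open>f\<close> of the noise.
  Continuity is demanded on every path, which keeps exceptional sets out of sums; the values before
  and after the stage are demanded almost surely.\<close>

definition stage_mart :: "nat \<Rightarrow> (real \<Rightarrow> real) \<Rightarrow> (real \<Rightarrow> 'a \<Rightarrow> real) \<Rightarrow> bool" where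
  "stage_mart j f N \<longleftrightarrow> integrable gauss f \<and>
     (\<forall>\<omega>\<in>space P. continuous_on {0..} (\<lambda>t. N t \<omega>)) \<and>
     mart_to N (\<lambda>\<omega>. f (\<xi> (real j) \<omega>)) \<and>
     (AE \<omega> in P. (\<forall>t\<in>{0..real j}. N t \<omega> = (\<integral>x. f x \<partial>gauss)) \<and> (\<forall>t\<ge>real j + 1. N t \<omega> = f (\<xi> (real j) \<omega>)))"

lemma distr_noise: "distr P borel (\<xi> q) = gauss"
  using iid by (simp add: iid_gauss_def)

lemma integral_noise: "f \<in> borel_measurable borel \<Longrightarrow> (\<integral>\<omega>. f (\<xi> q \<omega>) \<partial>P) = (\<integral>x. f x \<partial>gauss)"
  for f :: "real \<Rightarrow> real"
  using integral_distr[of "\<xi> q" P borel f] by (simp add: distr_noise)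

lemma integrable_noise: "integrable gauss f \<Longrightarrow> integrable P (\<lambda>\<omega>. f (\<xi> q \<omega>))"
  for f :: "real \<Rightarrow> real"
  using integrable_distr_eq[of "\<xi> q" P borel f] by (simp add: distr_noise)

lemma stage_mart_half_line: "\<exists>N. stage_mart j (indicator {..a}) N"
proof -
  define good where "good \<omega> \<longleftrightarrow> continuous_on {0..} (\<lambda>t. W t \<omega>) \<and> \<xi> (real j) \<omega> \<noteq> a" for \<omega>
  \<comment> \<open>Exceptional paths get the constant mean; completeness makes the set of these
    paths measurable.\<close>
  define N where "N t \<omega> = (if good \<omega> then half_line j a t \<omega> else cdf gauss a)" for t \<omega>
  have "AE \<omega> in P. \<xi> (real j) \<omega> \<noteq> a"
  proof -
    have "measure gauss {a} = 0" using isCont_cdf_gauss gauss.isCont_cdf by blast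
    then have "prob {\<omega>\<in>space P. \<xi> (real j) \<omega> \<in> {a}} = 0" using iid_gauss_prob[OF iid, of "{a}"] by simp
    moreover have "{\<omega>\<in>space P. \<xi> (real j) \<omega> \<in> {a}} \<in> events" by measurable
    ultimately have "{\<omega>\<in>space P. \<xi> (real j) \<omega> \<in> {a}} \<in> null_sets P"
      by (simp add: null_sets_def emeasure_eq_measure)
    then have "AE \<omega> in P. \<omega> \<notin> {\<omega>\<in>space P. \<xi> (real j) \<omega> \<in> {a}}" by (rule AE_not_in)
    then show ?thesis using AE_space by eventually_elim auto
  qed
  then have good: "AE \<omega> in P. good \<omega>" using W_continuous by eventually_elim (simp add: good_def)
  obtain Nn where Nn: "Nn \<in> null_sets P" "{\<omega>\<in>space P. \<not> good \<omega>} \<subseteq> Nn"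
    using good by (auto simp: eventually_ae_filter)
  have goodP: "{\<omega>\<in>space P. good \<omega>} \<in> events"
  proof -
    have "{\<omega>\<in>space P. \<not> good \<omega>} \<in> events" 
      using complete_measure.complete[OF complete Nn(2,1)] .
    then have "space P - {\<omega>\<in>space P. \<not> good \<omega>} \<in> events" by auto
    moreover have "space P - {\<omega>\<in>space P. \<not> good \<omega>} = {\<omega>\<in>space P. good \<omega>}" by auto
    ultimately show ?thesis by simp
  qed
  have NP: "N t \<in> borel_measurable P" if "0 \<le> t" for t
    unfolding N_def[abs_def] using half_line_measurable_P[OF that] goodP
    by (intro measurable_If) auto
  have Neq: "AE \<omega> in P. half_line j a t \<omega> = N t \<omega>" for t
    using good by eventually_elim (simp add: N_def)
  have int: "(\<integral>x. indicat_real {..a} x \<partial>gauss) = cdf gauss a" by (simp add: cdf_def)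
  show ?thesis
  proof (intro exI[of _ N], unfold stage_mart_def, intro conjI)
    show "integrable gauss (indicat_real {..a})"
      by (intro integrable_real_indicator) (auto simp: gauss.emeasure_eq_measure)
    show "\<forall>\<omega>\<in>space P. continuous_on {0..} (\<lambda>t. N t \<omega>)"
    proof
      fix \<omega> show "continuous_on {0..} (\<lambda>t. N t \<omega>)"
        using half_line_path_continuous[of \<omega> j a] by (cases "good \<omega>") (auto simp: N_def good_def)
    qed
    show "mart_to N (\<lambda>\<omega>. indicat_real {..a} (\<xi> (real j) \<omega>))"
      unfolding mart_to_def
    proof (intro conjI ballI)
      show "integrable P (\<lambda>\<omega>. indicat_real {..a} (\<xi> (real j) \<omega>))" using half_line_martingale by (rule mart_toD)
      fix t :: real assume t: "t \<in> {0..}"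
      then have t0: "0 \<le> t" by simp
      have Neq': "AE \<omega> in P. N t \<omega> = half_line j a t \<omega>" using Neq[of t] by eventually_elim simp
      show "N t \<in> borel_measurable (F t)"
        by (rule measurable_F_AE[OF half_line_measurable[OF t0] NP[OF t0] Neq])
      show "integrable P (N t)"
        using half_line_integrable[OF t0]
        by (subst integrable_cong_AE[OF NP[OF t0] half_line_measurable_P[OF t0] Neq'])
      fix A assume A: "A \<in> sets (F t)"
      then have "A \<in> events" using sets_F t by blast
      then have "(\<integral>\<omega>\<in>A. N t \<omega> \<partial>P) = (\<integral>\<omega>\<in>A. half_line j a t \<omega> \<partial>P)"
        using NP[OF t0] half_line_measurable_P[OF t0] Neq'
        by (intro set_lebesgue_integral_cong_AE) (auto elim: eventually_mono)
      then show "(\<integral>\<omega>\<in>A. N t \<omega> \<partial>P) = (\<integral>\<omega>\<in>A. indicat_real {..a} (\<xi> (real j) \<omega>) \<partial>P)"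
        using mart_toD(4)[OF half_line_martingale t A] by simp
    qed
    show "AE \<omega> in P. (\<forall>t\<in>{0..real j}. N t \<omega> = (\<integral>x. indicat_real {..a} x \<partial>gauss)) \<and> (\<forall>t\<ge>real j + 1. N t \<omega> = indicat_real {..a} (\<xi> (real j) \<omega>))"
      using good by eventually_elim (auto simp: N_def half_line_early half_line_late cdf_def)
  qed
qed

lemma stage_mart_add: "stage_mart j f N \<Longrightarrow> stage_mart j f' N' \<Longrightarrow> stage_mart j (\<lambda>x. f x + f' x) (\<lambda>t \<omega>. N t \<omega> + N' t \<omega>)"
  unfolding stage_mart_def by (auto intro!: continuous_intros mart_to_add)

lemma stage_mart_cmult: "stage_mart j f N \<Longrightarrow> stage_mart j (\<lambda>x. c * f x) (\<lambda>t \<omega>. c * N t \<omega>)"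
  unfolding stage_mart_def by (auto intro!: continuous_intros mart_to_cmult)

lemma stage_mart_const: "stage_mart j (\<lambda>x. c) (\<lambda>t \<omega>. c)"
  unfolding stage_mart_def using gauss.prob_space by (auto intro!: mart_to_const)

end

text \<open>The Weierstrass test for the telescoping series.\<close>

lemma uniform_limit_geometric:
  fixes g :: "nat \<Rightarrow> real \<Rightarrow> real"
  assumes "\<forall>\<^sub>F n in sequentially. \<forall>t\<in>S. \<bar>g (Suc n) t - g n t\<bar> \<le> (1/2) ^ n"
  shows "uniform_limit S g (\<lambda>t. lim (\<lambda>n. g n t)) sequentially"
proof -
  define f where "f n t = g (Suc n) t - g n t" for n t
  have "uniform_limit S (\<lambda>n t. \<Sum>i<n. f i t) (\<lambda>t. suminf (\<lambda>i. f i t)) sequentially"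
    by (rule Weierstrass_m_test_ev[where M="\<lambda>n. (1/2) ^ n"]) (use assms in \<open>auto simp: f_def summable_geometric\<close>)
  then have "uniform_limit S (\<lambda>n t. g 0 t + (\<Sum>i<n. f i t)) (\<lambda>t. g 0 t + suminf (\<lambda>i. f i t)) sequentially"
    by (intro uniform_limit_add uniform_limit_const)
  moreover have "g 0 t + (\<Sum>i<n. f i t) = g n t" for n t
    using sum_lessThan_telescope[of "\<lambda>i. g i t" n] by (simp add: f_def)
  ultimately have u: "uniform_limit S g (\<lambda>t. g 0 t + suminf (\<lambda>i. f i t)) sequentially" by simp
  have "lim (\<lambda>n. g n t) = g 0 t + suminf (\<lambda>i. f i t)" if "t \<in> S" for t
    using tendsto_uniform_limitI[OF u that] by (rule limI)
  then show ?thesis using u by (subst uniform_limit_cong'[OF refl]) auto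
qed

lemma continuous_on_le_rational:
  fixes g :: "real \<Rightarrow> real"
  assumes c: "continuous_on {0..} g" and le: "\<And>q. q \<in> \<rat> \<Longrightarrow> 0 \<le> q \<Longrightarrow> g q \<le> c" and t: "0 \<le> t"
  shows "g t \<le> c"
proof (rule ccontr)
  assume "\<not> g t \<le> c"
  then have "0 < g t - c" by simp
  then obtain d where d: "0 < d" "\<And>x. x \<in> {0..} \<Longrightarrow> dist x t < d \<Longrightarrow> dist (g x) (g t) < g t - c"
    using c t unfolding continuous_on_iff by (meson atLeast_iff)
  obtain q where q: "q \<in> \<rat>" "t < q" "q < t + d" using Rats_dense_in_real[of t "t + d"] d(1) by auto
  then have "dist (g q) (g t) < g t - c" using d(2)[of q] t by (simp add: dist_real_def)
  moreover have "g q \<le> c" using le q t by simp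
  ultimately show False by (simp add: dist_real_def)
qed

context prob_space begin

text \<open>Fatou's lemma turns a Cauchy bound in the mean into a bound on the distance to the
  almost sure limit, with the same rate.\<close>

lemma L1_Cauchy_limit:
  fixes Y :: "nat \<Rightarrow> 'a \<Rightarrow> real"
  assumes Y: "\<And>i. integrable M (Y i)" and Z: "Z \<in> borel_measurable M"
    and lim: "AE \<omega> in M. (\<lambda>i. Y i \<omega>) \<longlonglongrightarrow> Z \<omega>"
    and cauchy: "\<And>i k. k \<le> i \<Longrightarrow> (\<integral>\<omega>. \<bar>Y i \<omega> - Y k \<omega>\<bar> \<partial>M) \<le> e k"
  shows "integrable M Z" "(\<integral>\<omega>. \<bar>Z \<omega> - Y k \<omega>\<bar> \<partial>M) \<le> e k"
proof -
  have Ym[measurable]: "Y i \<in> borel_measurable M" for i using Y by auto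
  note [measurable] = Z
  have e0: "0 \<le> e k" for k using cauchy[of k k] by simp
  have fatou: "(\<integral>\<^sup>+\<omega>. ennreal \<bar>Z \<omega> - Y k \<omega>\<bar> \<partial>M) \<le> ennreal (e k)" for k
  proof -
    have "(\<integral>\<^sup>+\<omega>. ennreal \<bar>Z \<omega> - Y k \<omega>\<bar> \<partial>M) = (\<integral>\<^sup>+\<omega>. liminf (\<lambda>i. ennreal \<bar>Y i \<omega> - Y k \<omega>\<bar>) \<partial>M)"
    proof (rule nn_integral_cong_AE)
      show "AE \<omega> in M. ennreal \<bar>Z \<omega> - Y k \<omega>\<bar> = liminf (\<lambda>i. ennreal \<bar>Y i \<omega> - Y k \<omega>\<bar>)"
        using lim
      proof eventually_elim
        case (elim \<omega>)
        have "(\<lambda>i. ennreal \<bar>Y i \<omega> - Y k \<omega>\<bar>) \<longlonglongrightarrow> ennreal \<bar>Z \<omega> - Y k \<omega>\<bar>"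
          by (intro tendsto_ennrealI tendsto_intros elim)
        then show ?case by (intro lim_imp_Liminf[symmetric]) auto
      qed
    qed
    also have "\<dots> \<le> liminf (\<lambda>i. \<integral>\<^sup>+\<omega>. ennreal \<bar>Y i \<omega> - Y k \<omega>\<bar> \<partial>M)"
      by (rule nn_integral_liminf) measurable
    also have "\<dots> \<le> ennreal (e k)"
    proof (rule Liminf_le)
      show "\<forall>\<^sub>F i in sequentially. (\<integral>\<^sup>+\<omega>. ennreal \<bar>Y i \<omega> - Y k \<omega>\<bar> \<partial>M) \<le> ennreal (e k)"
        using eventually_ge_at_top[of k]
      proof eventually_elim
        case (elim i)
        have "(\<integral>\<^sup>+\<omega>. ennreal \<bar>Y i \<omega> - Y k \<omega>\<bar> \<partial>M) = ennreal (\<integral>\<omega>. \<bar>Y i \<omega> - Y k \<omega>\<bar> \<partial>M)"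
          using Y by (intro nn_integral_eq_integral) auto
        then show ?case using cauchy[OF elim] by (simp add: ennreal_leI)
      qed
    qed simp
    finally show ?thesis .
  qed
  have iD: "integrable M (\<lambda>\<omega>. Z \<omega> - Y k \<omega>)" for k
    using le_less_trans[OF fatou[of k] ennreal_less_top] by (intro integrableI_bounded) auto
  from Bochner_Integration.integrable_add[OF iD[of 0] Y[of 0]] show "integrable M Z" by simp
  have "ennreal (\<integral>\<omega>. \<bar>Z \<omega> - Y k \<omega>\<bar> \<partial>M) = (\<integral>\<^sup>+\<omega>. ennreal \<bar>Z \<omega> - Y k \<omega>\<bar> \<partial>M)"
    using iD[of k] by (intro nn_integral_eq_integral[symmetric]) auto
  with fatou[of k] have "ennreal (\<integral>\<omega>. \<bar>Z \<omega> - Y k \<omega>\<bar> \<partial>M) \<le> ennreal (e k)" by simp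
  then show "(\<integral>\<omega>. \<bar>Z \<omega> - Y k \<omega>\<bar> \<partial>M) \<le> e k" using e0[of k] by (simp only: ennreal_le_iff)
qed

end

context gaussian_noise begin

text \<open>Along a fast subsequence the maximal inequality and Borel-Cantelli make the paths
  converge uniformly, hence to continuous paths, while the set integrals pass to the limit in the
  mean. The factor 2 in \<open>dom\<close> is the domination that the induction over integrable
  functions supplies.\<close>

lemma stage_mart_limit:
  assumes S: "\<And>i. stage_mart j (f i) (N i)" and f': "integrable gauss f'"
    and lim: "\<And>x. (\<lambda>i. f i x) \<longlonglongrightarrow> f' x"
    and dom: "\<And>i x. \<bar>f i x\<bar> \<le> 2 * \<bar>f' x\<bar>"
  shows "\<exists>N. stage_mart j f' N"
proof -
  let ?j = "real j"
  note Sd = S[unfolded stage_mart_def]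
  have fi: "integrable gauss (f i)" for i using Sd by blast
  have [measurable]: "f' \<in> borel_measurable borel" "f i \<in> borel_measurable borel" for i
    using borel_measurable_integrable[OF f'] borel_measurable_integrable[OF fi[of i]] by simp_all
  define e where "e i = (\<integral>x. \<bar>f i x - f' x\<bar> \<partial>gauss)" for i
  have "e \<longlonglongrightarrow> (\<integral>x. 0 \<partial>gauss)"
    unfolding e_def
  proof (rule integral_dominated_convergence[where w="\<lambda>x. 3 * \<bar>f' x\<bar>"])
    show "integrable gauss (\<lambda>x. 3 * \<bar>f' x\<bar>)" using f' by simp
    show "AE x in gauss. (\<lambda>i. \<bar>f i x - f' x\<bar>) \<longlonglongrightarrow> 0"
    proof (rule AE_I2)
      fix x
      have "(\<lambda>i. \<bar>f i x - f' x\<bar>) \<longlonglongrightarrow> \<bar>f' x - f' x\<bar>" by (intro tendsto_intros lim)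
      then show "(\<lambda>i. \<bar>f i x - f' x\<bar>) \<longlonglongrightarrow> 0" by simp
    qed
    show "AE x in gauss. norm \<bar>f i x - f' x\<bar> \<le> 3 * \<bar>f' x\<bar>" for i
    proof (rule AE_I2)
      fix x show "norm \<bar>f i x - f' x\<bar> \<le> 3 * \<bar>f' x\<bar>" using dom[of i x] by simp
    qed
  qed auto
  then have e0: "e \<longlonglongrightarrow> 0" by simp
  \<comment> \<open>The rate \<open>1/8\<close> leaves room: divided by the threshold
    \<open>(1/2) ^ i\<close> of the maximal inequality it becomes the summable
    \<open>(1/4) ^ i\<close>.\<close>
  have "\<exists>k\<ge>i. e k \<le> (1/8) ^ i" for i :: nat
  proof -
    have "\<forall>\<^sub>F k in sequentially. e k < (1/8) ^ i" by (rule order_tendstoD(2)[OF e0]) simp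
    then have "\<forall>\<^sub>F k in sequentially. i \<le> k \<and> e k < (1/8) ^ i"
      using eventually_ge_at_top[of i] by eventually_elim simp
    then obtain k where "i \<le> k \<and> e k < (1/8) ^ i" by (auto simp: eventually_sequentially)
    then show ?thesis by (auto intro: less_imp_le)
  qed
  then obtain r :: "nat \<Rightarrow> nat" where r: "\<And>i. i \<le> r i" "\<And>i. e (r i) \<le> (1/8) ^ i" by metis
  have rtop: "filterlim r at_top sequentially"
    by (rule filterlim_at_top_mono[OF filterlim_ident]) (use r(1) in auto)
  define X where "X i \<omega> = f (r i) (\<xi> ?j \<omega>)" for i \<omega>
  define Y where "Y i = N (r i)" for i
  have mY: "mart_to (Y i) (X i)" for i using Sd[of "r i"] by (simp add: X_def[abs_def] Y_def)
  have cY: "continuous_on {0..} (\<lambda>t. Y i t \<omega>)" if "\<omega> \<in> space P" for i \<omega> using Sd[of "r i"] that by (simp add: Y_def)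
  have eX: "(\<integral>\<omega>. \<bar>X i \<omega> - f' (\<xi> ?j \<omega>)\<bar> \<partial>P) \<le> (1/8) ^ i" for i
    using integral_noise[of "\<lambda>x. \<bar>f (r i) x - f' x\<bar>" ?j] r(2)[of i] by (simp add: X_def e_def)
  have iX: "integrable P (X i)" "integrable P (\<lambda>\<omega>. f' (\<xi> ?j \<omega>))" for i
    unfolding X_def[abs_def] by (intro integrable_noise fi f')+
  have XX: "(\<integral>\<omega>. \<bar>X i \<omega> - X k \<omega>\<bar> \<partial>P) \<le> 2 * (1/8) ^ k" if "k \<le> i" for i k
  proof -
    have "(\<integral>\<omega>. \<bar>X i \<omega> - X k \<omega>\<bar> \<partial>P) \<le> (\<integral>\<omega>. \<bar>X i \<omega> - f' (\<xi> ?j \<omega>)\<bar> + \<bar>X k \<omega> - f' (\<xi> ?j \<omega>)\<bar> \<partial>P)"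
      using iX by (intro integral_mono) auto
    also have "\<dots> = (\<integral>\<omega>. \<bar>X i \<omega> - f' (\<xi> ?j \<omega>)\<bar> \<partial>P) + (\<integral>\<omega>. \<bar>X k \<omega> - f' (\<xi> ?j \<omega>)\<bar> \<partial>P)"
      using iX by (intro Bochner_Integration.integral_add) auto
    also have "\<dots> \<le> (1/8) ^ i + (1/8) ^ k" by (intro add_mono eX)
    also have "(1/8::real) ^ i \<le> (1/8) ^ k" using that by (intro power_decreasing) auto
    finally show ?thesis by simp
  qed
  \<comment> \<open>The maximal inequality takes countably many times; path continuity extends the
    bound from rational to all times.\<close>
  define Q where "Q = (\<rat> \<inter> {0..} :: real set)"
  have Q: "countable Q" "Q \<subseteq> {0..}" by (auto simp: Q_def countable_rat)
  define E where "E i = {\<omega>\<in>space P. \<exists>t\<in>Q. (1/2) ^ i < \<bar>Y (Suc i) t \<omega> - Y i t \<omega>\<bar>}" for i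
  have YP[measurable]: "t \<in> {0..} \<Longrightarrow> Y i t \<in> borel_measurable P" for i t
    using mart_to_measurable[OF mY] by blast
  have EP[measurable]: "E i \<in> events" for i
  proof -
    have "{\<omega> \<in> space P. (1 / 2) ^ i < \<bar>Y (Suc i) t \<omega> - Y i t \<omega>\<bar>} \<in> events" if "t \<in> Q" for t
    proof -
    have "t \<in> {0..}" using Q(2) that by blast
    then have [measurable]: "Y i t \<in> borel_measurable P" "Y (Suc i) t \<in> borel_measurable P" using YP by blast+
    show ?thesis by measurable
    qed
    then have "(\<Union>t\<in>Q. {\<omega> \<in> space P. (1 / 2) ^ i < \<bar>Y (Suc i) t \<omega> - Y i t \<omega>\<bar>}) \<in> events"
      using Q(1) by (intro sets.countable_UN') auto
    also have "(\<Union>t\<in>Q. {\<omega> \<in> space P. (1 / 2) ^ i < \<bar>Y (Suc i) t \<omega> - Y i t \<omega>\<bar>}) = E i"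
      by (auto simp: E_def)
    finally show ?thesis .
  qed
  have pE: "prob (E i) \<le> 4 * (1/4) ^ i" for i
  proof -
    have "(1/2) ^ i * prob (E i) \<le> 2 * (\<integral>\<omega>. \<bar>X (Suc i) \<omega> - X i \<omega>\<bar> \<partial>P)"
      unfolding E_def by (rule maximal_inequality[OF mart_to_diff[OF mY mY] Q]) simp
    also have "\<dots> \<le> 4 * (1/8) ^ i" using XX[of i "Suc i"] by simp
    finally have "2 ^ i * ((1/2) ^ i * prob (E i)) \<le> 2 ^ i * (4 * (1/8) ^ i)" by (intro mult_left_mono) auto
    moreover have "2 ^ i * ((1/2) ^ i * prob (E i)) = prob (E i)" by (simp add: power_one_over)
    moreover have "2 ^ i * (4 * (1/8) ^ i) = 4 * (1/4 :: real) ^ i"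
    proof -
      have "(2::real) ^ i * (1/8) ^ i = (1/4) ^ i" by (simp add: power_mult_distrib[symmetric])
      then show ?thesis by simp
    qed
    ultimately show ?thesis by simp
  qed
  have sE: "summable (\<lambda>i. prob (E i))"
  proof (rule summable_comparison_test'[where N=0 and g="\<lambda>i. 4 * (1/4) ^ i"])
    show "summable (\<lambda>i. 4 * (1/4 :: real) ^ i)" by (intro summable_mult summable_geometric) simp
    fix n show "norm (prob (E n)) \<le> 4 * (1/4) ^ n" using pE[of n] by simp
  qed
  define good where "good \<omega> \<longleftrightarrow> (\<forall>\<^sub>F i in sequentially. \<omega> \<in> space P - E i)" for \<omega>
  have goodAE: "AE \<omega> in P. good \<omega>"
    unfolding good_def using sE by (intro borel_cantelli_AE1) (auto simp: emeasure_eq_measure)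
  have goodP[measurable]: "{\<omega>\<in>space P. good \<omega>} \<in> events"
    unfolding good_def eventually_sequentially by measurable
  have unif: "uniform_limit {0..} (\<lambda>i t. Y i t \<omega>) (\<lambda>t. lim (\<lambda>i. Y i t \<omega>)) sequentially" if "good \<omega>" for \<omega>
  proof (rule uniform_limit_geometric)
    show "\<forall>\<^sub>F n in sequentially. \<forall>t\<in>{0..}. \<bar>Y (Suc n) t \<omega> - Y n t \<omega>\<bar> \<le> (1/2) ^ n"
      using that unfolding good_def
    proof eventually_elim
      case (elim n)
      then have w: "\<omega> \<in> space P" and le: "\<And>q. q \<in> Q \<Longrightarrow> \<bar>Y (Suc n) q \<omega> - Y n q \<omega>\<bar> \<le> (1/2) ^ n"
        by (auto simp: E_def not_less)
      show ?case
      proof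
        fix t :: real assume "t \<in> {0..}"
        then have t0: "0 \<le> t" by simp
        show "\<bar>Y (Suc n) t \<omega> - Y n t \<omega>\<bar> \<le> (1/2) ^ n"
        proof (rule continuous_on_le_rational[of "\<lambda>t. \<bar>Y (Suc n) t \<omega> - Y n t \<omega>\<bar>", OF _ _ t0])
          show "continuous_on {0..} (\<lambda>t. \<bar>Y (Suc n) t \<omega> - Y n t \<omega>\<bar>)"
            by (intro continuous_on_rabs continuous_on_diff cY[OF w])
          show "\<bar>Y (Suc n) q \<omega> - Y n q \<omega>\<bar> \<le> (1/2) ^ n" if "q \<in> \<rat>" "0 \<le> q" for q
            by (rule le) (use that in \<open>simp add: Q_def\<close>)
        qed
      qed
    qed
  qed
  define N' where "N' t \<omega> = (if good \<omega> then lim (\<lambda>i. Y i t \<omega>) else (\<integral>x. f' x \<partial>gauss))" for t \<omega>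
  have N'P: "N' t \<in> borel_measurable P" if "0 \<le> t" for t
  proof -
    have "(\<lambda>\<omega>. lim (\<lambda>i. Y i t \<omega>)) \<in> borel_measurable P"
      by (rule borel_measurable_lim_metric) (use YP that in auto)
    then show ?thesis unfolding N'_def[abs_def] using goodP by (intro measurable_If) auto
  qed
  have N'lim: "(\<lambda>i. Y i t \<omega>) \<longlonglongrightarrow> N' t \<omega>" if "good \<omega>" "0 \<le> t" for t \<omega>
    using tendsto_uniform_limitI[OF unif[OF that(1)], of t] that by (simp add: N'_def)
  have fl: "(\<lambda>i. \<integral>x. f (r i) x \<partial>gauss) \<longlonglongrightarrow> (\<integral>x. f' x \<partial>gauss)"
  proof -
    have "(\<lambda>i. \<integral>x. f i x \<partial>gauss) \<longlonglongrightarrow> (\<integral>x. f' x \<partial>gauss)"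
      by (rule integral_dominated_convergence[where w="\<lambda>x. 2 * \<bar>f' x\<bar>"]) (use f' dom lim in auto)
    then show ?thesis by (rule filterlim_compose[OF _ rtop])
  qed
  show ?thesis
  proof (intro exI[of _ N'], unfold stage_mart_def, intro conjI)
    show "integrable gauss f'" by (rule f')
    show "\<forall>\<omega>\<in>space P. continuous_on {0..} (\<lambda>t. N' t \<omega>)"
    proof
      fix \<omega> assume w: "\<omega> \<in> space P"
      show "continuous_on {0..} (\<lambda>t. N' t \<omega>)"
      proof (cases "good \<omega>")
        case True
        have "continuous_on {0..} (\<lambda>t. lim (\<lambda>i. Y i t \<omega>))"
          by (rule uniform_limit_theorem[OF _ unif[OF True]]) (use cY[OF w] in auto)
        then show ?thesis using True by (simp add: N'_def)
      qed (simp add: N'_def)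
    qed
    show "mart_to N' (\<lambda>\<omega>. f' (\<xi> ?j \<omega>))"
      unfolding mart_to_def
    proof (intro conjI ballI)
      show "integrable P (\<lambda>\<omega>. f' (\<xi> ?j \<omega>))" by (rule iX)
      fix t :: real assume t: "t \<in> {0..}"
      then have t0: "0 \<le> t" by simp
      have limF: "(\<lambda>\<omega>. lim (\<lambda>i. Y i t \<omega>)) \<in> borel_measurable (F t)"
        by (rule borel_measurable_lim_metric) (rule mart_toD(2)[OF mY t])
      have eq: "AE \<omega> in P. lim (\<lambda>i. Y i t \<omega>) = N' t \<omega>" using goodAE by eventually_elim (simp add: N'_def)
      show "N' t \<in> borel_measurable (F t)" by (rule measurable_F_AE[OF limF N'P[OF t0] eq])
      have iY: "integrable P (Y i t)" for i by (rule mart_toD(3)[OF mY t])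
      have AEl: "AE \<omega> in P. (\<lambda>i. Y i t \<omega>) \<longlonglongrightarrow> N' t \<omega>" using goodAE by eventually_elim (rule N'lim[OF _ t0])
      have YY: "(\<integral>\<omega>. \<bar>Y i t \<omega> - Y k t \<omega>\<bar> \<partial>P) \<le> 2 * (1/8) ^ k" if "k \<le> i" for i k
        using mart_to_L1[OF mart_to_diff[OF mY mY] t] XX[OF that] by (rule order_trans)
      note L1 = L1_Cauchy_limit[OF iY N'P[OF t0] AEl YY]
      show iN: "integrable P (N' t)" by (rule L1(1))
      fix A assume A: "A \<in> sets (F t)"
      then have AP: "A \<in> events" using sets_F t by blast
      \<comment> \<open>The error splits into \<open>N' t\<close> against \<open>Y k t\<close>, at
        most \<open>2 * (1/8) ^ k\<close>, and \<open>X k\<close> against the limit, at most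
        \<open>(1/8) ^ k\<close>; in between, \<open>Y k t\<close> and \<open>X k\<close> have equal
        integrals over \<open>A\<close>.\<close>
      have "\<bar>(\<integral>\<omega>\<in>A. N' t \<omega> \<partial>P) - (\<integral>\<omega>\<in>A. f' (\<xi> ?j \<omega>) \<partial>P)\<bar> \<le> 3 * (1/8) ^ k" for k
      proof -
        have ind: "integrable P (\<lambda>\<omega>. indicator A \<omega> *\<^sub>R g \<omega>)" if "integrable P g" for g :: "'a \<Rightarrow> real"
          using integrable_mult_indicator[OF AP that] .
        have d: "\<bar>(\<integral>\<omega>\<in>A. g \<omega> \<partial>P) - (\<integral>\<omega>\<in>A. h \<omega> \<partial>P)\<bar> \<le> (\<integral>\<omega>. \<bar>g \<omega> - h \<omega>\<bar> \<partial>P)"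
          if gh: "integrable P g" "integrable P h" for g h :: "'a \<Rightarrow> real"
        proof -
          have "(\<integral>\<omega>\<in>A. g \<omega> \<partial>P) - (\<integral>\<omega>\<in>A. h \<omega> \<partial>P) = (\<integral>\<omega>. indicator A \<omega> *\<^sub>R g \<omega> - indicator A \<omega> *\<^sub>R h \<omega> \<partial>P)"
            unfolding set_lebesgue_integral_def using ind gh by (intro Bochner_Integration.integral_diff[symmetric])
          also have "\<bar>\<dots>\<bar> \<le> (\<integral>\<omega>. \<bar>indicator A \<omega> *\<^sub>R g \<omega> - indicator A \<omega> *\<^sub>R h \<omega>\<bar> \<partial>P)" by (rule integral_abs_bound)
          also have "\<dots> \<le> (\<integral>\<omega>. \<bar>g \<omega> - h \<omega>\<bar> \<partial>P)"
            using ind gh by (intro integral_mono Bochner_Integration.integrable_diff integrable_abs) (auto simp: indicator_def)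
          finally show ?thesis .
        qed
        have "\<bar>(\<integral>\<omega>\<in>A. N' t \<omega> \<partial>P) - (\<integral>\<omega>\<in>A. Y k t \<omega> \<partial>P)\<bar> \<le> 2 * (1/8) ^ k"
          using d[OF iN iY[of k]] L1(2)[of k] by (rule order_trans)
        moreover have "\<bar>(\<integral>\<omega>\<in>A. X k \<omega> \<partial>P) - (\<integral>\<omega>\<in>A. f' (\<xi> ?j \<omega>) \<partial>P)\<bar> \<le> (1/8) ^ k"
          using d[OF iX(1)[of k] iX(2)] eX[of k] by (rule order_trans)
        moreover have "(\<integral>\<omega>\<in>A. Y k t \<omega> \<partial>P) = (\<integral>\<omega>\<in>A. X k \<omega> \<partial>P)" by (rule mart_toD(4)[OF mY t A])
        ultimately show ?thesis by linarith
      qed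
      note bound = this
      have l: "(\<lambda>k. 3 * (1/8 :: real) ^ k) \<longlonglongrightarrow> 3 * 0" by (intro tendsto_intros LIMSEQ_power_zero) auto
      have "\<bar>(\<integral>\<omega>\<in>A. N' t \<omega> \<partial>P) - (\<integral>\<omega>\<in>A. f' (\<xi> ?j \<omega>) \<partial>P)\<bar> \<le> 3 * 0"
        by (rule LIMSEQ_le_const[OF l]) (use bound in blast)
      then show "(\<integral>\<omega>\<in>A. N' t \<omega> \<partial>P) = (\<integral>\<omega>\<in>A. f' (\<xi> ?j \<omega>) \<partial>P)" by simp
    qed
    have "AE \<omega> in P. \<forall>i. (\<forall>t\<in>{0..?j}. Y i t \<omega> = (\<integral>x. f (r i) x \<partial>gauss)) \<and> (\<forall>t\<ge>?j + 1. Y i t \<omega> = X i \<omega>)"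
      unfolding AE_all_countable using Sd by (auto simp: Y_def X_def)
    then show "AE \<omega> in P. (\<forall>t\<in>{0..?j}. N' t \<omega> = (\<integral>x. f' x \<partial>gauss)) \<and> (\<forall>t\<ge>?j + 1. N' t \<omega> = f' (\<xi> ?j \<omega>))"
      using goodAE
    proof eventually_elim
      case (elim \<omega>)
      show ?case
      proof (intro conjI ballI allI impI)
        fix t assume t: "t \<in> {0..?j}"
        then have "(\<lambda>i. \<integral>x. f (r i) x \<partial>gauss) \<longlonglongrightarrow> N' t \<omega>"
          using N'lim[OF elim(2), of t] elim(1) by simp
        then show "N' t \<omega> = (\<integral>x. f' x \<partial>gauss)" using fl by (rule LIMSEQ_unique)
      next
        fix t assume t: "?j + 1 \<le> t"
        then have "(\<lambda>i. X i \<omega>) \<longlonglongrightarrow> N' t \<omega>"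
          using N'lim[OF elim(2), of t] elim(1) by simp
        moreover have "(\<lambda>i. X i \<omega>) \<longlonglongrightarrow> f' (\<xi> ?j \<omega>)"
          unfolding X_def using filterlim_compose[OF lim rtop] .
        ultimately show "N' t \<omega> = f' (\<xi> ?j \<omega>)" by (rule LIMSEQ_unique)
      qed
    qed
  qed
qed

lemma stage_mart_sum:
  assumes "finite A" "\<And>a. a \<in> A \<Longrightarrow> \<exists>N. stage_mart j (f a) N"
  shows "\<exists>N. stage_mart j (\<lambda>x. \<Sum>a\<in>A. f a x) N"
  using assms
proof (induction A)
  case empty show ?case using stage_mart_const[of j 0] by auto
next
  case (insert a A)
  then obtain N N' where "stage_mart j (f a) N" "stage_mart j (\<lambda>x. \<Sum>a\<in>A. f a x) N'" by blast
  from stage_mart_add[OF this] show ?case using insert by auto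
qed

text \<open>Half-lines form a generator stable under intersection, so complements and disjoint
  unions lead to all Borel sets. A disjoint union is a limit of partial sums dominated by its
  indicator.\<close>

lemma stage_mart_indicator:
  assumes "A \<in> sets borel" shows "\<exists>N. stage_mart j (indicator A) N"
proof -
  have b: "sets (borel :: real measure) = sigma_sets UNIV (range atMost)"
    by (subst borel_eq_atMost) (auto simp: full_SetCompr_eq)
  have "Int_stable (range (atMost :: real \<Rightarrow> _))" by (auto simp: Int_stable_def)
  moreover have "range (atMost :: real \<Rightarrow> _) \<subseteq> Pow UNIV" by simp
  moreover have "A \<in> sigma_sets UNIV (range atMost)" using assms b by simp
  ultimately show ?thesis
  proof (induction rule: sigma_sets_induct_disjoint)
    case (basic A) then show ?case using stage_mart_half_line by auto
  next
    case empty
    have "indicator {} = (\<lambda>x::real. 0::real)" by auto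
    then show ?case using stage_mart_const[of j 0] by auto
  next
    case (compl A)
    then obtain N where "stage_mart j (indicator A) N" by blast
    from stage_mart_add[OF stage_mart_const[of j 1] stage_mart_cmult[OF this, of "-1"]]
    have "stage_mart j (\<lambda>x. 1 + - 1 * indicator A x) (\<lambda>t \<omega>. 1 + - 1 * N t \<omega>)" .
    moreover have "(\<lambda>x. 1 + - 1 * indicator A x) = (indicator (UNIV - A) :: real \<Rightarrow> real)" by (auto simp: indicator_def)
    ultimately show ?case by auto
  next
    case (union A)
    have "\<exists>N. stage_mart j (\<lambda>x. \<Sum>i<n. indicator (A i) x) N" for n
      using union by (intro stage_mart_sum) auto
    then obtain N where N: "\<And>n. stage_mart j (\<lambda>x. \<Sum>i<n. indicator (A i) x) (N n)" by metis
    have UB: "(\<Union>i. A i) \<in> sets borel" using union(2) unfolding b[symmetric] by auto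
    have le: "(\<Sum>i<n. indicator (A i) x) \<le> (indicator (\<Union>i. A i) x :: real)" for n x
    proof -
      have "(\<Sum>i<n. indicator (A i) x) = (indicator (\<Union>i<n. A i) x :: real)"
        using union(1) by (intro indicator_UN_disjoint[symmetric]) (auto simp: disjoint_family_on_def)
      then show ?thesis by (auto simp: indicator_def)
    qed
    show ?case
    proof (rule stage_mart_limit[OF N])
      show "integrable gauss (indicat_real (\<Union>i. A i))"
        using UB by (intro integrable_real_indicator) (auto simp: gauss.emeasure_eq_measure)
      fix x :: real
      show "(\<lambda>n. \<Sum>i<n. indicator (A i) x) \<longlonglongrightarrow> indicat_real (\<Union>i. A i) x"
        using indicator_sums[of A x] union(1) by (auto simp: sums_def disjoint_family_on_def)
      fix i show "\<bar>\<Sum>i<i. indicat_real (A i) x\<bar> \<le> 2 * \<bar>indicat_real (\<Union>i. A i) x\<bar>"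
        using le[of x i] sum_nonneg[of "{..<i}" "\<lambda>i. indicat_real (A i) x"] by simp
    qed
  qed
qed

theorem stage_mart_exists:
  assumes "integrable gauss f" shows "\<exists>N. stage_mart j f N"
  using assms
proof (induction rule: integrable_induct)
  case (base A c)
  then obtain N where "stage_mart j (indicator A) N" using stage_mart_indicator[of A] by auto
  from stage_mart_cmult[OF this, of c] show ?case by (auto simp: mult.commute)
next
  case (add f g)
  then show ?case using stage_mart_add by blast
next
  case (lim f s)
  then obtain N where "\<And>i. stage_mart j (s i) (N i)" by metis
  then show ?case
    by (rule stage_mart_limit) (use lim in auto)
qed

end

section \<open>Tools for joining the stages\<close>

context gaussian_noise begin

lemma complete_set: "N \<in> null_sets P \<Longrightarrow> E \<subseteq> N \<Longrightarrow> E \<in> events"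
  using complete_measure.complete[OF complete] by blast

lemma AE_set_in_events:
  assumes "AE \<omega> in P. \<phi> \<omega>" shows "{\<omega>\<in>space P. \<phi> \<omega>} \<in> events"
proof -
  obtain N where N: "N \<in> null_sets P" "{\<omega>\<in>space P. \<not> \<phi> \<omega>} \<subseteq> N"
    using assms by (auto simp: eventually_ae_filter)
  then have "space P - {\<omega>\<in>space P. \<not> \<phi> \<omega>} \<in> events" using complete_set by blast
  moreover have "space P - {\<omega>\<in>space P. \<not> \<phi> \<omega>} = {\<omega>\<in>space P. \<phi> \<omega>}" by auto
  ultimately show ?thesis by simp
qed

text \<open>A nonnegative martingale does not recover from zero, read backwards from the end: over
  the event that the path gets below \<open>1 / real (Suc n)\<close> the final value has integral at
  most \<open>1 / real (Suc n)\<close>, so it vanishes almost surely where this happens for all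
  \<open>n\<close>.\<close>

lemma positive_paths:
  assumes m: "mart_to Y X" and c: "\<And>\<omega>. \<omega> \<in> space P \<Longrightarrow> continuous_on {0..} (\<lambda>t. Y t \<omega>)"
    and X: "AE \<omega> in P. 0 \<le> X \<omega>"
  shows "AE \<omega> in P. 0 < X \<omega> \<longrightarrow> (\<forall>t\<ge>0. 0 < Y t \<omega>)"
proof -
  define Q where "Q = (\<rat> \<inter> {0..} :: real set)"
  have Q: "countable Q" "Q \<subseteq> {0..}" by (auto simp: Q_def countable_rat)
  define H where "H n = {\<omega>\<in>space P. \<exists>t\<in>Q. Y t \<omega> \<le> 1 / real (Suc n)}" for n
  have HP: "H n \<in> events" for n
  proof -
    have "{\<omega>\<in>space P. Y t \<omega> \<le> 1 / real (Suc n)} \<in> events" if "t \<in> Q" for t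
      using level_sets(2)[OF m] sets_F that Q(2) by blast
    then have "(\<Union>t\<in>Q. {\<omega>\<in>space P. Y t \<omega> \<le> 1 / real (Suc n)}) \<in> events"
      using Q(1) by (intro sets.countable_UN') auto
    also have "(\<Union>t\<in>Q. {\<omega>\<in>space P. Y t \<omega> \<le> 1 / real (Suc n)}) = H n" by (auto simp: H_def)
    finally show ?thesis .
  qed
  have iX: "integrable P X" by (rule mart_toD(1)[OF m])
  let ?H = "\<Inter>n. H n"
  have HH: "?H \<in> events" using HP by auto
  have i: "integrable P (\<lambda>\<omega>. indicator A \<omega> * X \<omega>)" if "A \<in> events" for A
    using integrable_mult_indicator[OF that iX] by simp
  have "(\<integral>\<omega>. indicator ?H \<omega> * X \<omega> \<partial>P) \<le> 1 / real (Suc n)" for n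
  proof -
    have "(\<integral>\<omega>. indicator ?H \<omega> * X \<omega> \<partial>P) \<le> (\<integral>\<omega>. indicator (H n) \<omega> * X \<omega> \<partial>P)"
    proof (rule integral_mono_AE[OF i[OF HH] i[OF HP]])
      show "AE \<omega> in P. indicator ?H \<omega> * X \<omega> \<le> indicator (H n) \<omega> * X \<omega>"
        using X by eventually_elim (auto simp: indicator_def)
    qed
    also have "\<dots> = (\<integral>\<omega>\<in>H n. X \<omega> \<partial>P)" by (simp add: set_lebesgue_integral_def)
    also have "\<dots> \<le> 1 / real (Suc n)" unfolding H_def by (rule small_value_integral[OF m Q]) simp
    finally show ?thesis .
  qed
  then have "(\<integral>\<omega>. indicator ?H \<omega> * X \<omega> \<partial>P) \<le> 0"
    by (intro LIMSEQ_le_const[OF LIMSEQ_Suc[OF lim_const_over_n]]) blast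
  moreover have nn: "AE \<omega> in P. 0 \<le> indicator ?H \<omega> * X \<omega>" using X by eventually_elim auto
  ultimately have "(\<integral>\<omega>. indicator ?H \<omega> * X \<omega> \<partial>P) = 0" using integral_nonneg_AE[OF nn] by simp
  then have "AE \<omega> in P. indicator ?H \<omega> * X \<omega> = 0"
    using integral_nonneg_eq_0_iff_AE[OF i[OF HH] nn] by simp
  then show ?thesis using AE_space
  proof eventually_elim
    case (elim \<omega>)
    show ?case
    proof (intro impI allI)
      fix t :: real assume X: "0 < X \<omega>" and t: "0 \<le> t"
      then have "\<omega> \<notin> ?H" using elim(1) by (auto simp: indicator_def split: if_splits)
      then obtain n where n: "\<omega> \<notin> H n" by blast
      have "- Y t \<omega> \<le> - (1 / real (Suc n))"
      proof (rule continuous_on_le_rational[of "\<lambda>t. - Y t \<omega>", OF _ _ t])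
        show "continuous_on {0..} (\<lambda>t. - Y t \<omega>)" by (intro continuous_on_minus c elim)
        fix q :: real assume "q \<in> \<rat>" "0 \<le> q"
        then show "- Y q \<omega> \<le> - (1 / real (Suc n))" using n elim(2) by (auto simp: H_def Q_def not_le intro: less_imp_le)
      qed
      moreover have "0 < 1 / real (Suc n)" by simp
      ultimately show "0 < Y t \<omega>" by linarith
    qed
  qed
qed

lemma mart_to_stop_time:
  assumes m: "mart_to Y X" and k: "0 \<le> k"
  shows "mart_to (\<lambda>t. Y (min t k)) (Y k)"
  unfolding mart_to_def
proof (intro conjI ballI)
  have k': "k \<in> {0..}" using k by simp
  show "integrable P (Y k)" by (rule mart_toD(3)[OF m k'])
  fix t :: real assume t: "t \<in> {0..}"
  then have mt: "min t k \<in> {0..}" using k by simp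
  show "integrable P (Y (min t k))" by (rule mart_toD(3)[OF m mt])
  have "subalgebra (F t) (F (min t k))"
    using F_mono[of "min t k" t] by (auto simp: subalgebra_def space_F_eq)
  then show "Y (min t k) \<in> borel_measurable (F t)" using mart_toD(2)[OF m mt] by (rule measurable_from_subalg)
  fix A assume A: "A \<in> sets (F t)"
  show "(\<integral>\<omega>\<in>A. Y (min t k) \<omega> \<partial>P) = (\<integral>\<omega>\<in>A. Y k \<omega> \<partial>P)"
  proof (cases "t \<le> k")
    case True
    then have "A \<in> sets (F k)" using F_mono[OF True] A by auto
    then show ?thesis using mart_toD(4)[OF m t A] mart_toD(4)[OF m k'] True by (simp add: min_absorb1)
  qed (simp add: min_absorb2)
qed

text \<open>The stage martingale of \<open>f\<close> sits at its mean at time \<open>j\<close>, so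
  its integral over an event of \<open>F (real j)\<close> is that of a constant. Independence of the
  noise from the augmented filtration is thus read off the martingale.\<close>

lemma stage_independence:
  assumes f: "integrable gauss f" and A: "A \<in> sets (F (real j))"
  shows "(\<integral>\<omega>\<in>A. f (\<xi> (real j) \<omega>) \<partial>P) = prob A * (\<integral>x. f x \<partial>gauss)"
proof -
  obtain N where N: "stage_mart j f N" using stage_mart_exists[OF f] by blast
  have j: "real j \<in> {0..}" by simp
  have mN: "mart_to N (\<lambda>\<omega>. f (\<xi> (real j) \<omega>))" using N by (simp add: stage_mart_def)
  have AP: "A \<in> events" using A sets_F j by blast
  have "(\<integral>\<omega>\<in>A. f (\<xi> (real j) \<omega>) \<partial>P) = (\<integral>\<omega>\<in>A. N (real j) \<omega> \<partial>P)"
    by (rule mart_toD(4)[OF mN j A, symmetric])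
  also have "\<dots> = (\<integral>\<omega>\<in>A. (\<integral>x. f x \<partial>gauss) \<partial>P)"
  proof (rule set_lebesgue_integral_cong_AE[OF AP])
    have "AE \<omega> in P. N (real j) \<omega> = (\<integral>x. f x \<partial>gauss)" using N unfolding stage_mart_def by (auto elim!: eventually_mono)
    then show "AE \<omega>\<in>A in P. N (real j) \<omega> = (\<integral>x. f x \<partial>gauss)" by eventually_elim simp
    show "N (real j) \<in> borel_measurable P" by (rule mart_to_measurable[OF mN j])
  qed simp
  also have "\<dots> = prob A * (\<integral>x. f x \<partial>gauss)" using AP by (simp add: set_lebesgue_integral_def)
  finally show ?thesis .
qed

end

section \<open>The martingale built from the stages\<close>

locale staged_model = gaussian_noise P \<xi> for P :: "'a measure" and \<xi> +
  fixes m :: nat and B :: "nat \<Rightarrow> real" and y :: "nat \<Rightarrow> real \<Rightarrow> real" and T :: real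
  assumes T: "0 < T"
    and B_mono: "\<And>j. j < m \<Longrightarrow> B j \<le> B (Suc j)"
    and y_int: "\<And>j. j \<le> m \<Longrightarrow> integrable gauss (y j)"
    and y_mean: "\<And>j. j \<le> m \<Longrightarrow> (\<integral>z. y j z \<partial>gauss) = B j"
    and y_pos: "\<And>j z. j \<le> m \<Longrightarrow> 0 < y j z"
    and y_le: "\<And>j z. j < m \<Longrightarrow> y j z \<le> B (Suc j)"
begin

text \<open>The event that stage \<open>j\<close> is active: the path has landed on the barriers 1
  to \<open>j\<close> one after the other. \<open>B 0\<close> is the starting price, so stage 0 is
  always active.\<close>

fun A :: "nat \<Rightarrow> 'a set" where
  "A 0 = space P"
| "A (Suc j) = {\<omega>\<in>A j. y j (\<xi> (real j) \<omega>) = B (Suc j)}"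

text \<open>The state at time \<open>j\<close>; a path that missed a barrier keeps the value where
  it landed.\<close>

fun X :: "nat \<Rightarrow> 'a \<Rightarrow> real" where
  "X 0 \<omega> = B 0"
| "X (Suc j) \<omega> = (if \<omega> \<in> A j then y j (\<xi> (real j) \<omega>) else X j \<omega>)"

lemma y_measurable: "j \<le> m \<Longrightarrow> y j \<in> borel_measurable borel"
  using borel_measurable_integrable[OF y_int] by simp

lemma A_decreasing: "i \<le> j \<Longrightarrow> A j \<subseteq> A i"
  by (induction j rule: dec_induct) auto

lemma A_F: "j \<le> Suc m \<Longrightarrow> A j \<in> sets (F (real j))"
proof (induction j)
  case 0 then show ?case using sets.top[of "F 0"] by (simp add: space_F_eq)
next
  case (Suc j)
  have AF: "A j \<in> sets (F (real (Suc j)))" using Suc F_mono[of "real j" "real (Suc j)"] by auto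
  have [measurable]: "\<xi> (real j) \<in> borel_measurable (F (real (Suc j)))"
    by (rule noise_measurable_F) simp
  have [measurable]: "y j \<in> borel_measurable borel" using Suc by (intro y_measurable) auto
  have "{\<omega>\<in>space (F (real (Suc j))). y j (\<xi> (real j) \<omega>) = B (Suc j)} \<in> sets (F (real (Suc j)))"
    by measurable
  then have "A j \<inter> {\<omega>\<in>space P. y j (\<xi> (real j) \<omega>) = B (Suc j)} \<in> sets (F (real (Suc j)))"
    using AF by (simp add: space_F_eq)
  moreover have "A j \<subseteq> space P" using A_decreasing[of 0 j] by simp
  then have "A j \<inter> {\<omega>\<in>space P. y j (\<xi> (real j) \<omega>) = B (Suc j)} = A (Suc j)" by auto
  ultimately show ?case by simp
qed

lemma A_events: "j \<le> Suc m \<Longrightarrow> A j \<in> events"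
  using A_F sets_F by (meson atLeast_iff of_nat_0_le_iff)

text \<open>Given that stage \<open>j\<close> is active, its noise is independent of the past, so
  the probability is multiplied by the atom of the stage law at the next barrier.\<close>

lemma A_prob:
  assumes "j \<le> m"
  shows "prob (A (Suc j)) = prob (A j) * measure gauss {z. y j z = B (Suc j)}"
proof -
  let ?E = "{z. y j z = B (Suc j)}"
  have [measurable]: "y j \<in> borel_measurable borel" using assms by (rule y_measurable)
  have "{z\<in>space borel. y j z = B (Suc j)} \<in> sets borel" by measurable
  then have E: "?E \<in> sets borel" by simp
  have "(\<integral>\<omega>\<in>A j. indicat_real ?E (\<xi> (real j) \<omega>) \<partial>P) = prob (A j) * (\<integral>x. indicat_real ?E x \<partial>gauss)"
    using assms E by (intro stage_independence A_F integrable_real_indicator) (auto simp: gauss.emeasure_eq_measure)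
  also have "(\<integral>\<omega>\<in>A j. indicat_real ?E (\<xi> (real j) \<omega>) \<partial>P) = (\<integral>\<omega>. indicat_real (A (Suc j)) \<omega> \<partial>P)"
    unfolding set_lebesgue_integral_def by (intro Bochner_Integration.integral_cong) (auto simp: indicator_def)
  also have "\<dots> = prob (A (Suc j))" using A_events[of "Suc j"] assms by simp
  also have "(\<integral>x. indicat_real ?E x \<partial>gauss) = measure gauss ?E" using E by simp
  finally show ?thesis .
qed

lemma X_on_A: "\<omega> \<in> A j \<Longrightarrow> X j \<omega> = B j"
  by (cases j) auto

text \<open>Missing a barrier under \<open>y_le\<close> means landing strictly below it, and since
  the barriers increase the gap persists.\<close>

lemma X_off_A: "j \<le> m \<Longrightarrow> \<omega> \<in> space P \<Longrightarrow> \<omega> \<notin> A j \<Longrightarrow> X j \<omega> < B j"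
proof (induction j)
  case (Suc j)
  show ?case
  proof (cases "\<omega> \<in> A j")
    case True
    then show ?thesis using Suc y_le[of j "\<xi> (real j) \<omega>"] by auto
  next
    case False
    then show ?thesis using Suc B_mono[of j] by auto
  qed
qed simp

lemma X_Suc: "X (Suc j) \<omega> = X j \<omega> + indicator (A j) \<omega> * (y j (\<xi> (real j) \<omega>) - B j)"
  using X_on_A[of \<omega> j] by (cases "\<omega> \<in> A j") auto

lemma X_sum: "X k \<omega> = B 0 + (\<Sum>j<k. indicator (A j) \<omega> * (y j (\<xi> (real j) \<omega>) - B j))"
proof (induction k)
  case (Suc k) then show ?case by (simp only: X_Suc sum.lessThan_Suc add.assoc)
qed simp

lemma X_pos: "\<omega> \<in> space P \<Longrightarrow> 0 < B 0 \<Longrightarrow> k \<le> Suc m \<Longrightarrow> 0 < X k \<omega>"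
  by (induction k) (auto simp: y_pos)

lemma X_bound: "B 0 \<le> C \<Longrightarrow> (\<And>j z. j \<le> m \<Longrightarrow> y j z \<le> C) \<Longrightarrow> k \<le> Suc m \<Longrightarrow> X k \<omega> \<le> C"
  by (induction k) auto

text \<open>In stage \<open>j\<close> the payoff changes only on \<open>A j\<close>, by a function
  of noise that is independent of \<open>A j\<close>; the changes telescope.\<close>

lemma X_call:
  assumes k: "k \<le> Suc m"
  shows "integrable P (\<lambda>\<omega>. max (X k \<omega> - x) 0)" (is ?i)
    "(\<integral>\<omega>. max (X k \<omega> - x) 0 \<partial>P) = max (B 0 - x) 0
      + (\<Sum>j<k. prob (A j) * ((\<integral>z. max (y j z - x) 0 \<partial>gauss) - max (B j - x) 0))" (is ?e)
proof -
  define g where "g j z = max (y j z - x) 0 - max (B j - x) 0" for j z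
  have gi: "integrable gauss (g j)" if "j \<le> m" for j
    unfolding g_def using y_int[OF that] by (intro Bochner_Integration.integrable_diff integrable_max) auto
  have X: "max (X k \<omega> - x) 0 = max (B 0 - x) 0 + (\<Sum>j<k. indicator (A j) \<omega> * g j (\<xi> (real j) \<omega>))" for \<omega>
  proof (induction k)
    case (Suc k)
    have "max (X (Suc k) \<omega> - x) 0 = max (X k \<omega> - x) 0 + indicator (A k) \<omega> * g k (\<xi> (real k) \<omega>)"
      using X_on_A[of \<omega> k] by (cases "\<omega> \<in> A k") (auto simp: g_def)
    then show ?case using Suc by (simp only: sum.lessThan_Suc)
  qed simp
  have ii: "integrable P (\<lambda>\<omega>. indicator (A j) \<omega> * g j (\<xi> (real j) \<omega>))" if "j < k" for j
    using integrable_mult_indicator[OF A_events integrable_noise[OF gi], of j j] that k by simp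
  show ?i unfolding X using ii by (intro Bochner_Integration.integrable_add Bochner_Integration.integrable_sum) auto
  have "(\<integral>\<omega>. max (X k \<omega> - x) 0 \<partial>P) = max (B 0 - x) 0 + (\<Sum>j<k. (\<integral>\<omega>\<in>A j. g j (\<xi> (real j) \<omega>) \<partial>P))"
  proof -
    have "(\<integral>\<omega>. max (X k \<omega> - x) 0 \<partial>P) = (\<integral>\<omega>. max (B 0 - x) 0 \<partial>P)
        + (\<integral>\<omega>. (\<Sum>j<k. indicator (A j) \<omega> * g j (\<xi> (real j) \<omega>)) \<partial>P)"
      unfolding X using ii by (intro Bochner_Integration.integral_add Bochner_Integration.integrable_sum) simp_all
    also have "(\<integral>\<omega>. max (B 0 - x) 0 \<partial>P) = max (B 0 - x) 0" using prob_space by simp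
    also have "(\<integral>\<omega>. (\<Sum>j<k. indicator (A j) \<omega> * g j (\<xi> (real j) \<omega>)) \<partial>P)
        = (\<Sum>j<k. \<integral>\<omega>. indicator (A j) \<omega> * g j (\<xi> (real j) \<omega>) \<partial>P)"
      by (rule Bochner_Integration.integral_sum) (use ii in simp)
    finally show ?thesis by (simp only: set_lebesgue_integral_def real_scaleR_def)
  qed
  also have "(\<Sum>j<k. (\<integral>\<omega>\<in>A j. g j (\<xi> (real j) \<omega>) \<partial>P)) = (\<Sum>j<k. prob (A j) * ((\<integral>z. max (y j z - x) 0 \<partial>gauss) - max (B j - x) 0))"
  proof (rule sum.cong[OF refl])
    fix j assume "j \<in> {..<k}"
    then have j: "j \<le> m" using k by auto
    have "(\<integral>\<omega>\<in>A j. g j (\<xi> (real j) \<omega>) \<partial>P) = prob (A j) * (\<integral>z. g j z \<partial>gauss)"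
      using j by (intro stage_independence gi A_F) auto
    also have "(\<integral>z. g j z \<partial>gauss) = (\<integral>z. max (y j z - x) 0 \<partial>gauss) - max (B j - x) 0"
      unfolding g_def using y_int[OF j] gauss.prob_space
      by (subst Bochner_Integration.integral_diff) (auto intro!: integrable_max)
    finally show "(\<integral>\<omega>\<in>A j. g j (\<xi> (real j) \<omega>) \<partial>P) = prob (A j) * ((\<integral>z. max (y j z - x) 0 \<partial>gauss) - max (B j - x) 0)" .
  qed
  finally show ?e .
qed

definition N :: "nat \<Rightarrow> real \<Rightarrow> 'a \<Rightarrow> real" where
  "N j = (SOME N. stage_mart j (y j) N)"

lemma N: "j \<le> m \<Longrightarrow> stage_mart j (y j) (N j)"
  unfolding N_def using stage_mart_exists[OF y_int] by (rule someI_ex)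

text \<open>Each stage martingale, centred at \<open>B j\<close>, is switched on by
  \<open>A j\<close>. Before time \<open>j\<close> it is almost surely zero, so the switch acts only
  once \<open>A j\<close> is known.\<close>

definition S :: "real \<Rightarrow> 'a \<Rightarrow> real" where
  "S t \<omega> = B 0 + (\<Sum>j\<le>m. indicator (A j) \<omega> * (N j t \<omega> - B j))"

lemma S_continuous: "\<omega> \<in> space P \<Longrightarrow> continuous_on {0..} (\<lambda>t. S t \<omega>)"
  unfolding S_def using N unfolding stage_mart_def by (intro continuous_intros) auto

lemma mart_to_sum:
  fixes Y :: "nat \<Rightarrow> real \<Rightarrow> 'a \<Rightarrow> real" and Z :: "nat \<Rightarrow> 'a \<Rightarrow> real"
  assumes "finite J" "\<And>j. j \<in> J \<Longrightarrow> mart_to (Y j) (Z j)"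
  shows "mart_to (\<lambda>t \<omega>. \<Sum>j\<in>J. Y j t \<omega>) (\<lambda>\<omega>. \<Sum>j\<in>J. Z j \<omega>)"
  using assms
proof (induction J)
  case empty then show ?case using mart_to_const[of 0] by simp
next
  case (insert j J) then show ?case using mart_to_add by simp
qed

lemma S_martingale: "mart_to S (X (Suc m))"
proof -
  have "mart_to (\<lambda>t \<omega>. indicator (A j) \<omega> * (N j t \<omega> - B j)) (\<lambda>\<omega>. indicator (A j) \<omega> * (y j (\<xi> (real j) \<omega>) - B j))"
    (is "mart_to ?Y ?Z") if j: "j \<le> m" for j
  proof -
    define D where "D t \<omega> = N j t \<omega> - B j" for t \<omega>
    have mD: "mart_to D (\<lambda>\<omega>. y j (\<xi> (real j) \<omega>) - B j)"
      unfolding D_def using N[OF j] by (intro mart_to_diff mart_to_const) (auto simp: stage_mart_def)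
    have AP: "A j \<in> events" using A_events j by simp
    have D0: "AE \<omega> in P. \<forall>t\<in>{0..real j}. D t \<omega> = 0"
    proof -
      have "AE \<omega> in P. \<forall>t\<in>{0..real j}. N j t \<omega> = B j"
        using N[OF j] y_mean[OF j] by (auto simp: stage_mart_def elim!: eventually_mono)
      then show ?thesis by eventually_elim (simp add: D_def)
    qed
    have jj: "real j \<in> {0..}" by simp
    show ?thesis unfolding D_def[symmetric] mart_to_def
    proof (intro conjI ballI)
      show "integrable P ?Z" using integrable_mult_indicator[OF AP mart_toD(1)[OF mD]] by simp
      fix t :: real assume t: "t \<in> {0..}"
      have iD: "integrable P (D t)" by (rule mart_toD(3)[OF mD t])
      show "integrable P (\<lambda>\<omega>. indicator (A j) \<omega> * D t \<omega>)"
        using integrable_mult_indicator[OF AP iD] by simp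
      have DP: "D t \<in> borel_measurable P" using iD by auto
      show "(\<lambda>\<omega>. indicator (A j) \<omega> * D t \<omega>) \<in> borel_measurable (F t)"
      proof (cases "real j \<le> t")
        case True
        then have [measurable]: "A j \<in> sets (F t)" using A_F[of j] j F_mono[OF True] by auto
        have [measurable]: "D t \<in> borel_measurable (F t)" by (rule mart_toD(2)[OF mD t])
        show ?thesis by measurable
      next
        case False
        \<comment> \<open>Before time \<open>j\<close> the event \<open>A j\<close> may be unknown,
          but the product is almost surely zero, which suffices in a filtration that contains the
          null sets.\<close>
        have z: "AE \<omega> in P. 0 = indicator (A j) \<omega> * D t \<omega>" using D0 t False by (auto elim!: eventually_mono)
        have b: "(\<lambda>\<omega>. indicator (A j) \<omega> * D t \<omega>) \<in> borel_measurable P" using DP AP by measurable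
        have a: "(\<lambda>_. 0 :: real) \<in> borel_measurable (F t)" by simp
        show ?thesis by (rule measurable_F_AE[OF a b z])
      qed
      fix E assume E: "E \<in> sets (F t)"
      have e: "(\<integral>\<omega>\<in>E. indicator (A j) \<omega> * h \<omega> \<partial>P) = (\<integral>\<omega>\<in>E \<inter> A j. h \<omega> \<partial>P)" for h :: "'a \<Rightarrow> real"
        unfolding set_lebesgue_integral_def by (intro Bochner_Integration.integral_cong) (auto simp: indicator_def)
      show "(\<integral>\<omega>\<in>E. indicator (A j) \<omega> * D t \<omega> \<partial>P) = (\<integral>\<omega>\<in>E. indicator (A j) \<omega> * (y j (\<xi> (real j) \<omega>) - B j) \<partial>P)"
      proof (cases "real j \<le> t")
        case True
        then have "E \<inter> A j \<in> sets (F t)" using A_F[of j] j F_mono[OF True] E by auto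
        then show ?thesis unfolding e by (rule mart_toD(4)[OF mD t])
      next
        case False
        \<comment> \<open>The identity is moved to time \<open>j\<close>, where \<open>A j\<close>
          is known; both \<open>D t\<close> and \<open>D (real j)\<close> vanish almost
          surely.\<close>
        then have EA: "E \<inter> A j \<in> sets (F (real j))" using A_F[of j] j F_mono[of t "real j"] E by auto
        then have EAP: "E \<inter> A j \<in> events" using sets_F jj by blast
        have "(\<integral>\<omega>\<in>E \<inter> A j. D t \<omega> \<partial>P) = (\<integral>\<omega>\<in>E \<inter> A j. D (real j) \<omega> \<partial>P)"
          using D0 t False DP mart_to_measurable[OF mD jj]
          by (intro set_lebesgue_integral_cong_AE EAP) (auto elim!: eventually_mono)
        also have "\<dots> = (\<integral>\<omega>\<in>E \<inter> A j. y j (\<xi> (real j) \<omega>) - B j \<partial>P)" by (rule mart_toD(4)[OF mD jj EA])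
        finally show ?thesis unfolding e .
      qed
    qed
  qed
  then have "mart_to (\<lambda>t \<omega>. B 0 + (\<Sum>j\<in>{..m}. indicator (A j) \<omega> * (N j t \<omega> - B j)))
      (\<lambda>\<omega>. B 0 + (\<Sum>j\<in>{..m}. indicator (A j) \<omega> * (y j (\<xi> (real j) \<omega>) - B j)))"
    by (intro mart_to_add mart_to_const mart_to_sum) auto
  then show ?thesis unfolding S_def[abs_def] X_sum[abs_def] lessThan_Suc_atMost .
qed

text \<open>The almost sure facts about a path in one place. For a path off \<open>A k\<close> the
  last two clauses show that \<open>B k\<close> is never reached: strictly below until
  \<open>k\<close>, and frozen from then on.\<close>

definition good :: "'a \<Rightarrow> bool" where
  "good \<omega> \<longleftrightarrow> (\<forall>t\<ge>0. 0 < S t \<omega>) \<and> (\<forall>t\<ge>real (Suc m). S t \<omega> = X (Suc m) \<omega>) \<and>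
     (\<forall>k\<le>m. S (real k) \<omega> = X k \<omega> \<and> (\<omega> \<notin> A k \<longrightarrow> (\<forall>t\<ge>real k. S t \<omega> = X k \<omega>) \<and> (\<forall>t\<in>{0..real k}. S t \<omega> < B k)))"

lemma good_AE: assumes B0: "0 < B 0" shows "AE \<omega> in P. good \<omega>"
proof -
  have AEN: "AE \<omega> in P. \<forall>j\<le>m. (\<forall>t\<in>{0..real j}. N j t \<omega> = B j) \<and> (\<forall>t\<ge>real j + 1. N j t \<omega> = y j (\<xi> (real j) \<omega>))"
  proof -
    have "AE \<omega> in P. \<forall>j\<in>{..m}. (\<forall>t\<in>{0..real j}. N j t \<omega> = B j) \<and> (\<forall>t\<ge>real j + 1. N j t \<omega> = y j (\<xi> (real j) \<omega>))"
      using N y_mean by (intro AE_finite_allI) (auto simp: stage_mart_def)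
    then show ?thesis by eventually_elim auto
  qed
  \<comment> \<open>Finished stages contribute their final values. A later stage contributes
    nothing, either because it has not started at time \<open>k\<close> or because it is switched
    off.\<close>
  have S_eq: "S t \<omega> = X k \<omega>"
    if h: "\<forall>j\<le>m. (\<forall>t\<in>{0..real j}. N j t \<omega> = B j) \<and> (\<forall>t\<ge>real j + 1. N j t \<omega> = y j (\<xi> (real j) \<omega>))"
      and k: "k \<le> Suc m" and t: "real k \<le> t" and c: "t = real k \<or> k = Suc m \<or> \<omega> \<notin> A k" for \<omega> t k
  proof -
    have "(\<Sum>j\<in>{..m}. indicator (A j) \<omega> * (N j t \<omega> - B j)) = (\<Sum>j\<in>{..<k}. indicator (A j) \<omega> * (y j (\<xi> (real j) \<omega>) - B j))"
    proof (rule sum.mono_neutral_cong_right)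
      show "{..<k} \<subseteq> {..m}" using k by auto
      show "\<forall>i\<in>{..m} - {..<k}. indicator (A i) \<omega> * (N i t \<omega> - B i) = 0"
      proof
        fix i assume i: "i \<in> {..m} - {..<k}"
        then have "k \<le> i" "i \<le> m" by auto
        then consider "t = real k" | "\<omega> \<notin> A i" using c A_decreasing[of k i] by auto
        then show "indicator (A i) \<omega> * (N i t \<omega> - B i) = 0"
        proof cases
          case 1 then show ?thesis using h \<open>k \<le> i\<close> \<open>i \<le> m\<close> by simp
        qed simp
      qed
      fix j assume "j \<in> {..<k}"
      then have "real j + 1 \<le> t" "j \<le> m" using t k by auto
      then show "indicator (A j) \<omega> * (N j t \<omega> - B j) = indicator (A j) \<omega> * (y j (\<xi> (real j) \<omega>) - B j)"
        using h by simp
    qed simp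
    then show ?thesis unfolding S_def X_sum by simp
  qed
  have pos: "AE \<omega> in P. 0 < X (Suc m) \<omega> \<longrightarrow> (\<forall>t\<ge>0. 0 < S t \<omega>)"
  proof (rule positive_paths[OF S_martingale S_continuous])
    show "AE \<omega> in P. 0 \<le> X (Suc m) \<omega>"
    proof (rule AE_I2)
      fix \<omega> assume "\<omega> \<in> space P"
      then show "0 \<le> X (Suc m) \<omega>" using X_pos[OF _ B0, of \<omega> "Suc m"] by (simp del: X.simps)
    qed
  qed
  \<comment> \<open>\<open>positive_paths\<close> is applied to the distance to \<open>B k\<close>,
    stopped at time \<open>k\<close>. It is nonnegative at the end, so a path that ends below
    \<open>B k\<close> has not touched \<open>B k\<close> on the way.\<close>
  have below: "AE \<omega> in P. \<forall>k\<in>{..m}. 0 < B k - S (real k) \<omega> \<longrightarrow> (\<forall>t\<ge>0. 0 < B k - S (min t (real k)) \<omega>)"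
  proof (rule AE_finite_allI)
    fix k assume "k \<in> {..m}"
    then have k: "k \<le> m" by simp
    have mk: "mart_to (\<lambda>t \<omega>. B k - S (min t (real k)) \<omega>) (\<lambda>\<omega>. B k - S (real k) \<omega>)"
      by (intro mart_to_diff mart_to_const mart_to_stop_time[OF S_martingale]) simp
    show "AE \<omega> in P. 0 < B k - S (real k) \<omega> \<longrightarrow> (\<forall>t\<ge>0. 0 < B k - S (min t (real k)) \<omega>)"
    proof (rule positive_paths[OF mk])
      fix \<omega> assume w: "\<omega> \<in> space P"
      have "continuous_on {0..} (\<lambda>t. S (min t (real k)) \<omega>)"
        by (rule continuous_on_compose2[OF S_continuous[OF w]]) (auto intro!: continuous_intros)
      then show "continuous_on {0..} (\<lambda>t. B k - S (min t (real k)) \<omega>)" by (intro continuous_intros)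
    next
      show "AE \<omega> in P. 0 \<le> B k - S (real k) \<omega>"
        using AEN AE_space
      proof eventually_elim
        case (elim \<omega>)
        have "S (real k) \<omega> = X k \<omega>" using S_eq[OF elim(1), of k "real k"] k by simp
        then show ?case using X_on_A[of \<omega> k] X_off_A[OF k elim(2)] by (cases "\<omega> \<in> A k") auto
      qed
    qed
  qed simp
  show ?thesis
    using AEN pos below AE_space
  proof eventually_elim
    case (elim \<omega>)
    show ?case unfolding good_def
    proof (intro conjI allI impI ballI)
      show "0 < S t \<omega>" if "0 \<le> t" for t using elim(2) X_pos[OF elim(4) B0, of "Suc m"] that by simp
      show "S t \<omega> = X (Suc m) \<omega>" if "real (Suc m) \<le> t" for t using S_eq[OF elim(1), of "Suc m" t] that by simp
      fix k assume k: "k \<le> m"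
      show Sk: "S (real k) \<omega> = X k \<omega>" using S_eq[OF elim(1), of k "real k"] k by simp
      assume off: "\<omega> \<notin> A k"
      show "S t \<omega> = X k \<omega>" if "real k \<le> t" for t using S_eq[OF elim(1), of k t] that k off by simp
      show "S t \<omega> < B k" if "t \<in> {0..real k}" for t
      proof -
        have "0 < B k - S (real k) \<omega>" using Sk X_off_A[OF k elim(4) off] by simp
        moreover have "k \<in> {..m}" using k by simp
        ultimately have "\<forall>t\<ge>0. 0 < B k - S (min t (real k)) \<omega>" using elim(3) by blast
        then have "0 < B k - S (min t (real k)) \<omega>" using that by (meson atLeastAtMost_iff)
        then show ?thesis using that by (simp add: min_absorb1)
      qed
    qed
  qed
qed

end

section \<open>Rescaling to the time horizon\<close>

context staged_model begin

text \<open>Fits the stages 0 to \<open>m\<close>, each of unit length, into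
  \<open>{0..T}\<close>.\<close>

definition speed :: real where "speed = real (Suc m) / T"

lemma speed: "0 < speed" "T * speed = real (Suc m)"
  using T by (simp_all add: speed_def)

definition filtration :: "real \<Rightarrow> 'a measure" where "filtration t = F (t * speed)"

text \<open>A market model asks for continuity, positivity and the starting value on every path, so
  exceptional paths are set to the constant \<open>B 0\<close>.\<close>

definition asset :: "real \<Rightarrow> 'a \<Rightarrow> real" where
  "asset t \<omega> = (if good \<omega> then S (t * speed) \<omega> else B 0)"

lemma filtration_usual: "usual_filtration P T filtration"
  unfolding usual_filtration_def
proof (intro conjI ballI allI impI)
  show "subalgebra P (filtration t)" for t unfolding filtration_def by (rule F_subalgebra)
  fix s t assume "0 \<le> s \<and> s \<le> t \<and> t \<le> T"
  then show "sets (filtration s) \<subseteq> sets (filtration t)"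
    unfolding filtration_def using speed by (intro F_mono mult_right_mono) auto
next
  show "complete_measure P" by (rule complete)
  show "null_sets P \<subseteq> sets (filtration 0)" unfolding filtration_def by (rule null_sets_F)
  fix t assume t: "t \<in> {0..<T}"
  have "sets (F (t * speed)) = (\<Inter>s\<in>{t * speed<..T * speed}. sets (F s))"
    using t speed(1) by (intro F_right_continuous) (auto intro: mult_nonneg_nonneg less_imp_le)
  also have "{t * speed<..T * speed} = (\<lambda>s. s * speed) ` {t<..T}"
  proof (intro equalityI subsetI)
    fix u assume u: "u \<in> {t * speed<..T * speed}"
    then have "u = u / speed * speed" "u / speed \<in> {t<..T}"
      using speed(1) by (auto simp: less_divide_eq divide_le_eq)
    then show "u \<in> (\<lambda>s. s * speed) ` {t<..T}" by blast
  qed (use speed(1) in auto)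
  finally show "sets (filtration t) = (\<Inter>s\<in>{t<..T}. sets (filtration s))"
    by (simp add: filtration_def)
qed

lemma filtered: "filtered_prob_space P {0..T} filtration"
  by (rule market_filtered[OF prob_space_axioms filtration_usual])

context assumes B0: "0 < B 0" begin

lemma good_events: "{\<omega>\<in>space P. good \<omega>} \<in> events"
  by (rule AE_set_in_events[OF good_AE[OF B0]])

lemma asset_eq: "AE \<omega> in P. S (t * speed) \<omega> = asset t \<omega>"
  using good_AE[OF B0] by eventually_elim (simp add: asset_def)

lemma asset_T: "AE \<omega> in P. X (Suc m) \<omega> = asset T \<omega>"
  using good_AE[OF B0] by eventually_elim (simp add: asset_def good_def speed(2) del: X.simps)

lemma asset_mart: "filtered_prob_space.mart_to P {0..T} filtration asset (asset T)"
  unfolding filtered_prob_space.mart_to_def[OF filtered]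
proof (intro conjI ballI)
  have meas: "asset t \<in> borel_measurable P" if "0 \<le> t" for t
  proof -
    have "S (t * speed) \<in> borel_measurable P"
      using that speed(1) by (intro mart_to_measurable[OF S_martingale]) simp
    then show ?thesis unfolding asset_def[abs_def] using good_events by (intro measurable_If) auto
  qed
  have T0: "0 \<le> T" using T by simp
  have iX: "integrable P (X (Suc m))" by (rule mart_toD(1)[OF S_martingale])
  show iT: "integrable P (asset T)"
    using integrable_cong_AE_imp[OF iX meas[OF T0]] asset_T by (auto elim: eventually_mono)
  fix t assume t: "t \<in> {0..T}"
  then have st: "t * speed \<in> {0..}" and t0: "0 \<le> t" using speed(1) by auto
  note D = mart_toD(2-4)[OF S_martingale st]
  show "asset t \<in> borel_measurable (filtration t)"
    unfolding filtration_def by (rule measurable_F_AE[OF D(1) meas[OF t0] asset_eq])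
  show "integrable P (asset t)"
    using integrable_cong_AE_imp[OF D(2) meas[OF t0]] asset_eq[of t] by (auto elim: eventually_mono)
  fix A assume A: "A \<in> sets (filtration t)"
  then have AP: "A \<in> events" using sets_F st by (auto simp: filtration_def)
  have "(\<integral>\<omega>\<in>A. asset t \<omega> \<partial>P) = (\<integral>\<omega>\<in>A. S (t * speed) \<omega> \<partial>P)"
    using meas[OF t0] mart_to_measurable[OF S_martingale st] asset_eq[of t]
    by (intro set_lebesgue_integral_cong_AE AP) (auto elim!: eventually_mono)
  also have "\<dots> = (\<integral>\<omega>\<in>A. X (Suc m) \<omega> \<partial>P)" using D(3) A by (simp add: filtration_def del: X.simps)
  also have "\<dots> = (\<integral>\<omega>\<in>A. asset T \<omega> \<partial>P)"
    using meas[OF T0] borel_measurable_integrable[OF iX] asset_T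
    by (intro set_lebesgue_integral_cong_AE AP) (auto elim!: eventually_mono simp del: X.simps)
  finally show "(\<integral>\<omega>\<in>A. asset t \<omega> \<partial>P) = (\<integral>\<omega>\<in>A. asset T \<omega> \<partial>P)" .
qed

lemma asset_market: "continuous_market P T filtration asset (B 0)"
proof (rule continuous_market.intro[OF filtered], unfold_locales)
  show "0 < T" "0 < B 0" by (rule T, rule B0)
  show "filtered_prob_space.mart_to P {0..T} filtration asset (asset T)" by (rule asset_mart)
  fix \<omega> assume w: "\<omega> \<in> space P"
  have "S 0 \<omega> = B 0" if "good \<omega>" using that unfolding good_def by (metis X.simps(1) le0 of_nat_0)
  then show "asset 0 \<omega> = B 0" by (auto simp: asset_def)
  show "continuous_on {0..T} (\<lambda>t. asset t \<omega>)"
  proof (cases "good \<omega>")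
    case True
    have "continuous_on {0..T} (\<lambda>t. S (t * speed) \<omega>)"
      by (rule continuous_on_compose2[OF S_continuous[OF w]])
         (use speed(1) in \<open>auto intro!: continuous_intros\<close>)
    then show ?thesis using True by (simp add: asset_def)
  qed (simp add: asset_def)
  show "0 < asset t \<omega>" if "t \<in> {0..T}" for t
    using that B0 speed(1) by (auto simp: asset_def good_def)
qed

lemma asset_call:
  "(\<integral>\<omega>. max (asset T \<omega> - x) 0 \<partial>P) = max (B 0 - x) 0
      + (\<Sum>j<Suc m. prob (A j) * ((\<integral>z. max (y j z - x) 0 \<partial>gauss) - max (B j - x) 0))"
proof -
  interpret cm: continuous_market P T filtration asset "B 0" by (rule asset_market)
  have "asset T \<in> borel_measurable P" by (rule cm.S_measurable[OF cm.T_mem])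
  moreover have "X (Suc m) \<in> borel_measurable P" using mart_toD(1)[OF S_martingale] by (rule borel_measurable_integrable)
  ultimately have "(\<integral>\<omega>. max (asset T \<omega> - x) 0 \<partial>P) = (\<integral>\<omega>. max (X (Suc m) \<omega> - x) 0 \<partial>P)"
    using asset_T by (intro integral_cong_AE) (auto elim: eventually_mono simp del: X.simps)
  then show ?thesis using X_call(2)[of "Suc m" x] by simp
qed

lemma asset_bound:
  assumes "B 0 \<le> C" "\<And>j z. j \<le> m \<Longrightarrow> y j z \<le> C" "\<omega> \<in> space P"
  shows "asset T \<omega> \<le> C"
  using X_bound[OF assms(1,2), of "Suc m" \<omega>] assms(1)
  by (auto simp: asset_def good_def speed(2) simp del: X.simps)

text \<open>On a good path in \<open>A k\<close> the barrier is attained at the rescaled integer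
  time; on a good path off \<open>A k\<close> the bounds before and after that time exclude it. An
  exceptional path stays at \<open>B 0 < B k\<close>.\<close>

lemma asset_barrier:
  assumes k: "k \<in> {1..m}" and Bk: "B 0 < B k"
  shows "(\<integral>\<omega>. indicator {\<omega>\<in>space P. B k \<le> running_max asset T \<omega>} \<omega> \<partial>P) = prob (A k)"
proof -
  interpret cm: continuous_market P T filtration asset "B 0" by (rule asset_market)
  have "B k \<le> running_max asset T \<omega> \<longleftrightarrow> good \<omega> \<and> \<omega> \<in> A k" if w: "\<omega> \<in> space P" for \<omega>
  proof (cases "good \<omega>")
    case False
    then show ?thesis using Bk by (subst cm.max_ge_iff[OF w]) (auto simp: asset_def)
  next
    case True
    note g = True[unfolded good_def, THEN conjunct2, THEN conjunct2, rule_format, of k]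
    have km: "k \<le> m" using k by simp
    show ?thesis
    proof (cases "\<omega> \<in> A k")
      case hit: True
      have "asset (real k / speed) \<omega> = B k"
        using g[OF km] X_on_A[OF hit] speed(1) True by (simp add: asset_def)
      moreover have "real k / speed \<in> {0..T}"
        using speed km by (auto simp: divide_le_eq)
      ultimately have "B k \<le> running_max asset T \<omega>" by (subst cm.max_ge_iff[OF w]) (auto intro!: bexI[of _ "real k / speed"])
      then show ?thesis using hit True by simp
    next
      case off: False
      have "asset u \<omega> < B k" if "u \<in> {0..T}" for u
      proof (cases "u * speed \<le> real k")
        case True
        then show ?thesis using g[OF km] off that speed(1) \<open>good \<omega>\<close> by (auto simp: asset_def)
      next
        case False
        then show ?thesis using g[OF km] off that X_off_A[OF km w off] \<open>good \<omega>\<close> by (auto simp: asset_def)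
      qed
      then have "\<not> B k \<le> running_max asset T \<omega>" by (subst cm.max_ge_iff[OF w]) (auto simp: not_le)
      then show ?thesis using off by simp
    qed
  qed
  then have "{\<omega>\<in>space P. B k \<le> running_max asset T \<omega>} = {\<omega>\<in>space P. good \<omega>} \<inter> A k"
    using A_decreasing[of 0 k] by auto
  moreover have "prob ({\<omega>\<in>space P. good \<omega>} \<inter> A k) = prob (A k)"
    using good_AE[OF B0] good_events A_events[of k] k AE_space
    by (intro finite_measure_eq_AE) (auto elim!: eventually_mono)
  moreover have "{\<omega>\<in>space P. good \<omega>} \<inter> A k \<in> events" using good_events A_events[of k] k by auto
  ultimately show ?thesis by simp
qed

theorem asset_market_model:
  assumes "\<And>k. k \<in> {1..m} \<Longrightarrow> B 0 < B k" "\<And>k. k \<in> {1..m} \<Longrightarrow> prob (A k) = b (B k)"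
    and "\<And>i. i \<in> {1..n} \<Longrightarrow> max (B 0 - K i) 0
      + (\<Sum>j<Suc m. prob (A j) * ((\<integral>z. max (y j z - K i) 0 \<partial>gauss) - max (B j - K i) 0)) = c (K i)"
  shows "market_model (B 0) T n K c m B b P filtration asset"
proof -
  interpret cm: continuous_market P T filtration asset "B 0" by (rule asset_market)
  have "martingale_on P T filtration asset"
    using martingale_on_iff_mart_to[OF filtered, of asset] asset_mart T by simp
  then show ?thesis
    unfolding market_model_def
    using prob_space_axioms filtration_usual cm.S_0 cm.cont cm.S_pos assms asset_call asset_barrier by auto
qed

end
end

subsection \<open>Noise on path space\<close>

text \<open>The type \<open>path\<close> consists of functions from real indices to reals, so the
  noise itself can live on it: a point is a family of normal variables here, not a price
  trajectory.\<close>

definition path_noise :: "path measure" where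
  "path_noise = completion (PiM UNIV (\<lambda>_. gauss))"

lemma gaussian_noise_path: "gaussian_noise path_noise (\<lambda>q \<omega>. \<omega> q)"
proof -
  interpret product_prob_space "\<lambda>_::real. gauss" UNIV by unfold_locales
  interpret c: prob_space path_noise unfolding path_noise_def by (rule prob_space_completion)
  show ?thesis
  proof (intro gaussian_noise.intro gaussian_noise_axioms.intro)
    show "prob_space path_noise" by (rule c.prob_space_axioms)
    show "complete_measure path_noise" unfolding path_noise_def by (rule completion.complete_measure_axioms)
    have coord: "(\<lambda>\<omega>. \<omega> q) \<in> borel_measurable (PiM UNIV (\<lambda>_. gauss))" for q :: real
      using measurable_component_singleton[of q UNIV "\<lambda>_. gauss"] by (simp add: measurable_cong_sets[of _ _ gauss borel])
    show "c.iid_gauss (\<lambda>q \<omega>. \<omega> q)"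
      unfolding c.iid_gauss_iff
    proof (intro conjI allI impI)
      show "(\<lambda>\<omega>. \<omega> q) \<in> borel_measurable path_noise" for q
        unfolding path_noise_def by (rule measurable_completion[OF coord])
      fix J :: "real set" and A :: "real \<Rightarrow> real set" assume J: "finite J" and A: "\<forall>j\<in>J. A j \<in> sets borel"
      have S: "{\<omega>\<in>space (PiM UNIV (\<lambda>_. gauss)). \<forall>j\<in>J. \<omega> j \<in> A j} \<in> sets (PiM UNIV (\<lambda>_. gauss))"
      proof -
        have "{\<omega>\<in>space (PiM UNIV (\<lambda>_. gauss)). \<omega> j \<in> A j} \<in> sets (PiM UNIV (\<lambda>_. gauss))" if "j \<in> J" for j
          using measurable_sets[OF coord, of "A j" j] A that by (simp add: vimage_def Int_def conj_commute)
        then show ?thesis using J by (intro sets.sets_Collect_finite_All) auto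
      qed
      have "emeasure (PiM UNIV (\<lambda>_. gauss)) {\<omega>\<in>space (PiM UNIV (\<lambda>_. gauss)). \<forall>j\<in>J. \<omega> j \<in> A j} = (\<Prod>j\<in>J. emeasure gauss (A j))"
        using J A by (intro emeasure_PiM_Collect) auto
      also have "\<dots> = ennreal (\<Prod>j\<in>J. measure gauss (A j))"
        by (simp add: gauss.emeasure_eq_measure prod_ennreal)
      finally have "measure (PiM UNIV (\<lambda>_. gauss)) {\<omega>\<in>space (PiM UNIV (\<lambda>_. gauss)). \<forall>j\<in>J. \<omega> j \<in> A j} = (\<Prod>j\<in>J. measure gauss (A j))"
        by (simp add: measure_def prod_nonneg)
      then show "c.prob {\<omega>\<in>space path_noise. \<forall>j\<in>J. \<omega> j \<in> A j} = (\<Prod>j\<in>J. measure gauss (A j))"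
        using S by (simp add: path_noise_def)
    qed
  qed
qed

section \<open>From the convex functions to the stage laws\<close>

lemma has_field_derivative_within_unique:
  fixes f :: "real \<Rightarrow> real"
  assumes "(f has_field_derivative d) (at x within A)" "(f has_field_derivative e) (at x within A)"
    "at x within A \<noteq> bot"
  shows "d = e"
  using assms tendsto_unique unfolding has_field_derivative_iff by blast

context convex_call begin

text \<open>\<open>fin\<close> records whether a next barrier \<open>U\<close> exists; the last
  stage has none. The law has no mass above \<open>U\<close> because its call at \<open>U\<close>
  vanishes. Positivity and the bound by \<open>U\<close> are made to hold everywhere by resetting
  \<open>y\<close> to \<open>b\<close> on a null set. For \<open>\<beta> = 0\<close> the stage is
  entered with probability zero, and a constant serves.\<close>

lemma stage_quantile:
  assumes b: "g 0 = \<beta> * b" "0 < b" and U: "fin \<Longrightarrow> b \<le> U \<and> g U = 0"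
  obtains y where "integrable gauss y" "\<And>z. 0 < y z" "(\<integral>z. y z \<partial>gauss) = b"
    "\<And>x. 0 \<le> x \<Longrightarrow> \<beta> * (\<integral>z. max (y z - x) 0 \<partial>gauss) = g x"
    "fin \<Longrightarrow> \<forall>z. y z \<le> U"
proof (cases "\<beta> = 0")
  case True
  have "(\<integral>z. b \<partial>gauss) = b" using gauss.prob_space by simp
  then show ?thesis
    by (intro that[of "\<lambda>_. b"]) (use b U True g_zero in auto)
next
  case False
  then have bpos: "0 < \<beta>" using beta_nonneg by simp
  obtain y0 where y0: "y0 \<in> borel_measurable borel" "integrable gauss y0" "AE z in gauss. 0 < y0 z"
    "\<And>x. 0 \<le> x \<Longrightarrow> (\<integral>z. max (y0 z - x) 0 \<partial>gauss) = g x / \<beta>"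
    using quantile_of_calls[OF bpos] by blast
  define ok where "ok z \<longleftrightarrow> 0 < y0 z \<and> (fin \<longrightarrow> y0 z \<le> U)" for z
  define y where "y z = (if ok z then y0 z else b)" for z
  have "AE z in gauss. fin \<longrightarrow> y0 z \<le> U"
  proof (cases fin)
    case True
    then have U': "0 \<le> U" "g U = 0" using U b by auto
    have i: "integrable gauss (\<lambda>z. max (y0 z - U) 0)" using y0(2) by (intro integrable_max) auto
    have "(\<integral>z. max (y0 z - U) 0 \<partial>gauss) = 0" using y0(4)[OF U'(1)] U'(2) by simp
    then have "AE z in gauss. max (y0 z - U) 0 = 0"
      using integral_nonneg_eq_0_iff_AE[OF i] by simp
    then show ?thesis by eventually_elim auto
  qed simp
  with y0(3) have ok: "AE z in gauss. ok z" by eventually_elim (simp add: ok_def)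
  then have yy: "AE z in gauss. y z = y0 z" by eventually_elim (simp add: y_def)
  note [measurable] = y0(1)
  have okm: "{z\<in>space borel. ok z} \<in> sets borel" unfolding ok_def by (cases fin) simp_all
  have ym[measurable]: "y \<in> borel_measurable borel"
    unfolding y_def[abs_def] using okm by (intro measurable_If) auto
  have call: "(\<integral>z. max (y z - x) 0 \<partial>gauss) = g x / \<beta>" if "0 \<le> x" for x
  proof -
    have "(\<integral>z. max (y z - x) 0 \<partial>gauss) = (\<integral>z. max (y0 z - x) 0 \<partial>gauss)"
      using yy by (intro integral_cong_AE) (auto elim: eventually_mono)
    then show ?thesis using y0(4)[OF that] by simp
  qed
  show ?thesis
  proof (rule that[of y])
    have "AE z in gauss. y0 z = y z" using yy by eventually_elim simp
    then show "integrable gauss y" by (rule integrable_cong_AE_imp[OF y0(2), rotated]) simp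
    show pos: "0 < y z" for z using b by (simp add: y_def ok_def)
    have "(\<integral>z. y z \<partial>gauss) = (\<integral>z. max (y z - 0) 0 \<partial>gauss)"
      using pos by (intro Bochner_Integration.integral_cong) (auto simp: less_imp_le max_absorb1)
    then show "(\<integral>z. y z \<partial>gauss) = b" using call[of 0] b bpos by simp
    show "\<beta> * (\<integral>z. max (y z - x) 0 \<partial>gauss) = g x" if "0 \<le> x" for x
      using call[OF that] bpos by simp
    show "\<forall>z. y z \<le> U" if fin using U[OF that] that by (auto simp: y_def ok_def)
  qed
qed

text \<open>Since \<open>y\<close> never exceeds \<open>U\<close>, the closed tail at
  \<open>U\<close> is the atom there, and the left slope of the call function is its
  negative.\<close>

lemma stage_atom:
  assumes y: "integrable gauss y" "\<And>z. y z \<le> U" and U: "0 < U"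
    and call: "\<And>x. 0 \<le> x \<Longrightarrow> \<beta> * (\<integral>z. max (y z - x) 0 \<partial>gauss) = g x"
    and left: "(g has_real_derivative - \<beta>') (at_left U)"
  shows "\<beta> * measure gauss {z. y z = U} = \<beta>'"
proof -
  have [measurable]: "y \<in> borel_measurable borel" using borel_measurable_integrable[OF y(1)] by simp
  interpret d: call_distribution "distr gauss borel y" by (rule gauss.call_distribution_distr[OF y(1)])
  have "measure (distr gauss borel y) {U..} = measure gauss {z. y z = U}"
    using y(2) by (simp add: measure_distr vimage_def) (intro arg_cong[where f="measure gauss"], auto intro: antisym)
  then have "((\<lambda>x. \<beta> * call_of_measure (distr gauss borel y) x) has_real_derivative \<beta> * - measure gauss {z. y z = U}) (at_left U)"
    using d.call_left_derivative[of U] by (intro DERIV_cmult) simp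
  moreover have "\<forall>\<^sub>F x in at_left U. \<beta> * call_of_measure (distr gauss borel y) x = g x"
  proof -
    have "\<forall>\<^sub>F x in at_left U. 0 < x" using U by (auto simp: eventually_at_left_field)
    then show ?thesis by eventually_elim (simp add: call_of_distr call)
  qed
  moreover have "\<beta> * call_of_measure (distr gauss borel y) U = g U" using U by (simp add: call_of_distr call)
  ultimately have "(g has_real_derivative \<beta> * - measure gauss {z. y z = U}) (at_left U)"
    by (subst (asm) has_field_derivative_cong_eventually) auto
  from has_field_derivative_within_unique[OF this left] show ?thesis by simp
qed

end

text \<open>Values above \<open>R\<close> are replaced by their conditional mean, which is at least
  \<open>R\<close>. Calls struck at or below \<open>R\<close> are linear on that range and keep
  their prices.\<close>

lemma truncate_tail:
  fixes y :: "real \<Rightarrow> real" and R :: real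
  assumes y: "integrable gauss y" "\<And>z. 0 < y z" and R: "0 < R"
  obtains y' C where "integrable gauss y'" "\<And>z. 0 < y' z" "\<And>z. y' z \<le> C"
    "\<And>x. x \<le> R \<Longrightarrow> (\<integral>z. max (y' z - x) 0 \<partial>gauss) = (\<integral>z. max (y z - x) 0 \<partial>gauss)"
proof -
  have [measurable]: "y \<in> borel_measurable borel" using borel_measurable_integrable[OF y(1)] by simp
  define D where "D = {z. R < y z}"
  have "y -` {R<..} \<inter> space borel \<in> sets borel" by (rule measurable_sets[where A=borel]) auto
  then have D[measurable]: "D \<in> sets borel" by (simp add: D_def vimage_def)
  define p where "p = measure gauss D"
  \<comment> \<open>If almost nothing lies above \<open>R\<close> there is no conditional mean, and
    \<open>R\<close> itself is taken.\<close>
  define a where "a = (if p = 0 then R else (\<integral>z\<in>D. y z \<partial>gauss) / p)"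
  have iD: "integrable gauss (\<lambda>z. indicator D z * f z)" if "integrable gauss f" for f :: "real \<Rightarrow> real"
    using integrable_mult_indicator[of D gauss f] that by simp
  have i1: "integrable gauss (\<lambda>z. c * indicator D z)" for c :: real
    by (intro integrable_mult_right integrable_real_indicator) (auto simp: gauss.emeasure_eq_measure)
  have tot: "a * p = (\<integral>z. indicator D z * y z \<partial>gauss)"
  proof (cases "p = 0")
    case True
    then have "D \<in> null_sets gauss" by (simp add: null_sets_def gauss.emeasure_eq_measure p_def)
    then have "AE z in gauss. z \<notin> D" by (rule AE_not_in)
    then have "(\<integral>z. indicator D z * y z \<partial>gauss) = (\<integral>z. 0 \<partial>gauss)"
      by (intro integral_cong_AE) (auto elim!: eventually_mono)
    then show ?thesis using True by simp
  next
    case False then show ?thesis by (simp add: a_def set_lebesgue_integral_def)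
  qed
  have aR: "R \<le> a"
  proof (cases "p = 0")
    case False
    then have "0 < p" by (simp add: p_def zero_less_measure_iff)
    have "R * p = (\<integral>z. R * indicator D z \<partial>gauss)" by (simp add: p_def)
    also have "\<dots> \<le> (\<integral>z. indicator D z * y z \<partial>gauss)"
      by (rule integral_mono[OF i1 iD[OF y(1)]]) (auto simp: D_def indicator_def)
    finally have "R * p \<le> a * p" by (simp add: tot)
    then show ?thesis using \<open>0 < p\<close> by simp
  qed (simp add: a_def)
  define y' where "y' z = (if z \<in> D then a else y z)" for z
  have iy': "integrable gauss y'"
  proof -
    have "y' = (\<lambda>z. y z - indicator D z * y z + a * indicator D z)" by (auto simp: y'_def fun_eq_iff)
    then show ?thesis
      using Bochner_Integration.integrable_add[OF Bochner_Integration.integrable_diff[OF y(1) iD[OF y(1)]] i1[of a]] by simp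
  qed
  show ?thesis
  proof (rule that[OF iy'])
    show "0 < y' z" for z using y(2) R aR by (simp add: y'_def)
    show "y' z \<le> max R a" for z by (auto simp: y'_def D_def not_less)
    fix x assume x: "x \<le> R"
    have "(\<integral>z. max (y' z - x) 0 \<partial>gauss) = (\<integral>z. max (y z - x) 0 + (a * indicator D z - indicator D z * y z) \<partial>gauss)"
      using x aR by (intro Bochner_Integration.integral_cong) (auto simp: y'_def D_def indicator_def)
    also have "\<dots> = (\<integral>z. max (y z - x) 0 \<partial>gauss) + ((\<integral>z. a * indicator D z \<partial>gauss) - (\<integral>z. indicator D z * y z \<partial>gauss))"
    proof (subst Bochner_Integration.integral_add)
      show "integrable gauss (\<lambda>z. max (y z - x) 0)" using y(1) by (intro integrable_max) auto
    qed (auto intro!: iD y i1 simp: Bochner_Integration.integral_diff[OF i1 iD[OF y(1)]])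
    also have "(\<integral>z. a * indicator D z \<partial>gauss) = a * p" by (simp add: p_def)
    finally show "(\<integral>z. max (y' z - x) 0 \<partial>gauss) = (\<integral>z. max (y z - x) 0 \<partial>gauss)" by (simp add: tot)
  qed
qed

text \<open>\<open>\<beta> j\<close> is the probability that stage \<open>j\<close> is active, and
  the condition on the atoms is its recursion. The last conclusion serves the model with bounded
  support.\<close>

lemma staged_market_model:
  fixes B :: "nat \<Rightarrow> real"
  assumes T: "0 < T" and B0: "0 < B 0" and B: "\<And>k. k \<in> {1..m} \<Longrightarrow> B 0 < B k" "\<And>j. j < m \<Longrightarrow> B j \<le> B (Suc j)"
    and y: "\<And>j. j \<le> m \<Longrightarrow> integrable gauss (y j)" "\<And>j. j \<le> m \<Longrightarrow> (\<integral>z. y j z \<partial>gauss) = B j"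
      "\<And>j z. j \<le> m \<Longrightarrow> 0 < y j z" "\<And>j z. j < m \<Longrightarrow> y j z \<le> B (Suc j)"
    and \<beta>: "\<beta> 0 = 1" "\<And>j. j < m \<Longrightarrow> \<beta> j * measure gauss {z. y j z = B (Suc j)} = \<beta> (Suc j)"
      "\<And>k. k \<in> {1..m} \<Longrightarrow> \<beta> k = b (B k)"
    and c: "\<And>i. i \<in> {1..n} \<Longrightarrow> max (B 0 - K i) 0
        + (\<Sum>j<Suc m. \<beta> j * ((\<integral>z. max (y j z - K i) 0 \<partial>gauss) - max (B j - K i) 0)) = c (K i)"
  shows "\<exists>F S. market_model (B 0) T n K c m B b path_noise F S \<and>
    (\<forall>x. (\<integral>\<omega>. max (S T \<omega> - x) 0 \<partial>path_noise) = max (B 0 - x) 0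
        + (\<Sum>j<Suc m. \<beta> j * ((\<integral>z. max (y j z - x) 0 \<partial>gauss) - max (B j - x) 0))) \<and>
    (\<forall>C\<ge>B 0. (\<forall>j\<le>m. \<forall>z. y j z \<le> C) \<longrightarrow> (\<forall>\<omega>\<in>space path_noise. S T \<omega> \<le> C))"
proof -
  interpret gaussian_noise path_noise "\<lambda>q \<omega>. \<omega> q" by (rule gaussian_noise_path)
  interpret staged_model path_noise "\<lambda>q \<omega>. \<omega> q" m B y T
    by unfold_locales (use T B(2) y in auto)
  have A: "prob (A k) = \<beta> k" if "k \<le> m" for k using that
  proof (induction k)
    case 0 then show ?case using \<beta>(1) prob_space by simp
  next
    case (Suc k) then show ?case using A_prob[of k] \<beta>(2)[of k] by simp
  qed
  have sums: "(\<Sum>j<Suc m. prob (A j) * f j) = (\<Sum>j<Suc m. \<beta> j * f j)" for f :: "nat \<Rightarrow> real"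
    using A by (intro sum.cong) auto
  show ?thesis
  proof (intro exI[of _ filtration] exI[of _ asset] conjI allI impI ballI)
    show "market_model (B 0) T n K c m B b path_noise filtration asset"
    proof (rule asset_market_model[OF B0])
      show "prob (A k) = b (B k)" if "k \<in> {1..m}" for k using A[of k] \<beta>(3)[OF that] that by simp
    qed (use B(1) c in \<open>auto simp only: sums\<close>)
    show "(\<integral>\<omega>. max (asset T \<omega> - x) 0 \<partial>path_noise) = max (B 0 - x) 0
        + (\<Sum>j<Suc m. \<beta> j * ((\<integral>z. max (y j z - x) 0 \<partial>gauss) - max (B j - x) 0))" for x
      using asset_call[OF B0, of x] unfolding sums .
    show "asset T \<omega> \<le> C" if "B 0 \<le> C" "\<forall>j\<le>m. \<forall>z. y j z \<le> C" "\<omega> \<in> space path_noise" for C \<omega>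
      using that by (intro asset_bound[OF B0]) auto
  qed
qed

theorem market_model_sufficient:
  fixes B :: "nat \<Rightarrow> real"
  assumes T: "0 < T" and B0: "0 < B 0" and B: "\<And>k. k \<in> {1..m} \<Longrightarrow> B 0 < B k" "mono_on {1..m} B"
    and ic: "interpolating_calls (B 0) n K c \<mu>" and bc: "barrier_calls (B 0) m B b \<mu> \<cc>"
    and K: "\<And>i. i \<in> {1..n} \<Longrightarrow> 0 < K i"
  shows "\<exists>F S. market_model (B 0) T n K c m B b path_noise F S \<and>
      (\<forall>x\<ge>0. (\<integral>\<omega>. max (S T \<omega> - x) 0 \<partial>path_noise) = call_of_measure \<mu> x)" (is ?exact)
    and "\<exists>F S C. market_model (B 0) T n K c m B b path_noise F S \<and> (\<forall>\<omega>\<in>space path_noise. S T \<omega> \<le> C)" (is ?bounded)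
proof -
  \<comment> \<open>The start is treated as a barrier \<open>B 0\<close> reached with probability 1,
    and \<open>max (B 0 - x) 0\<close> is the call function of the constant \<open>B 0\<close>.
    Stage 0 then has the form of the others.\<close>
  define \<cc>' where "\<cc>' j = (if j = 0 then (\<lambda>x. max (B 0 - x) 0) else \<cc> j)" for j
  define \<beta> where "\<beta> j = (if j = 0 then 1 else b (B j))" for j
  define g where "g j x = \<cc>' (Suc j) x - \<cc>' j x + \<beta> j * max (B j - x) 0" for j x
  have Bj: "0 < B j" if "j \<le> m" for j
    using B0 B(1)[of j] that by (cases "j = 0") auto
  have Bmono: "B j \<le> B (Suc j)" if "j < m" for j
    using B(1)[of "Suc j"] mono_onD[OF B(2), of j "Suc j"] that by (cases "j = 0") auto
  have \<cc>_last: "\<cc>' (Suc m) = call_of_measure \<mu>" using bc by (simp add: \<cc>'_def barrier_calls_def)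
  have \<cc>_bar: "\<cc>' j = \<cc> j" if "j \<in> {1..m}" for j using that by (simp add: \<cc>'_def)
  have bc': "convex_on {0..} (\<cc> j)" "(\<cc> j has_real_derivative - 1) (at_right 0)" "\<cc> j 0 = B 0"
      "\<And>x. B j \<le> x \<Longrightarrow> \<cc> j x = 0" "(\<cc> j has_real_derivative - b (B j)) (at_left (B j))"
      "convex_on {0..} (\<lambda>x. \<cc> (j + 1) x - \<cc> j x + b (B j) * max (B j - x) 0)"
    if "j \<in> {1..m}" for j
    using bc that unfolding barrier_calls_def by blast+
  have mx_der0: "((\<lambda>x. max (a - x) 0) has_real_derivative - 1) (at_right 0)" if "0 < a" for a :: real
  proof -
    have "((\<lambda>x. a - x) has_real_derivative - 1) (at_right 0)" by (auto intro!: derivative_eq_intros)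
    moreover have "\<forall>\<^sub>F x in at_right 0. a - x = max (a - x) 0"
      using that by (auto simp: eventually_at_right_field intro!: exI[of _ a])
    ultimately show ?thesis
      using that by (subst (asm) has_field_derivative_cong_eventually) auto
  qed
  have c_der: "(\<cc>' (Suc j) has_real_derivative - 1) (at_right 0)" "\<cc>' (Suc j) 0 = B 0" if "j \<le> m" for j
    using bc'(2,3)[of "Suc j"] ic that \<cc>_last \<cc>_bar[of "Suc j"]
    by (cases "j = m"; auto simp: interpolating_calls_def)+
  have c_der': "(\<cc>' j has_real_derivative - 1) (at_right 0)" "\<cc>' j 0 = B 0" if "j \<le> m" for j
    using c_der[of "j - 1"] that mx_der0[OF B0] B0 by (cases j; auto simp: \<cc>'_def)+
  have c_zero: "\<cc>' j x = 0" if "j \<le> m" "B j \<le> x" for j x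
    using bc'(4)[of j x] that by (cases "j = 0") (auto simp: \<cc>'_def)
  have c_lim: "(\<cc>' (Suc j) \<longlongrightarrow> 0) at_top" if "j \<le> m" for j
  proof (cases "j = m")
    case True
    then show ?thesis using ic \<cc>_last by (simp add: interpolating_calls_def call_price_function_def)
  next
    case False
    then show ?thesis using c_zero[of "Suc j"] that
      by (intro tendsto_eventually) (auto simp: eventually_at_top_linorder)
  qed
  have c_lim': "(\<cc>' j \<longlongrightarrow> 0) at_top" if "j \<le> m" for j
    using c_zero[OF that] by (intro tendsto_eventually) (auto simp: eventually_at_top_linorder)
  \<comment> \<open>Convexity is condition (v); in stage 0 two terms cancel and it is the convexity
    of the first call function. At 0 the slopes of the two call functions cancel, which leaves
    \<open>- \<beta> j\<close>.\<close>
  have cc: "convex_call (g j) (\<beta> j)" if j: "j \<le> m" for j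
  proof
    show "convex_on {0..} (g j)"
    proof (cases "j = 0")
      case True
      have "g 0 = \<cc>' 1" by (auto simp: g_def \<cc>'_def \<beta>_def fun_eq_iff)
      moreover have "convex_on {0..} (\<cc>' 1)"
        using bc'(1)[of 1] ic \<cc>_last \<cc>_bar[of 1]
        by (cases "m = 0") (auto simp: interpolating_calls_def call_price_function_def)
      ultimately show ?thesis using True by simp
    next
      case False
      then show ?thesis using bc'(6)[of j] j by (simp add: g_def[abs_def] \<cc>'_def \<beta>_def)
    qed
    have "((\<lambda>x. \<cc>' (Suc j) x - \<cc>' j x + \<beta> j * max (B j - x) 0) has_real_derivative (- 1 - (- 1) + \<beta> j * - 1)) (at_right 0)"
      by (intro DERIV_add DERIV_diff DERIV_cmult c_der c_der' mx_der0 Bj j)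
    then show "(g j has_real_derivative - \<beta> j) (at_right 0)" by (simp add: g_def[abs_def])
    have "((\<lambda>x. max (B j - x) 0) \<longlongrightarrow> 0) at_top"
      by (rule tendsto_eventually) (auto simp: eventually_at_top_linorder intro!: exI[of _ "B j"])
    then have "((\<lambda>x. \<cc>' (Suc j) x - \<cc>' j x + \<beta> j * max (B j - x) 0) \<longlongrightarrow> 0 - 0 + \<beta> j * 0) at_top"
      by (intro tendsto_intros c_lim c_lim' j)
    then show "(g j \<longlongrightarrow> 0) at_top" by (simp add: g_def[abs_def])
  qed
  have g0: "g j 0 = \<beta> j * B j" if "j \<le> m" for j
    using c_der(2)[OF that] c_der'(2)[OF that] Bj[OF that] by (simp add: g_def)
  have gU: "g j (B (Suc j)) = 0" if "j < m" for j
    using c_zero[of j "B (Suc j)"] c_zero[of "Suc j" "B (Suc j)"] Bmono[OF that] that by (simp add: g_def)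
  \<comment> \<open>The slope at the next barrier comes from \<open>\<cc>' (Suc j)\<close> alone:
    for distinct barriers the other terms vanish near it, and for equal ones their slopes
    \<open>\<beta> j\<close> and \<open>- \<beta> j\<close> cancel.\<close>
  have left: "(g j has_real_derivative - \<beta> (Suc j)) (at_left (B (Suc j)))" if j: "j < m" for j
  proof -
    let ?U = "B (Suc j)"
    have l1: "(\<cc>' (Suc j) has_real_derivative - \<beta> (Suc j)) (at_left ?U)"
      using bc'(5)[of "Suc j"] j by (simp add: \<cc>'_def \<beta>_def)
    have l2: "((\<lambda>x. - \<cc>' j x + \<beta> j * max (B j - x) 0) has_real_derivative 0) (at_left ?U)"
    proof (cases "B j < ?U")
      case True
      have "((\<lambda>x. 0) has_real_derivative 0) (at_left ?U)" by simp
      moreover have "\<forall>\<^sub>F x in at_left ?U. 0 = - \<cc>' j x + \<beta> j * max (B j - x) 0"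
        using True c_zero[of j] j by (auto simp: eventually_at_left_field intro!: exI[of _ "B j"])
      ultimately show ?thesis
        using True c_zero[of j ?U] j by (subst (asm) has_field_derivative_cong_eventually) auto
    next
      case False
      then have e: "B j = ?U" using Bmono[OF j] by simp
      then have j1: "j \<in> {1..m}" using B(1)[of "Suc j"] j by (cases "j = 0") auto
      have "((\<lambda>x. B j - x) has_real_derivative - 1) (at_left ?U)" by (auto intro!: derivative_eq_intros)
      moreover have "\<forall>\<^sub>F x in at_left ?U. B j - x = max (B j - x) 0"
        using e by (auto simp: eventually_at_filter)
      ultimately have "((\<lambda>x. max (B j - x) 0) has_real_derivative - 1) (at_left ?U)"
        using e by (subst (asm) has_field_derivative_cong_eventually) auto
      moreover have "(\<cc>' j has_real_derivative - \<beta> j) (at_left ?U)"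
        using bc'(5)[OF j1] e j1 by (simp add: \<cc>'_def \<beta>_def)
      ultimately have "((\<lambda>x. - \<cc>' j x + \<beta> j * max (B j - x) 0) has_real_derivative (- (- \<beta> j) + \<beta> j * - 1)) (at_left ?U)"
        by (intro DERIV_add DERIV_minus DERIV_cmult)
      then show ?thesis by simp
    qed
    have "((\<lambda>x. \<cc>' (Suc j) x + (- \<cc>' j x + \<beta> j * max (B j - x) 0)) has_real_derivative (- \<beta> (Suc j) + 0)) (at_left ?U)"
      by (intro DERIV_add l1 l2)
    moreover have "(\<lambda>x. \<cc>' (Suc j) x + (- \<cc>' j x + \<beta> j * max (B j - x) 0)) = g j"
      by (auto simp: g_def fun_eq_iff)
    ultimately show ?thesis by simp
  qed
  have "\<exists>y. integrable gauss y \<and> (\<forall>z. 0 < y z) \<and> (\<integral>z. y z \<partial>gauss) = B j \<and>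
      (\<forall>x\<ge>0. \<beta> j * (\<integral>z. max (y z - x) 0 \<partial>gauss) = g j x) \<and> (j < m \<longrightarrow> (\<forall>z. y z \<le> B (Suc j)))" if j: "j \<le> m" for j
  proof -
    interpret convex_call "g j" "\<beta> j" by (rule cc[OF j])
    have U: "j < m \<Longrightarrow> B j \<le> B (Suc j) \<and> g j (B (Suc j)) = 0" using Bmono gU by blast
    obtain y where "integrable gauss y" "\<And>z. 0 < y z" "(\<integral>z. y z \<partial>gauss) = B j"
      "\<And>x. 0 \<le> x \<Longrightarrow> \<beta> j * (\<integral>z. max (y z - x) 0 \<partial>gauss) = g j x"
      "j < m \<Longrightarrow> \<forall>z. y z \<le> B (Suc j)"
      using stage_quantile[OF g0[OF j] Bj[OF j] U] by blast
    then show ?thesis by blast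
  qed
  then have "\<forall>j\<in>{..m}. \<exists>y. integrable gauss y \<and> (\<forall>z. 0 < y z) \<and> (\<integral>z. y z \<partial>gauss) = B j \<and>
      (\<forall>x\<ge>0. \<beta> j * (\<integral>z. max (y z - x) 0 \<partial>gauss) = g j x) \<and> (j < m \<longrightarrow> (\<forall>z. y z \<le> B (Suc j)))" by blast
  from bchoice[OF this] obtain y where "\<forall>j\<in>{..m}. integrable gauss (y j) \<and> (\<forall>z. 0 < y j z) \<and> (\<integral>z. y j z \<partial>gauss) = B j \<and>
      (\<forall>x\<ge>0. \<beta> j * (\<integral>z. max (y j z - x) 0 \<partial>gauss) = g j x) \<and> (j < m \<longrightarrow> (\<forall>z. y j z \<le> B (Suc j)))" by blast
  then have y: "\<And>j. j \<le> m \<Longrightarrow> integrable gauss (y j)" "\<And>j z. j \<le> m \<Longrightarrow> 0 < y j z"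
    "\<And>j. j \<le> m \<Longrightarrow> (\<integral>z. y j z \<partial>gauss) = B j"
    "\<And>j x. j \<le> m \<Longrightarrow> 0 \<le> x \<Longrightarrow> \<beta> j * (\<integral>z. max (y j z - x) 0 \<partial>gauss) = g j x"
    "\<And>j z. j < m \<Longrightarrow> y j z \<le> B (Suc j)" by simp_all
  have atom: "\<beta> j * measure gauss {z. y j z = B (Suc j)} = \<beta> (Suc j)" if j: "j < m" for j
  proof -
    interpret convex_call "g j" "\<beta> j" using j by (intro cc) simp
    show ?thesis
      using j y(4)[of j] Bj[of "Suc j"] by (intro stage_atom y(1) y(5) left) auto
  qed
  have \<beta>: "\<beta> 0 = 1" "\<And>k. k \<in> {1..m} \<Longrightarrow> \<beta> k = b (B k)" by (auto simp: \<beta>_def)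
  \<comment> \<open>The sum over the stages telescopes from the call function of the starting price
    to that of \<mu>.\<close>
  have total: "max (B 0 - x) 0 + (\<Sum>j<Suc m. \<beta> j * ((\<integral>z. max (y j z - x) 0 \<partial>gauss) - max (B j - x) 0)) = call_of_measure \<mu> x"
    if x: "0 \<le> x" for x
  proof -
    have "(\<Sum>j<Suc m. \<beta> j * ((\<integral>z. max (y j z - x) 0 \<partial>gauss) - max (B j - x) 0)) = (\<Sum>j<Suc m. \<cc>' (Suc j) x - \<cc>' j x)"
      using y(4)[OF _ x] by (intro sum.cong) (auto simp: right_diff_distrib g_def)
    also have "\<dots> = \<cc>' (Suc m) x - \<cc>' 0 x" by (rule sum_lessThan_telescope)
    also have "\<cc>' 0 x = max (B 0 - x) 0" by (simp add: \<cc>'_def)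
    finally show ?thesis by (simp add: \<cc>_last)
  qed
  have total_K: "max (B 0 - K i) 0 + (\<Sum>j<Suc m. \<beta> j * ((\<integral>z. max (y j z - K i) 0 \<partial>gauss) - max (B j - K i) 0)) = c (K i)"
    if "i \<in> {1..n}" "0 \<le> K i" for i
    using total[OF that(2)] ic that(1) by (simp add: interpolating_calls_def)
  show ?exact
  proof -
    have "\<exists>F S. market_model (B 0) T n K c m B b path_noise F S \<and>
      (\<forall>x. (\<integral>\<omega>. max (S T \<omega> - x) 0 \<partial>path_noise) = max (B 0 - x) 0
          + (\<Sum>j<Suc m. \<beta> j * ((\<integral>z. max (y j z - x) 0 \<partial>gauss) - max (B j - x) 0))) \<and>
      (\<forall>C\<ge>B 0. (\<forall>j\<le>m. \<forall>z. y j z \<le> C) \<longrightarrow> (\<forall>\<omega>\<in>space path_noise. S T \<omega> \<le> C))"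
      by (rule staged_market_model[where y=y and \<beta>=\<beta> and B=B and b=b and K=K and c=c and n=n and m=m and T=T,
          OF T B0 B(1) Bmono y(1,3,2,5) \<beta>(1) atom \<beta>(2) total_K[OF _ less_imp_le[OF K]]])
    then obtain F S where FS: "market_model (B 0) T n K c m B b path_noise F S"
      "\<forall>x. (\<integral>\<omega>. max (S T \<omega> - x) 0 \<partial>path_noise) = max (B 0 - x) 0
        + (\<Sum>j<Suc m. \<beta> j * ((\<integral>z. max (y j z - x) 0 \<partial>gauss) - max (B j - x) 0))" by (elim exE conjE)
    show ?thesis
    proof (intro exI[of _ F] exI[of _ S] conjI allI impI)
      fix x :: real assume "0 \<le> x"
      then show "(\<integral>\<omega>. max (S T \<omega> - x) 0 \<partial>path_noise) = call_of_measure \<mu> x"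
        using FS(2)[rule_format, of x] total[of x] by (simp only:)
    qed (rule FS(1))
  qed
  show ?bounded
  proof -
    \<comment> \<open>A level above all strikes; the summand 1 keeps it positive when there are
      none.\<close>
    define R where "R = (\<Sum>i\<in>{1..n}. \<bar>K i\<bar>) + 1"
    have R0: "0 < R" unfolding R_def by (intro add_nonneg_pos sum_nonneg) auto
    have KR: "K i \<le> R" if "i \<in> {1..n}" for i
      using member_le_sum[of i "{1..n}" "\<lambda>i. \<bar>K i\<bar>"] that by (simp add: R_def)
    obtain y' C where y': "integrable gauss y'" "\<And>z. 0 < y' z" "\<And>z. y' z \<le> C"
      "\<And>x. x \<le> R \<Longrightarrow> (\<integral>z. max (y' z - x) 0 \<partial>gauss) = (\<integral>z. max (y m z - x) 0 \<partial>gauss)"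
      using truncate_tail[OF y(1)[OF order_refl] y(2)[OF order_refl] R0] by blast
    have mean': "(\<integral>z. y' z \<partial>gauss) = B m"
    proof -
      have "(\<integral>z. y' z \<partial>gauss) = (\<integral>z. max (y' z - 0) 0 \<partial>gauss)"
        using y'(2) by (intro Bochner_Integration.integral_cong) (auto simp: less_imp_le max_absorb1)
      also have "\<dots> = (\<integral>z. max (y m z - 0) 0 \<partial>gauss)" using R0 by (intro y'(4)) simp
      also have "\<dots> = (\<integral>z. y m z \<partial>gauss)"
        using y(2)[of m] by (intro Bochner_Integration.integral_cong) (auto simp: less_imp_le max_absorb1)
      finally show ?thesis using y(3)[of m] by simp
    qed
    \<comment> \<open>Only the last stage is truncated. No barrier lies after it, so the earlier
      laws and the hitting probabilities stay as they are.\<close>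
    define Y where "Y = y(m := y')"
    have Y1: "integrable gauss (Y j)" "(\<integral>z. Y j z \<partial>gauss) = B j" if "j \<le> m" for j
      using that y y' mean' by (auto simp: Y_def)
    have Y2: "0 < Y j z" if "j \<le> m" for j z using that y y' by (auto simp: Y_def)
    have Y3: "Y j z \<le> B (Suc j)" if "j < m" for j z using that y by (auto simp: Y_def)
    have Y4: "\<beta> j * measure gauss {z. Y j z = B (Suc j)} = \<beta> (Suc j)" if "j < m" for j
      using atom[OF that] that by (simp add: Y_def)
    have Y5: "max (B 0 - K i) 0 + (\<Sum>j<Suc m. \<beta> j * ((\<integral>z. max (Y j z - K i) 0 \<partial>gauss) - max (B j - K i) 0)) = c (K i)"
      if i: "i \<in> {1..n}" for i
    proof -
      have "(\<integral>z. max (Y j z - K i) 0 \<partial>gauss) = (\<integral>z. max (y j z - K i) 0 \<partial>gauss)" for j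
        using y'(4)[OF KR[OF i]] by (simp add: Y_def)
      then show ?thesis using total_K[OF i] K[OF i] by simp
    qed
    have "\<exists>F S. market_model (B 0) T n K c m B b path_noise F S \<and>
      (\<forall>x. (\<integral>\<omega>. max (S T \<omega> - x) 0 \<partial>path_noise) = max (B 0 - x) 0
          + (\<Sum>j<Suc m. \<beta> j * ((\<integral>z. max (Y j z - x) 0 \<partial>gauss) - max (B j - x) 0))) \<and>
      (\<forall>C\<ge>B 0. (\<forall>j\<le>m. \<forall>z. Y j z \<le> C) \<longrightarrow> (\<forall>\<omega>\<in>space path_noise. S T \<omega> \<le> C))"
      by (rule staged_market_model[where y=Y and \<beta>=\<beta> and B=B and b=b and K=K and c=c and n=n and m=m and T=T,
          OF T B0 B(1) Bmono Y1 Y2 Y3 \<beta>(1) Y4 \<beta>(2) Y5])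
    then obtain F S where FS: "market_model (B 0) T n K c m B b path_noise F S"
      and bd: "\<forall>C\<ge>B 0. (\<forall>j\<le>m. \<forall>z. Y j z \<le> C) \<longrightarrow> (\<forall>\<omega>\<in>space path_noise. S T \<omega> \<le> C)" by (elim exE conjE)
    \<comment> \<open>Earlier stages are bounded by the next barrier and the last one by
      \<open>C\<close>; \<open>D\<close> dominates all of these.\<close>
    define D where "D = (\<Sum>j\<le>m. \<bar>B j\<bar>) + \<bar>C\<bar>"
    have BD: "B j \<le> D" if "j \<le> m" for j
      using member_le_sum[of j "{..m}" "\<lambda>j. \<bar>B j\<bar>"] that by (simp add: D_def)
    have "0 \<le> (\<Sum>j\<le>m. \<bar>B j\<bar>)" by (intro sum_nonneg) auto
    then have CD: "C \<le> D" unfolding D_def using abs_ge_self[of C] by linarith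
    have YD: "Y j z \<le> D" if "j \<le> m" for j z
    proof (cases "j = m")
      case True then show ?thesis using y'(3)[of z] CD by (simp add: Y_def)
    next
      case False then show ?thesis using Y3[of j z] BD[of "Suc j"] that by simp
    qed
    have "\<forall>\<omega>\<in>space path_noise. S T \<omega> \<le> D" using bd BD[of 0] YD by simp
    with FS show ?thesis by (intro exI[of _ F] exI[of _ S] exI[of _ D] conjI)
  qed
qed

section \<open>Support of the terminal law and conclusion\<close>

lemma market_S_T_measurable:
  assumes "market_model S\<^sub>0 T n K c m B b P F S" "0 < T" "0 < S\<^sub>0"
  shows "S T \<in> borel_measurable P" "AE \<omega> in P. 0 < S T \<omega>"
proof -
  interpret continuous_market P T F S S\<^sub>0 by (rule market_model_continuous_market[OF assms])
  show "S T \<in> borel_measurable P" by (rule S_measurable[OF T_mem])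
  show "AE \<omega> in P. 0 < S T \<omega>" using S_pos[OF _ T_mem] by simp
qed

text \<open>A vanishing call at strike \<open>C\<close> excludes mass above \<open>C\<close>, so
  equality of the call functions transfers bounded support to \<mu>. The contrapositive yields the
  model with unbounded support.\<close>

lemma bounded_support_of_calls:
  assumes mm: "market_model S\<^sub>0 T n K c m B b P F S" "0 < T" "0 < S\<^sub>0"
    and ic: "interpolating_calls S\<^sub>0 n K c \<mu>"
    and eq: "\<forall>x\<ge>0. (\<integral>\<omega>. max (S T \<omega> - x) 0 \<partial>P) = call_of_measure \<mu> x"
    and bd: "bounded_support (distr P borel (S T))"
  shows "bounded_support \<mu>"
proof -
  have [measurable]: "S T \<in> borel_measurable P" by (rule market_S_T_measurable[OF mm])
  obtain C0 where C0: "AE y in distr P borel (S T). \<bar>y\<bar> \<le> C0" using bd by (auto simp: bounded_support_def)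
  \<comment> \<open>The call functions are compared at nonnegative strikes only.\<close>
  define C where "C = max C0 0"
  have "AE \<omega> in P. \<bar>S T \<omega>\<bar> \<le> C0" using C0 by (subst (asm) AE_distr_iff) auto
  then have "AE \<omega> in P. max (S T \<omega> - C) 0 = 0" by eventually_elim (auto simp: C_def)
  then have "(\<integral>\<omega>. max (S T \<omega> - C) 0 \<partial>P) = (\<integral>\<omega>. 0 \<partial>P)" by (intro integral_cong_AE) auto
  then have z: "(\<integral>y. max (y - C) 0 \<partial>\<mu>) = 0" using eq by (simp add: C_def call_of_measure_def)
  have cm: "call_measure \<mu>" using ic by (simp add: interpolating_calls_def)
  then interpret call_distribution \<mu> by (intro call_distributionI) (auto simp: call_measure_def)
  have "AE y in \<mu>. max (y - C) 0 = 0"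
    using z integral_nonneg_eq_0_iff_AE[OF integrable_call[of C]] by simp
  moreover have "AE y in \<mu>. 0 \<le> y" using cm by (simp add: call_measure_def)
  ultimately have "AE y in \<mu>. \<bar>y\<bar> \<le> C" by eventually_elim auto
  then show ?thesis by (auto simp: bounded_support_def)
qed

theorem theorem2p2:
  fixes S\<^sub>0 T :: real and n m :: nat and K B :: "nat \<Rightarrow> real" and c b :: "real \<Rightarrow> real"
  assumes "0 < S\<^sub>0" and "0 < T"
    and "\<And>i. i \<in> {1..n} \<Longrightarrow> 0 < K i" and "strict_mono_on {1..n} K"
    and "B 0 = S\<^sub>0" and "\<And>j. j \<in> {1..m} \<Longrightarrow> B 0 < B j" and "mono_on {1..m} B"
  shows
    "((\<exists>(P :: path measure) F S. market_model S\<^sub>0 T n K c m B b P F S) \<longleftrightarrow>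
        (\<exists>\<mu>. interpolating_calls S\<^sub>0 n K c \<mu> \<and> (\<exists>\<cc>. barrier_calls S\<^sub>0 m B b \<mu> \<cc>))) \<and>
     (\<forall>(P :: 'a measure) F S. market_model S\<^sub>0 T n K c m B b P F S \<longrightarrow>
        (\<exists>\<mu>. interpolating_calls S\<^sub>0 n K c \<mu> \<and> (\<exists>\<cc>. barrier_calls S\<^sub>0 m B b \<mu> \<cc>))) \<and>
     ((\<exists>(P :: path measure) F S. market_model S\<^sub>0 T n K c m B b P F S) \<longrightarrow>
        (\<exists>(P :: path measure) F S. market_model S\<^sub>0 T n K c m B b P F S \<and>
           bounded_support (distr P borel (S T)))) \<and>
     ((\<exists>\<mu>. interpolating_calls S\<^sub>0 n K c \<mu> \<and> \<not> bounded_support \<mu> \<and>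
           (\<exists>\<cc>. barrier_calls S\<^sub>0 m B b \<mu> \<cc>)) \<longrightarrow>
        (\<exists>(P :: path measure) F S. market_model S\<^sub>0 T n K c m B b P F S \<and>
           \<not> bounded_support (distr P borel (S T)))) \<and>
     (\<forall>(P :: 'a measure) F S \<mu> \<cc>.
        market_model S\<^sub>0 T n K c m B b P F S \<and>
        interpolating_calls S\<^sub>0 n K c \<mu> \<and> barrier_calls S\<^sub>0 m B b \<mu> \<cc> \<and>
        corresponding T m B \<mu> \<cc> P S \<longrightarrow>
        (\<forall>j\<in>{1..m}. \<forall>x. 0 \<le> x \<and> x < B j \<longrightarrow>
           (\<exists>d. (\<cc> j has_real_derivative d) (at_right x) \<and>
                measure P {\<omega>\<in>space P. S T \<omega> > x \<and> running_max S T \<omega> < B j} = - d - b (B j))))"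
proof -
  have B1: "S\<^sub>0 < B j" if "j \<in> {1..m}" for j using assms(5) assms(6)[OF that] by simp
  \<comment> \<open>Stated at a fresh type, since it serves both path models and models on an
    arbitrary space.\<close>
  have nec: "\<exists>\<mu>. interpolating_calls S\<^sub>0 n K c \<mu> \<and> (\<exists>\<cc>. barrier_calls S\<^sub>0 m B b \<mu> \<cc>)"
    if "market_model S\<^sub>0 T n K c m B b P F S" for P :: "'c measure" and F S
    using market_model_necessary[OF that assms(2,1) B1 assms(7)] by blast
  have suf: "\<exists>F S. market_model S\<^sub>0 T n K c m B b path_noise F S \<and>
        (\<forall>x\<ge>0. (\<integral>\<omega>. max (S T \<omega> - x) 0 \<partial>path_noise) = call_of_measure \<mu> x)"
      "\<exists>F S C. market_model S\<^sub>0 T n K c m B b path_noise F S \<and> (\<forall>\<omega>\<in>space path_noise. S T \<omega> \<le> C)"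
    if "interpolating_calls S\<^sub>0 n K c \<mu>" "barrier_calls S\<^sub>0 m B b \<mu> \<cc>" for \<mu> \<cc>
  proof -
    have 0: "0 < B 0" using assms(1,5) by simp
    have ic: "interpolating_calls (B 0) n K c \<mu>" and bc: "barrier_calls (B 0) m B b \<mu> \<cc>"
      using that assms(5) by simp_all
    show "\<exists>F S. market_model S\<^sub>0 T n K c m B b path_noise F S \<and>
        (\<forall>x\<ge>0. (\<integral>\<omega>. max (S T \<omega> - x) 0 \<partial>path_noise) = call_of_measure \<mu> x)"
      using market_model_sufficient(1)[OF assms(2) 0 assms(6) assms(7) ic bc assms(3)] assms(5) by simp
    show "\<exists>F S C. market_model S\<^sub>0 T n K c m B b path_noise F S \<and> (\<forall>\<omega>\<in>space path_noise. S T \<omega> \<le> C)"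
      using market_model_sufficient(2)[OF assms(2) 0 assms(6) assms(7) ic bc assms(3)] assms(5) by simp
  qed
  show ?thesis
  proof (intro conjI)
    show "(\<exists>(P :: path measure) F S. market_model S\<^sub>0 T n K c m B b P F S) \<longleftrightarrow>
        (\<exists>\<mu>. interpolating_calls S\<^sub>0 n K c \<mu> \<and> (\<exists>\<cc>. barrier_calls S\<^sub>0 m B b \<mu> \<cc>))"
      using nec suf(1) by blast
    show "\<forall>(P :: 'a measure) F S. market_model S\<^sub>0 T n K c m B b P F S \<longrightarrow>
        (\<exists>\<mu>. interpolating_calls S\<^sub>0 n K c \<mu> \<and> (\<exists>\<cc>. barrier_calls S\<^sub>0 m B b \<mu> \<cc>))"
      using nec by blast
    show "(\<exists>(P :: path measure) F S. market_model S\<^sub>0 T n K c m B b P F S) \<longrightarrow>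
        (\<exists>(P :: path measure) F S. market_model S\<^sub>0 T n K c m B b P F S \<and>
           bounded_support (distr P borel (S T)))"
    proof
      assume "\<exists>(P :: path measure) F S. market_model S\<^sub>0 T n K c m B b P F S"
      \<comment> \<open>The given model may have unbounded support; only its call functions are
        kept, and a new bounded model is built from them.\<close>
      then obtain \<mu> \<cc> where "interpolating_calls S\<^sub>0 n K c \<mu>" "barrier_calls S\<^sub>0 m B b \<mu> \<cc>"
        using nec by blast
      from suf(2)[OF this] obtain F S C where mm: "market_model S\<^sub>0 T n K c m B b path_noise F S"
        and C: "\<forall>\<omega>\<in>space path_noise. S T \<omega> \<le> C" by (elim exE conjE)
      note S_T = market_S_T_measurable[OF mm assms(2,1)]
      have "AE \<omega> in path_noise. \<bar>S T \<omega>\<bar> \<le> C"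
        using S_T(2) AE_space by eventually_elim (use C in auto)
      then have "AE y in distr path_noise borel (S T). \<bar>y\<bar> \<le> C"
        using S_T(1) by (subst AE_distr_iff) auto
      then have "bounded_support (distr path_noise borel (S T))" by (auto simp: bounded_support_def)
      with mm show "\<exists>(P :: path measure) F S. market_model S\<^sub>0 T n K c m B b P F S \<and>
           bounded_support (distr P borel (S T))" by blast
    qed
    show "(\<exists>\<mu>. interpolating_calls S\<^sub>0 n K c \<mu> \<and> \<not> bounded_support \<mu> \<and>
           (\<exists>\<cc>. barrier_calls S\<^sub>0 m B b \<mu> \<cc>)) \<longrightarrow>
        (\<exists>(P :: path measure) F S. market_model S\<^sub>0 T n K c m B b P F S \<and>
           \<not> bounded_support (distr P borel (S T)))"
    proof
      assume "\<exists>\<mu>. interpolating_calls S\<^sub>0 n K c \<mu> \<and> \<not> bounded_support \<mu> \<and>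
           (\<exists>\<cc>. barrier_calls S\<^sub>0 m B b \<mu> \<cc>)"
      then obtain \<mu> \<cc> where ic: "interpolating_calls S\<^sub>0 n K c \<mu>" and ub: "\<not> bounded_support \<mu>"
        and bc: "barrier_calls S\<^sub>0 m B b \<mu> \<cc>" by blast
      from suf(1)[OF ic bc] obtain F S where mm: "market_model S\<^sub>0 T n K c m B b path_noise F S"
        and eq: "\<forall>x\<ge>0. (\<integral>\<omega>. max (S T \<omega> - x) 0 \<partial>path_noise) = call_of_measure \<mu> x" by (elim exE conjE)
      have "\<not> bounded_support (distr path_noise borel (S T))"
        using bounded_support_of_calls[OF mm assms(2,1) ic eq] ub by blast
      with mm show "\<exists>(P :: path measure) F S. market_model S\<^sub>0 T n K c m B b P F S \<and>
           \<not> bounded_support (distr P borel (S T))" by blast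
    qed
    show "\<forall>(P :: 'a measure) F S \<mu> \<cc>.
        market_model S\<^sub>0 T n K c m B b P F S \<and>
        interpolating_calls S\<^sub>0 n K c \<mu> \<and> barrier_calls S\<^sub>0 m B b \<mu> \<cc> \<and>
        corresponding T m B \<mu> \<cc> P S \<longrightarrow>
        (\<forall>j\<in>{1..m}. \<forall>x. 0 \<le> x \<and> x < B j \<longrightarrow>
           (\<exists>d. (\<cc> j has_real_derivative d) (at_right x) \<and>
                measure P {\<omega>\<in>space P. S T \<omega> > x \<and> running_max S T \<omega> < B j} = - d - b (B j)))"
    proof (intro allI impI ballI, elim conjE)
      fix P :: "'a measure" and F S \<mu> \<cc> j x
      assume "market_model S\<^sub>0 T n K c m B b P F S" "corresponding T m B \<mu> \<cc> P S"
        "j \<in> {1..m}" "0 \<le> x" "x < B j"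
      then show "\<exists>d. (\<cc> j has_real_derivative d) (at_right x) \<and>
                measure P {\<omega>\<in>space P. S T \<omega> > x \<and> running_max S T \<omega> < B j} = - d - b (B j)"
        by (intro market_model_joint_law[OF _ assms(2,1) B1])
    qed
  qed
qed

end
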